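(* Let $f,h\in\mathfrak{D}'(\mathbb{T})$. (1) Suppose that $u$ satisfies the homogeneous biharmonic Dirichlet problem $$\Delta^2u=0\ \text{in }\mathbb{D},\qquad u=f\ \text{on }\mathbb{T},\qquad \partial_n u=h\ \text{on }\mathbb{T},$$ and that $w\in C^\infty(\overline{\mathbb{D}})$ satisfies $$\Delta^2w=g\ \text{in }\mathbb{D},\qquad w=0\ \text{on }\mathbb{T},\qquad \partial_n w=0\ \text{on }\mathbb{T}.$$ Then $\Phi=u+w$ is the only solution to the inhomogeneous biharmonic Dirichlet problem $$\Delta^2\Phi=g\ \text{in }\mathbb{D},\qquad \Phi=f\ \text{on }\mathbb{T},\qquad \partial_n\Phi=h\ \text{on }\mathbb{T},$$ and, for $z\in\mathbb{D}$, $$u(z)=F_0[f](z)+H_0[h](z)\quad\text{and}\quad w(z)=-G[g](z).$$ (2) If $g\in C(\overline{\mathbb{D}})$, then the function $$\Phi(z)=F_0[f](z)+H_0[h](z)-G[g](z),\qquad z\in\mathbb{D},$$ solves $$\Delta^2\Phi=g\ \text{in }\mathbb{D},\qquad \Phi=f\ \text{on }\mathbb{T},\qquad \partial_n\Phi=h\ \text{on }\mathbb{T}.$$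
   Context: $\mathbb{D}=\{z\in\mathbb{C}:|z|<1\}$ is the open unit disk and $\mathbb{T}=\partial\mathbb{D}$. The Laplacian is normalized as $\Delta=\frac{\partial^2}{\partial z\,\partial\overline z}=\frac14\left(\frac{\partial^2}{\partial x^2}+\frac{\partial^2}{\partial y^2}\right)$; equations in $\mathbb{D}$ are understood in the sense of distributions. $\mathfrak{D}'(\mathbb{T})$ is the space of distributions on $\mathbb{T}$; a function $f$ on $\mathbb{T}$ is identified with the distribution $\varphi\mapsto\frac1{2\pi}\int_0^{2\pi}f(e^{i\theta})\varphi(e^{i\theta})\,d\theta$. $\partial_n$ is differentiation in the inward normal direction. Solutions are continuous complex-valued functions on $\mathbb{D}$, and the boundary conditions are understood distributionally: writing $v_r(e^{i\theta})=v(re^{i\theta})$, "$v=f$ on $\mathbb{T}$" means $v_r\to f$ in $\mathfrak{D}'(\mathbb{T})$ as $r\to1^-$, and "$\partial_nv=h$ on $\mathbb{T}$" (given $v=f$ on $\mathbb{T}$) means $(v_r-f)/(1-r)\to h$ in $\mathfrak{D}'(\mathbb{T})$ as $r\to1^-$. Kernels on $\mathbb{D}$: $$H_0(z)=\frac12\frac{(1-|z|^2)^2}{|1-z|^2},\qquad F_0(z)=H_0(z)+\frac12\frac{(1-|z|^2)^3}{|1-z|^4},$$ $$F_0[f](z)=\frac1{2\pi}\int_0^{2\pi}F_0(ze^{-i\theta})f(e^{i\theta})\,d\theta,\qquad H_0[h](z)=\frac1{2\pi}\int_0^{2\pi}H_0(ze^{-i\theta})h(e^{i\theta})\,d\theta,$$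 where for distributions $f,h$ the integrals denote the pairings with the smooth functions $e^{i\theta}\mapsto F_0(ze^{-i\theta})$, $e^{i\theta}\mapsto H_0(ze^{-i\theta})$. For $z,\zeta\in\mathbb{D}$, $z\ne\zeta$, $$G(z,\zeta)=|z-\zeta|^2\log\left|\frac{1-\overline\zeta z}{z-\zeta}\right|^2-(1-|z|^2)(1-|\zeta|^2),$$ (extended continuously to $z=\zeta$), and $G[g](z)=\int_{\mathbb{D}}G(z,\zeta)g(\zeta)\,dA(\zeta)$, where $dA=\frac1\pi\,dx\,dy$ is normalized area measure on $\mathbb{D}$. *)

theory Defs
  imports "HOL-Analysis.Analysis"
begin

section \<open>Smooth functions\<close>

text \<open>\<open>iter_deriv [v1, ..., vk] f\<close> is the iterated directional derivative of \<open>f\<close> along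
  \<open>vk\<close> first and \<open>v1\<close> last. On \<open>complex\<close>, whose \<open>Basis\<close> is \<open>{1, \<i>}\<close>, the directions \<open>1\<close> and
  \<open>\<i>\<close> give the partial derivatives in \<open>x\<close> and \<open>y\<close>; on \<open>real\<close>, \<open>replicate k 1\<close> gives the
  \<open>k\<close>-th derivative.\<close>

definition iter_deriv :: "'a::euclidean_space list \<Rightarrow> ('a \<Rightarrow> complex) \<Rightarrow> 'a \<Rightarrow> complex" where
  "iter_deriv vs f = foldr (\<lambda>v g x. frechet_derivative g (at x) v) vs f"

text \<open>For \<open>S\<close> open this is the class of infinitely differentiable functions on \<open>S\<close> (in the real
  sense: \<open>differentiable\<close> is real Frechet differentiability).\<close>

definition smooth_on :: "'a::euclidean_space set \<Rightarrow> ('a \<Rightarrow> complex) \<Rightarrow> bool" where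
  "smooth_on S f \<longleftrightarrow>
     (\<forall>vs. set vs \<subseteq> Basis \<longrightarrow> (\<forall>x\<in>S. iter_deriv vs f differentiable (at x)))"

text \<open>Infinite differentiability up to the boundary of the unit disk: all partial derivatives
  extend continuously from the open to the closed disk.\<close>

definition smooth_on_closed_disk :: "(complex \<Rightarrow> complex) \<Rightarrow> bool" where
  "smooth_on_closed_disk w \<longleftrightarrow>
     continuous_on (cball 0 1) w \<and> smooth_on (ball 0 1) w \<and>
     (\<forall>vs. set vs \<subseteq> Basis \<longrightarrow>
        (\<exists>W. continuous_on (cball 0 1) W \<and> (\<forall>z\<in>ball 0 1. W z = iter_deriv vs w z)))"

definition laplacian :: "(complex \<Rightarrow> complex) \<Rightarrow> complex \<Rightarrow> complex" where
  "laplacian f z = (iter_deriv [1, 1] f z + iter_deriv [\<i>, \<i>] f z) / 4"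

section \<open>Distributions on the unit circle\<close>

text \<open>Test functions on the circle are represented by functions on \<open>complex\<close>; only the values
  on the circle matter. For a distribution \<open>T\<close>, the estimate in \<open>circle_distribution\<close> (together
  with linearity) forces \<open>T \<phi>\<close> to depend on those values only. The suprema are finite, the
  functions being continuous and periodic.\<close>

definition circle_test :: "(complex \<Rightarrow> complex) \<Rightarrow> bool" where
  "circle_test \<phi> \<longleftrightarrow> smooth_on UNIV (\<lambda>t::real. \<phi> (cis t))"

definition circle_distribution :: "((complex \<Rightarrow> complex) \<Rightarrow> complex) \<Rightarrow> bool" where
  "circle_distribution T \<longleftrightarrow>
     (\<forall>\<phi> \<psi>. circle_test \<phi> \<longrightarrow> circle_test \<psi> \<longrightarrow> T (\<lambda>z. \<phi> z + \<psi> z) = T \<phi> + T \<psi>) \<and>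
     (\<forall>c \<phi>. circle_test \<phi> \<longrightarrow> T (\<lambda>z. c * \<phi> z) = c * T \<phi>) \<and>
     (\<exists>C N. \<forall>\<phi>. circle_test \<phi> \<longrightarrow>
        norm (T \<phi>) \<le>
          C * (\<Sum>k\<le>N. SUP t::real. norm (iter_deriv (replicate k 1) (\<lambda>s. \<phi> (cis s)) t)))"

definition circle_dist_of_fun :: "(complex \<Rightarrow> complex) \<Rightarrow> (complex \<Rightarrow> complex) \<Rightarrow> complex" where
  "circle_dist_of_fun F \<phi> =
     1 / (2 * of_real pi) * integral {0..2 * pi} (\<lambda>\<theta>. F (cis \<theta>) * \<phi> (cis \<theta>))"

definition circle_dist_tendsto ::
  "('b \<Rightarrow> (complex \<Rightarrow> complex) \<Rightarrow> complex) \<Rightarrow> ((complex \<Rightarrow> complex) \<Rightarrow> complex) \<Rightarrow> 'b filter \<Rightarrow> bool"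
  where
  "circle_dist_tendsto S T F \<longleftrightarrow> (\<forall>\<phi>. circle_test \<phi> \<longrightarrow> ((\<lambda>r. S r \<phi>) \<longlongrightarrow> T \<phi>) F)"

definition dilate :: "(complex \<Rightarrow> complex) \<Rightarrow> real \<Rightarrow> complex \<Rightarrow> complex" where
  "dilate v r = (\<lambda>\<zeta>. v (of_real r * \<zeta>))"

definition boundary_value ::
  "(complex \<Rightarrow> complex) \<Rightarrow> ((complex \<Rightarrow> complex) \<Rightarrow> complex) \<Rightarrow> bool" where
  "boundary_value v f \<longleftrightarrow>
     circle_dist_tendsto (\<lambda>r. circle_dist_of_fun (dilate v r)) f (at_left 1)"

text \<open>The inward normal derivative of \<open>v\<close> is \<open>h\<close>, given that the boundary value of \<open>v\<close> is \<open>f\<close>.\<close>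

definition boundary_normal_deriv ::
  "(complex \<Rightarrow> complex) \<Rightarrow> ((complex \<Rightarrow> complex) \<Rightarrow> complex) \<Rightarrow>
   ((complex \<Rightarrow> complex) \<Rightarrow> complex) \<Rightarrow> bool" where
  "boundary_normal_deriv v f h \<longleftrightarrow>
     circle_dist_tendsto
       (\<lambda>r \<phi>. (circle_dist_of_fun (dilate v r) \<phi> - f \<phi>) / of_real (1 - r)) h (at_left 1)"

section \<open>The biharmonic equation in the disk\<close>

definition disk_test :: "(complex \<Rightarrow> complex) \<Rightarrow> bool" where
  "disk_test \<psi> \<longleftrightarrow>
     smooth_on UNIV \<psi> \<and> (\<exists>K. compact K \<and> K \<subseteq> ball 0 1 \<and> (\<forall>z. z \<notin> K \<longrightarrow> \<psi> z = 0))"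

text \<open>Integration over the disk against the normalized area measure \<open>dA = dx dy / \<pi>\<close>.\<close>

definition disk_integral :: "(complex \<Rightarrow> complex) \<Rightarrow> complex" where
  "disk_integral F = 1 / of_real pi * (LINT z:ball 0 1|lebesgue. F z)"

definition locally_integrable_disk :: "(complex \<Rightarrow> complex) \<Rightarrow> bool" where
  "locally_integrable_disk g \<longleftrightarrow>
     (\<forall>K. compact K \<longrightarrow> K \<subseteq> ball 0 1 \<longrightarrow> set_integrable lebesgue K g)"

text \<open>The equation \<open>\<Delta>\<^sup>2 v = g\<close> in the disk, in the sense of distributions. The squared Laplacian
  is its own formal adjoint. Local integrability of \<open>g\<close> is what makes \<open>g\<close> a distribution.\<close>

definition bilaplacian_eq :: "(complex \<Rightarrow> complex) \<Rightarrow> (complex \<Rightarrow> complex) \<Rightarrow> bool" where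
  "bilaplacian_eq v g \<longleftrightarrow>
     locally_integrable_disk v \<and> locally_integrable_disk g \<and>
     (\<forall>\<psi>. disk_test \<psi> \<longrightarrow>
        disk_integral (\<lambda>z. v z * laplacian (laplacian \<psi>) z) = disk_integral (\<lambda>z. g z * \<psi> z))"

definition solves_biharmonic_dirichlet ::
  "(complex \<Rightarrow> complex) \<Rightarrow> ((complex \<Rightarrow> complex) \<Rightarrow> complex) \<Rightarrow>
   ((complex \<Rightarrow> complex) \<Rightarrow> complex) \<Rightarrow> (complex \<Rightarrow> complex) \<Rightarrow> bool" where
  "solves_biharmonic_dirichlet g f h v \<longleftrightarrow>
     continuous_on (ball 0 1) v \<and> bilaplacian_eq v g \<and>
     boundary_value v f \<and> boundary_normal_deriv v f h"

section \<open>Kernels\<close>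

definition H0 :: "complex \<Rightarrow> real" where
  "H0 z = 1/2 * ((1 - (cmod z)\<^sup>2)\<^sup>2 / (cmod (1 - z))\<^sup>2)"

definition F0 :: "complex \<Rightarrow> real" where
  "F0 z = H0 z + 1/2 * ((1 - (cmod z)\<^sup>2) ^ 3 / (cmod (1 - z)) ^ 4)"

text \<open>On the circle, \<open>cnj \<zeta>\<close> with \<open>\<zeta> = e^{i\<theta>}\<close> is \<open>e^{-i\<theta>}\<close>.\<close>

definition F0_pot :: "((complex \<Rightarrow> complex) \<Rightarrow> complex) \<Rightarrow> complex \<Rightarrow> complex" where
  "F0_pot f z = f (\<lambda>\<zeta>. of_real (F0 (z * cnj \<zeta>)))"

definition H0_pot :: "((complex \<Rightarrow> complex) \<Rightarrow> complex) \<Rightarrow> complex \<Rightarrow> complex" where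
  "H0_pot h z = h (\<lambda>\<zeta>. of_real (H0 (z * cnj \<zeta>)))"

text \<open>For \<open>z = \<zeta>\<close> the first summand vanishes because of its factor \<open>0\<close> (whatever the value of
  the logarithm), which is the continuous extension to the diagonal.\<close>

definition biharmonic_G :: "complex \<Rightarrow> complex \<Rightarrow> real" where
  "biharmonic_G z \<zeta> =
     (cmod (z - \<zeta>))\<^sup>2 * ln ((cmod ((1 - cnj \<zeta> * z) / (z - \<zeta>)))\<^sup>2)
     - (1 - (cmod z)\<^sup>2) * (1 - (cmod \<zeta>)\<^sup>2)"

definition G_pot :: "(complex \<Rightarrow> complex) \<Rightarrow> complex \<Rightarrow> complex" where
  "G_pot g z = disk_integral (\<lambda>\<zeta>. of_real (biharmonic_G z \<zeta>) * g \<zeta>)"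

end

theory Submission
  imports Defs "HOL-Library.Nat_Bijection"
begin

text \<open>Writing \<open>E\<^sub>n\<close> for the harmonic monomial \<open>harm n\<close>, the kernels expand into the
  biharmonic monomials \<open>E\<^sub>n(z) (a + b |z|\<^sup>2)\<close>. Fourier coefficients of a distribution grow
  polynomially, so \<open>F\<^sub>0[f] + H\<^sub>0[h]\<close> is a locally uniform limit of biharmonic polynomials, and its
  boundary values are read off term by term.

  The fundamental solution is a limit of \<open>(s + e) ln (s + e)\<close> with \<open>s = |z - w|\<^sup>2\<close>, whose bilaplacian
  \<open>2 e\<^sup>2 / (s + e)^3\<close> is an approximate identity; the rest of \<open>G\<close> is biharmonic in \<open>z\<close>.
  The bound \<open>|G(z, w)| \<le> 16 (1 - |z|\<^sup>2)\<^sup>2\<close> gives the vanishing boundary data of \<open>G[g]\<close>.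

  For uniqueness, pairing a weakly biharmonic function with the test functions
  \<open>E\<^sub>n(z) \<omega>(|z|\<^sup>2)\<close> shows that its \<open>n\<close>-th angular mean, divided by \<open>|z|\<close> to the power \<open>|n|\<close>,
  is an affine function of \<open>|z|\<^sup>2\<close>; zero boundary data force this function to vanish. If the solution \<open>w\<close>
  is smooth up to the boundary, the lemma of du Bois-Reymond identifies \<open>g\<close> almost everywhere
  with a continuous function, so that the representation by \<open>G\<close> applies.\<close>

section \<open>Calculus of smooth functions\<close>

text \<open>With k = |n| and \<rho> = |z|^2, the bilaplacian of E_n(z) g(\<rho>) has the profile
  \<rho>^(-k) (\<rho>^(k+2) g'')''. Profiles that are regular at the origin and solve the
  homogeneous equation are therefore affine, a + b \<rho>: each mode carries two constants, and the
  data f_n, h_n of that mode determine them. From a + b = f_n and the inward derivative -(k (a + b)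
  + 2 b) = h_n come b = -(k f_n + h_n) / 2 and a = f_n - b, which are the coefficients of the two
  kernels. Read backwards, the same formula produces the test functions of the uniqueness proof: a
  prescribed \<omega> is reached as soon as its moments of order 0 and 1 vanish. All derivatives
  have to sit on the test side, because a solution is only assumed continuous and its modes cannot
  be differentiated directly. In the first claim g is only locally integrable, so its equation alone
  does not control it near the circle; the smoothness of w up to the boundary supplies that
  control.\<close>

lemma iter_deriv_Nil [simp]: "iter_deriv [] f = f"
  by (simp add: iter_deriv_def)

lemma iter_deriv_Cons [simp]:
  "iter_deriv (v # vs) f = (\<lambda>x. frechet_derivative (iter_deriv vs f) (at x) v)"
  by (simp add: iter_deriv_def)

lemma iter_deriv_append: "iter_deriv (us @ vs) f = iter_deriv us (iter_deriv vs f)"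
  by (simp add: iter_deriv_def)

lemma frechet_derivative_eqI:
  "(f has_derivative f') (at x) \<Longrightarrow> frechet_derivative f (at x) v = f' v"
  using frechet_derivative_at by metis

lemma frechet_derivative_cong_open:
  assumes "open S" "x \<in> S" "\<And>y. y \<in> S \<Longrightarrow> f y = g y"
  shows "frechet_derivative f (at x) = frechet_derivative g (at x)"
proof -
  have "(f has_derivative D) (at x) \<longleftrightarrow> (g has_derivative D) (at x)" for D
    using has_derivative_transform_within_open[OF _ assms(1,2), of f D UNIV g]
      has_derivative_transform_within_open[OF _ assms(1,2), of g D UNIV f] assms(3) by auto
  then show ?thesis by (simp add: frechet_derivative_def)
qed

lemma differentiable_cong_open:
  assumes "open S" "x \<in> S" "\<And>y. y \<in> S \<Longrightarrow> f y = g y" "f differentiable (at x)"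
  shows "g differentiable (at x)"
  using assms has_derivative_transform_within_open[OF _ assms(1,2), of f _ UNIV g]
  unfolding differentiable_def by blast

text \<open>\<open>iter_deriv\<close> applies the head of its list last, whereas the product and
  chain rules start with the derivative applied first. Peeling that one off gives inductions on the
  order in which the function itself varies.\<close>

primrec diff_order :: "nat \<Rightarrow> 'a::euclidean_space set \<Rightarrow> ('a \<Rightarrow> complex) \<Rightarrow> bool" where
  "diff_order 0 S f \<longleftrightarrow> (\<forall>x\<in>S. f differentiable (at x))"
| "diff_order (Suc n) S f \<longleftrightarrow> (\<forall>x\<in>S. f differentiable (at x)) \<and>
     (\<forall>v\<in>Basis. diff_order n S (\<lambda>x. frechet_derivative f (at x) v))"

lemma diff_order_iff:
  "diff_order n S f \<longleftrightarrow>
     (\<forall>vs. set vs \<subseteq> Basis \<longrightarrow> length vs \<le> n \<longrightarrow> (\<forall>x\<in>S. iter_deriv vs f differentiable (at x)))"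
proof (induction n arbitrary: f)
  case 0
  then show ?case by auto
next
  case (Suc n)
  \<comment> \<open>Lists are split at the end, since the last entry is the direction differentiated
    first.\<close>
  have *: "(\<forall>vs. P vs) \<longleftrightarrow> P [] \<and> (\<forall>v vs. P (vs @ [v]))" for P :: "'a list \<Rightarrow> bool"
    by (metis rev_exhaust)
  have "(\<forall>vs. set vs \<subseteq> Basis \<longrightarrow> length vs \<le> Suc n \<longrightarrow> (\<forall>x\<in>S. iter_deriv vs f differentiable (at x)))
     \<longleftrightarrow> (\<forall>x\<in>S. f differentiable (at x)) \<and> (\<forall>v\<in>Basis. \<forall>vs. set vs \<subseteq> Basis \<longrightarrow> length vs \<le> n \<longrightarrow>
       (\<forall>x\<in>S. iter_deriv vs (\<lambda>x. frechet_derivative f (at x) v) differentiable (at x)))"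
    by (subst *) (auto simp: iter_deriv_append)
  then show ?case using Suc by simp
qed

lemma smooth_on_iff_diff_order: "smooth_on S f \<longleftrightarrow> (\<forall>n. diff_order n S f)"
  unfolding smooth_on_def diff_order_iff by auto

lemma diff_order_differentiable: "diff_order n S f \<Longrightarrow> x \<in> S \<Longrightarrow> f differentiable (at x)"
  by (cases n) auto

lemma diff_order_SucD: "diff_order (Suc n) S f \<Longrightarrow> diff_order n S f"
  by (simp add: diff_order_iff)

lemma diff_order_cong:
  assumes "open S" "\<And>y. y \<in> S \<Longrightarrow> f y = g y" "diff_order n S f"
  shows "diff_order n S g"
  using assms(2,3)
proof (induction n arbitrary: f g)
  case 0
  have "g differentiable (at x)" if "x \<in> S" for x
    by (rule differentiable_cong_open[OF assms(1) that 0(1)]) (use 0 that in auto)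
  then show ?case by simp
next
  case (Suc n)
  have "frechet_derivative f (at x) v = frechet_derivative g (at x) v" if "x \<in> S" for x v
    by (simp only: frechet_derivative_cong_open[OF assms(1) that Suc.prems(1)])
  then have "diff_order n S (\<lambda>x. frechet_derivative g (at x) v)" if "v \<in> Basis" for v
    by (rule Suc.IH[of "\<lambda>x. frechet_derivative f (at x) v"]) (use Suc.prems(2) that in auto)
  moreover have "g differentiable (at x)" if "x \<in> S" for x
    by (rule differentiable_cong_open[OF assms(1) that Suc.prems(1)]) (use Suc.prems that in auto)
  ultimately show ?case by simp
qed

lemma diff_order_const: "diff_order n S (\<lambda>x. c)"
  by (induction n arbitrary: c) (auto simp: frechet_derivative_const)

lemma diff_order_linear:
  assumes "bounded_linear L"
  shows "diff_order n S L"
proof -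
  have "L differentiable (at x)" "frechet_derivative L (at x) = L" for x
    using bounded_linear_imp_has_derivative[OF assms, of "at x"] frechet_derivative_at[of L L x]
    by (auto simp: differentiable_def)
  then show ?thesis by (cases n) (auto simp: diff_order_const)
qed

lemma diff_order_add:
  assumes "open S" "diff_order n S f" "diff_order n S g"
  shows "diff_order n S (\<lambda>x. f x + g x)"
  using assms(2,3)
proof (induction n arbitrary: f g)
  case (Suc n)
  have "diff_order n S (\<lambda>x. frechet_derivative (\<lambda>x. f x + g x) (at x) v)" if "v \<in> Basis" for v
    by (rule diff_order_cong[OF assms(1) _ Suc.IH[of "\<lambda>x. frechet_derivative f (at x) v" "\<lambda>x. frechet_derivative g (at x) v"]])
      (use Suc.prems that in \<open>auto intro!: frechet_derivative_eqI[symmetric] has_derivative_add simp: frechet_derivative_works[symmetric]\<close>)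
  then show ?case using Suc.prems by auto
qed auto

lemma diff_order_mult:
  assumes "open S" "diff_order n S f" "diff_order n S g"
  shows "diff_order n S (\<lambda>x. f x * g x)"
  using assms(2,3)
proof (induction n arbitrary: f g)
  case (Suc n)
  have "diff_order n S (\<lambda>x. frechet_derivative (\<lambda>x. f x * g x) (at x) v)" if "v \<in> Basis" for v
  proof (rule diff_order_cong[OF assms(1)])
    show "diff_order n S (\<lambda>x. f x * frechet_derivative g (at x) v + frechet_derivative f (at x) v * g x)"
      using Suc.prems that Suc.prems[THEN diff_order_SucD] by (intro diff_order_add assms(1) Suc.IH) auto
  next
    fix x assume "x \<in> S"
    then have "f differentiable (at x)" "g differentiable (at x)" using Suc.prems by auto
    then have "((\<lambda>x. f x * g x) has_derivative (\<lambda>h. f x * frechet_derivative g (at x) h + frechet_derivative f (at x) h * g x)) (at x)"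
      by (intro has_derivative_mult) (auto simp: frechet_derivative_works[symmetric])
    then show "f x * frechet_derivative g (at x) v + frechet_derivative f (at x) v * g x = frechet_derivative (\<lambda>x. f x * g x) (at x) v"
      by (simp add: frechet_derivative_eqI)
  qed
  then show ?case using Suc.prems by auto
qed auto

text \<open>The direction enters only through the inner function: the derivative is the composite of
  g' with the same q, times the derivative of q. So the induction varies g and keeps q fixed.
  Smoothness of q is phrased for \<open>of_real (q x)\<close> because \<open>diff_order\<close>
  speaks of complex values.\<close>

lemma diff_order_comp:
  fixes g :: "real \<Rightarrow> complex" and q :: "'a::euclidean_space \<Rightarrow> real"
  assumes "open S" "\<And>x. x \<in> S \<Longrightarrow> q x \<in> T" "diff_order n T g" "diff_order n S (\<lambda>x. of_real (q x))"
  shows "diff_order n S (\<lambda>x. g (q x))"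
  using assms(3,4)
proof (induction n arbitrary: g)
  case (0 g)
  have "q differentiable (at x)" if "x \<in> S" for x
  proof -
    have "(\<lambda>x. complex_of_real (q x)) differentiable (at x)" using 0 that by auto
    then have "(\<lambda>x. Re (complex_of_real (q x))) differentiable (at x)"
      using bounded_linear.has_derivative[OF bounded_linear_Re] unfolding differentiable_def by blast
    then show ?thesis by simp
  qed
  then show ?case using 0 assms(2) differentiable_compose[of g q _ UNIV] by auto
next
  case (Suc n g)
  have q: "((\<lambda>x. complex_of_real (q x)) has_derivative frechet_derivative (\<lambda>x. complex_of_real (q x)) (at x)) (at x)"
    if "x \<in> S" for x using Suc.prems that by (auto simp: frechet_derivative_works[symmetric])
  have q': "(q has_derivative (\<lambda>h. Re (frechet_derivative (\<lambda>x. complex_of_real (q x)) (at x) h))) (at x)"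
    if "x \<in> S" for x using bounded_linear.has_derivative[OF bounded_linear_Re q[OF that]] by simp
  \<comment> \<open>The derivative of a real-valued function embedded in the complex plane is real,
    so taking real parts loses nothing.\<close>
  have eq: "complex_of_real (Re (frechet_derivative (\<lambda>x. complex_of_real (q x)) (at x) h)) = frechet_derivative (\<lambda>x. complex_of_real (q x)) (at x) h"
    if "x \<in> S" for x h
    using frechet_derivative_eqI[OF bounded_linear.has_derivative[OF bounded_linear_of_real q'[OF that]], of h] by (rule sym)
  have g: "(g has_derivative frechet_derivative g (at (q x))) (at (q x))" if "x \<in> S" for x
    using Suc.prems assms(2)[OF that] by (auto simp: frechet_derivative_works[symmetric])
  have D: "((\<lambda>x. g (q x)) has_derivative (\<lambda>h. frechet_derivative g (at (q x)) 1 * frechet_derivative (\<lambda>x. complex_of_real (q x)) (at x) h)) (at x)"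
    if "x \<in> S" for x
  proof -
    have fr: "frechet_derivative g (at (q x)) r = frechet_derivative g (at (q x)) 1 * of_real r" for r
      using linear_cmul[OF has_derivative_linear[OF g[OF that]], of r 1] by (simp add: scaleR_conv_of_real)
    have "(\<lambda>h. frechet_derivative g (at (q x)) (Re (frechet_derivative (\<lambda>x. complex_of_real (q x)) (at x) h))) =
      (\<lambda>h. frechet_derivative g (at (q x)) 1 * frechet_derivative (\<lambda>x. complex_of_real (q x)) (at x) h)"
      by (subst fr, subst eq[OF that], rule refl)
    with has_derivative_compose[OF q'[OF that] g[OF that]] show ?thesis by (simp only:)
  qed
  have "diff_order n S (\<lambda>x. frechet_derivative (\<lambda>x. g (q x)) (at x) v)" if v: "v \<in> Basis" for v
  proof (rule diff_order_cong[OF assms(1)])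
    show "diff_order n S (\<lambda>x. frechet_derivative g (at (q x)) 1 * frechet_derivative (\<lambda>x. complex_of_real (q x)) (at x) v)"
      using Suc.prems v diff_order_SucD[OF Suc.prems(2)]
      by (intro diff_order_mult assms(1) Suc.IH[of "\<lambda>x. frechet_derivative g (at x) 1"]) auto
  qed (simp add: frechet_derivative_eqI[OF D])
  then show ?case using D by (auto simp: differentiable_def)
qed

lemma smooth_on_cong: "open S \<Longrightarrow> (\<And>y. y \<in> S \<Longrightarrow> f y = g y) \<Longrightarrow> smooth_on S f \<Longrightarrow> smooth_on S g"
  using diff_order_cong unfolding smooth_on_iff_diff_order by blast

lemma smooth_on_subset: "smooth_on S f \<Longrightarrow> T \<subseteq> S \<Longrightarrow> smooth_on T f"
  unfolding smooth_on_def by blast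

lemma smooth_on_const: "smooth_on S (\<lambda>x. c)"
  by (simp add: smooth_on_iff_diff_order diff_order_const)

lemma smooth_on_linear: "bounded_linear L \<Longrightarrow> smooth_on S L"
  by (simp add: smooth_on_iff_diff_order diff_order_linear)

lemma smooth_on_add: "open S \<Longrightarrow> smooth_on S f \<Longrightarrow> smooth_on S g \<Longrightarrow> smooth_on S (\<lambda>x. f x + g x)"
  by (simp add: smooth_on_iff_diff_order diff_order_add)

lemma smooth_on_mult: "open S \<Longrightarrow> smooth_on S f \<Longrightarrow> smooth_on S g \<Longrightarrow> smooth_on S (\<lambda>x. f x * g x)"
  by (simp add: smooth_on_iff_diff_order diff_order_mult)

lemma smooth_on_diff: "open S \<Longrightarrow> smooth_on S f \<Longrightarrow> smooth_on S g \<Longrightarrow> smooth_on S (\<lambda>x. f x - g x)"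
  using smooth_on_add[of S f "\<lambda>x. -1 * g x"] smooth_on_mult[of S "\<lambda>x. -1" g] smooth_on_const[of S "-1"] by simp

lemma smooth_on_power: "open S \<Longrightarrow> smooth_on S f \<Longrightarrow> smooth_on S (\<lambda>x. f x ^ n)"
  by (induction n) (auto simp: smooth_on_const smooth_on_mult)

lemma smooth_on_comp:
  fixes g :: "real \<Rightarrow> complex" and q :: "'a::euclidean_space \<Rightarrow> real"
  assumes "open S" "\<And>x. x \<in> S \<Longrightarrow> q x \<in> T" "smooth_on T g" "smooth_on S (\<lambda>x. of_real (q x))"
  shows "smooth_on S (\<lambda>x. g (q x))"
  using assms diff_order_comp[of S q T] by (simp add: smooth_on_iff_diff_order)

lemma smooth_on_iter_deriv: "smooth_on S f \<Longrightarrow> set vs \<subseteq> Basis \<Longrightarrow> smooth_on S (iter_deriv vs f)"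
  unfolding smooth_on_def by (auto simp flip: iter_deriv_append)

lemma smooth_on_differentiable: "smooth_on S f \<Longrightarrow> x \<in> S \<Longrightarrow> f differentiable (at x)"
  by (metis diff_order_differentiable smooth_on_iff_diff_order)

lemma smooth_on_continuous: "smooth_on S f \<Longrightarrow> continuous_on S f"
  by (meson continuous_at_imp_continuous_on differentiable_imp_continuous_within smooth_on_differentiable)

lemma frechet_derivative_real:
  fixes f :: "real \<Rightarrow> complex"
  assumes "(f has_vector_derivative D) (at x)"
  shows "frechet_derivative f (at x) 1 = D"
  using frechet_derivative_eqI[of f "\<lambda>h. h *\<^sub>R D" x 1] assms by (simp add: has_vector_derivative_def)

lemma smooth_on_antiderivative:
  fixes f g :: "real \<Rightarrow> complex"
  assumes "open S" "\<And>x. x \<in> S \<Longrightarrow> (f has_vector_derivative g x) (at x)" "smooth_on S g"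
  shows "smooth_on S f"
proof -
  have "diff_order n S f" for n
  proof (cases n)
    case 0
    then show ?thesis using assms(2) by (auto simp: has_vector_derivative_def differentiable_def)
  next
    case (Suc m)
    have "diff_order m S (\<lambda>x. frechet_derivative f (at x) 1)"
      by (rule diff_order_cong[OF assms(1), of g]) (use assms(3) frechet_derivative_real[OF assms(2)] in \<open>auto simp: smooth_on_iff_diff_order\<close>)
    then show ?thesis using Suc assms(2) by (auto simp: has_vector_derivative_def differentiable_def)
  qed
  then show ?thesis by (simp add: smooth_on_iff_diff_order)
qed

lemma smooth_on_real_has_vector_derivative:
  fixes f :: "real \<Rightarrow> complex"
  assumes "smooth_on S f" "x \<in> S"
  shows "(f has_vector_derivative iter_deriv [1] f x) (at x)"
proof -
  have D: "(f has_derivative frechet_derivative f (at x)) (at x)"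
    using smooth_on_differentiable[OF assms] frechet_derivative_works by blast
  then have "frechet_derivative f (at x) r = r *\<^sub>R frechet_derivative f (at x) 1" for r
    using linear_cmul[OF has_derivative_linear[OF D], of r 1] by simp
  then have "frechet_derivative f (at x) = (\<lambda>r. r *\<^sub>R frechet_derivative f (at x) 1)" by (rule ext)
  with D have "(f has_derivative (\<lambda>r. r *\<^sub>R frechet_derivative f (at x) 1)) (at x)" by (rule subst[rotated])
  then show ?thesis by (simp add: has_vector_derivative_def)
qed

section \<open>Integration by parts\<close>

text \<open>Bounds the difference quotients in \<open>integral_directional_derivative_eq_0\<close>
  uniformly, as dominated convergence requires there.\<close>

lemma bounded_linear_vector_mean_value:
  fixes F :: "complex \<Rightarrow> complex"
  assumes "\<And>x. F differentiable (at x)" "\<And>x. norm (frechet_derivative F (at x) v) \<le> M" "0 \<le> h"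
  shows "norm (F (z + h *\<^sub>R v) - F z) \<le> M * h"
proof -
  have "((\<lambda>t. F (z + t *\<^sub>R v)) has_derivative (\<lambda>s. s *\<^sub>R frechet_derivative F (at (z + t *\<^sub>R v)) v)) (at t within {0..h})" for t
  proof -
    have F: "(F has_derivative frechet_derivative F (at (z + t *\<^sub>R v))) (at (z + t *\<^sub>R v))"
      using assms(1) frechet_derivative_works by blast
    have "((\<lambda>t. z + t *\<^sub>R v) has_derivative (\<lambda>s. s *\<^sub>R v)) (at t within {0..h})"
      by (auto intro!: derivative_eq_intros)
    from has_derivative_compose[OF this F] show ?thesis
      using linear_cmul[OF has_derivative_linear[OF F]] by simp
  qed
  then have "norm (F (z + h *\<^sub>R v) - F (z + 0 *\<^sub>R v)) \<le> M * norm (h - 0)"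
  proof (intro differentiable_bound[where f = "\<lambda>t. F (z + t *\<^sub>R v)" and S = "{0..h}"])
    show "onorm (\<lambda>s. s *\<^sub>R frechet_derivative F (at (z + x *\<^sub>R v)) v) \<le> M" for x
      by (rule onorm_le) (use assms(2)[of "z + x *\<^sub>R v"] in \<open>simp add: mult.commute[of M] mult_left_mono\<close>)
  qed (use assms(3) in auto)
  then show ?thesis using assms(3) by simp
qed

lemma has_vector_derivative_difference_quotient:
  fixes f :: "real \<Rightarrow> 'b::real_normed_vector"
  assumes "(f has_vector_derivative D) (at 0)"
  shows "((\<lambda>h. (f h - f 0) /\<^sub>R h) \<longlongrightarrow> D) (at 0)"
proof -
  have "((\<lambda>y. norm ((f y - f 0) - y *\<^sub>R D) / norm y) \<longlongrightarrow> 0) (at 0)"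
    using assms by (simp add: has_vector_derivative_def has_derivative_iff_norm)
  moreover have "\<forall>\<^sub>F y in at 0. norm ((f y - f 0) - y *\<^sub>R D) / norm y = norm ((f y - f 0) /\<^sub>R y - D)"
  proof -
    have "norm ((f y - f 0) - y *\<^sub>R D) / norm y = norm ((f y - f 0) /\<^sub>R y - D)" if "y \<noteq> 0" for y
    proof -
      have "(f y - f 0) /\<^sub>R y - D = ((f y - f 0) - y *\<^sub>R D) /\<^sub>R y"
        using that by (simp add: scaleR_diff_right)
      then show ?thesis by (simp add: divide_inverse_commute)
    qed
    then show ?thesis by (auto simp: eventually_at_filter)
  qed
  ultimately have "((\<lambda>y. norm ((f y - f 0) /\<^sub>R y - D)) \<longlongrightarrow> 0) (at 0)"
    by (rule Lim_transform_eventually)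
  then show ?thesis by (simp add: tendsto_norm_zero_iff LIM_zero_iff)
qed

lemma lborel_integral_translation:
  fixes F :: "complex \<Rightarrow> complex"
  assumes "F \<in> borel_measurable borel"
  shows "(\<integral>z. F (a + z) \<partial>lborel) = (\<integral>z. F z \<partial>lborel)"
proof -
  have "(\<integral>z. F z \<partial>lborel) = (\<integral>z. F z \<partial>distr lborel borel ((+) a))"
    by (simp add: lborel_distr_plus)
  also have "\<dots> = (\<integral>z. F (a + z) \<partial>lborel)"
    using assms by (subst integral_distr) auto
  finally show ?thesis ..
qed

lemma integrable_compact_support:
  fixes F :: "'a::euclidean_space \<Rightarrow> complex"
  assumes "continuous_on UNIV F" "compact K" "\<And>z. z \<notin> K \<Longrightarrow> F z = 0"
  shows "integrable lborel F"
proof -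
  have "integrable lborel (\<lambda>z. indicator K z *\<^sub>R F z)"
    using assms by (intro borel_integrable_compact) (auto intro: continuous_on_subset)
  moreover have "(\<lambda>z. indicator K z *\<^sub>R F z) = F" using assms(3) by (auto simp: indicator_def fun_eq_iff)
  ultimately show ?thesis by simp
qed

lemma frechet_derivative_zero_outside:
  assumes "compact K" "\<And>z. z \<notin> K \<Longrightarrow> F z = 0" "z \<notin> K"
  shows "frechet_derivative F (at z) v = 0"
proof -
  have "frechet_derivative F (at z) = frechet_derivative (\<lambda>_. 0) (at z)"
    by (rule frechet_derivative_cong_open[of "-K"]) (use assms in \<open>auto simp: compact_imp_closed\<close>)
  then show ?thesis by (simp add: frechet_derivative_const)
qed

lemma compact_support_bounded:
  fixes F :: "'a::euclidean_space \<Rightarrow> complex"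
  assumes "continuous_on UNIV F" "compact K" "\<And>z. z \<notin> K \<Longrightarrow> F z = 0"
  obtains M where "M > 0" "\<And>z. norm (F z) \<le> M"
proof -
  have "bounded (F ` K)"
    using assms by (meson compact_continuous_image compact_imp_bounded continuous_on_subset subset_UNIV)
  then obtain M where M: "\<And>z. z \<in> K \<Longrightarrow> norm (F z) \<le> M" unfolding bounded_iff by blast
  have "norm (F z) \<le> max M 1" for z
    using M[of z] assms(3)[of z] by (cases "z \<in> K") auto
  then show ?thesis using that[of "max M 1"] by simp
qed

text \<open>By translation invariance of Lebesgue measure every difference quotient of F has
  integral 0; compact support and the mean value bound allow the limit under the integral
  sign.\<close>

lemma integral_directional_derivative_eq_0:
  fixes F :: "complex \<Rightarrow> complex"
  assumes diff: "\<And>x. F differentiable (at x)"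
    and cont: "continuous_on UNIV (\<lambda>x. frechet_derivative F (at x) v)"
    and K: "compact K" "\<And>z. z \<notin> K \<Longrightarrow> F z = 0"
  shows "(\<integral>z. frechet_derivative F (at z) v \<partial>lborel) = 0"
proof -
  let ?D = "\<lambda>z. frechet_derivative F (at z) v"
  have contF: "continuous_on UNIV F"
    using diff by (meson differentiable_imp_continuous_within continuous_at_imp_continuous_on)
  obtain M where M: "M > 0" "\<And>z. norm (?D z) \<le> M"
    by (rule compact_support_bounded[OF cont K(1)]) (use frechet_derivative_zero_outside[OF K] in auto)
  obtain R where R: "\<And>z. z \<in> K \<Longrightarrow> norm z \<le> R"
    using compact_imp_bounded[OF K(1)] unfolding bounded_iff by blast
  define q where "q n z = of_nat (Suc n) * (F (z + (1 / real (Suc n)) *\<^sub>R v) - F z)" for n z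
  have [measurable]: "F \<in> borel_measurable borel" "?D \<in> borel_measurable borel"
    using contF cont by (auto intro: borel_measurable_continuous_onI)
  have "(\<lambda>n. \<integral>z. q n z \<partial>lborel) \<longlonglongrightarrow> (\<integral>z. ?D z \<partial>lborel)"
  \<comment> \<open>The steps \<open>1 / Suc n\<close> are at most 1, so all quotients vanish
    outside the ball whose radius exceeds that of the support by \<open>norm v\<close>.\<close>
  proof (rule integral_dominated_convergence[where w = "\<lambda>z. indicator (cball 0 (R + norm v)) z *\<^sub>R M"])
    show "AE z in lborel. (\<lambda>n. q n z) \<longlonglongrightarrow> ?D z"
    proof (intro AE_I2)
      fix z
      have F: "(F has_derivative frechet_derivative F (at z)) (at z)"
        using diff frechet_derivative_works by blast
      have "((\<lambda>t. F (z + t *\<^sub>R v)) has_derivative (\<lambda>s. frechet_derivative F (at (z + 0 *\<^sub>R v)) (s *\<^sub>R v))) (at 0)"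
        by (rule has_derivative_compose[of "\<lambda>t. z + t *\<^sub>R v" "\<lambda>s. s *\<^sub>R v"]) (use F in \<open>auto intro!: derivative_eq_intros\<close>)
      then have "((\<lambda>t. F (z + t *\<^sub>R v)) has_vector_derivative ?D z) (at 0)"
        using linear_cmul[OF has_derivative_linear[OF F]] by (simp add: has_vector_derivative_def)
      then have "((\<lambda>h. (F (z + h *\<^sub>R v) - F z) /\<^sub>R h) \<longlongrightarrow> ?D z) (at 0)"
        using has_vector_derivative_difference_quotient[of "\<lambda>t. F (z + t *\<^sub>R v)"] by simp
      moreover have "filterlim (\<lambda>n. 1 / real (Suc n)) (at 0) sequentially"
        using LIMSEQ_Suc[OF lim_1_over_n] by (auto simp: filterlim_at)
      ultimately have "(\<lambda>n. (F (z + (1 / real (Suc n)) *\<^sub>R v) - F z) /\<^sub>R (1 / real (Suc n))) \<longlonglongrightarrow> ?D z"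
        by (rule filterlim_compose)
      then show "(\<lambda>n. q n z) \<longlonglongrightarrow> ?D z" by (simp add: q_def scaleR_conv_of_real)
    qed
    show "AE z in lborel. norm (q n z) \<le> indicator (cball 0 (R + norm v)) z *\<^sub>R M" for n
    proof (intro AE_I2)
      fix z
      have "norm (F (z + (1 / real (Suc n)) *\<^sub>R v) - F z) \<le> M * (1 / real (Suc n))"
        by (rule bounded_linear_vector_mean_value) (use diff M in auto)
      then have *: "norm (q n z) \<le> M"
        unfolding q_def norm_mult by (simp add: field_simps del: of_nat_Suc)
      have "q n z = 0" if "z \<notin> cball 0 (R + norm v)"
      proof -
        have z: "norm z > R + norm v" using that by simp
        have "norm ((1 / real (Suc n)) *\<^sub>R v) \<le> norm v"
          using mult_left_mono[of 1 "1 + real n" "norm v"] by (simp add: divide_le_eq)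
        then have "norm (z + (1 / real (Suc n)) *\<^sub>R v) > R"
          using z norm_triangle_ineq2[of z "- ((1 / real (Suc n)) *\<^sub>R v)"] by simp
        then have "z + (1 / real (Suc n)) *\<^sub>R v \<notin> K" using R by (meson not_less)
        moreover have "z \<notin> K" using R[of z] z norm_ge_zero[of v] by linarith
        ultimately show ?thesis using K(2) by (simp add: q_def)
      qed
      then show "norm (q n z) \<le> indicator (cball 0 (R + norm v)) z *\<^sub>R M"
        using * by (auto simp: indicator_def)
    qed
    show "integrable lborel (\<lambda>z. indicator (cball 0 (R + norm v)) z *\<^sub>R M)"
      by (intro borel_integrable_compact) auto
  qed (auto simp: q_def)
  moreover have "(\<integral>z. q n z \<partial>lborel) = 0" for n
  proof -
    have F: "integrable lborel F" by (rule integrable_compact_support[OF contF K])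
    have F': "integrable lborel (\<lambda>z. F (a + z))" for a
    proof (rule integrable_compact_support)
      show "compact ((\<lambda>z. - a + z) ` K)" by (rule compact_translation[OF K(1)])
      show "F (a + z) = 0" if "z \<notin> (\<lambda>z. - a + z) ` K" for z
      proof (rule K(2), rule notI)
        assume "a + z \<in> K"
        then have "- a + (a + z) \<in> (\<lambda>z. - a + z) ` K" by (rule imageI)
        then show False using that by simp
      qed
      show "continuous_on UNIV (\<lambda>z. F (a + z))"
        by (rule continuous_on_compose2[OF contF]) (auto intro!: continuous_intros)
    qed
    show ?thesis
      unfolding q_def using F F'[of "(1 / real (Suc n)) *\<^sub>R v"]
        lborel_integral_translation[of F "(1 / real (Suc n)) *\<^sub>R v"]
      by (simp add: add.commute del: of_nat_Suc)
  qed
  ultimately show ?thesis by (simp add: LIMSEQ_const_iff)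
qed

text \<open>\<open>U\<close> and the complement of \<open>K\<close> are open and cover the space,
  and the extension by zero is continuous on each of them.\<close>

lemma continuous_on_indicator_compact_support:
  fixes F :: "'a::euclidean_space \<Rightarrow> complex"
  assumes "open U" "compact K" "K \<subseteq> U" "continuous_on U F" "\<And>z. z \<in> U \<Longrightarrow> z \<notin> K \<Longrightarrow> F z = 0"
  shows "continuous_on UNIV (\<lambda>z. indicator U z *\<^sub>R F z)"
proof -
  have "continuous_on (U \<union> - K) (\<lambda>z. indicator U z *\<^sub>R F z)"
  proof (rule continuous_on_open_Un)
    show "continuous_on U (\<lambda>z. indicator U z *\<^sub>R F z)"
      by (rule continuous_on_eq[OF assms(4)]) simp
    show "continuous_on (- K) (\<lambda>z. indicator U z *\<^sub>R F z)"
      by (rule continuous_on_eq[of _ "\<lambda>_. 0"])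
        (use assms(5) in \<open>auto simp: indicator_def\<close>)
  qed (use assms in \<open>auto simp: compact_imp_closed\<close>)
  moreover have "U \<union> - K = UNIV" using assms by auto
  ultimately show ?thesis by simp
qed

text \<open>Only \<psi> lives on the whole plane. Its support lies inside U, so the product
  continued by zero is differentiable everywhere, and its directional derivative has integral
  0.\<close>

lemma integration_by_parts:
  fixes f \<psi> :: "complex \<Rightarrow> complex"
  assumes U: "open U" "compact K" "K \<subseteq> U"
    and f: "\<And>x. x \<in> U \<Longrightarrow> f differentiable (at x)" "continuous_on U (\<lambda>x. frechet_derivative f (at x) v)"
    and \<psi>: "\<And>x. \<psi> differentiable (at x)" "continuous_on UNIV (\<lambda>x. frechet_derivative \<psi> (at x) v)" "\<And>x. x \<notin> K \<Longrightarrow> \<psi> x = 0"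
  shows "(LINT z:U|lborel. f z * frechet_derivative \<psi> (at z) v) = - (LINT z:U|lborel. frechet_derivative f (at z) v * \<psi> z)"
proof -
  define F where "F z = indicator U z *\<^sub>R (f z * \<psi> z)" for z
  have supp: "F z = 0" if "z \<notin> K" for z using \<psi>(3)[OF that] by (simp add: F_def)
  have D: "(F has_derivative (\<lambda>h. indicator U x *\<^sub>R (f x * frechet_derivative \<psi> (at x) h + frechet_derivative f (at x) h * \<psi> x))) (at x)" for x
  proof (cases "x \<in> U")
    case True
    have "((\<lambda>x. f x * \<psi> x) has_derivative (\<lambda>h. f x * frechet_derivative \<psi> (at x) h + frechet_derivative f (at x) h * \<psi> x)) (at x)"
      by (intro has_derivative_mult) (use f(1)[OF True] \<psi>(1) in \<open>auto simp: frechet_derivative_works[symmetric]\<close>)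
    then have "(F has_derivative (\<lambda>h. f x * frechet_derivative \<psi> (at x) h + frechet_derivative f (at x) h * \<psi> x)) (at x)"
      by (rule has_derivative_transform_within_open[OF _ U(1) True]) (simp add: F_def)
    then show ?thesis using True by simp
  next
    case False
    have "(F has_derivative (\<lambda>h. 0)) (at x)"
      by (rule has_derivative_transform_within_open[of "\<lambda>_. 0" _ _ UNIV "- K"])
        (use U False supp in \<open>auto simp: compact_imp_closed\<close>)
    then show ?thesis using False by simp
  qed
  have \<psi>c: "continuous_on UNIV \<psi>"
    using \<psi>(1) by (meson differentiable_imp_continuous_within continuous_at_imp_continuous_on)
  have fc: "continuous_on U f"
    using f(1) by (meson differentiable_imp_continuous_within continuous_at_imp_continuous_on)
  have c1: "continuous_on UNIV (\<lambda>x. indicator U x *\<^sub>R (f x * frechet_derivative \<psi> (at x) v))"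
    by (rule continuous_on_indicator_compact_support[OF U])
      (auto intro!: continuous_intros fc continuous_on_subset[OF \<psi>(2)] simp: frechet_derivative_zero_outside[OF U(2) \<psi>(3)])
  have c2: "continuous_on UNIV (\<lambda>x. indicator U x *\<^sub>R (frechet_derivative f (at x) v * \<psi> x))"
    by (rule continuous_on_indicator_compact_support[OF U])
      (auto intro!: continuous_intros f(2) continuous_on_subset[OF \<psi>c] simp: \<psi>(3))
  have Dv: "frechet_derivative F (at x) v =
      indicator U x *\<^sub>R (f x * frechet_derivative \<psi> (at x) v) + indicator U x *\<^sub>R (frechet_derivative f (at x) v * \<psi> x)" for x
    using frechet_derivative_eqI[OF D] by (simp add: scaleR_add_right)
  have i1: "integrable lborel (\<lambda>x. indicator U x *\<^sub>R (f x * frechet_derivative \<psi> (at x) v))"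
    by (rule integrable_compact_support[OF c1 U(2)]) (simp add: frechet_derivative_zero_outside[OF U(2) \<psi>(3)])
  have i2: "integrable lborel (\<lambda>x. indicator U x *\<^sub>R (frechet_derivative f (at x) v * \<psi> x))"
    by (rule integrable_compact_support[OF c2 U(2)]) (simp add: \<psi>(3))
  have "(\<integral>z. frechet_derivative F (at z) v \<partial>lborel) = 0"
    by (rule integral_directional_derivative_eq_0[of F v K])
      (use D supp U in \<open>auto simp: differentiable_def Dv intro!: continuous_on_add c1 c2\<close>)
  then show ?thesis
    using i1 i2 by (simp add: Dv set_lebesgue_integral_def add_eq_0_iff2)
qed

text \<open>The regularity that two integrations by parts in the same direction consume: pure second
  derivatives along basis vectors. It can be read off from two derivatives of a radial
  profile.\<close>

definition C2_on :: "complex set \<Rightarrow> (complex \<Rightarrow> complex) \<Rightarrow> bool" where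
  "C2_on U f \<longleftrightarrow> (\<forall>x\<in>U. f differentiable (at x)) \<and>
     (\<forall>v\<in>Basis. (\<forall>x\<in>U. iter_deriv [v] f differentiable (at x)) \<and> continuous_on U (iter_deriv [v, v] f))"

lemma smooth_on_C2: "smooth_on U f \<Longrightarrow> C2_on U f"
  unfolding C2_on_def
  using smooth_on_differentiable smooth_on_iter_deriv[of U f "[v]" for v]
    smooth_on_continuous[OF smooth_on_iter_deriv[of U f "[v,v]" for v]]
  by (auto simp del: iter_deriv_Cons)

lemma C2_on_continuous: "C2_on U f \<Longrightarrow> continuous_on U f"
  unfolding C2_on_def by (meson differentiable_imp_continuous_within continuous_at_imp_continuous_on)

lemma smooth_on_laplacian:
  assumes "open U" "smooth_on U f"
  shows "smooth_on U (laplacian f)"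
  unfolding laplacian_def[abs_def]
  using smooth_on_mult[OF assms(1) smooth_on_const[of U "1/4"] smooth_on_add[OF assms(1) smooth_on_iter_deriv[OF assms(2), of "[1,1]"] smooth_on_iter_deriv[OF assms(2), of "[\<i>,\<i>]"]]]
  by (simp add: Basis_complex_def del: iter_deriv_Cons)

lemma laplacian_zero_outside:
  assumes "compact K" "\<And>z. z \<notin> K \<Longrightarrow> \<psi> z = 0" "z \<notin> K"
  shows "laplacian \<psi> z = 0"
proof -
  have *: "iter_deriv [v] \<psi> z = 0" if "z \<notin> K" for v z
    using frechet_derivative_zero_outside[OF assms(1,2) that] by simp
  have "iter_deriv [v, v] \<psi> z = 0" for v
    using frechet_derivative_zero_outside[OF assms(1) _ assms(3), of "iter_deriv [v] \<psi>" v] * by simp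
  then show ?thesis by (simp add: laplacian_def del: iter_deriv_Cons)
qed

lemma set_integrable_compact_support:
  fixes F :: "complex \<Rightarrow> complex"
  assumes "open U" "compact K" "K \<subseteq> U" "continuous_on U F" "\<And>z. z \<in> U \<Longrightarrow> z \<notin> K \<Longrightarrow> F z = 0"
  shows "set_integrable lborel U F"
  unfolding set_integrable_def
  using continuous_on_indicator_compact_support[OF assms]
  by (rule integrable_compact_support[OF _ assms(2)]) (use assms(5) in \<open>auto simp: indicator_def\<close>)

lemma green_identity:
  fixes f \<psi> :: "complex \<Rightarrow> complex"
  assumes U: "open U" "compact K" "K \<subseteq> U"
    and f: "C2_on U f" and \<psi>: "C2_on UNIV \<psi>" "\<And>x. x \<notin> K \<Longrightarrow> \<psi> x = 0"
  shows "(LINT z:U|lborel. f z * laplacian \<psi> z) = (LINT z:U|lborel. laplacian f z * \<psi> z)"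
proof -
  have cd: "continuous_on S g" if "\<And>x. x \<in> S \<Longrightarrow> g differentiable (at x)" for g :: "complex \<Rightarrow> complex" and S
    using that by (meson differentiable_imp_continuous_within continuous_at_imp_continuous_on)
  have z1: "iter_deriv [v] \<psi> z = 0" if "z \<notin> K" for v z
    using frechet_derivative_zero_outside[OF U(2) \<psi>(2) that] by simp
  have z2: "iter_deriv [v, v] \<psi> z = 0" if "z \<notin> K" for v z
    using frechet_derivative_zero_outside[OF U(2) _ that, of "iter_deriv [v] \<psi>" v] z1 by simp
  have *: "(LINT z:U|lborel. f z * iter_deriv [v, v] \<psi> z) = (LINT z:U|lborel. iter_deriv [v, v] f z * \<psi> z)"
    if v: "v \<in> Basis" for v
  proof -
    note fv = f[unfolded C2_on_def, THEN conjunct2, rule_format, OF v]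
    note \<psi>v = \<psi>(1)[unfolded C2_on_def, THEN conjunct2, rule_format, OF v]
    have f0: "f differentiable (at x)" if "x \<in> U" for x using f that by (auto simp: C2_on_def)
    have \<psi>0: "\<psi> differentiable (at x)" for x using \<psi>(1) by (auto simp: C2_on_def)
    have f1: "iter_deriv [v] f differentiable (at x)" if "x \<in> U" for x using fv that by blast
    have \<psi>1: "iter_deriv [v] \<psi> differentiable (at x)" for x using \<psi>v by blast
    have "(LINT z:U|lborel. f z * frechet_derivative (iter_deriv [v] \<psi>) (at z) v) = - (LINT z:U|lborel. frechet_derivative f (at z) v * iter_deriv [v] \<psi> z)"
      by (rule integration_by_parts[OF U])
        (use f0 f1 \<psi>1 cd[of U "iter_deriv [v] f"] \<psi>v z1 in auto)
    also have "(LINT z:U|lborel. frechet_derivative f (at z) v * iter_deriv [v] \<psi> z) =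
       (LINT z:U|lborel. iter_deriv [v] f z * frechet_derivative \<psi> (at z) v)" by simp
    also have "\<dots> = - (LINT z:U|lborel. frechet_derivative (iter_deriv [v] f) (at z) v * \<psi> z)"
      by (rule integration_by_parts[OF U])
        (use f1 \<psi>0 \<psi>1 cd[of UNIV "iter_deriv [v] \<psi>"] fv \<psi>(2) in auto)
    finally show ?thesis by simp
  qed
  have fc: "continuous_on U f" and \<psi>c: "continuous_on U \<psi>"
    using C2_on_continuous[OF f] continuous_on_subset[OF C2_on_continuous[OF \<psi>(1)], of U] by auto
  have i1: "set_integrable lborel U (\<lambda>z. f z * iter_deriv [v, v] \<psi> z)" if v: "v \<in> Basis" for v
  proof (rule set_integrable_compact_support[OF U])
    have "continuous_on U (iter_deriv [v, v] \<psi>)"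
      using \<psi>(1) v unfolding C2_on_def by (meson continuous_on_subset subset_UNIV)
    then show "continuous_on U (\<lambda>z. f z * iter_deriv [v, v] \<psi> z)" by (rule continuous_on_mult[OF fc])
  qed (use z2 in \<open>simp del: iter_deriv_Cons\<close>)
  have i2: "set_integrable lborel U (\<lambda>z. iter_deriv [v, v] f z * \<psi> z)" if v: "v \<in> Basis" for v
  proof (rule set_integrable_compact_support[OF U])
    have "continuous_on U (iter_deriv [v, v] f)" using f v unfolding C2_on_def by blast
    then show "continuous_on U (\<lambda>z. iter_deriv [v, v] f z * \<psi> z)" by (rule continuous_on_mult[OF _ \<psi>c])
  qed (use \<psi>(2) in simp)
  have b: "(1::complex) \<in> Basis" "\<i> \<in> Basis" by (auto simp: Basis_complex_def)
  have "(LINT z:U|lborel. f z * laplacian \<psi> z) =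
     (LINT z:U|lborel. (f z * iter_deriv [1, 1] \<psi> z + f z * iter_deriv [\<i>, \<i>] \<psi> z) / 4)"
    by (simp add: laplacian_def algebra_simps del: iter_deriv_Cons)
  also have "\<dots> = (LINT z:U|lborel. (iter_deriv [1, 1] f z * \<psi> z + iter_deriv [\<i>, \<i>] f z * \<psi> z) / 4)"
    using * i1 i2 b by (simp add: set_integral_add del: iter_deriv_Cons)
  also have "\<dots> = (LINT z:U|lborel. laplacian f z * \<psi> z)"
    by (simp add: laplacian_def algebra_simps del: iter_deriv_Cons)
  finally show ?thesis .
qed

section \<open>Radial functions times harmonic monomials\<close>

text \<open>The harmonic extension of the character \<open>cis (n * t)\<close> of the circle,
  homogeneous of degree |n|.\<close>

definition harm :: "int \<Rightarrow> complex \<Rightarrow> complex" where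
  "harm n z = (if n \<ge> 0 then z ^ nat n else cnj z ^ nat (- n))"

lemma has_derivative_cmod_sq:
  "((\<lambda>z. (cmod (z - a))\<^sup>2) has_derivative (\<lambda>h. 2 * ((z - a) \<bullet> h))) (at z)"
  unfolding power2_norm_eq_inner by (auto intro!: derivative_eq_intros simp: inner_commute)

lemma has_derivative_radial_monomial:
  fixes g g1 :: "real \<Rightarrow> complex"
  assumes \<kappa>: "bounded_linear \<kappa>" and g: "(g has_vector_derivative g1 ((cmod (z - a))\<^sup>2)) (at ((cmod (z - a))\<^sup>2))"
  shows "((\<lambda>z. \<kappa> (z - a) ^ k * g ((cmod (z - a))\<^sup>2)) has_derivative
    (\<lambda>h. of_nat k * \<kappa> (z - a) ^ (k - 1) * \<kappa> h * g ((cmod (z - a))\<^sup>2) +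
      \<kappa> (z - a) ^ k * (of_real (2 * ((z - a) \<bullet> h)) * g1 ((cmod (z - a))\<^sup>2)))) (at z)"
proof -
  have 1: "((\<lambda>z. \<kappa> (z - a)) has_derivative \<kappa>) (at z)"
    by (rule bounded_linear.has_derivative[OF \<kappa>]) (auto intro!: derivative_eq_intros)
  have 2: "((\<lambda>z. g ((cmod (z - a))\<^sup>2)) has_derivative
      (\<lambda>h. (2 * ((z - a) \<bullet> h)) *\<^sub>R g1 ((cmod (z - a))\<^sup>2))) (at z)"
    using has_derivative_compose[OF has_derivative_cmod_sq g[unfolded has_vector_derivative_def]] .
  show ?thesis
    by (rule has_derivative_eq_rhs, (rule has_derivative_mult has_derivative_power 1 2)+)
      (auto simp: fun_eq_iff scaleR_conv_of_real algebra_simps)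
qed

text \<open>In complex terms: for the normalised Laplacian, differentiating z^k g(|z|^2) in the
  conjugate variable gives z^(k+1) g1, and differentiating this in z gives the two summands.
  \<open>\<kappa>\<close> treats z and its conjugate at once; the proof computes with the real
  partial derivatives.\<close>

lemma laplacian_radial_monomial:
  fixes g g1 g2 :: "real \<Rightarrow> complex" and a :: complex and k :: nat
  assumes \<kappa>: "\<kappa> = (\<lambda>z. z) \<or> \<kappa> = cnj"
    and g: "\<And>\<rho>. \<rho> \<ge> 0 \<Longrightarrow> (g has_vector_derivative g1 \<rho>) (at \<rho>)"
    and g1: "\<And>\<rho>. \<rho> \<ge> 0 \<Longrightarrow> (g1 has_vector_derivative g2 \<rho>) (at \<rho>)"
    and g2: "continuous_on {0..} g2"
  defines "f \<equiv> \<lambda>z. \<kappa> (z - a) ^ k * g ((cmod (z - a))\<^sup>2)"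
  shows "C2_on UNIV f"
    and "laplacian f z = \<kappa> (z - a) ^ k *
      (of_nat (Suc k) * g1 ((cmod (z - a))\<^sup>2) + of_real ((cmod (z - a))\<^sup>2) * g2 ((cmod (z - a))\<^sup>2))"
proof -
  have bl: "bounded_linear \<kappa>" using \<kappa> bounded_linear_ident bounded_linear_cnj by auto
  let ?q = "\<lambda>z. (cmod (z - a))\<^sup>2"
  have D0: "(f has_derivative (\<lambda>h. of_nat k * \<kappa> (z - a) ^ (k - 1) * \<kappa> h * g (?q z) +
      \<kappa> (z - a) ^ k * (of_real (2 * ((z - a) \<bullet> h)) * g1 (?q z)))) (at z)" for z
    unfolding f_def by (rule has_derivative_radial_monomial[OF bl]) (rule g, simp)
  have fv: "iter_deriv [v] f = (\<lambda>z. (of_nat k * \<kappa> v) * (\<kappa> (z - a) ^ (k - 1) * g (?q z)) +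
      of_real (2 * ((z - a) \<bullet> v)) * (\<kappa> (z - a) ^ k * g1 (?q z)))" for v
    using frechet_derivative_eqI[OF D0] by (simp add: fun_eq_iff algebra_simps)
  have D1: "((\<lambda>z. \<kappa> (z - a) ^ (k - 1) * g (?q z)) has_derivative
    (\<lambda>h. of_nat (k - 1) * \<kappa> (z - a) ^ (k - 1 - 1) * \<kappa> h * g (?q z) +
      \<kappa> (z - a) ^ (k - 1) * (of_real (2 * ((z - a) \<bullet> h)) * g1 (?q z)))) (at z)" for z
    by (rule has_derivative_radial_monomial[OF bl]) (rule g, simp)
  have D2: "((\<lambda>z. \<kappa> (z - a) ^ k * g1 (?q z)) has_derivative
    (\<lambda>h. of_nat k * \<kappa> (z - a) ^ (k - 1) * \<kappa> h * g1 (?q z) +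
      \<kappa> (z - a) ^ k * (of_real (2 * ((z - a) \<bullet> h)) * g2 (?q z)))) (at z)" for z
    by (rule has_derivative_radial_monomial[OF bl]) (rule g1, simp)
  have D3: "((\<lambda>z. complex_of_real (2 * ((z - a) \<bullet> v))) has_derivative (\<lambda>h. of_real (2 * (h \<bullet> v)))) (at z)" for v z
    by (auto intro!: derivative_eq_intros)
  have Dv: "(iter_deriv [v] f has_derivative (\<lambda>h. (of_nat k * \<kappa> v) * (of_nat (k - 1) * \<kappa> (z - a) ^ (k - 1 - 1) * \<kappa> h * g (?q z) +
      \<kappa> (z - a) ^ (k - 1) * (of_real (2 * ((z - a) \<bullet> h)) * g1 (?q z))) +
      (of_real (2 * ((z - a) \<bullet> v)) * (of_nat k * \<kappa> (z - a) ^ (k - 1) * \<kappa> h * g1 (?q z) +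
        \<kappa> (z - a) ^ k * (of_real (2 * ((z - a) \<bullet> h)) * g2 (?q z))) +
       of_real (2 * (h \<bullet> v)) * (\<kappa> (z - a) ^ k * g1 (?q z))))) (at z)" for v z
    unfolding fv by (intro has_derivative_add has_derivative_mult_right has_derivative_mult D1 D2 D3)
  have fvv: "iter_deriv [v, v] f = (\<lambda>z. (of_nat k * \<kappa> v) * (of_nat (k - 1) * \<kappa> (z - a) ^ (k - 1 - 1) * \<kappa> v * g (?q z) +
      \<kappa> (z - a) ^ (k - 1) * (of_real (2 * ((z - a) \<bullet> v)) * g1 (?q z))) +
      (of_real (2 * ((z - a) \<bullet> v)) * (of_nat k * \<kappa> (z - a) ^ (k - 1) * \<kappa> v * g1 (?q z) +
        \<kappa> (z - a) ^ k * (of_real (2 * ((z - a) \<bullet> v)) * g2 (?q z))) +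
       of_real (2 * (v \<bullet> v)) * (\<kappa> (z - a) ^ k * g1 (?q z))))" for v
    unfolding iter_deriv_Cons[of v "[v]" f] by (rule ext, rule frechet_derivative_eqI[OF Dv])
  have cg: "continuous_on UNIV (\<lambda>z. g (?q z))" and cg1: "continuous_on UNIV (\<lambda>z. g1 (?q z))"
    and cg2: "continuous_on UNIV (\<lambda>z. g2 (?q z))"
  proof -
    have "continuous_on {0..} g" "continuous_on {0..} g1"
      using g g1 by (meson atLeast_iff continuous_at_imp_continuous_on has_vector_derivative_continuous)+
    then show "continuous_on UNIV (\<lambda>z. g (?q z))" "continuous_on UNIV (\<lambda>z. g1 (?q z))" "continuous_on UNIV (\<lambda>z. g2 (?q z))"
      using g2 by (auto intro!: continuous_on_compose2[where f = ?q and t = "{0..}"] continuous_intros)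
  qed
  have ck: "continuous_on UNIV (\<lambda>z. \<kappa> (z - a))"
    using bl by (intro bounded_linear.continuous_on[OF bl] continuous_intros)
  have "continuous_on UNIV (iter_deriv [v, v] f)" for v
    unfolding fvv by (intro continuous_intros ck cg cg1 cg2)
  moreover have "f differentiable (at z)" "iter_deriv [v] f differentiable (at z)" for v z
    using D0[of z] Dv[of v z] unfolding differentiable_def by blast+
  ultimately show "C2_on UNIV f" unfolding C2_on_def by blast
  \<comment> \<open>Since \<open>w * w = - 1\<close>, the second derivatives of the monomial itself,
    collected in \<open>C\<close> below, cancel between the two directions.\<close>
  define w where "w = \<kappa> \<i>"
  define c where "c = \<kappa> (z - a)"
  have w: "w * w = -1" "\<kappa> 1 = 1" using \<kappa> by (auto simp: w_def)
  define x where "x = complex_of_real (Re (z - a))"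
  define y where "y = complex_of_real (Im (z - a))"
  have c: "c = x + w * y" using \<kappa> by (auto simp: c_def w_def x_def y_def complex_eq_iff)
  have q: "complex_of_real (?q z) = x * x + y * y"
    unfolding x_def y_def cmod_power2 by (simp only: power2_eq_square of_real_add of_real_mult)
  have ip: "complex_of_real (2 * ((z - a) \<bullet> 1)) = 2 * x" "complex_of_real (2 * ((z - a) \<bullet> \<i>)) = 2 * y"
    "complex_of_real (2 * ((1::complex) \<bullet> 1)) = 2" "complex_of_real (2 * (\<i> \<bullet> \<i>)) = 2"
    by (simp_all add: x_def y_def inner_complex_def)
  \<comment> \<open>For k = 0 the truncated exponent \<open>k - 1\<close> is harmless because of the
    factor \<open>of_nat k\<close>.\<close>
  have kc: "of_nat k * c ^ (k - 1) * c = of_nat k * c ^ k" by (cases k) auto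
  define A where "A = of_nat k * c ^ (k - 1)"
  define B where "B = c ^ k"
  define C where "C = of_nat k * of_nat (k - 1) * c ^ (k - 1 - 1) * g (?q z)"
  have AB: "A * (x + w * y) = of_nat k * B" using kc c by (simp add: A_def B_def)
  have "4 * laplacian f z = iter_deriv [1, 1] f z + iter_deriv [\<i>, \<i>] f z"
    by (simp add: laplacian_def del: iter_deriv_Cons)
  also have "\<dots> = (C + A * 2 * x * g1 (?q z) + (2 * x * (A * g1 (?q z) + B * (2 * x * g2 (?q z))) + 2 * (B * g1 (?q z)))) +
      (w * w * C + A * w * 2 * y * g1 (?q z) + (2 * y * (A * w * g1 (?q z) + B * (2 * y * g2 (?q z))) + 2 * (B * g1 (?q z))))"
    unfolding fvv ip w(2) w_def[symmetric] c_def[symmetric] A_def B_def C_def by (simp add: algebra_simps)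
  also have "\<dots> = 4 * (A * (x + w * y)) * g1 (?q z) + 4 * B * g1 (?q z) + 4 * B * (x * x + y * y) * g2 (?q z)"
    unfolding w(1) by (simp add: algebra_simps)
  also have "\<dots> = 4 * (B * (of_nat (Suc k) * g1 (?q z) + of_real (?q z) * g2 (?q z)))"
    unfolding AB q by (simp add: algebra_simps)
  finally show "laplacian f z = \<kappa> (z - a) ^ k * (of_nat (Suc k) * g1 (?q z) + of_real (?q z) * g2 (?q z))"
    by (simp add: B_def c_def)
qed

lemma harm_cases:
  obtains \<kappa> where "\<kappa> = (\<lambda>z. z) \<or> \<kappa> = cnj" "harm n = (\<lambda>z. \<kappa> z ^ nat \<bar>n\<bar>)"
proof (cases "n \<ge> 0")
  case True
  then show ?thesis using that[of "\<lambda>z. z"] by (auto simp: harm_def fun_eq_iff)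
next
  case False
  then show ?thesis using that[of cnj] by (auto simp: harm_def fun_eq_iff)
qed

lemma laplacian_radial_harm:
  fixes g g1 g2 :: "real \<Rightarrow> complex"
  assumes "\<And>\<rho>. \<rho> \<ge> 0 \<Longrightarrow> (g has_vector_derivative g1 \<rho>) (at \<rho>)"
    and "\<And>\<rho>. \<rho> \<ge> 0 \<Longrightarrow> (g1 has_vector_derivative g2 \<rho>) (at \<rho>)"
    and "continuous_on {0..} g2"
  shows "C2_on UNIV (\<lambda>z. harm n z * g ((cmod z)\<^sup>2))"
    and "laplacian (\<lambda>z. harm n z * g ((cmod z)\<^sup>2)) = (\<lambda>z. harm n z *
      ((of_nat (nat \<bar>n\<bar>) + 1) * g1 ((cmod z)\<^sup>2) + of_real ((cmod z)\<^sup>2) * g2 ((cmod z)\<^sup>2)))"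
proof -
  obtain \<kappa> where \<kappa>: "\<kappa> = (\<lambda>z. z) \<or> \<kappa> = cnj" "harm n = (\<lambda>z. \<kappa> z ^ nat \<bar>n\<bar>)" using harm_cases[of n] by blast
  show "C2_on UNIV (\<lambda>z. harm n z * g ((cmod z)\<^sup>2))"
    using laplacian_radial_monomial(1)[OF \<kappa>(1) assms, of 0 "nat \<bar>n\<bar>"] \<kappa>(2) by simp
  show "laplacian (\<lambda>z. harm n z * g ((cmod z)\<^sup>2)) = (\<lambda>z. harm n z *
      ((of_nat (nat \<bar>n\<bar>) + 1) * g1 ((cmod z)\<^sup>2) + of_real ((cmod z)\<^sup>2) * g2 ((cmod z)\<^sup>2)))"
    using laplacian_radial_monomial(2)[OF \<kappa>(1) assms, of 0 "nat \<bar>n\<bar>"] \<kappa>(2) by (simp add: fun_eq_iff add.commute)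
qed

text \<open>The bracket is \<rho>^(-k) times the second derivative of \<rho>^(k+2) g2, expanded.
  \<open>weakly_biharmonic_radial_mean\<close> relies on this factorisation.\<close>

lemma bilaplacian_radial_harm:
  fixes g g1 g2 g3 g4 :: "real \<Rightarrow> complex" and n :: int
  assumes "\<And>\<rho>. \<rho> \<ge> 0 \<Longrightarrow> (g has_vector_derivative g1 \<rho>) (at \<rho>)"
    and "\<And>\<rho>. \<rho> \<ge> 0 \<Longrightarrow> (g1 has_vector_derivative g2 \<rho>) (at \<rho>)"
    and "\<And>\<rho>. \<rho> \<ge> 0 \<Longrightarrow> (g2 has_vector_derivative g3 \<rho>) (at \<rho>)"
    and "\<And>\<rho>. \<rho> \<ge> 0 \<Longrightarrow> (g3 has_vector_derivative g4 \<rho>) (at \<rho>)"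
    and c4: "continuous_on {0..} g4"
  defines "k \<equiv> of_nat (nat \<bar>n\<bar>)"
  shows "C2_on UNIV (\<lambda>z. harm n z * g ((cmod z)\<^sup>2))"
    and "C2_on UNIV (laplacian (\<lambda>z. harm n z * g ((cmod z)\<^sup>2)))"
    and "laplacian (laplacian (\<lambda>z. harm n z * g ((cmod z)\<^sup>2))) = (\<lambda>z. harm n z *
      ((k + 1) * (k + 2) * g2 ((cmod z)\<^sup>2) + 2 * (k + 2) * of_real ((cmod z)\<^sup>2) * g3 ((cmod z)\<^sup>2) +
       of_real ((cmod z)\<^sup>2) * of_real ((cmod z)\<^sup>2) * g4 ((cmod z)\<^sup>2)))"
proof -
  have c: "continuous_on {0..} g2" "continuous_on {0..} g3"
    using assms by (meson atLeast_iff continuous_at_imp_continuous_on has_vector_derivative_continuous)+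
  let ?m = "\<lambda>\<rho>. (k + 1) * g1 \<rho> + of_real \<rho> * g2 \<rho>"
  let ?m1 = "\<lambda>\<rho>. (k + 1) * g2 \<rho> + (of_real \<rho> * g3 \<rho> + 1 * g2 \<rho>)"
  let ?m2 = "\<lambda>\<rho>. (k + 1) * g3 \<rho> + ((of_real \<rho> * g4 \<rho> + 1 * g3 \<rho>) + 1 * g3 \<rho>)"
  have L: "laplacian (\<lambda>z. harm n z * g ((cmod z)\<^sup>2)) = (\<lambda>z. harm n z * ?m ((cmod z)\<^sup>2))"
    using laplacian_radial_harm(2)[OF assms(1,2) c(1)] by (simp add: k_def)
  have id: "((\<lambda>\<rho>. complex_of_real \<rho>) has_vector_derivative 1) (at \<rho>)" for \<rho>
    by (auto intro!: derivative_eq_intros)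
  have 1: "(?m has_vector_derivative ?m1 \<rho>) (at \<rho>)" if "\<rho> \<ge> 0" for \<rho>
    by (intro has_vector_derivative_add has_vector_derivative_mult_right has_vector_derivative_mult id assms(2,3) that)
  have 2: "(?m1 has_vector_derivative ?m2 \<rho>) (at \<rho>)" if "\<rho> \<ge> 0" for \<rho>
    by (intro has_vector_derivative_add has_vector_derivative_mult_right has_vector_derivative_mult id assms(3,4) that)
  have 3: "continuous_on {0..} ?m2" by (intro continuous_intros c c4)
  show "C2_on UNIV (\<lambda>z. harm n z * g ((cmod z)\<^sup>2))" by (rule laplacian_radial_harm(1)[OF assms(1,2) c(1)])
  show "C2_on UNIV (laplacian (\<lambda>z. harm n z * g ((cmod z)\<^sup>2)))"
    unfolding L by (rule laplacian_radial_harm(1)[OF 1 2 3])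
  show "laplacian (laplacian (\<lambda>z. harm n z * g ((cmod z)\<^sup>2))) = (\<lambda>z. harm n z *
      ((k + 1) * (k + 2) * g2 ((cmod z)\<^sup>2) + 2 * (k + 2) * of_real ((cmod z)\<^sup>2) * g3 ((cmod z)\<^sup>2) +
       of_real ((cmod z)\<^sup>2) * of_real ((cmod z)\<^sup>2) * g4 ((cmod z)\<^sup>2)))"
    unfolding L using laplacian_radial_harm(2)[of ?m ?m1 ?m2 n, OF 1 2 3, folded k_def]
    by (simp add: fun_eq_iff algebra_simps)
qed

lemma disk_testD:
  assumes "disk_test \<psi>"
  obtains K where "compact K" "K \<subseteq> ball 0 1" "\<And>z. z \<notin> K \<Longrightarrow> \<psi> z = 0"
    "\<And>z. z \<notin> K \<Longrightarrow> laplacian \<psi> z = 0" "\<And>z. z \<notin> K \<Longrightarrow> laplacian (laplacian \<psi>) z = 0"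
    "smooth_on UNIV \<psi>" "smooth_on UNIV (laplacian \<psi>)" "smooth_on UNIV (laplacian (laplacian \<psi>))"
proof -
  obtain K where K: "compact K" "K \<subseteq> ball 0 1" "\<And>z. z \<notin> K \<Longrightarrow> \<psi> z = 0" and s: "smooth_on UNIV \<psi>"
    using assms unfolding disk_test_def by blast
  have L: "laplacian \<psi> z = 0" if "z \<notin> K" for z
    by (rule laplacian_zero_outside[OF K(1) _ that]) (use K(3) in auto)
  have "laplacian (laplacian \<psi>) z = 0" if "z \<notin> K" for z
    by (rule laplacian_zero_outside[OF K(1) _ that]) (use L in auto)
  then show ?thesis using that[OF K L _ s] smooth_on_laplacian s open_UNIV by blast
qed

lemma C2_on_subset: "C2_on S f \<Longrightarrow> T \<subseteq> S \<Longrightarrow> C2_on T f"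
  unfolding C2_on_def by (meson continuous_on_subset subset_iff)

lemma bilaplacian_green_identity:
  assumes U: "open U" "compact K" "K \<subseteq> U"
    and f: "C2_on U f" "C2_on U (laplacian f)"
    and \<psi>: "smooth_on UNIV \<psi>" "\<And>x. x \<notin> K \<Longrightarrow> \<psi> x = 0"
  shows "(LINT z:U|lborel. f z * laplacian (laplacian \<psi>) z) = (LINT z:U|lborel. laplacian (laplacian f) z * \<psi> z)"
proof -
  have "(LINT z:U|lborel. f z * laplacian (laplacian \<psi>) z) = (LINT z:U|lborel. laplacian f z * laplacian \<psi> z)"
    by (rule green_identity[OF U f(1)])
      (use smooth_on_C2 smooth_on_laplacian[OF open_UNIV \<psi>(1)] laplacian_zero_outside[OF U(2) \<psi>(2)] in auto)
  also have "\<dots> = (LINT z:U|lborel. laplacian (laplacian f) z * \<psi> z)"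
    by (rule green_identity[OF U f(2) smooth_on_C2[OF \<psi>(1)] \<psi>(2)])
  finally show ?thesis .
qed

lemma set_integral_lebesgue_eq_lborel:
  fixes F :: "complex \<Rightarrow> complex"
  assumes "open U" "continuous_on U F"
  shows "(LINT z:U|lebesgue. F z) = (LINT z:U|lborel. F z)"
proof -
  have "(\<lambda>z. indicator U z *\<^sub>R F z) \<in> borel_measurable borel"
    using assms by (intro borel_measurable_continuous_on_indicator) auto
  then show ?thesis
    unfolding set_lebesgue_integral_def by (intro integral_completion) simp
qed

lemma disk_integral_eq_lborel:
  assumes "continuous_on (ball 0 1) F"
  shows "disk_integral F = 1 / of_real pi * (LINT z:ball 0 1|lborel. F z)"
  unfolding disk_integral_def using set_integral_lebesgue_eq_lborel[OF open_ball assms] by simp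

lemma continuous_imp_locally_integrable_disk:
  assumes "continuous_on (ball 0 1) v"
  shows "locally_integrable_disk v"
  unfolding locally_integrable_disk_def
proof (intro allI impI)
  fix K :: "complex set" assume K: "compact K" "K \<subseteq> ball 0 1"
  have c: "continuous_on K v" using assms K(2) by (rule continuous_on_subset)
  have "integrable lborel (\<lambda>z. indicator K z *\<^sub>R v z)"
    by (rule borel_integrable_compact[OF K(1) c])
  moreover have "(\<lambda>z. indicator K z *\<^sub>R v z) \<in> borel_measurable borel"
    using K c by (intro borel_measurable_continuous_on_indicator) (auto simp: compact_imp_closed)
  ultimately show "set_integrable lebesgue K v"
    unfolding set_integrable_def by (subst integrable_completion) auto
qed

section \<open>Continuous weak solutions of the homogeneous equation\<close>

definition weakly_biharmonic :: "(complex \<Rightarrow> complex) \<Rightarrow> bool" where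
  "weakly_biharmonic v \<longleftrightarrow> continuous_on (ball 0 1) v \<and>
     (\<forall>\<psi>. disk_test \<psi> \<longrightarrow> (LINT z:ball 0 1|lborel. v z * laplacian (laplacian \<psi>) z) = 0)"

lemma disk_test_continuous:
  assumes "disk_test \<psi>"
  shows "continuous_on S \<psi>" "continuous_on S (laplacian (laplacian \<psi>))"
proof -
  obtain K where "smooth_on UNIV \<psi>" "smooth_on UNIV (laplacian (laplacian \<psi>))"
    using disk_testD[OF assms] by metis
  then show "continuous_on S \<psi>" "continuous_on S (laplacian (laplacian \<psi>))"
    by (meson smooth_on_continuous continuous_on_subset subset_UNIV)+
qed

lemma weakly_biharmonic_iff:
  "continuous_on (ball 0 1) v \<Longrightarrow> weakly_biharmonic v \<longleftrightarrow> bilaplacian_eq v (\<lambda>_. 0)"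
  unfolding weakly_biharmonic_def bilaplacian_eq_def
  using continuous_imp_locally_integrable_disk[of v] continuous_imp_locally_integrable_disk[OF continuous_on_const]
    disk_integral_eq_lborel[OF continuous_on_mult[OF _ disk_test_continuous(2)], of v]
  by (auto simp: disk_integral_def[of "\<lambda>_. 0"])

lemma weakly_biharmonic_set_integrable:
  assumes "disk_test \<psi>" "continuous_on (ball 0 1) v"
  shows "set_integrable lborel (ball 0 1) (\<lambda>z. v z * laplacian (laplacian \<psi>) z)"
    and "set_integrable lborel (ball 0 1) (\<lambda>z. v z * \<psi> z)"
proof -
  obtain K where K: "compact K" "K \<subseteq> ball 0 1" "\<And>z. z \<notin> K \<Longrightarrow> laplacian (laplacian \<psi>) z = 0"
    "\<And>z. z \<notin> K \<Longrightarrow> \<psi> z = 0"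
    using disk_testD[OF assms(1)] by metis
  show "set_integrable lborel (ball 0 1) (\<lambda>z. v z * laplacian (laplacian \<psi>) z)"
    by (rule set_integrable_compact_support[OF open_ball K(1,2)])
      (simp_all add: K(3) continuous_on_mult[OF assms(2) disk_test_continuous(2)[OF assms(1)]])
  show "set_integrable lborel (ball 0 1) (\<lambda>z. v z * \<psi> z)"
    by (rule set_integrable_compact_support[OF open_ball K(1,2)])
      (simp_all add: K(4) continuous_on_mult[OF assms(2) disk_test_continuous(1)[OF assms(1)]])
qed

lemma weakly_biharmonic_add:
  assumes "weakly_biharmonic u" "weakly_biharmonic v"
  shows "weakly_biharmonic (\<lambda>z. u z + v z)"
  using assms weakly_biharmonic_set_integrable(1)
  unfolding weakly_biharmonic_def by (auto intro!: continuous_intros simp: distrib_right set_integral_add)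

lemma weakly_biharmonic_cmult:
  assumes "weakly_biharmonic u"
  shows "weakly_biharmonic (\<lambda>z. c * u z)"
  using assms
  unfolding weakly_biharmonic_def by (auto intro!: continuous_intros simp: mult.assoc)

lemma weakly_biharmonic_sum:
  assumes "\<And>i. i \<in> I \<Longrightarrow> weakly_biharmonic (u i)"
  shows "weakly_biharmonic (\<lambda>z. \<Sum>i\<in>I. u i z)"
  using assms
proof (induction I rule: infinite_finite_induct)
  case (insert i I)
  then show ?case by (simp add: weakly_biharmonic_add)
qed (auto simp: weakly_biharmonic_def)

text \<open>Both functions have an affine profile in \<open>(cmod z)\<^sup>2\<close>, and the
  formula for the bilaplacian contains only derivatives of the profile of order two and
  higher.\<close>

lemma weakly_biharmonic_harm: "weakly_biharmonic (\<lambda>z. harm n z)"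
  and weakly_biharmonic_cmod_sq_harm: "weakly_biharmonic (\<lambda>z. of_real ((cmod z)\<^sup>2) * harm n z)"
proof -
  have *: "weakly_biharmonic (\<lambda>z. harm n z * g ((cmod z)\<^sup>2))"
    if "\<And>\<rho>. (g has_vector_derivative c) (at \<rho>)" for g c
  proof -
    note L = bilaplacian_radial_harm[of g "\<lambda>_. c" "\<lambda>_. 0" "\<lambda>_. 0" "\<lambda>_. 0" n, OF that has_vector_derivative_const has_vector_derivative_const has_vector_derivative_const continuous_on_const]
    show ?thesis unfolding weakly_biharmonic_def
    proof (intro conjI allI impI)
      show "continuous_on (ball 0 1) (\<lambda>z. harm n z * g ((cmod z)\<^sup>2))"
        using C2_on_continuous[OF L(1)] continuous_on_subset by blast
      fix \<psi> assume "disk_test \<psi>"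
      then obtain K where K: "compact K" "K \<subseteq> ball 0 1" "\<And>z. z \<notin> K \<Longrightarrow> \<psi> z = 0" "smooth_on UNIV \<psi>"
        using disk_testD by metis
      show "(LINT z:ball 0 1|lborel. harm n z * g ((cmod z)\<^sup>2) * laplacian (laplacian \<psi>) z) = 0"
        using bilaplacian_green_identity[OF open_ball K(1,2) C2_on_subset[OF L(1)] C2_on_subset[OF L(2)] K(4,3)] L(3)
        by (simp add: set_lebesgue_integral_def)
    qed
  qed
  from *[of "\<lambda>_. 1" 0] show "weakly_biharmonic (\<lambda>z. harm n z)" by (simp add: has_vector_derivative_const)
  have "(complex_of_real has_vector_derivative 1) (at \<rho>)" for \<rho>
    by (auto intro!: derivative_eq_intros)
  from *[OF this] show "weakly_biharmonic (\<lambda>z. of_real ((cmod z)\<^sup>2) * harm n z)"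
    by (simp add: mult.commute)
qed

text \<open>All derivatives sit on the test function, so locally uniform convergence is enough to
  pass to the limit: on the support of the differentiated test function for the equation, on small
  closed discs for continuity.\<close>

lemma weakly_biharmonic_uniform_limit:
  assumes u: "\<And>n. weakly_biharmonic (u n)"
    and lim: "\<And>K. compact K \<Longrightarrow> K \<subseteq> ball 0 1 \<Longrightarrow> uniform_limit K u v sequentially"
  shows "weakly_biharmonic v"
proof -
  have cont: "continuous_on (ball 0 1) v"
  proof (rule continuous_at_imp_continuous_on, rule ballI)
    fix z :: complex assume z: "z \<in> ball 0 1"
    then obtain e where e: "e > 0" "cball z e \<subseteq> ball 0 1" by (metis open_contains_cball open_ball)
    have "continuous_on (cball z e) v"
    proof (rule uniform_limit_theorem)
      show "\<forall>\<^sub>F n in sequentially. continuous_on (cball z e) (u n)"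
        using u e(2) unfolding weakly_biharmonic_def by (intro always_eventually allI) (meson continuous_on_subset)
    qed (use lim e in auto)
    then show "isCont v z"
      using e(1) by (meson ball_subset_cball centre_in_ball continuous_on_eq_continuous_at continuous_on_subset open_ball)
  qed
  show ?thesis unfolding weakly_biharmonic_def
  proof (intro conjI allI impI cont)
    fix \<psi> assume \<psi>: "disk_test \<psi>"
    then obtain K where K: "compact K" "K \<subseteq> ball 0 1" "\<And>z. z \<notin> K \<Longrightarrow> laplacian (laplacian \<psi>) z = 0"
      using disk_testD by metis
    obtain M where M: "M > 0" "\<And>z. norm (laplacian (laplacian \<psi>) z) \<le> M"
      using compact_support_bounded[OF disk_test_continuous(2)[OF \<psi>] K(1,3)] by metis
    let ?f = "\<lambda>w z. indicator (ball 0 1) z *\<^sub>R (w z * laplacian (laplacian \<psi>) z)"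
    have "(\<lambda>n. \<integral>z. ?f (u n) z \<partial>lborel) \<longlonglongrightarrow> (\<integral>z. ?f v z \<partial>lborel)"
    proof (rule tendstoI)
      fix e :: real assume "e > 0"
      define c where "c = measure lborel K"
      have cK: "emeasure lborel K < \<infinity>" using K(1) compact_imp_bounded emeasure_bounded_finite by blast
      have "c \<ge> 0" by (simp add: c_def)
      \<comment> \<open>With this \<open>d\<close> the error is at most
        \<open>c * (e / (c + 1))\<close>; the summand 1 also covers supports of measure
        zero.\<close>
      define d where "d = e / (M * (c + 1))"
      have d: "d > 0" using \<open>e > 0\<close> M \<open>c \<ge> 0\<close> by (simp add: d_def)
      have "\<forall>\<^sub>F n in sequentially. \<forall>z\<in>K. dist (u n z) (v z) < d"
        using lim[OF K(1,2)] d unfolding uniform_limit_iff by blast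
      then show "\<forall>\<^sub>F n in sequentially. dist (\<integral>z. ?f (u n) z \<partial>lborel) (\<integral>z. ?f v z \<partial>lborel) < e"
      proof eventually_elim
        case (elim n)
        have i: "integrable lborel (?f (u n))" "integrable lborel (?f v)"
          using weakly_biharmonic_set_integrable(1)[OF \<psi>] u cont unfolding set_integrable_def weakly_biharmonic_def by auto
        have "norm ((\<integral>z. ?f (u n) z \<partial>lborel) - (\<integral>z. ?f v z \<partial>lborel)) = norm (\<integral>z. ?f (u n) z - ?f v z \<partial>lborel)"
          using i by simp
        also have "\<dots> \<le> (\<integral>z. indicator K z *\<^sub>R (d * M) \<partial>lborel)"
        proof (rule Bochner_Integration.integral_norm_bound_integral)
          show "integrable lborel (\<lambda>z. indicator K z *\<^sub>R (d * M))"
            using K(1) by (intro borel_integrable_compact) auto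
          fix z
          have "norm (?f (u n) z - ?f v z) \<le> d * M" if "z \<in> K"
          proof -
            have "norm (u n z - v z) \<le> d" using elim that by (auto simp: dist_norm intro: less_imp_le)
            then have "norm (u n z - v z) * norm (laplacian (laplacian \<psi>) z) \<le> d * M"
              using M(2)[of z] d by (intro mult_mono) auto
            then show ?thesis using that K(2) by (auto simp: norm_mult left_diff_distrib[symmetric])
          qed
          then show "norm (?f (u n) z - ?f v z) \<le> indicator K z *\<^sub>R (d * M)"
            using K(3)[of z] by (cases "z \<in> K") auto
        qed (use i in simp)
        also have "\<dots> = c * (d * M)" using cK by (simp add: c_def K(1) borel_compact)
        also have "\<dots> = c * (e / (c + 1))" using M(1) by (simp add: d_def)
        also have "\<dots> < e"
          using \<open>e > 0\<close> \<open>c \<ge> 0\<close> by (simp add: divide_less_eq algebra_simps)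
        finally show ?case by (simp add: dist_norm)
      qed
    qed
    moreover have "(\<integral>z. ?f (u n) z \<partial>lborel) = 0" for n
      using u[of n] \<psi> unfolding weakly_biharmonic_def set_lebesgue_integral_def by blast
    ultimately show "(LINT z:ball 0 1|lborel. v z * laplacian (laplacian \<psi>) z) = 0"
      unfolding set_lebesgue_integral_def by (simp add: LIMSEQ_const_iff)
  qed
qed

section \<open>Fourier series on the circle\<close>

lemma int_decode_eq: "int_decode k = (if even k then int (k div 2) else - int (k div 2) - 1)"
  by (simp add: int_decode_def sum_decode_def)

lemma abs_int_decode_ge: "real k \<le> 2 * \<bar>real_of_int (int_decode k)\<bar>"
proof (cases "even k")
  case True
  then show ?thesis by (auto simp: int_decode_eq elim!: evenE)
next
  case False
  then show ?thesis by (auto simp: int_decode_eq elim!: oddE)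
qed

text \<open>Doubly infinite series are summed along the enumeration \<open>int_decode\<close> of the integers.\<close>

definition rapidly_decreasing :: "(int \<Rightarrow> complex) \<Rightarrow> bool" where
  "rapidly_decreasing c \<longleftrightarrow>
     (\<forall>N. summable (\<lambda>k. norm (c (int_decode k)) * (1 + \<bar>real_of_int (int_decode k)\<bar>) ^ N))"

definition fourier_series :: "(int \<Rightarrow> complex) \<Rightarrow> real \<Rightarrow> complex" where
  "fourier_series c t = (\<Sum>k. c (int_decode k) * cis (of_int (int_decode k) * t))"

lemma rapidly_decreasing_summable_norm:
  "rapidly_decreasing c \<Longrightarrow> summable (\<lambda>k. norm (c (int_decode k)))"
  unfolding rapidly_decreasing_def by (drule spec[of _ 0]) simp

lemma summable_inverse_square_int_decode:
  "summable (\<lambda>k. 1 / (1 + \<bar>real_of_int (int_decode k)\<bar>) ^ 2)"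
proof (rule summable_comparison_test')
  have "summable (\<lambda>k. 1 / real k ^ 2)" using inverse_power_summable[of 2, where 'a = real] by (simp add: field_simps)
  then have "summable (\<lambda>k. 1 / real (Suc k) ^ 2)" by (subst summable_Suc_iff)
  \<comment> \<open>The factor 4 is the square of the 2 in k + 1 \<le> 2 (1 + |int_decode
    k|).\<close>
  then show "summable (\<lambda>k. 4 * (1 / real (Suc k) ^ 2))" by (rule summable_mult)
  fix k :: nat
  have "real (Suc k) ^ 2 \<le> (2 * (1 + \<bar>real_of_int (int_decode k)\<bar>)) ^ 2"
    using abs_int_decode_ge[of k] by (intro power_mono) auto
  then have "1 / (2 * (1 + \<bar>real_of_int (int_decode k)\<bar>)) ^ 2 \<le> 1 / real (Suc k) ^ 2"
    by (intro divide_left_mono) (auto intro!: mult_pos_pos zero_less_power)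
  moreover have "1 / (2 * (1 + \<bar>real_of_int (int_decode k)\<bar>)) ^ 2 = (1 / 4) * (1 / (1 + \<bar>real_of_int (int_decode k)\<bar>) ^ 2)"
    by (simp only: power_mult_distrib) simp
  ultimately have "1 / (1 + \<bar>real_of_int (int_decode k)\<bar>) ^ 2 \<le> 4 * (1 / real (Suc k) ^ 2)" by linarith
  then show "norm (1 / (1 + \<bar>real_of_int (int_decode k)\<bar>) ^ 2) \<le> 4 * (1 / real (Suc k) ^ 2)" by simp
qed

text \<open>The bound is used with exponent N + 2: the two spare powers leave a convergent series of
  inverse squares.\<close>

lemma rapidly_decreasingI:
  assumes "\<And>N. \<exists>A. \<forall>n. norm (c n) * (1 + \<bar>real_of_int n\<bar>) ^ N \<le> A"
  shows "rapidly_decreasing c"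
  unfolding rapidly_decreasing_def
proof
  fix N
  obtain A where A: "\<And>n. norm (c n) * (1 + \<bar>real_of_int n\<bar>) ^ (N + 2) \<le> A" using assms by metis
  show "summable (\<lambda>k. norm (c (int_decode k)) * (1 + \<bar>real_of_int (int_decode k)\<bar>) ^ N)"
  proof (rule summable_comparison_test')
    show "summable (\<lambda>k. A * (1 / (1 + \<bar>real_of_int (int_decode k)\<bar>) ^ 2))"
      by (intro summable_mult summable_inverse_square_int_decode)
    show "norm (norm (c (int_decode k)) * (1 + \<bar>real_of_int (int_decode k)\<bar>) ^ N) \<le> A * (1 / (1 + \<bar>real_of_int (int_decode k)\<bar>) ^ 2)" for k
    proof -
      let ?w = "1 + \<bar>real_of_int (int_decode k)\<bar>"
      have "0 < ?w ^ 2" by (intro zero_less_power) auto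
      moreover have "norm (c (int_decode k)) * ?w ^ N * ?w ^ 2 \<le> A"
        using A[of "int_decode k"] by (simp only: power_add mult.assoc)
      ultimately have "norm (c (int_decode k)) * ?w ^ N \<le> A / ?w ^ 2" by (simp add: le_divide_eq)
      then show ?thesis by simp
    qed
  qed
qed

lemma rapidly_decreasing_mult:
  assumes c: "rapidly_decreasing c" and d: "\<And>n. norm (d n) \<le> A * (1 + \<bar>real_of_int n\<bar>) ^ M"
  shows "rapidly_decreasing (\<lambda>n. d n * c n)"
  unfolding rapidly_decreasing_def
proof
  fix N
  show "summable (\<lambda>k. norm (d (int_decode k) * c (int_decode k)) * (1 + \<bar>real_of_int (int_decode k)\<bar>) ^ N)"
  proof (rule summable_comparison_test')
    show "summable (\<lambda>k. A * (norm (c (int_decode k)) * (1 + \<bar>real_of_int (int_decode k)\<bar>) ^ (M + N)))"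
      using c unfolding rapidly_decreasing_def by (intro summable_mult) blast
    show "norm (norm (d (int_decode k) * c (int_decode k)) * (1 + \<bar>real_of_int (int_decode k)\<bar>) ^ N)
      \<le> A * (norm (c (int_decode k)) * (1 + \<bar>real_of_int (int_decode k)\<bar>) ^ (M + N))" for k
    proof -
      let ?w = "1 + \<bar>real_of_int (int_decode k)\<bar>"
      have "norm (d (int_decode k)) * (norm (c (int_decode k)) * ?w ^ N) \<le> (A * ?w ^ M) * (norm (c (int_decode k)) * ?w ^ N)"
        by (intro mult_right_mono d) auto
      then show ?thesis by (simp add: norm_mult power_add mult_ac)
    qed
  qed
qed

lemma rapidly_decreasing_deriv:
  "rapidly_decreasing c \<Longrightarrow> rapidly_decreasing (\<lambda>n. \<i> * of_int n * c n)"
  by (rule rapidly_decreasing_mult[where A = 1 and M = 1]) (auto simp: norm_mult)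

lemma rapidly_decreasing_power:
  assumes "rapidly_decreasing c"
  shows "rapidly_decreasing (\<lambda>n. (\<i> * of_int n) ^ m * c n)"
proof (rule rapidly_decreasing_mult[OF assms, where A = 1 and M = m])
  show "norm ((\<i> * of_int n) ^ m) \<le> 1 * (1 + \<bar>real_of_int n\<bar>) ^ m" for n
    by (auto simp: norm_power norm_mult intro!: power_mono)
qed

lemma summable_fourier_series:
  assumes "rapidly_decreasing c"
  shows "summable (\<lambda>k. c (int_decode k) * cis (of_int (int_decode k) * t))"
  by (rule summable_norm_cancel) (simp add: norm_mult rapidly_decreasing_summable_norm[OF assms])

lemma norm_fourier_series_le:
  assumes "rapidly_decreasing c"
  shows "norm (fourier_series c t) \<le> (\<Sum>k. norm (c (int_decode k)))"
  unfolding fourier_series_def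
  using summable_norm[of "\<lambda>k. c (int_decode k) * cis (of_int (int_decode k) * t)"] rapidly_decreasing_summable_norm[OF assms]
  by (simp add: norm_mult)

lemma uniform_limit_fourier_series:
  assumes "rapidly_decreasing c"
  shows "uniform_limit A (\<lambda>n t. \<Sum>k<n. c (int_decode k) * cis (of_int (int_decode k) * t)) (fourier_series c) sequentially"
  unfolding fourier_series_def[abs_def]
  by (rule Weierstrass_m_test[of _ _ "\<lambda>k. norm (c (int_decode k))"])
    (simp_all add: norm_mult rapidly_decreasing_summable_norm[OF assms])

lemma has_vector_derivative_cis:
  "((\<lambda>t. cis (a * t)) has_vector_derivative \<i> * of_real a * cis (a * t)) (at t within S)"
proof -
  have "((\<lambda>w. exp (\<i> * of_real a * w)) has_field_derivative \<i> * of_real a * exp (\<i> * of_real a * of_real t)) (at (of_real t))"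
    by (auto intro!: derivative_eq_intros)
  from has_vector_derivative_real_field[OF this]
  have "((\<lambda>t. exp (\<i> * of_real a * of_real t)) has_vector_derivative \<i> * of_real a * exp (\<i> * of_real a * of_real t)) (at t within S)" .
  then show ?thesis by (simp add: cis_conv_exp mult_ac)
qed

text \<open>The coefficients multiplied by \<open>\<i> * n\<close> are still rapidly decreasing, so
  the differentiated series converges uniformly on the real line.\<close>

lemma fourier_series_has_vector_derivative:
  assumes c: "rapidly_decreasing c"
  shows "(fourier_series c has_vector_derivative fourier_series (\<lambda>n. \<i> * of_int n * c n) t) (at t)"
proof -
  let ?f = "\<lambda>k t. c (int_decode k) * cis (of_int (int_decode k) * t)"
  let ?d = "\<lambda>k t. (\<i> * of_int (int_decode k) * c (int_decode k)) * cis (of_int (int_decode k) * t)"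
  let ?g = "fourier_series (\<lambda>n. \<i> * of_int n * c n)"
  have "\<exists>g. \<forall>x\<in>UNIV. (\<lambda>k. ?f k x) sums g x \<and> (g has_derivative (\<lambda>h. h *\<^sub>R ?g x)) (at x within UNIV)"
  proof (rule has_derivative_series[where f' = "\<lambda>k x h. h *\<^sub>R ?d k x"])
    show "(?f n has_derivative (\<lambda>h. h *\<^sub>R ?d n x)) (at x within UNIV)" for n x
      using has_vector_derivative_mult_right[OF has_vector_derivative_cis, of "c (int_decode n)" "of_int (int_decode n)" x UNIV]
      by (simp add: has_vector_derivative_def mult_ac)
    show "\<forall>\<^sub>F n in sequentially. \<forall>x\<in>UNIV. \<forall>h. norm ((\<Sum>i<n. h *\<^sub>R ?d i x) - h *\<^sub>R ?g x) \<le> e * norm h" if "e > 0" for e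
    proof -
      have "\<forall>\<^sub>F n in sequentially. \<forall>x\<in>UNIV. dist (\<Sum>k<n. ?d k x) (?g x) < e"
        using uniform_limit_fourier_series[OF rapidly_decreasing_deriv[OF c], of UNIV] that unfolding uniform_limit_iff by blast
      then show ?thesis
      proof eventually_elim
        case (elim n)
        show ?case
        proof (intro ballI allI)
          fix x h :: real
          have "norm ((\<Sum>i<n. h *\<^sub>R ?d i x) - h *\<^sub>R ?g x) = \<bar>h\<bar> * dist (\<Sum>k<n. ?d k x) (?g x)"
            by (simp add: dist_norm scaleR_sum_right[symmetric] scaleR_diff_right[symmetric])
          also have "\<dots> \<le> \<bar>h\<bar> * e" using elim by (intro mult_left_mono) (auto intro: less_imp_le)
          finally show "norm ((\<Sum>i<n. h *\<^sub>R ?d i x) - h *\<^sub>R ?g x) \<le> e * norm h" by (simp add: mult.commute)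
        qed
      qed
    qed
    show "(\<lambda>n. ?f n 0) sums fourier_series c 0"
      unfolding fourier_series_def by (rule summable_sums[OF summable_fourier_series[OF c]])
  qed auto
  then obtain g where g: "\<And>x. (\<lambda>k. ?f k x) sums g x" "\<And>x. (g has_derivative (\<lambda>h. h *\<^sub>R ?g x)) (at x)" by auto
  have "g = fourier_series c" unfolding fourier_series_def using g(1) by (auto simp: sums_iff fun_eq_iff)
  then show ?thesis using g(2) by (simp add: has_vector_derivative_def)
qed

lemma iter_deriv_fourier_series:
  assumes "rapidly_decreasing c"
  shows "iter_deriv (replicate m 1) (fourier_series c) = fourier_series (\<lambda>n. (\<i> * of_int n) ^ m * c n)"
proof (induction m)
  case (Suc m)
  have "iter_deriv (replicate (Suc m) 1) (fourier_series c) =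
      (\<lambda>x. frechet_derivative (fourier_series (\<lambda>n. (\<i> * of_int n) ^ m * c n)) (at x) 1)"
    by (simp add: Suc)
  also have "\<dots> = fourier_series (\<lambda>n. \<i> * of_int n * ((\<i> * of_int n) ^ m * c n))"
    using frechet_derivative_real[OF fourier_series_has_vector_derivative[OF rapidly_decreasing_power[OF assms]]] by blast
  finally show ?case by (simp add: mult.assoc)
qed simp

lemma real_Basis_list: "set vs \<subseteq> (Basis :: real set) \<Longrightarrow> vs = replicate (length vs) 1"
  by (rule replicate_eqI) auto

lemma smooth_on_fourier_series:
  assumes "rapidly_decreasing c"
  shows "smooth_on UNIV (fourier_series c)"
  unfolding smooth_on_def
proof (intro allI impI ballI)
  fix vs :: "real list" and x :: real assume "set vs \<subseteq> Basis"
  then have "iter_deriv vs (fourier_series c) = fourier_series (\<lambda>n. (\<i> * of_int n) ^ length vs * c n)"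
    using iter_deriv_fourier_series[OF assms, of "length vs"] real_Basis_list by metis
  then show "iter_deriv vs (fourier_series c) differentiable at x"
    using fourier_series_has_vector_derivative[OF rapidly_decreasing_power[OF assms], of "length vs" x]
    by (auto simp: has_vector_derivative_def differentiable_def)
qed

lemma rapidly_decreasing_finite_support:
  assumes "finite {n. c n \<noteq> 0}"
  shows "rapidly_decreasing c"
proof (rule rapidly_decreasingI)
  fix N
  let ?S = "(\<lambda>n. norm (c n) * (1 + \<bar>real_of_int n\<bar>) ^ N) ` {n. c n \<noteq> 0}"
  have "norm (c n) * (1 + \<bar>real_of_int n\<bar>) ^ N \<le> Max (insert 0 ?S)" for n
    using assms by (cases "c n = 0") (auto intro!: Max_ge)
  then show "\<exists>A. \<forall>n. norm (c n) * (1 + \<bar>real_of_int n\<bar>) ^ N \<le> A" by blast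
qed

lemma fourier_series_delta: "fourier_series (\<lambda>m. if m = n then a else 0) t = a * cis (of_int n * t)"
proof -
  have "(\<lambda>k. (if int_decode k = n then a else 0) * cis (of_int (int_decode k) * t)) sums
     (\<Sum>k\<in>{int_encode n}. (if int_decode k = n then a else 0) * cis (of_int (int_decode k) * t))"
  proof (rule sums_finite)
    show "(if int_decode k = n then a else 0) * cis (of_int (int_decode k) * t) = 0" if "k \<notin> {int_encode n}" for k
      using that by (metis int_decode_inverse mult_zero_left singletonI)
  qed simp
  then show ?thesis unfolding fourier_series_def by (simp add: sums_iff)
qed

lemma harm_cis: "harm n (cis t) = cis (of_int n * t)"
  by (cases "n \<ge> 0") (auto simp: harm_def Complex.DeMoivre cis_cnj[symmetric] simp flip: complex_cnj_power)

lemma cis_of_int_2pi: "cis (of_int n * (2 * pi)) = 1"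
  using cis_multiple_2pi[of "of_int n"] by (simp add: mult_ac)

lemma circle_test_harm: "circle_test (harm n)"
proof -
  have "(\<lambda>t. harm n (cis t)) = fourier_series (\<lambda>m. if m = n then 1 else 0)"
    by (simp add: fun_eq_iff fourier_series_delta harm_cis)
  moreover have "smooth_on UNIV (fourier_series (\<lambda>m. if m = n then 1 else 0))"
    by (intro smooth_on_fourier_series rapidly_decreasing_finite_support) simp
  ultimately show ?thesis by (simp add: circle_test_def)
qed

lemma circle_test_add: "circle_test \<phi> \<Longrightarrow> circle_test \<psi> \<Longrightarrow> circle_test (\<lambda>z. \<phi> z + \<psi> z)"
  unfolding circle_test_def by (intro smooth_on_add open_UNIV)

lemma circle_test_cmult: "circle_test \<phi> \<Longrightarrow> circle_test (\<lambda>z. a * \<phi> z)"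
  unfolding circle_test_def by (intro smooth_on_mult smooth_on_const open_UNIV)

lemma circle_test_sum: "(\<And>i. i \<in> I \<Longrightarrow> circle_test (\<phi> i)) \<Longrightarrow> circle_test (\<lambda>z. \<Sum>i\<in>I. \<phi> i z)"
proof (induction I rule: infinite_finite_induct)
  case (insert i I)
  then show ?case by (simp add: circle_test_add)
qed (simp_all add: circle_test_def smooth_on_const)

lemma circle_distribution_add:
  "circle_distribution T \<Longrightarrow> circle_test \<phi> \<Longrightarrow> circle_test \<psi> \<Longrightarrow> T (\<lambda>z. \<phi> z + \<psi> z) = T \<phi> + T \<psi>"
  unfolding circle_distribution_def by (elim conjE) simp

lemma circle_distribution_cmult:
  "circle_distribution T \<Longrightarrow> circle_test \<phi> \<Longrightarrow> T (\<lambda>z. a * \<phi> z) = a * T \<phi>"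
  unfolding circle_distribution_def by (elim conjE) simp

lemma circle_distribution_sum:
  assumes T: "circle_distribution T" and \<phi>: "\<And>i. i \<in> I \<Longrightarrow> circle_test (\<phi> i)"
  shows "T (\<lambda>z. \<Sum>i\<in>I. \<phi> i z) = (\<Sum>i\<in>I. T (\<phi> i))"
  using \<phi>
proof (induction I rule: infinite_finite_induct)
  case (insert i I)
  then have "T (\<lambda>z. \<phi> i z + (\<Sum>i\<in>I. \<phi> i z)) = T (\<phi> i) + T (\<lambda>z. \<Sum>i\<in>I. \<phi> i z)"
    by (intro circle_distribution_add[OF T] circle_test_sum) auto
  then show ?case using insert by simp
next
  case empty
  have "T (\<lambda>z. 0 * harm 0 z) = 0 * T (harm 0)"
    by (rule circle_distribution_cmult[OF T circle_test_harm])
  then show ?case by simp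
next
  case (infinite A)
  have "T (\<lambda>z. 0 * harm 0 z) = 0 * T (harm 0)"
    by (rule circle_distribution_cmult[OF T circle_test_harm])
  then show ?case using infinite by simp
qed

text \<open>The m-th derivative of a Fourier series is dominated by its coefficients with weight
  |n|^m. A distribution that sees N derivatives is thus bounded by the coefficients with weight (1 +
  |n|)^N, with A and N independent of the test function.\<close>

lemma circle_distribution_fourier_bound:
  assumes T: "circle_distribution T"
  obtains A N where "A \<ge> 0"
    "\<And>\<phi> c. rapidly_decreasing c \<Longrightarrow> (\<And>t. \<phi> (cis t) = fourier_series c t) \<Longrightarrow>
      norm (T \<phi>) \<le> A * (\<Sum>k. norm (c (int_decode k)) * (1 + \<bar>real_of_int (int_decode k)\<bar>) ^ N)"
proof -
  have "\<exists>C N. \<forall>\<phi>. circle_test \<phi> \<longrightarrow> norm (T \<phi>) \<le>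
          C * (\<Sum>k\<le>N. SUP t::real. norm (iter_deriv (replicate k 1) (\<lambda>s. \<phi> (cis s)) t))"
    using T unfolding circle_distribution_def by (elim conjE)
  then obtain C N where CN': "\<forall>\<phi>. circle_test \<phi> \<longrightarrow> norm (T \<phi>) \<le>
          C * (\<Sum>k\<le>N. SUP t::real. norm (iter_deriv (replicate k 1) (\<lambda>s. \<phi> (cis s)) t))"
    by (elim exE) (rule that)
  note CN = CN'[rule_format]
  \<comment> \<open>The constant in the definition of a distribution may be negative, hence
    \<open>\<bar>C\<bar>\<close>; \<open>Suc N\<close> counts the orders 0 to N.\<close>
  have "norm (T \<phi>) \<le> (\<bar>C\<bar> * real (Suc N)) * (\<Sum>k. norm (c (int_decode k)) * (1 + \<bar>real_of_int (int_decode k)\<bar>) ^ N)"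
    if c: "rapidly_decreasing c" and \<phi>: "\<And>t. \<phi> (cis t) = fourier_series c t" for \<phi> c
  proof -
    let ?S = "\<Sum>k. norm (c (int_decode k)) * (1 + \<bar>real_of_int (int_decode k)\<bar>) ^ N"
    have eq: "(\<lambda>s. \<phi> (cis s)) = fourier_series c" using \<phi> by blast
    have "circle_test \<phi>" unfolding circle_test_def eq by (rule smooth_on_fourier_series[OF c])
    from CN[OF this] have 1: "norm (T \<phi>) \<le> C * (\<Sum>k\<le>N. SUP t::real. norm (iter_deriv (replicate k 1) (fourier_series c) t))"
      unfolding eq .
    have b: "norm (iter_deriv (replicate m 1) (fourier_series c) t) \<le> ?S" if "m \<le> N" for m t
    proof -
      have "norm (iter_deriv (replicate m 1) (fourier_series c) t) \<le> (\<Sum>k. norm ((\<i> * of_int (int_decode k)) ^ m * c (int_decode k)))"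
        unfolding iter_deriv_fourier_series[OF c]
        by (rule norm_fourier_series_le[OF rapidly_decreasing_power[OF c]])
      also have "\<dots> \<le> ?S"
      proof (rule suminf_le)
        fix k
        have "\<bar>real_of_int (int_decode k)\<bar> ^ m \<le> (1 + \<bar>real_of_int (int_decode k)\<bar>) ^ m" by (intro power_mono) auto
        also have "\<dots> \<le> (1 + \<bar>real_of_int (int_decode k)\<bar>) ^ N" using that by (intro power_increasing) auto
        finally have "norm (c (int_decode k)) * \<bar>real_of_int (int_decode k)\<bar> ^ m \<le> norm (c (int_decode k)) * (1 + \<bar>real_of_int (int_decode k)\<bar>) ^ N"
          by (intro mult_left_mono) auto
        then show "norm ((\<i> * of_int (int_decode k)) ^ m * c (int_decode k)) \<le> norm (c (int_decode k)) * (1 + \<bar>real_of_int (int_decode k)\<bar>) ^ N"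
          by (simp add: norm_mult norm_power mult.commute)
      next
        show "summable (\<lambda>k. norm ((\<i> * of_int (int_decode k)) ^ m * c (int_decode k)))"
          by (rule rapidly_decreasing_summable_norm[OF rapidly_decreasing_power[OF c]])
        show "summable (\<lambda>k. norm (c (int_decode k)) * (1 + \<bar>real_of_int (int_decode k)\<bar>) ^ N)"
          using c unfolding rapidly_decreasing_def by blast
      qed
      finally show ?thesis .
    qed
    \<comment> \<open>\<open>SUP\<close> over the reals is informative only for bounded families, so
      boundedness is established together with the two estimates.\<close>
    have s: "0 \<le> (SUP t::real. norm (iter_deriv (replicate m 1) (fourier_series c) t))"
      "(SUP t::real. norm (iter_deriv (replicate m 1) (fourier_series c) t)) \<le> ?S" if "m \<le> N" for m
    proof -
      have "bdd_above (range (\<lambda>t. norm (iter_deriv (replicate m 1) (fourier_series c) t)))"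
        by (rule bdd_aboveI2[where M = ?S]) (rule b[OF that])
      then show "0 \<le> (SUP t::real. norm (iter_deriv (replicate m 1) (fourier_series c) t))"
        by (intro cSUP_upper2[of _ _ 0]) auto
      show "(SUP t::real. norm (iter_deriv (replicate m 1) (fourier_series c) t)) \<le> ?S"
        using b[OF that] by (intro cSUP_least) auto
    qed
    let ?Q = "\<Sum>k\<le>N. SUP t::real. norm (iter_deriv (replicate k 1) (fourier_series c) t)"
    have "?Q \<ge> 0" using s(1) by (intro sum_nonneg) auto
    have "?Q \<le> (\<Sum>k\<le>N. ?S)" using s(2) by (intro sum_mono) auto
    have "C * ?Q \<le> \<bar>C\<bar> * ?Q" using \<open>?Q \<ge> 0\<close> by (intro mult_right_mono) auto
    also have "\<dots> \<le> \<bar>C\<bar> * (\<Sum>k\<le>N. ?S)" using \<open>?Q \<le> (\<Sum>k\<le>N. ?S)\<close> by (intro mult_left_mono) auto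
    also have "(\<Sum>k\<le>N. ?S) = real (Suc N) * ?S" by simp
    finally show ?thesis using 1 by (simp add: mult.assoc)
  qed
  then show ?thesis using that[of "\<bar>C\<bar> * real (Suc N)" N] by simp
qed

text \<open>The coefficient family concentrated at n has weighted norm
  \<open>(1 + \<bar>n\<bar>) ^ N\<close>.\<close>

lemma circle_distribution_harm_growth:
  assumes T: "circle_distribution T"
  obtains A N where "A \<ge> 0" "\<And>n. norm (T (harm n)) \<le> A * (1 + \<bar>real_of_int n\<bar>) ^ N"
proof -
  obtain A N where A: "A \<ge> 0"
    "\<And>\<phi> c. rapidly_decreasing c \<Longrightarrow> (\<And>t. \<phi> (cis t) = fourier_series c t) \<Longrightarrow>
      norm (T \<phi>) \<le> A * (\<Sum>k. norm (c (int_decode k)) * (1 + \<bar>real_of_int (int_decode k)\<bar>) ^ N)"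
    using circle_distribution_fourier_bound[OF T] by blast
  have "norm (T (harm n)) \<le> A * (1 + \<bar>real_of_int n\<bar>) ^ N" for n
  proof -
    let ?c = "\<lambda>m. if m = n then 1 else (0::complex)"
    have "(\<lambda>k. norm (?c (int_decode k)) * (1 + \<bar>real_of_int (int_decode k)\<bar>) ^ N) sums
      (\<Sum>k\<in>{int_encode n}. norm (?c (int_decode k)) * (1 + \<bar>real_of_int (int_decode k)\<bar>) ^ N)"
    proof (rule sums_finite)
      show "norm (?c (int_decode k)) * (1 + \<bar>real_of_int (int_decode k)\<bar>) ^ N = 0" if "k \<notin> {int_encode n}" for k
        using that by (metis int_decode_inverse mult_zero_left norm_zero singletonI)
    qed simp
    then have "(\<Sum>k. norm (?c (int_decode k)) * (1 + \<bar>real_of_int (int_decode k)\<bar>) ^ N) = (1 + \<bar>real_of_int n\<bar>) ^ N"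
      by (simp add: sums_iff)
    then show ?thesis
      using A(2)[of ?c "harm n"] rapidly_decreasing_finite_support[of ?c] fourier_series_delta[of n 1]
      by (simp add: harm_cis)
  qed
  then show ?thesis using that A(1) by blast
qed

text \<open>Subtracting a partial sum from \<phi> leaves a test function whose coefficients are a
  tail of c. The uniform bound for T turns the weighted norm of this tail, which tends to 0, into an
  error estimate.\<close>

lemma circle_distribution_fourier_sums:
  assumes T: "circle_distribution T" and c: "rapidly_decreasing c" and \<phi>: "\<And>t. \<phi> (cis t) = fourier_series c t"
  shows "(\<lambda>k. c (int_decode k) * T (harm (int_decode k))) sums T \<phi>"
proof -
  obtain A N where A: "A \<ge> 0"
    "\<And>\<phi> c. rapidly_decreasing c \<Longrightarrow> (\<And>t. \<phi> (cis t) = fourier_series c t) \<Longrightarrow>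
      norm (T \<phi>) \<le> A * (\<Sum>k. norm (c (int_decode k)) * (1 + \<bar>real_of_int (int_decode k)\<bar>) ^ N)"
    using circle_distribution_fourier_bound[OF T] by blast
  let ?a = "\<lambda>k. norm (c (int_decode k)) * (1 + \<bar>real_of_int (int_decode k)\<bar>) ^ N"
  have a: "summable ?a" using c unfolding rapidly_decreasing_def by blast
  have test: "circle_test \<phi>" unfolding circle_test_def \<phi> using smooth_on_fourier_series[OF c] by simp
  have bound: "norm ((\<Sum>k<K. c (int_decode k) * T (harm (int_decode k))) - T \<phi>) \<le> A * (\<Sum>k. ?a (k + K))" for K
  proof -
    let ?p = "\<lambda>z. \<Sum>k<K. c (int_decode k) * harm (int_decode k) z"
    let ?\<psi> = "\<lambda>z. \<phi> z + (-1) * ?p z"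
    \<comment> \<open>Coefficients of the remainder: the first K places of the enumeration are
      erased.\<close>
    define d where "d n = (if int_encode n \<ge> K then c n else 0)" for n
    have p: "circle_test ?p" by (intro circle_test_sum circle_test_cmult circle_test_harm)
    have Tp: "T ?p = (\<Sum>k<K. c (int_decode k) * T (harm (int_decode k)))"
      using circle_distribution_sum[OF T, of "{..<K}" "\<lambda>k z. c (int_decode k) * harm (int_decode k) z"]
      by (simp add: circle_test_cmult circle_test_harm circle_distribution_cmult[OF T])
    have T\<psi>: "T ?\<psi> = T \<phi> + (-1) * T ?p"
      using circle_distribution_add[OF T test circle_test_cmult[OF p, of "-1"]]
        circle_distribution_cmult[OF T p, of "-1"] by simp
    have d: "rapidly_decreasing d"
      using rapidly_decreasing_mult[OF c, of "\<lambda>n. if int_encode n \<ge> K then 1 else 0" 1 0]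
      by (simp add: d_def[abs_def] if_distrib if_distribR cong: if_cong)
    have \<psi>: "?\<psi> (cis t) = fourier_series d t" for t
    proof -
      have 1: "(\<lambda>k. c (int_decode k) * cis (of_int (int_decode k) * t)) sums fourier_series c t"
        unfolding fourier_series_def by (rule summable_sums[OF summable_fourier_series[OF c]])
      have "(\<lambda>k. if k < K then c (int_decode k) * cis (of_int (int_decode k) * t) else 0) sums (\<Sum>k<K. c (int_decode k) * cis (of_int (int_decode k) * t))"
        using sums_If_finite_set[of "{..<K}" "\<lambda>k. c (int_decode k) * cis (of_int (int_decode k) * t)"] by simp
      from sums_diff[OF 1 this] have "(\<lambda>k. d (int_decode k) * cis (of_int (int_decode k) * t)) sums
          (fourier_series c t - (\<Sum>k<K. c (int_decode k) * cis (of_int (int_decode k) * t)))"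
        by (rule sums_cong[THEN iffD1, rotated]) (auto simp: d_def)
      then show ?thesis unfolding fourier_series_def[of d] by (simp add: sums_iff \<phi> harm_cis)
    qed
    have "norm (T ?\<psi>) \<le> A * (\<Sum>k. norm (d (int_decode k)) * (1 + \<bar>real_of_int (int_decode k)\<bar>) ^ N)"
      by (rule A(2)[OF d \<psi>])
    also have "(\<Sum>k. norm (d (int_decode k)) * (1 + \<bar>real_of_int (int_decode k)\<bar>) ^ N) = (\<Sum>k. ?a (k + K))"
    proof -
      have "summable (\<lambda>k. norm (d (int_decode k)) * (1 + \<bar>real_of_int (int_decode k)\<bar>) ^ N)"
        using d unfolding rapidly_decreasing_def by blast
      from suminf_split_initial_segment[OF this, of K] show ?thesis by (simp add: d_def)
    qed
    finally show ?thesis using T\<psi> Tp by (simp add: norm_minus_commute)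
  qed
  have "(\<lambda>K. A * (\<Sum>k. ?a (k + K))) \<longlonglongrightarrow> A * 0"
  proof (intro tendsto_mult_left LIMSEQ_I)
    fix r :: real assume "r > 0"
    from suminf_exist_split[OF this a] show "\<exists>no. \<forall>n\<ge>no. norm ((\<Sum>k. ?a (k + n)) - 0) < r" by simp
  qed
  then have "(\<lambda>K. A * (\<Sum>k. ?a (k + K))) \<longlonglongrightarrow> 0" by simp
  then have "(\<lambda>K. (\<Sum>k<K. c (int_decode k) * T (harm (int_decode k))) - T \<phi>) \<longlonglongrightarrow> 0"
    by (rule Lim_null_comparison[rotated]) (use bound in auto)
  then show ?thesis unfolding sums_def by (simp add: LIM_zero_iff)
qed

section \<open>Fourier coefficients and completeness of the characters\<close>

definition fourier_coeff :: "(real \<Rightarrow> complex) \<Rightarrow> int \<Rightarrow> complex" where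
  "fourier_coeff p n = 1 / (2 * of_real pi) * integral {0..2 * pi} (\<lambda>t. p t * cis (- of_int n * t))"

lemma has_integral_cis: "((\<lambda>t. cis (of_int n * t)) has_integral (if n = 0 then 2 * of_real pi else 0)) {0..2 * pi}"
proof (cases "n = 0")
  case True
  then show ?thesis using has_integral_const_real[of "1::complex" 0 "2 * pi"] by (simp add: scaleR_conv_of_real)
next
  case False
  have "((\<lambda>t. \<i> * of_real (of_int n) * cis (of_int n * t)) has_integral cis (of_int n * (2 * pi)) - cis (of_int n * 0)) {0..2 * pi}"
    by (rule fundamental_theorem_of_calculus, simp, rule has_vector_derivative_cis)
  then have "((\<lambda>t. 1 / (\<i> * of_int n) * (\<i> * of_int n * cis (of_int n * t))) has_integral 1 / (\<i> * of_int n) * 0) {0..2 * pi}"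
    unfolding cis_of_int_2pi by (intro has_integral_mult_right) simp
  then show ?thesis using False by simp
qed

lemma fourier_coeff_fourier_series:
  assumes c: "rapidly_decreasing c"
  shows "fourier_coeff (fourier_series c) n = c n"
proof -
  let ?f = "\<lambda>K t. (\<Sum>k<K. c (int_decode k) * cis (of_int (int_decode k) * t)) * cis (- of_int n * t)"
  have u: "uniform_limit {0..2*pi} ?f (\<lambda>t. fourier_series c t * cis (- of_int n * t)) sequentially"
  proof (rule uniform_lim_mult[OF uniform_limit_fourier_series[OF c] uniform_limit_const])
    show "bounded (fourier_series c ` {0..2*pi})"
      by (intro boundedI[of _ "\<Sum>k. norm (c (int_decode k))"]) (use norm_fourier_series_le[OF c] in auto)
    show "bounded ((\<lambda>t. cis (- of_int n * t)) ` {0..2*pi})"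
      by (intro boundedI[of _ 1]) auto
  qed
  have "continuous_on {0..2*pi} (?f K)" for K by (intro continuous_intros)
  from uniform_limit_integral[OF u this] obtain I J where I: "\<And>K. (?f K has_integral I K) {0..2*pi}"
    "((\<lambda>t. fourier_series c t * cis (- of_int n * t)) has_integral J) {0..2*pi}" "I \<longlonglongrightarrow> J" by auto
  have IK: "I K = (\<Sum>k<K. c (int_decode k) * (if int_decode k = n then 2 * of_real pi else 0))" for K
  proof -
    have "?f K = (\<lambda>t. \<Sum>k<K. c (int_decode k) * cis (of_int (int_decode k - n) * t))"
      by (simp add: fun_eq_iff sum_distrib_right mult.assoc cis_mult left_diff_distrib)
    moreover have "((\<lambda>t. \<Sum>k<K. c (int_decode k) * cis (of_int (int_decode k - n) * t)) has_integral
       (\<Sum>k<K. c (int_decode k) * (if int_decode k - n = 0 then 2 * of_real pi else 0))) {0..2*pi}"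
      by (intro has_integral_sum has_integral_mult_right has_integral_cis) auto
    ultimately show ?thesis using I(1)[of K] has_integral_unique by (simp add: has_integral_unique)
  qed
  \<comment> \<open>Once the partial sum contains the index n, orthogonality leaves that term
    alone.\<close>
  have "I K = 2 * of_real pi * c n" if "K > int_encode n" for K
  proof -
    have "I K = (\<Sum>k\<in>{int_encode n}. c (int_decode k) * (if int_decode k = n then 2 * of_real pi else 0))"
      unfolding IK
    proof (rule sum.mono_neutral_right)
      show "\<forall>i\<in>{..<K} - {int_encode n}. c (int_decode i) * (if int_decode i = n then 2 * of_real pi else 0) = 0"
        by (metis Diff_iff int_decode_inverse mult_zero_right singletonI)
    qed (use that in auto)
    then show ?thesis by simp
  qed
  then have "\<forall>\<^sub>F K in sequentially. I K = 2 * of_real pi * c n"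
    by (rule eventually_mono[OF eventually_gt_at_top[of "int_encode n"], rotated -1])
  then have "I \<longlonglongrightarrow> 2 * of_real pi * c n" by (rule tendsto_eventually)
  then have "J = 2 * of_real pi * c n" using I(3) LIMSEQ_unique by blast
  then show ?thesis using I(2) unfolding fourier_coeff_def by (simp add: integral_unique)
qed

text \<open>Functions orthogonal to all characters stay so after multiplication by any real
  polynomial in the coordinates. By Stone-Weierstrass such polynomials approximate the real and
  imaginary parts of \<phi>, so the integral of |\<phi>|^2 vanishes.\<close>

lemma fourier_uniqueness:
  assumes \<phi>: "continuous_on (sphere 0 1) \<phi>"
    and zero: "\<And>n. fourier_coeff (\<lambda>t. \<phi> (cis t)) n = 0"
  shows "\<phi> (cis t) = 0"
proof -
  define Z where "Z p \<longleftrightarrow> continuous_on {0..2*pi} p \<and> (\<forall>n::int. integral {0..2*pi} (\<lambda>t. p t * cis (of_int n * t)) = 0)"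
    for p :: "real \<Rightarrow> complex"
  have cc: "continuous_on S (\<lambda>t. cis (a * t))" for a S by (intro continuous_intros)
  have Zi: "(\<lambda>t. p t * cis (of_int n * t)) integrable_on {0..2*pi}" if "Z p" for p and n :: int
    using that unfolding Z_def by (intro integrable_continuous_real continuous_intros) auto
  have Zadd: "Z (\<lambda>t. p t + q t)" if "Z p" "Z q" for p q
    using that Zi[OF that(1)] Zi[OF that(2)] unfolding Z_def
    by (auto intro!: continuous_intros simp: distrib_right Henstock_Kurzweil_Integration.integral_add)
  have Zc: "Z (\<lambda>t. a * p t)" if "Z p" for p and a
    using that unfolding Z_def by (auto intro!: continuous_intros simp: mult.assoc)
  have Zcis: "Z (\<lambda>t. p t * cis (of_int m * t))" if "Z p" for p and m :: int
  proof -
    have eq: "p t * cis (of_int m * t) * cis (of_int n * t) = p t * cis (of_int (m + n) * t)" for n :: int and t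
      by (simp add: mult.assoc cis_mult distrib_right)
    show ?thesis
      using that unfolding Z_def eq by (intro conjI allI continuous_on_mult cc) blast+
  qed
  have Zpoly: "Z (\<lambda>t. p t * of_real (q (cis t)))" if "real_polynomial_function q" "Z p" for p and q :: "complex \<Rightarrow> real"
    using that
  proof (induction q arbitrary: p rule: real_polynomial_function.induct)
    case (linear f)
    interpret f: bounded_linear f by (rule linear.hyps)
    \<comment> \<open>A real linear functional of \<open>cis t\<close> is a combination of cos t and
      sin t, hence of the characters with indices 1 and -1.\<close>
    have f: "complex_of_real (f (cis t)) = (of_real (f 1) / 2 - \<i> * of_real (f \<i>) / 2) * cis t + (of_real (f 1) / 2 + \<i> * of_real (f \<i>) / 2) * cis (- t)" for t
    proof -
      have 1: "cis t = cos t *\<^sub>R 1 + sin t *\<^sub>R \<i>" by (simp add: complex_eq_iff)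
      have "f (cis t) = cos t * f 1 + sin t * f \<i>"
        unfolding 1 by (simp only: f.add f.scaleR real_scaleR_def)
      then show ?thesis by (simp add: complex_eq_iff)
    qed
    have X: "Z (\<lambda>t. (of_real (f 1) / 2 - \<i> * of_real (f \<i>) / 2) * (p t * cis (of_int 1 * t)) + (of_real (f 1) / 2 + \<i> * of_real (f \<i>) / 2) * (p t * cis (of_int (-1) * t)))"
      by (intro Zadd Zc Zcis linear.prems)
    have eq: "p t * of_real (f (cis t)) = (of_real (f 1) / 2 - \<i> * of_real (f \<i>) / 2) * (p t * cis (of_int 1 * t)) +
        (of_real (f 1) / 2 + \<i> * of_real (f \<i>) / 2) * (p t * cis (of_int (-1) * t))" for t
      unfolding f by (simp add: algebra_simps)
    show ?case unfolding eq by (rule X)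
  next
    case (const c)
    then show ?case using Zc[of p "of_real c"] by (simp add: mult.commute)
  next
    case (add f g)
    then show ?case using Zadd[of "\<lambda>t. p t * of_real (f (cis t))" "\<lambda>t. p t * of_real (g (cis t))"] by (simp add: distrib_left)
  next
    case (mult f g)
    then have "Z (\<lambda>t. (p t * of_real (f (cis t))) * of_real (g (cis t)))" by blast
    then show ?case by (simp add: mult.assoc)
  qed
  have cont: "continuous_on S (\<lambda>t. \<phi> (cis t))" for S
    by (rule continuous_on_compose2[OF \<phi>]) (auto intro!: continuous_intros)
  have Z\<phi>: "Z (\<lambda>t. \<phi> (cis t))"
    unfolding Z_def using cont zero[of "- n" for n] by (auto simp: fourier_coeff_def)
  obtain M where M: "M > 0" "\<And>z. z \<in> sphere 0 1 \<Longrightarrow> norm (\<phi> z) \<le> M"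
  proof -
    have "bounded (\<phi> ` sphere 0 1)" using \<phi> by (intro compact_imp_bounded compact_continuous_image) auto
    then obtain M where "\<And>z. z \<in> sphere 0 1 \<Longrightarrow> norm (\<phi> z) \<le> M" unfolding bounded_iff by blast
    then have "norm (\<phi> z) \<le> max M 1" if "z \<in> sphere 0 1" for z using that by (meson max.coboundedI1)
    then show ?thesis using that[of "max M 1"] by simp
  qed
  \<comment> \<open>\<open>2 * e\<close> adds the errors in the real and imaginary parts,
    \<open>M\<close> bounds \<phi>, and \<open>2 * pi\<close> is the length of the interval.\<close>
  have small: "norm (integral {0..2*pi} (\<lambda>t. \<phi> (cis t) * cnj (\<phi> (cis t)))) \<le> M * (2 * e) * (2 * pi)" if e: "e > 0" for e
  proof -
    obtain q1 where q1: "real_polynomial_function q1" "\<And>x. x \<in> sphere 0 1 \<Longrightarrow> \<bar>Re (\<phi> x) - q1 x\<bar> < e"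
      using Stone_Weierstrass_real_polynomial_function[of "sphere 0 1" "\<lambda>x. Re (\<phi> x)" e] e \<phi>
      by (metis compact_sphere continuous_on_Re)
    obtain q2 where q2: "real_polynomial_function q2" "\<And>x. x \<in> sphere 0 1 \<Longrightarrow> \<bar>Im (\<phi> x) - q2 x\<bar> < e"
      using Stone_Weierstrass_real_polynomial_function[of "sphere 0 1" "\<lambda>x. Im (\<phi> x)" e] e \<phi>
      by (metis compact_sphere continuous_on_Im)
    let ?P = "\<lambda>t. \<phi> (cis t) * of_real (q1 (cis t)) + (- \<i>) * (\<phi> (cis t) * of_real (q2 (cis t)))"
    have ZP: "Z ?P" by (intro Zadd Zc Zpoly q1 q2 Z\<phi>)
    then have P: "integral {0..2*pi} ?P = 0" "continuous_on {0..2*pi} ?P"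
      using Zi[OF ZP, of 0] unfolding Z_def by (auto dest!: spec[of _ 0])
    have "integral {0..2*pi} (\<lambda>t. \<phi> (cis t) * cnj (\<phi> (cis t))) =
      integral {0..2*pi} (\<lambda>t. \<phi> (cis t) * cnj (\<phi> (cis t)) - ?P t)"
      using P cont by (subst Henstock_Kurzweil_Integration.integral_diff) (auto intro!: integrable_continuous_real continuous_intros)
    also have "norm \<dots> \<le> (M * (2 * e)) * (2 * pi - 0)"
    proof (rule integral_bound)
      show "norm (\<phi> (cis t) * cnj (\<phi> (cis t)) - ?P t) \<le> M * (2 * e)" if "t \<in> {0..2*pi}" for t
      proof -
        have "\<phi> (cis t) * cnj (\<phi> (cis t)) - ?P t =
            \<phi> (cis t) * (of_real (Re (\<phi> (cis t)) - q1 (cis t)) - \<i> * of_real (Im (\<phi> (cis t)) - q2 (cis t)))"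
          by (simp add: complex_eq_iff algebra_simps)
        moreover have "norm (of_real (Re (\<phi> (cis t)) - q1 (cis t)) - \<i> * complex_of_real (Im (\<phi> (cis t)) - q2 (cis t))) \<le> e + e"
          by (rule order_trans[OF norm_triangle_ineq4])
            (use q1(2)[of "cis t"] q2(2)[of "cis t"] in \<open>auto simp: norm_mult simp del: of_real_diff intro!: add_mono less_imp_le\<close>)
        moreover have "norm (\<phi> (cis t)) \<le> M" using M(2)[of "cis t"] by simp
        ultimately show ?thesis using M(1) e by (simp only: norm_mult) (intro mult_mono, auto)
      qed
      show "continuous_on {0..2*pi} (\<lambda>t. \<phi> (cis t) * cnj (\<phi> (cis t)) - ?P t)"
        by (intro continuous_on_diff P(2) continuous_intros cont)
    qed auto
    finally show ?thesis by simp
  qed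
  have "norm (integral {0..2*pi} (\<lambda>t. \<phi> (cis t) * cnj (\<phi> (cis t)))) \<le> 0"
  proof (rule field_le_epsilon)
    fix e :: real assume "e > 0"
    then have "e / (M * 2 * (2 * pi)) > 0" using M by simp
    from small[OF this] show "norm (integral {0..2*pi} (\<lambda>t. \<phi> (cis t) * cnj (\<phi> (cis t)))) \<le> 0 + e"
      using M by (simp add: field_simps)
  qed
  then have "integral {0..2*pi} (\<lambda>t. \<phi> (cis t) * cnj (\<phi> (cis t))) = 0" by simp
  moreover have "(\<lambda>t. \<phi> (cis t) * cnj (\<phi> (cis t))) integrable_on {0..2*pi}"
    by (intro integrable_continuous_real continuous_intros cont)
  ultimately have "((\<lambda>t. \<phi> (cis t) * cnj (\<phi> (cis t))) has_integral 0) {0..2*pi}" by (simp add: has_integral_iff)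
  from has_integral_linear[OF this bounded_linear_Re]
  have "((\<lambda>t. (cmod (\<phi> (cis t)))\<^sup>2) has_integral 0) {0..2*pi}"
    by (simp add: o_def complex_mult_cnj cmod_power2)
  then have 0: "integral {0..2*pi} (\<lambda>t. (cmod (\<phi> (cis t)))\<^sup>2) = 0" by (rule integral_unique)
  have "\<forall>t\<in>{0..2*pi}. (cmod (\<phi> (cis t)))\<^sup>2 = 0"
    using 0 by (subst (asm) integral_eq_0_iff) (auto intro!: continuous_intros cont)
  moreover obtain s where "s \<in> {0..2*pi}" "cis t = cis s"
    using complex_norm_eq_1_exp[of "cis t"] by (metis Arg2pi_ge_0 Arg2pi_lt_2pi atLeastAtMost_iff cis_conv_exp less_imp_le norm_cis complex_norm_eq_1_exp_eq)
  ultimately show ?thesis by simp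
qed

lemma fourier_coeff_bound:
  assumes "continuous_on {0..2*pi} q" "\<And>t. t \<in> {0..2*pi} \<Longrightarrow> norm (q t) \<le> B"
  shows "norm (fourier_coeff q n) \<le> B"
proof -
  have "norm (integral {0..2*pi} (\<lambda>t. q t * cis (- of_int n * t))) \<le> B * (2 * pi - 0)"
    by (rule integral_bound) (use assms in \<open>auto intro!: continuous_intros simp: norm_mult\<close>)
  then show ?thesis by (simp add: fourier_coeff_def norm_mult norm_divide field_simps)
qed

lemma fourier_coeff_diff:
  assumes "continuous_on {0..2*pi} p" "continuous_on {0..2*pi} q"
  shows "fourier_coeff (\<lambda>t. p t - q t) n = fourier_coeff p n - fourier_coeff q n"
proof -
  have "((\<lambda>t. p t * cis (- of_int n * t) - q t * cis (- of_int n * t)) has_integral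
      integral {0..2*pi} (\<lambda>t. p t * cis (- of_int n * t)) - integral {0..2*pi} (\<lambda>t. q t * cis (- of_int n * t))) {0..2*pi}"
    by (intro has_integral_diff integrable_integral integrable_continuous_real continuous_intros assms)
  then show ?thesis
    by (simp only: fourier_coeff_def left_diff_distrib right_diff_distrib integral_unique)
qed

lemma fourier_coeff_deriv:
  assumes D: "\<And>t. (p has_vector_derivative p' t) (at t)" and cont: "continuous_on UNIV p'"
    and per: "p (2 * pi) = p 0"
  shows "fourier_coeff p' n = \<i> * of_int n * fourier_coeff p n"
proof -
  have cp: "continuous_on S p" for S
    using D by (meson continuous_at_imp_continuous_on has_vector_derivative_continuous)
  have "((\<lambda>t. p t * (\<i> * of_real (- of_int n) * cis (- of_int n * t)) + p' t * cis (- of_int n * t)) has_integral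
      (p (2*pi) * cis (- of_int n * (2*pi)) - p 0 * cis (- of_int n * 0))) {0..2*pi}"
    by (rule fundamental_theorem_of_calculus, simp)
      (intro has_vector_derivative_mult has_vector_derivative_cis has_vector_derivative_at_within[OF D])
  moreover have "cis (- of_int n * (2*pi)) = 1" using cis_of_int_2pi[of "-n"] by simp
  ultimately have 1: "((\<lambda>t. (- \<i> * of_int n) * (p t * cis (- of_int n * t)) + p' t * cis (- of_int n * t)) has_integral 0) {0..2*pi}"
    using per by (simp add: mult_ac)
  have i: "(\<lambda>t. p t * cis (- of_int n * t)) integrable_on {0..2*pi}" "(\<lambda>t. p' t * cis (- of_int n * t)) integrable_on {0..2*pi}"
    by (intro integrable_continuous_real continuous_intros cp continuous_on_subset[OF cont], simp)+
  have "((\<lambda>t. (- \<i> * of_int n) * (p t * cis (- of_int n * t)) + p' t * cis (- of_int n * t)) has_integral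
     (- \<i> * of_int n) * integral {0..2*pi} (\<lambda>t. p t * cis (- of_int n * t)) + integral {0..2*pi} (\<lambda>t. p' t * cis (- of_int n * t))) {0..2*pi}"
    by (intro has_integral_add has_integral_mult_right integrable_integral i)
  from has_integral_unique[OF this 1]
  have "integral {0..2*pi} (\<lambda>t. p' t * cis (- of_int n * t)) = \<i> * of_int n * integral {0..2*pi} (\<lambda>t. p t * cis (- of_int n * t))"
    by (simp add: add_eq_0_iff2)
  then show ?thesis by (simp only: fourier_coeff_def) (simp only: mult_ac)
qed

text \<open>Integrating by parts m times bounds |n|^m times the coefficient by the supremum of the
  m-th derivative. The derivatives inherit the period, so no boundary terms appear.\<close>

lemma rapidly_decreasing_fourier_coeff:
  fixes p :: "real \<Rightarrow> complex"
  assumes s: "smooth_on UNIV p" and per: "\<And>t. p (t + 2 * pi) = p t"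
  shows "rapidly_decreasing (fourier_coeff p)"
proof -
  let ?D = "\<lambda>m. iter_deriv (replicate m 1) p"
  have sD: "smooth_on UNIV (?D m)" for m by (rule smooth_on_iter_deriv[OF s]) auto
  have D: "(?D m has_vector_derivative ?D (Suc m) t) (at t)" for m t
    using smooth_on_real_has_vector_derivative[OF sD, of t m] by simp
  have cD: "continuous_on S (?D m)" for m S
    using smooth_on_continuous[OF sD] continuous_on_subset by blast
  have pD: "?D m (t + 2 * pi) = ?D m t" for m t
  proof (induction m arbitrary: t)
    case (Suc m)
    have "((\<lambda>t. ?D m (t + 2 * pi)) has_vector_derivative 1 *\<^sub>R ?D (Suc m) (t + 2 * pi)) (at t)"
      by (rule vector_diff_chain_at[of "\<lambda>t. t + 2 * pi" 1 t "?D m", unfolded o_def])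
        (auto intro!: derivative_eq_intros D simp del: iter_deriv_Cons replicate_Suc)
    then have "(?D m has_vector_derivative ?D (Suc m) (t + 2 * pi)) (at t)" unfolding Suc by simp
    then show ?case using D vector_derivative_at by metis
  qed (simp add: per)
  have c: "fourier_coeff (?D m) n = (\<i> * of_int n) ^ m * fourier_coeff p n" for m n
  proof (induction m)
    case (Suc m)
    have "?D m (2 * pi) = ?D m 0" using pD[of m 0] by simp
    from fourier_coeff_deriv[OF D cD this] show ?case by (simp add: Suc mult.assoc del: iter_deriv_Cons replicate_Suc)
  qed simp
  have B: "\<exists>B. \<forall>n. \<bar>real_of_int n\<bar> ^ m * norm (fourier_coeff p n) \<le> B" for m
  proof -
    have "bounded (?D m ` {0..2*pi})" by (intro compact_imp_bounded compact_continuous_image cD) auto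
    then obtain B where "\<And>t. t \<in> {0..2*pi} \<Longrightarrow> norm (?D m t) \<le> B" unfolding bounded_iff by blast
    from fourier_coeff_bound[OF cD this] have "norm (fourier_coeff (?D m) n) \<le> B" for n by blast
    then show ?thesis unfolding c by (auto simp: norm_mult norm_power)
  qed
  show ?thesis
  proof (rule rapidly_decreasingI)
    fix N
    obtain B0 where B0: "\<And>n. norm (fourier_coeff p n) \<le> B0" using B[of 0] by auto
    obtain B1 where B1: "\<And>n. \<bar>real_of_int n\<bar> ^ N * norm (fourier_coeff p n) \<le> B1" using B[of N] by auto
    \<comment> \<open>The estimates for the exponents 0 and N combine through (1 + x)^N \<le> 2^N (1
      + x^N) for x \<ge> 0.\<close>
    have "norm (fourier_coeff p n) * (1 + \<bar>real_of_int n\<bar>) ^ N \<le> 2 ^ N * (B0 + B1)" for n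
    proof -
      let ?x = "\<bar>real_of_int n\<bar>"
      have "(1 + ?x) ^ N \<le> (2 * max 1 ?x) ^ N" by (intro power_mono) auto
      also have "\<dots> = 2 ^ N * max 1 ?x ^ N" by (simp add: power_mult_distrib)
      also have "max 1 ?x ^ N \<le> 1 + ?x ^ N" by (cases "?x \<le> 1") (auto simp: max_def)
      finally have "(1 + ?x) ^ N \<le> 2 ^ N * (1 + ?x ^ N)" by simp
      then have "norm (fourier_coeff p n) * (1 + ?x) ^ N \<le> norm (fourier_coeff p n) * (2 ^ N * (1 + ?x ^ N))"
        by (intro mult_left_mono) auto
      also have "\<dots> = 2 ^ N * (norm (fourier_coeff p n) + ?x ^ N * norm (fourier_coeff p n))" by (simp add: algebra_simps)
      also have "\<dots> \<le> 2 ^ N * (B0 + B1)" by (intro mult_left_mono add_mono B0 B1) auto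
      finally show ?thesis .
    qed
    then show "\<exists>A. \<forall>n. norm (fourier_coeff p n) * (1 + \<bar>real_of_int n\<bar>) ^ N \<le> A" by blast
  qed
qed

lemma sphere_cis_obtain:
  assumes "z \<in> sphere 0 1"
  obtains t where "t \<in> {0..2*pi}" "z = cis t"
proof -
  have "z = cis (Arg2pi z)" using assms Arg2pi_eq[of z] by (simp add: cis_conv_exp)
  then show ?thesis using that[of "Arg2pi z"] Arg2pi_ge_0[of z] Arg2pi_lt_2pi[of z] by simp
qed

text \<open>\<open>cis\<close> maps a compact interval onto the circle and carries compact sets to
  compact sets, so closedness of a preimage in the circle can be tested on the interval.\<close>

lemma continuous_on_sphere_of_cis:
  fixes \<phi> :: "complex \<Rightarrow> complex"
  assumes "continuous_on UNIV (\<lambda>t. \<phi> (cis t))"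
  shows "continuous_on (sphere 0 1) \<phi>"
proof (subst continuous_on_closed_vimage)
  show "\<forall>B. closed B \<longrightarrow> closed (\<phi> -` B \<inter> sphere 0 1)"
  proof (intro allI impI)
    fix B :: "complex set" assume B: "closed B"
    have "closed ({0..2*pi} \<inter> (\<lambda>t. \<phi> (cis t)) -` B)"
      using B by (intro continuous_closed_preimage continuous_on_subset[OF assms]) auto
    then have "closed ((\<lambda>t. \<phi> (cis t)) -` B \<inter> {0..2*pi})" by (simp add: Int_commute)
    then have "compact ((\<lambda>t. \<phi> (cis t)) -` B \<inter> {0..2*pi})"
      by (metis Int_lower2 bounded_closed_interval bounded_subset compact_eq_bounded_closed)
    then have "compact (cis ` ((\<lambda>t. \<phi> (cis t)) -` B \<inter> {0..2*pi}))"
      by (intro compact_continuous_image continuous_intros)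
    moreover have "cis ` ((\<lambda>t. \<phi> (cis t)) -` B \<inter> {0..2*pi}) = \<phi> -` B \<inter> sphere 0 1"
    proof safe
      fix z :: complex assume "\<phi> z \<in> B" "z \<in> sphere 0 1"
      moreover obtain t where "t \<in> {0..2*pi}" "z = cis t" using sphere_cis_obtain[OF \<open>z \<in> sphere 0 1\<close>] by blast
      ultimately show "z \<in> cis ` ((\<lambda>t. \<phi> (cis t)) -` B \<inter> {0..2*pi})" by auto
    qed auto
    ultimately show "closed (\<phi> -` B \<inter> sphere 0 1)" by (metis compact_imp_closed)
  qed
qed simp

text \<open>The difference of \<phi> and its Fourier series is continuous on the circle and has all
  coefficients 0.\<close>

lemma circle_test_fourier:
  assumes \<phi>: "circle_test \<phi>"
  defines "c \<equiv> fourier_coeff (\<lambda>t. \<phi> (cis t))"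
  shows "rapidly_decreasing c" "\<phi> (cis t) = fourier_series c t"
proof -
  have s: "smooth_on UNIV (\<lambda>t. \<phi> (cis t))" using \<phi> by (simp add: circle_test_def)
  have "cis (t + 2 * pi) = cis t" for t by (simp flip: cis_mult)
  then show c: "rapidly_decreasing c" unfolding c_def by (intro rapidly_decreasing_fourier_coeff[OF s]) simp
  let ?\<psi> = "\<lambda>z. \<phi> z - (\<Sum>k. c (int_decode k) * harm (int_decode k) z)"
  have \<psi>: "?\<psi> (cis t) = \<phi> (cis t) - fourier_series c t" for t by (simp add: fourier_series_def harm_cis)
  have cs: "continuous_on S (fourier_series c)" and cp: "continuous_on S (\<lambda>t. \<phi> (cis t))" for S
    using smooth_on_continuous[OF smooth_on_fourier_series[OF c]] smooth_on_continuous[OF s] continuous_on_subset by blast+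
  have "?\<psi> (cis t) = 0"
  proof (rule fourier_uniqueness)
    show "continuous_on (sphere 0 1) ?\<psi>"
    proof (rule continuous_on_sphere_of_cis)
      show "continuous_on UNIV (\<lambda>t. ?\<psi> (cis t))"
        unfolding \<psi> by (rule continuous_on_diff[OF cp cs])
    qed
    fix n
    have "fourier_coeff (\<lambda>t. ?\<psi> (cis t)) n = fourier_coeff (\<lambda>t. \<phi> (cis t)) n - fourier_coeff (fourier_series c) n"
      unfolding \<psi> by (rule fourier_coeff_diff[OF cp cs])
    also have "\<dots> = 0" using fourier_coeff_fourier_series[OF c] by (simp add: c_def)
    finally show "fourier_coeff (\<lambda>t. ?\<psi> (cis t)) n = 0" .
  qed
  then show "\<phi> (cis t) = fourier_series c t" by (simp add: \<psi>)
qed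

lemma circle_distribution_circle_test_sums:
  assumes "circle_distribution T" "circle_test \<phi>"
  shows "(\<lambda>k. fourier_coeff (\<lambda>t. \<phi> (cis t)) (int_decode k) * T (harm (int_decode k))) sums T \<phi>"
  by (rule circle_distribution_fourier_sums[OF assms(1) circle_test_fourier(1)[OF assms(2)] circle_test_fourier(2)[OF assms(2)]])

section \<open>Polynomial growth against geometric decay\<close>

lemma harm_cnj: "harm n (cnj z) = harm (- n) z"
  by (auto simp: harm_def)

lemma norm_harm: "norm (harm n z) = norm z ^ nat \<bar>n\<bar>"
  by (auto simp: harm_def norm_power)

lemma harm_mult: "harm n (z * w) = harm n z * harm n w"
  by (auto simp: harm_def power_mult_distrib)

lemma harm_of_real: "harm n (of_real r) = of_real r ^ nat \<bar>n\<bar>"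
  by (auto simp: harm_def)

text \<open>With s the N-th root of r the expression is the N-th power of s^m (1 + m), which reduces
  the claim to a linear factor.\<close>

lemma power_times_polynomial_bounded:
  fixes r :: real
  assumes "0 \<le> r" "r < 1"
  shows "\<exists>A. \<forall>m. r ^ m * (1 + real m) ^ N \<le> A"
proof (cases "N = 0")
  case True
  then show ?thesis using assms power_le_one[of r] by (intro exI[of _ 1]) auto
next
  case False
  define s where "s = root N r"
  have s: "0 \<le> s" "s < 1" "s ^ N = r" using assms False by (auto simp: s_def real_root_pow_pos2)
  have "(\<lambda>m. s ^ m + of_nat m * s ^ m) \<longlonglongrightarrow> 0 + 0"
    using s by (intro tendsto_add LIMSEQ_power_zero powser_times_n_limit_0) auto
  then have "Bseq (\<lambda>m. s ^ m + of_nat m * s ^ m)" using convergent_imp_Bseq convergentI by blast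
  then obtain K where K: "\<And>m. norm (s ^ m + of_nat m * s ^ m) \<le> K" by (auto simp: Bseq_def)
  have "r ^ m * (1 + real m) ^ N \<le> K ^ N" for m
  proof -
    have "r ^ m = (s ^ m) ^ N" by (simp only: s(3)[symmetric] power_mult[symmetric] mult.commute)
    then have "r ^ m * (1 + real m) ^ N = (s ^ m * (1 + real m)) ^ N" by (simp only: power_mult_distrib)
    also have "(s ^ m * (1 + real m)) ^ N = (s ^ m + of_nat m * s ^ m) ^ N" by (simp add: algebra_simps)
    also have "\<dots> \<le> K ^ N" using K[of m] s by (intro power_mono) auto
    finally show ?thesis .
  qed
  then show ?thesis by blast
qed

lemma rapidly_decreasing_power_abs:
  assumes "0 \<le> r" "r < 1"
  shows "rapidly_decreasing (\<lambda>n. of_real r ^ nat \<bar>n\<bar>)"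
proof (rule rapidly_decreasingI)
  fix N
  obtain A where "\<And>m. r ^ m * (1 + real m) ^ N \<le> A" using power_times_polynomial_bounded[OF assms] by blast
  from this[of "nat \<bar>n\<bar>" for n]
  have "norm (of_real r ^ nat \<bar>n\<bar> :: complex) * (1 + \<bar>real_of_int n\<bar>) ^ N \<le> A" for n
    using assms by (simp add: norm_power)
  then show "\<exists>A. \<forall>n. norm (of_real r ^ nat \<bar>n\<bar> :: complex) * (1 + \<bar>real_of_int n\<bar>) ^ N \<le> A" by blast
qed

definition poly_growth :: "(int \<Rightarrow> complex) \<Rightarrow> bool" where
  "poly_growth a \<longleftrightarrow> (\<exists>A N. \<forall>n. norm (a n) \<le> A * (1 + \<bar>real_of_int n\<bar>) ^ N)"

lemma poly_growth_rapidly_decreasing: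
  "poly_growth a \<Longrightarrow> rapidly_decreasing c \<Longrightarrow> rapidly_decreasing (\<lambda>n. a n * c n)"
  unfolding poly_growth_def using rapidly_decreasing_mult by blast

lemma poly_growth_mult:
  assumes "poly_growth a" "poly_growth b"
  shows "poly_growth (\<lambda>n. a n * b n)"
proof -
  obtain A N B M where a: "\<And>n. norm (a n) \<le> A * (1 + \<bar>real_of_int n\<bar>) ^ N" and b: "\<And>n. norm (b n) \<le> B * (1 + \<bar>real_of_int n\<bar>) ^ M"
    using assms unfolding poly_growth_def by blast
  have "norm (a n * b n) \<le> (A * B) * (1 + \<bar>real_of_int n\<bar>) ^ (N + M)" for n
  proof -
    have "norm (a n * b n) \<le> (A * (1 + \<bar>real_of_int n\<bar>) ^ N) * (B * (1 + \<bar>real_of_int n\<bar>) ^ M)"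
      unfolding norm_mult by (intro mult_mono a b order_trans[OF norm_ge_zero a] norm_ge_zero)
    then show ?thesis by (simp add: power_add mult_ac)
  qed
  then show ?thesis unfolding poly_growth_def by blast
qed

lemma poly_growth_add:
  assumes "poly_growth a" "poly_growth b"
  shows "poly_growth (\<lambda>n. a n + b n)"
proof -
  obtain A N B M where a: "\<And>n. norm (a n) \<le> A * (1 + \<bar>real_of_int n\<bar>) ^ N" and b: "\<And>n. norm (b n) \<le> B * (1 + \<bar>real_of_int n\<bar>) ^ M"
    using assms unfolding poly_growth_def by blast
  have "norm (a n + b n) \<le> (\<bar>A\<bar> + \<bar>B\<bar>) * (1 + \<bar>real_of_int n\<bar>) ^ (N + M)" for n
  proof -
    let ?w = "1 + \<bar>real_of_int n\<bar>"
    have p: "?w ^ N \<le> ?w ^ (N + M)" "?w ^ M \<le> ?w ^ (N + M)" by (intro power_increasing; simp)+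
    have "norm (a n) \<le> \<bar>A\<bar> * ?w ^ N" by (rule order_trans[OF a]) (auto intro!: mult_right_mono)
    also have "\<dots> \<le> \<bar>A\<bar> * ?w ^ (N + M)" using p by (intro mult_left_mono) auto
    finally have 1: "norm (a n) \<le> \<bar>A\<bar> * ?w ^ (N + M)" .
    have "norm (b n) \<le> \<bar>B\<bar> * ?w ^ M" by (rule order_trans[OF b]) (auto intro!: mult_right_mono)
    also have "\<dots> \<le> \<bar>B\<bar> * ?w ^ (N + M)" using p by (intro mult_left_mono) auto
    finally have 2: "norm (b n) \<le> \<bar>B\<bar> * ?w ^ (N + M)" .
    show ?thesis using norm_triangle_le[of "a n" "b n"] 1 2 by (simp add: distrib_right norm_triangle_le)
  qed
  then show ?thesis unfolding poly_growth_def by blast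
qed

lemma poly_growth_const: "poly_growth (\<lambda>n. a)"
  unfolding poly_growth_def by (intro exI[of _ "norm a"] exI[of _ 0]) simp

lemma poly_growth_abs: "poly_growth (\<lambda>n. of_int \<bar>n\<bar>)"
  unfolding poly_growth_def by (intro exI[of _ 1] exI[of _ 1]) simp

lemma poly_growth_circle_distribution: "circle_distribution T \<Longrightarrow> poly_growth (\<lambda>n. T (harm n))"
  unfolding poly_growth_def using circle_distribution_harm_growth[of T] by metis

section \<open>Biharmonic series\<close>

text \<open>The conjugate comes from the kernels: the expansion of
  \<open>F0 (z * cnj \<zeta>)\<close> consists of multiples of
  \<open>harm n (cnj z) * harm n \<zeta>\<close>, so the coefficient at n belongs to the value of a
  distribution at \<open>harm n\<close>.\<close>

definition biharm_series :: "(int \<Rightarrow> complex) \<Rightarrow> (int \<Rightarrow> complex) \<Rightarrow> complex \<Rightarrow> complex" where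
  "biharm_series a b z = (\<Sum>k. (a (int_decode k) + b (int_decode k) * of_real ((cmod z)\<^sup>2)) * harm (int_decode k) (cnj z))"

lemma biharm_series_term_bound:
  assumes "cmod z \<le> r" "r < 1"
  shows "norm ((a n + b n * of_real ((cmod z)\<^sup>2)) * harm n (cnj z)) \<le> norm (a n * of_real r ^ nat \<bar>n\<bar>) + norm (b n * of_real r ^ nat \<bar>n\<bar>)"
proof -
  have r: "0 \<le> r" using assms norm_ge_zero order_trans by blast
  have "norm (b n) * (cmod z)\<^sup>2 \<le> norm (b n) * 1"
    using assms by (intro mult_left_mono power_le_one) auto
  then have "norm (a n + b n * of_real ((cmod z)\<^sup>2)) \<le> norm (a n) + norm (b n)"
    using norm_triangle_ineq[of "a n" "b n * of_real ((cmod z)\<^sup>2)"] by (simp add: norm_mult norm_power)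
  moreover have "cmod z ^ nat \<bar>n\<bar> \<le> r ^ nat \<bar>n\<bar>" using assms by (intro power_mono) auto
  ultimately have "norm (a n + b n * of_real ((cmod z)\<^sup>2)) * cmod z ^ nat \<bar>n\<bar> \<le> (norm (a n) + norm (b n)) * r ^ nat \<bar>n\<bar>"
    by (intro mult_mono) auto
  moreover have "norm (complex_of_real r ^ nat \<bar>n\<bar>) = r ^ nat \<bar>n\<bar>" using r by (simp add: norm_power)
  ultimately show ?thesis unfolding norm_mult norm_harm complex_mod_cnj by (simp only: distrib_right)
qed

lemma biharm_series_majorant:
  assumes "poly_growth a" "poly_growth b" "0 \<le> r" "r < 1"
  shows "summable (\<lambda>k. norm (a (int_decode k) * of_real r ^ nat \<bar>int_decode k\<bar>) + norm (b (int_decode k) * of_real r ^ nat \<bar>int_decode k\<bar>))"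
  using rapidly_decreasing_summable_norm[OF poly_growth_rapidly_decreasing[OF assms(1) rapidly_decreasing_power_abs[OF assms(3,4)]]]
    rapidly_decreasing_summable_norm[OF poly_growth_rapidly_decreasing[OF assms(2) rapidly_decreasing_power_abs[OF assms(3,4)]]]
  by (rule summable_add)

lemma compact_subset_ball_radius:
  assumes "compact K" "K \<subseteq> ball (0::complex) 1"
  obtains r where "0 \<le> r" "r < 1" "\<And>z. z \<in> K \<Longrightarrow> cmod z \<le> r"
proof (cases "K = {}")
  case True
  then show ?thesis using that[of 0] by simp
next
  case False
  have "continuous_on K cmod" by (intro continuous_intros)
  then obtain x where "x \<in> K" "\<And>z. z \<in> K \<Longrightarrow> cmod z \<le> cmod x"
    using continuous_attains_sup[OF assms(1) False, of cmod] by auto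
  then show ?thesis using that[of "cmod x"] assms(2) by auto
qed

lemma weakly_biharmonic_biharm_series:
  assumes "poly_growth a" "poly_growth b"
  shows "weakly_biharmonic (biharm_series a b)"
proof (rule weakly_biharmonic_uniform_limit)
  let ?f = "\<lambda>k z. (a (int_decode k) + b (int_decode k) * of_real ((cmod z)\<^sup>2)) * harm (int_decode k) (cnj z)"
  have eq: "?f k = (\<lambda>z. a (int_decode k) * harm (- int_decode k) z + b (int_decode k) * (of_real ((cmod z)\<^sup>2) * harm (- int_decode k) z))" for k
    by (rule ext) (simp only: harm_cnj distrib_right mult.assoc)
  have "weakly_biharmonic (?f k)" for k
    unfolding eq by (intro weakly_biharmonic_add weakly_biharmonic_cmult weakly_biharmonic_harm weakly_biharmonic_cmod_sq_harm)
  then show "weakly_biharmonic (\<lambda>z. \<Sum>k<n. ?f k z)" for n by (rule weakly_biharmonic_sum)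
  fix K assume K: "compact K" "K \<subseteq> ball (0::complex) 1"
  then obtain r where r: "0 \<le> r" "r < 1" "\<And>z. z \<in> K \<Longrightarrow> cmod z \<le> r"
    using compact_subset_ball_radius by blast
  show "uniform_limit K (\<lambda>n z. \<Sum>k<n. ?f k z) (biharm_series a b) sequentially"
    unfolding biharm_series_def[abs_def]
    by (rule Weierstrass_m_test[OF _ biharm_series_majorant[OF assms r(1,2)]])
      (rule biharm_series_term_bound[OF r(3,2)])
qed

text \<open>On the circle of radius r the n-th term is a multiple of \<open>cis (- n * t)\<close>,
  so pairing it with \<phi> returns the n-th Fourier coefficient of \<phi>. Uniform convergence on
  that circle permits termwise integration.\<close>

lemma biharm_series_boundary_pairing:
  assumes ab: "poly_growth a" "poly_growth b" and r: "0 < r" "r < 1" and p: "continuous_on UNIV (\<lambda>t. \<phi> (cis t))"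
  shows "(\<lambda>k. (a (int_decode k) + b (int_decode k) * of_real (r\<^sup>2)) * of_real r ^ nat \<bar>int_decode k\<bar> * fourier_coeff (\<lambda>t. \<phi> (cis t)) (int_decode k))
    sums circle_dist_of_fun (dilate (biharm_series a b) r) \<phi>"
proof -
  let ?f = "\<lambda>k z. (a (int_decode k) + b (int_decode k) * of_real ((cmod z)\<^sup>2)) * harm (int_decode k) (cnj z)"
  let ?g = "\<lambda>K t. (\<Sum>k<K. ?f k (of_real r * cis t)) * \<phi> (cis t)"
  let ?B = "biharm_series a b"
  have m: "norm (?f k (of_real r * cis t)) \<le> norm (a (int_decode k) * of_real r ^ nat \<bar>int_decode k\<bar>) + norm (b (int_decode k) * of_real r ^ nat \<bar>int_decode k\<bar>)" for k t
    by (rule biharm_series_term_bound) (use r in \<open>auto simp: norm_mult\<close>)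
  have sm: "summable (\<lambda>k. norm (a (int_decode k) * of_real r ^ nat \<bar>int_decode k\<bar>) + norm (b (int_decode k) * of_real r ^ nat \<bar>int_decode k\<bar>))"
    using r by (intro biharm_series_majorant ab) auto
  have u: "uniform_limit {0..2*pi} (\<lambda>K t. \<Sum>k<K. ?f k (of_real r * cis t)) (\<lambda>t. ?B (of_real r * cis t)) sequentially"
    unfolding biharm_series_def by (rule Weierstrass_m_test[OF m sm])
  have cB: "continuous_on {0..2*pi} (\<lambda>t. ?B (of_real r * cis t))"
  proof (rule continuous_on_compose2[of "ball 0 1" ?B])
    show "continuous_on (ball 0 1) ?B" using weakly_biharmonic_biharm_series[OF ab] by (simp add: weakly_biharmonic_def)
  qed (use r in \<open>auto intro!: continuous_intros simp: norm_mult\<close>)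
  have cp: "continuous_on {0..2*pi} (\<lambda>t. \<phi> (cis t))" using p continuous_on_subset by blast
  have u2: "uniform_limit {0..2*pi} ?g (\<lambda>t. ?B (of_real r * cis t) * \<phi> (cis t)) sequentially"
    by (rule uniform_lim_mult[OF u uniform_limit_const])
      (auto intro!: compact_imp_bounded compact_continuous_image cB cp)
  have f: "?f k (of_real r * cis t) = ((a (int_decode k) + b (int_decode k) * of_real (r\<^sup>2)) * of_real r ^ nat \<bar>int_decode k\<bar>) * cis (- of_int (int_decode k) * t)" for k t
    using r harm_cis[of "- int_decode k" t] by (simp add: norm_mult harm_cnj harm_mult harm_of_real mult.assoc)
  have cg: "continuous_on {0..2*pi} (?g K)" for K
    unfolding f by (intro continuous_intros cp)
  from uniform_limit_integral[OF u2 this] obtain I J where I: "\<And>K. (?g K has_integral I K) {0..2*pi}"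
    "((\<lambda>t. ?B (of_real r * cis t) * \<phi> (cis t)) has_integral J) {0..2*pi}" "I \<longlonglongrightarrow> J" by auto
  let ?c = "\<lambda>k. (a (int_decode k) + b (int_decode k) * of_real (r\<^sup>2)) * of_real r ^ nat \<bar>int_decode k\<bar>"
  have "I K = (\<Sum>k<K. ?c k * (2 * of_real pi * fourier_coeff (\<lambda>t. \<phi> (cis t)) (int_decode k)))" for K
  proof -
    have "?g K = (\<lambda>t. \<Sum>k<K. ?c k * (\<phi> (cis t) * cis (- of_int (int_decode k) * t)))"
      unfolding f sum_distrib_right by (simp only: mult_ac)
    moreover have "((\<lambda>t. \<Sum>k<K. ?c k * (\<phi> (cis t) * cis (- of_int (int_decode k) * t))) has_integral
        (\<Sum>k<K. ?c k * integral {0..2*pi} (\<lambda>t. \<phi> (cis t) * cis (- of_int (int_decode k) * t)))) {0..2*pi}"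
      by (intro has_integral_sum has_integral_mult_right integrable_integral integrable_continuous_real continuous_intros cp) auto
    ultimately show ?thesis using I(1)[of K] by (simp add: has_integral_unique fourier_coeff_def)
  qed
  then have "I = (\<lambda>K. \<Sum>k<K. ?c k * (2 * of_real pi * fourier_coeff (\<lambda>t. \<phi> (cis t)) (int_decode k)))" by (rule ext)
  then have "(\<lambda>k. ?c k * (2 * of_real pi * fourier_coeff (\<lambda>t. \<phi> (cis t)) (int_decode k))) sums J"
    using I(3) by (simp only: sums_def)
  from sums_mult[OF this, of "1 / (2 * of_real pi)"]
  moreover have "1 / (2 * complex_of_real pi) * (x * (2 * of_real pi * y)) = x * y" for x y by simp
  ultimately have "(\<lambda>k. ?c k * fourier_coeff (\<lambda>t. \<phi> (cis t)) (int_decode k)) sums (1 / (2 * of_real pi) * J)"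
    by (simp only:)
  moreover have "circle_dist_of_fun (dilate ?B r) \<phi> = 1 / (2 * of_real pi) * J"
    using I(2) by (simp add: circle_dist_of_fun_def dilate_def integral_unique)
  ultimately show ?thesis by simp
qed

section \<open>Expansion of the kernels into harmonic monomials\<close>

lemma sums_int_decode:
  fixes f :: "int \<Rightarrow> complex"
  assumes "(\<lambda>m. f (int m)) sums s" "(\<lambda>m. f (- int m - 1)) sums s'"
  shows "(\<lambda>k. f (int_decode k)) sums (s + s')"
proof -
  have *: "(\<lambda>k. g (int_decode k)) sums (x + y)" if "(\<lambda>m. g (int m)) sums x" "(\<lambda>m. g (- int m - 1)) sums y"
    for g :: "int \<Rightarrow> real" and x y
  proof -
    have "(\<lambda>n. if even n then g (int (n div 2)) else g (- int ((n - 1) div 2) - 1)) sums (y + x)"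
      by (rule sums_if[OF that(2,1)])
    moreover have "(if even n then g (int (n div 2)) else g (- int ((n - 1) div 2) - 1)) = g (int_decode n)" for n
      by (auto simp: int_decode_eq elim!: oddE)
    ultimately show ?thesis by (simp add: add.commute)
  qed
  show ?thesis
    using assms by (auto simp: sums_complex_iff intro!: *[of "\<lambda>n. Re (f n)"] *[of "\<lambda>n. Im (f n)"])
qed

text \<open>The harmonic monomials sum to the Poisson kernel P = (1 - |z|^2) / |1 - z|^2, and with
  weight |n| to Q, twice the real part of z / (1 - z)^2. Then H0 = (1 - |z|^2) P / 2 and F0 = P + (1
  - |z|^2) Q / 2.\<close>

lemma H0_expansion:
  assumes z: "cmod z < 1"
  shows "(\<lambda>k. of_real (1 - (cmod z)\<^sup>2) / 2 * harm (int_decode k) z) sums of_real (H0 z)"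
    and "(\<lambda>k. (1 + of_int \<bar>int_decode k\<bar> * of_real (1 - (cmod z)\<^sup>2) / 2) * harm (int_decode k) z) sums of_real (F0 z)"
proof -
  have nz: "1 - z \<noteq> 0" "1 - cnj z \<noteq> 0" using z by auto
  define \<rho> where "\<rho> = z * cnj z"
  have \<rho>: "complex_of_real ((cmod z)\<^sup>2) = \<rho>" unfolding \<rho>_def by (rule complex_norm_square)
  define D where "D = (1 - z) * (1 - cnj z)"
  have D: "complex_of_real ((cmod (1 - z))\<^sup>2) = D" unfolding D_def complex_norm_square by simp
  have Dnz: "D \<noteq> 0" using nz by (simp add: D_def)
  have h: "harm (- int m - 1) z = cnj z ^ Suc m" for m by (simp add: harm_def nat_add_distrib del: power_Suc)
  have "(\<lambda>k. harm (int_decode k) z) sums (1 / (1 - z) + cnj z * (1 / (1 - cnj z)))"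
  proof (rule sums_int_decode)
    show "(\<lambda>m. harm (int m) z) sums (1 / (1 - z))" using geometric_sums[OF z] by (simp add: harm_def)
    have "(\<lambda>m. cnj z * cnj z ^ m) sums (cnj z * (1 / (1 - cnj z)))"
      using geometric_sums[of "cnj z"] z by (intro sums_mult) auto
    then show "(\<lambda>m. harm (- int m - 1) z) sums (cnj z * (1 / (1 - cnj z)))" unfolding h by simp
  qed
  moreover have "1 / (1 - z) + cnj z * (1 / (1 - cnj z)) = (1 - \<rho>) / D"
    using nz by (simp add: \<rho>_def D_def field_simps)
  ultimately have P: "(\<lambda>k. harm (int_decode k) z) sums ((1 - \<rho>) / D)" by simp
  have "(\<lambda>k. of_int \<bar>int_decode k\<bar> * harm (int_decode k) z) sums (z * (1 / (1 - z)\<^sup>2) + cnj z * (1 / (1 - cnj z)\<^sup>2))"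
  proof (rule sums_int_decode)
    have "(\<lambda>m. z * (of_nat (Suc m) * z ^ m)) sums (z * (1 / (1 - z)\<^sup>2))"
      by (intro sums_mult geometric_deriv_sums z)
    then have "(\<lambda>m. of_nat (Suc m) * z ^ Suc m) sums (z * (1 / (1 - z)\<^sup>2))" by (simp add: mult_ac)
    then have "(\<lambda>m. of_nat m * z ^ m) sums (z * (1 / (1 - z)\<^sup>2) + of_nat 0 * z ^ 0)" by (subst (asm) sums_Suc_iff) simp
    then show "(\<lambda>m. of_int \<bar>int m\<bar> * harm (int m) z) sums (z * (1 / (1 - z)\<^sup>2))" by (simp add: harm_def)
    have "(\<lambda>m. cnj z * (of_nat (Suc m) * cnj z ^ m)) sums (cnj z * (1 / (1 - cnj z)\<^sup>2))"
      using z by (intro sums_mult geometric_deriv_sums) simp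
    moreover have "of_int \<bar>- int m - 1\<bar> = (of_nat (Suc m) :: complex)" for m by simp
    ultimately show "(\<lambda>m. of_int \<bar>- int m - 1\<bar> * harm (- int m - 1) z) sums (cnj z * (1 / (1 - cnj z)\<^sup>2))"
      unfolding h by (simp add: mult_ac del: of_nat_Suc)
  qed
  \<comment> \<open>The common denominator is \<open>D\<^sup>2\<close>; the numerator takes this
    form because \<open>z + cnj z = 1 + \<rho> - D\<close>.\<close>
  moreover have "z * (1 / (1 - z)\<^sup>2) + cnj z * (1 / (1 - cnj z)\<^sup>2) = ((1 - \<rho>)\<^sup>2 - (1 + \<rho>) * D) / D\<^sup>2"
    using nz by (simp add: \<rho>_def D_def divide_simps) (simp add: power2_eq_square algebra_simps)
  ultimately have Q: "(\<lambda>k. of_int \<bar>int_decode k\<bar> * harm (int_decode k) z) sums (((1 - \<rho>)\<^sup>2 - (1 + \<rho>) * D) / D\<^sup>2)" by simp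
  have H: "complex_of_real (H0 z) = (1 - \<rho>)\<^sup>2 / (2 * D)"
    by (simp add: H0_def \<rho>[symmetric] D[symmetric])
  have D4: "complex_of_real (cmod (1 - z) ^ 4) = D\<^sup>2"
    using D by (simp add: power2_eq_square numeral_eq_Suc mult.assoc flip: D)
  have F: "complex_of_real (F0 z) = (1 - \<rho>)\<^sup>2 / (2 * D) + (1 - \<rho>) ^ 3 / (2 * D\<^sup>2)"
    unfolding F0_def of_real_add H by (simp add: \<rho>[symmetric] D4[symmetric])
  have "(1 - \<rho>) / 2 * ((1 - \<rho>) / D) = (1 - \<rho>)\<^sup>2 / (2 * D)" by (simp add: power2_eq_square)
  then show "(\<lambda>k. of_real (1 - (cmod z)\<^sup>2) / 2 * harm (int_decode k) z) sums of_real (H0 z)"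
    using sums_mult[OF P, of "(1 - \<rho>) / 2"] unfolding H of_real_diff of_real_1 \<rho> by (simp only:)
  have "(1 - \<rho>) / D + (1 - \<rho>) / 2 * (((1 - \<rho>)\<^sup>2 - (1 + \<rho>) * D) / D\<^sup>2) = (1 - \<rho>)\<^sup>2 / (2 * D) + (1 - \<rho>) ^ 3 / (2 * D\<^sup>2)"
    using Dnz by (simp add: divide_simps) (simp add: power2_eq_square power3_eq_cube algebra_simps)
  then have "(\<lambda>k. harm (int_decode k) z + (1 - \<rho>) / 2 * (of_int \<bar>int_decode k\<bar> * harm (int_decode k) z)) sums of_real (F0 z)"
    using sums_add[OF P sums_mult[OF Q, of "(1 - \<rho>) / 2"]] unfolding F by simp
  moreover have "harm (int_decode k) z + (1 - \<rho>) / 2 * (of_int \<bar>int_decode k\<bar> * harm (int_decode k) z) =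
     (1 + of_int \<bar>int_decode k\<bar> * of_real (1 - (cmod z)\<^sup>2) / 2) * harm (int_decode k) z" for k
    unfolding of_real_diff \<rho> by (simp add: algebra_simps)
  ultimately show "(\<lambda>k. (1 + of_int \<bar>int_decode k\<bar> * of_real (1 - (cmod z)\<^sup>2) / 2) * harm (int_decode k) z) sums of_real (F0 z)"
    by (simp only:)
qed

lemma cmod_one_minus_mult_cnj: "cmod (1 - z * cnj \<zeta>) = cmod (1 - cnj z * \<zeta>)"
  using complex_mod_cnj[of "1 - z * cnj \<zeta>"] by simp

lemma F0_mult_cnj: "F0 (z * cnj \<zeta>) = F0 (cnj z * \<zeta>)" and H0_mult_cnj: "H0 (z * cnj \<zeta>) = H0 (cnj z * \<zeta>)"
  unfolding F0_def H0_def cmod_one_minus_mult_cnj by (simp_all add: norm_mult)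

lemma poisson_type_potentials_sums:
  assumes f: "circle_distribution f" and h: "circle_distribution h" and z: "cmod z < 1"
  shows "(\<lambda>k. (1 + of_int \<bar>int_decode k\<bar> * of_real (1 - (cmod z)\<^sup>2) / 2) * harm (int_decode k) (cnj z) * f (harm (int_decode k))) sums F0_pot f z"
    and "(\<lambda>k. of_real (1 - (cmod z)\<^sup>2) / 2 * harm (int_decode k) (cnj z) * h (harm (int_decode k))) sums H0_pot h z"
proof -
  have rd: "rapidly_decreasing (\<lambda>n. harm n (cnj z))"
  proof -
    have "rapidly_decreasing (\<lambda>n. of_real (cmod z) ^ nat \<bar>n\<bar>)"
      using z by (intro rapidly_decreasing_power_abs) auto
    then show ?thesis unfolding rapidly_decreasing_def by (simp add: norm_harm norm_power)
  qed
  define c where "c n = (1 + of_int \<bar>n\<bar> * of_real (1 - (cmod z)\<^sup>2) / 2) * harm n (cnj z)" for n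
  define d where "d n = of_real (1 - (cmod z)\<^sup>2) / 2 * harm n (cnj z)" for n
  have "poly_growth (\<lambda>n. 1 + of_int \<bar>n\<bar> * (of_real (1 - (cmod z)\<^sup>2) / 2))"
    by (intro poly_growth_add poly_growth_mult poly_growth_const poly_growth_abs)
  from poly_growth_rapidly_decreasing[OF this rd] have c: "rapidly_decreasing c"
    unfolding c_def[abs_def] by simp
  have d: "rapidly_decreasing d"
    unfolding d_def[abs_def] by (rule poly_growth_rapidly_decreasing[OF poly_growth_const rd])
  have n: "cmod (cnj z * cis t) = cmod z" for t by (simp add: norm_mult)
  have "complex_of_real (F0 (z * cnj (cis t))) = fourier_series c t" for t
    using H0_expansion(2)[of "cnj z * cis t"] z unfolding n F0_mult_cnj fourier_series_def c_def
    by (simp add: sums_iff harm_mult harm_cis mult.assoc)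
  from circle_distribution_fourier_sums[OF f c this]
  show "(\<lambda>k. (1 + of_int \<bar>int_decode k\<bar> * of_real (1 - (cmod z)\<^sup>2) / 2) * harm (int_decode k) (cnj z) * f (harm (int_decode k))) sums F0_pot f z"
    by (simp only: F0_pot_def c_def)
  have "complex_of_real (H0 (z * cnj (cis t))) = fourier_series d t" for t
    using H0_expansion(1)[of "cnj z * cis t"] z unfolding n H0_mult_cnj fourier_series_def d_def
    by (simp add: sums_iff harm_mult harm_cis mult.assoc)
  from circle_distribution_fourier_sums[OF h d this]
  show "(\<lambda>k. of_real (1 - (cmod z)\<^sup>2) / 2 * harm (int_decode k) (cnj z) * h (harm (int_decode k))) sums H0_pot h z"
    by (simp only: H0_pot_def d_def)
qed

text \<open>\<open>a n + b n\<close> is the boundary value of the mode with index n and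
  \<open>- \<bar>n\<bar> * (a n + b n) - 2 * b n\<close> its inward derivative; the formulas make
  these equal to \<open>f (harm n)\<close> and \<open>h (harm n)\<close>.\<close>

lemma potentials_eq_biharm_series:
  assumes f: "circle_distribution f" and h: "circle_distribution h"
  obtains a b where "poly_growth a" "poly_growth b"
    "\<And>n. a n = f (harm n) * (1 + of_int \<bar>n\<bar> / 2) + h (harm n) / 2"
    "\<And>n. b n = - (f (harm n) * of_int \<bar>n\<bar> / 2 + h (harm n) / 2)"
    "\<And>z. cmod z < 1 \<Longrightarrow> F0_pot f z + H0_pot h z = biharm_series a b z"
proof -
  define a where "a n = f (harm n) * (1 + of_int \<bar>n\<bar> / 2) + h (harm n) / 2" for n
  define b where "b n = - (f (harm n) * of_int \<bar>n\<bar> / 2 + h (harm n) / 2)" for n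
  have pf: "poly_growth (\<lambda>n. f (harm n))" and ph: "poly_growth (\<lambda>n. h (harm n))"
    using poly_growth_circle_distribution f h by auto
  have "poly_growth (\<lambda>n. f (harm n) * (1 + of_int \<bar>n\<bar> * (1/2)) + h (harm n) * (1/2))"
    by (intro poly_growth_add poly_growth_mult poly_growth_const poly_growth_abs pf ph)
  then have a: "poly_growth a" by (simp add: a_def[abs_def])
  have "poly_growth (\<lambda>n. f (harm n) * (of_int \<bar>n\<bar> * (-1/2)) + h (harm n) * (-1/2))"
    by (intro poly_growth_add poly_growth_mult poly_growth_const poly_growth_abs pf ph)
  then have b: "poly_growth b" by (simp add: b_def[abs_def])
  have "F0_pot f z + H0_pot h z = biharm_series a b z" if z: "cmod z < 1" for z
  proof -
    have "(1 + of_int \<bar>n\<bar> * of_real (1 - (cmod z)\<^sup>2) / 2) * harm n (cnj z) * f (harm n) +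
        of_real (1 - (cmod z)\<^sup>2) / 2 * harm n (cnj z) * h (harm n) =
        (a n + b n * of_real ((cmod z)\<^sup>2)) * harm n (cnj z)" for n
      by (simp add: a_def b_def field_simps)
    then show ?thesis
      using sums_add[OF poisson_type_potentials_sums[OF f h z]] by (simp add: biharm_series_def sums_iff)
  qed
  then show ?thesis using that a b a_def b_def by blast
qed

section \<open>Boundary data of the series, term by term\<close>

lemma circle_dist_of_fun_cong:
  assumes "\<And>t. F (cis t) = G (cis t)"
  shows "circle_dist_of_fun F \<phi> = circle_dist_of_fun G \<phi>"
  by (simp add: circle_dist_of_fun_def assms)

lemma eventually_at_left_1: "\<forall>\<^sub>F r in at_left (1::real). 0 < r \<and> r < 1"
  using eventually_at_left_real[of 0 1] by (simp add: eventually_mono)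

lemma tannery_at_left:
  fixes e :: "nat \<Rightarrow> real \<Rightarrow> complex"
  assumes lim: "\<And>k. (e k \<longlongrightarrow> l k) (at_left 1)"
    and bound: "\<And>k r. 0 < r \<Longrightarrow> r < 1 \<Longrightarrow> norm (e k r) \<le> M k" and M: "summable M"
    and s: "\<And>r. 0 < r \<Longrightarrow> r < 1 \<Longrightarrow> (\<lambda>k. e k r) sums S r" and L: "l sums L"
  shows "(S \<longlongrightarrow> L) (at_left 1)"
proof -
  have ev: "eventually (\<lambda>x. (case x of (k, r) \<Rightarrow> norm (e k r) \<le> M k)) (at_top \<times>\<^sub>F at_left 1)"
    by (rule eventually_mono[OF eventually_prodI[OF always_eventually eventually_at_left_1], of "\<lambda>_. True"])
      (use bound in auto)
  have "((\<lambda>r. suminf (\<lambda>k. e k r)) \<longlongrightarrow> suminf l) (at_left 1)"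
    using tannerys_theorem[OF lim ev M] by (simp add: trivial_limit_at_left_real)
  moreover have "\<forall>\<^sub>F r in at_left 1. suminf (\<lambda>k. e k r) = S r"
    using eventually_at_left_1 by eventually_elim (use s sums_unique in metis)
  ultimately have "(S \<longlongrightarrow> suminf l) (at_left 1)" by (rule Lim_transform_eventually)
  then show ?thesis using L sums_unique by metis
qed

text \<open>For a fixed test function both pairings are series over the modes with a majorant
  independent of r: the polynomial growth of the data is absorbed by the rapid decrease of the
  coefficients c. Hence the limits may be taken term by term.\<close>

lemma homogeneous_boundary_values:
  assumes f: "circle_distribution f" and h: "circle_distribution h"
  defines "u \<equiv> \<lambda>z. F0_pot f z + H0_pot h z"
  shows "boundary_value u f" "boundary_normal_deriv u f h"
proof -
  obtain a b where ab: "poly_growth a" "poly_growth b"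
    "\<And>n. a n = f (harm n) * (1 + of_int \<bar>n\<bar> / 2) + h (harm n) / 2"
    "\<And>n. b n = - (f (harm n) * of_int \<bar>n\<bar> / 2 + h (harm n) / 2)"
    "\<And>z. cmod z < 1 \<Longrightarrow> F0_pot f z + H0_pot h z = biharm_series a b z"
    using potentials_eq_biharm_series[OF f h] by metis
  have main: "((\<lambda>r. circle_dist_of_fun (dilate u r) \<phi>) \<longlongrightarrow> f \<phi>) (at_left 1) \<and>
    ((\<lambda>r. (circle_dist_of_fun (dilate u r) \<phi> - f \<phi>) / of_real (1 - r)) \<longlongrightarrow> h \<phi>) (at_left 1)" if \<phi>: "circle_test \<phi>" for \<phi>
  proof -
    define c where "c = fourier_coeff (\<lambda>t. \<phi> (cis t))"
    have rc: "rapidly_decreasing c" unfolding c_def by (rule circle_test_fourier(1)[OF \<phi>])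
    have cp: "continuous_on UNIV (\<lambda>t. \<phi> (cis t))" using \<phi> smooth_on_continuous unfolding circle_test_def by blast
    define A where "A k = c (int_decode k) * f (harm (int_decode k))" for k
    define B where "B k = c (int_decode k) * h (harm (int_decode k))" for k
    define m where "m k = nat \<bar>int_decode k\<bar>" for k
    have mi: "complex_of_int \<bar>int_decode k\<bar> = of_nat (m k)" for k by (simp add: m_def)
    have A: "A sums f \<phi>" and B: "B sums h \<phi>"
      unfolding A_def B_def c_def using circle_distribution_circle_test_sums f h \<phi> by blast+
    \<comment> \<open>The weight \<open>1 + m k\<close> pays for the radial factors of the f-part,
      whose bounds grow linearly in the degree \<open>m k\<close>.\<close>
    have sAB: "summable (\<lambda>k. norm (A k) * (1 + real (m k)))" "summable (\<lambda>k. norm (B k))"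
    proof -
      have "rapidly_decreasing (\<lambda>n. f (harm n) * c n)" "rapidly_decreasing (\<lambda>n. h (harm n) * c n)"
        by (intro poly_growth_rapidly_decreasing poly_growth_circle_distribution f h rc)+
      note * = this[unfolded rapidly_decreasing_def, rule_format]
      have "1 + \<bar>real_of_int (int_decode k)\<bar> = 1 + real (m k)" for k by (simp add: m_def)
      then show "summable (\<lambda>k. norm (A k) * (1 + real (m k)))" "summable (\<lambda>k. norm (B k))"
        using *(1)[of 1] *(2)[of 0] by (simp_all add: A_def B_def mult.commute)
    qed
    define S where "S r = circle_dist_of_fun (dilate u r) \<phi>" for r
    \<comment> \<open>\<open>?P\<close> and \<open>?Q\<close> are the radial factors of the f-part
      and the h-part of the k-th mode.\<close>
    let ?P = "\<lambda>k r::real. of_real r ^ m k * (1 + of_nat (m k) / 2 * of_real (1 - r\<^sup>2)) :: complex"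
    let ?Q = "\<lambda>k r::real. of_real r ^ m k * of_real (1 - r\<^sup>2) / 2 :: complex"
    have S: "(\<lambda>k. A k * ?P k r + B k * ?Q k r) sums S r" if r: "0 < r" "r < 1" for r
    proof -
      have "S r = circle_dist_of_fun (dilate (biharm_series a b) r) \<phi>"
        unfolding S_def by (rule circle_dist_of_fun_cong) (use r in \<open>simp add: dilate_def u_def ab(5) norm_mult\<close>)
      moreover have "(a (int_decode k) + b (int_decode k) * of_real (r\<^sup>2)) * of_real r ^ m k * c (int_decode k) = A k * ?P k r + B k * ?Q k r" for k
        by (simp add: ab(3,4) A_def B_def mi field_simps)
      ultimately show ?thesis
        using biharm_series_boundary_pairing[OF ab(1,2) r cp] by (simp only: c_def m_def)
    qed
    have pw: "norm (of_real r ^ j :: complex) \<le> 1" if "0 < r" "r < 1" for r :: real and j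
      using that by (simp add: norm_power power_le_one)
    have r2: "norm (of_real (1 - r\<^sup>2) :: complex) \<le> 1" if "0 < r" "r < 1" for r :: real
      using that by (simp only: norm_of_real) (simp add: abs_le_iff power_le_one)
    have lim1: "((\<lambda>r. of_real r ^ j :: complex) \<longlongrightarrow> 1) (at_left 1)" for j
      by (rule tendsto_eq_intros refl | simp)+
    have "(S \<longlongrightarrow> f \<phi>) (at_left 1)"
    proof (rule tannery_at_left[OF _ _ _ S A])
      show "((\<lambda>r. A k * ?P k r + B k * ?Q k r) \<longlongrightarrow> A k) (at_left 1)" for k
        by (rule tendsto_eq_intros lim1 refl | simp)+
      show "norm (A k * ?P k r + B k * ?Q k r) \<le> norm (A k) * (1 + real (m k)) + norm (B k)" if r: "0 < r" "r < 1" for k r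
      proof -
        have "norm (of_nat (m k) / 2 * of_real (1 - r\<^sup>2) :: complex) \<le> real (m k) / 2 * 1"
          unfolding norm_mult by (intro mult_mono r2 r) auto
        from order_trans[OF norm_triangle_ineq add_mono[OF order_refl this]]
        have "norm (1 + of_nat (m k) / 2 * of_real (1 - r\<^sup>2) :: complex) \<le> 1 + real (m k)"
          by (rule order_trans) simp
        then have "norm (?P k r) \<le> 1 * (1 + real (m k))"
          using pw[OF r, of "m k"] unfolding norm_mult by (intro mult_mono) auto
        moreover have "norm (?Q k r) \<le> 1 * 1"
          unfolding norm_mult norm_divide using pw[OF r, of "m k"] r2[OF r] mult_mono[OF pw[OF r, of "m k"] r2[OF r]]
          by (simp add: norm_mult del: of_real_diff)
        ultimately have "norm (A k) * norm (?P k r) + norm (B k) * norm (?Q k r) \<le> norm (A k) * (1 * (1 + real (m k))) + norm (B k) * (1 * 1)"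
          by (intro add_mono mult_left_mono) auto
        then show ?thesis
          by (intro order_trans[OF norm_triangle_ineq]) (simp only: norm_mult mult_1_left mult_1_right)
      qed
      show "summable (\<lambda>k. norm (A k) * (1 + real (m k)) + norm (B k))" by (intro summable_add sAB)
    qed
    moreover have "((\<lambda>r. (S r - f \<phi>) / of_real (1 - r)) \<longlongrightarrow> h \<phi>) (at_left 1)"
    proof -
      \<comment> \<open>The exact quotients of \<open>?P - 1\<close> and \<open>?Q\<close> by 1 - r.
        At r = 1 they take the values - m k + m k = 0 and 1, so the f-part leaves no normal
        derivative.\<close>
      let ?P' = "\<lambda>k r::real. - (\<Sum>i<m k. of_real r ^ i) + of_real r ^ m k * (of_nat (m k) / 2 * (1 + of_real r)) :: complex"
      let ?Q' = "\<lambda>k r::real. of_real r ^ m k * (1 + of_real r) / 2 :: complex"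
      show ?thesis
      proof (rule tannery_at_left[OF _ _ _ _ B])
        show "((\<lambda>r. A k * ?P' k r + B k * ?Q' k r) \<longlongrightarrow> B k) (at_left 1)" for k
        proof -
          have "((\<lambda>r. A k * ?P' k r + B k * ?Q' k r) \<longlongrightarrow> A k * (- (\<Sum>i<m k. 1) + 1 * (of_nat (m k) / 2 * (1 + of_real 1))) + B k * (1 * (1 + of_real 1) / 2)) (at_left 1)"
            by (intro tendsto_intros lim1) auto
          then show ?thesis by simp
        qed
        show "norm (A k * ?P' k r + B k * ?Q' k r) \<le> 2 * (norm (A k) * (1 + real (m k))) + norm (B k)" if r: "0 < r" "r < 1" for k r
        proof -
          have r1: "norm (1 + of_real r :: complex) \<le> 2" using norm_triangle_ineq[of 1 "of_real r :: complex"] r by simp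
          have "norm (\<Sum>i<m k. of_real r ^ i :: complex) \<le> (\<Sum>i<m k. 1)" by (intro sum_norm_le pw r)
          moreover have "norm (of_real r ^ m k * (of_nat (m k) / 2 * (1 + of_real r)) :: complex) \<le> 1 * (real (m k) / 2 * 2)"
            unfolding norm_mult by (intro mult_mono pw r r1) auto
          ultimately have "norm (?P' k r) \<le> real (m k) + real (m k)"
            by (intro order_trans[OF norm_triangle_ineq] add_mono) auto
          then have "norm (A k) * norm (?P' k r) \<le> norm (A k) * (2 * (1 + real (m k)))" by (intro mult_left_mono) auto
          then have "norm (A k) * norm (?P' k r) \<le> 2 * (norm (A k) * (1 + real (m k)))" by (simp only: mult.left_commute)
          moreover have "norm (of_real r ^ m k * (1 + of_real r) :: complex) \<le> 1 * 2"
            unfolding norm_mult by (intro mult_mono pw r r1) auto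
          then have "norm (?Q' k r) \<le> 1" by (simp add: norm_divide)
          then have "norm (B k) * norm (?Q' k r) \<le> norm (B k) * 1" by (intro mult_left_mono) auto
          ultimately show ?thesis
            by (intro order_trans[OF norm_triangle_ineq]) (unfold norm_mult[of "A k"] norm_mult[of "B k"], linarith)
        qed
        show "summable (\<lambda>k. 2 * (norm (A k) * (1 + real (m k))) + norm (B k))" by (intro summable_add summable_mult sAB)
        show "(\<lambda>k. A k * ?P' k r + B k * ?Q' k r) sums ((S r - f \<phi>) / of_real (1 - r))" if r: "0 < r" "r < 1" for r
        proof -
          have nz: "complex_of_real (1 - r) \<noteq> 0" using r by (simp del: of_real_diff)
          have sq: "complex_of_real (1 - r\<^sup>2) = of_real (1 - r) * (1 + of_real r)" by (simp add: power2_eq_square algebra_simps)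
          have P: "?P k r - 1 = of_real (1 - r) * ?P' k r" for k
            unfolding sq using one_diff_power_eq[of "complex_of_real r" "m k"] by (simp add: algebra_simps)
          have Q: "?Q k r = of_real (1 - r) * ?Q' k r" for k unfolding sq by simp
          have "(A k * ?P k r + B k * ?Q k r - A k) / of_real (1 - r) = A k * ?P' k r + B k * ?Q' k r" for k
          proof -
            have "A k * ?P k r + B k * ?Q k r - A k = A k * (?P k r - 1) + B k * ?Q k r" by (simp add: algebra_simps)
            also have "\<dots> = of_real (1 - r) * (A k * ?P' k r + B k * ?Q' k r)" unfolding P Q by (simp only: distrib_left mult_ac)
            finally show ?thesis using nz by simp
          qed
          then show ?thesis using sums_divide[OF sums_diff[OF S[OF r] A], of "of_real (1 - r)"] by (simp only:)
        qed
      qed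
    qed
    ultimately show ?thesis unfolding S_def[abs_def] by (rule conjI)
  qed
  show "boundary_value u f" "boundary_normal_deriv u f h"
    unfolding boundary_value_def boundary_normal_deriv_def circle_dist_tendsto_def using main by blast+
qed

lemma solves_homogeneous:
  assumes f: "circle_distribution f" and h: "circle_distribution h"
  shows "solves_biharmonic_dirichlet (\<lambda>_. 0) f h (\<lambda>z. F0_pot f z + H0_pot h z)"
proof -
  obtain a b where ab: "poly_growth a" "poly_growth b"
    "\<And>z. cmod z < 1 \<Longrightarrow> F0_pot f z + H0_pot h z = biharm_series a b z"
    using potentials_eq_biharm_series[OF f h] by metis
  have w: "weakly_biharmonic (biharm_series a b)" by (rule weakly_biharmonic_biharm_series[OF ab(1,2)])
  have "weakly_biharmonic (\<lambda>z. F0_pot f z + H0_pot h z)"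
    unfolding weakly_biharmonic_def
  proof (intro conjI allI impI)
    show "continuous_on (ball 0 1) (\<lambda>z. F0_pot f z + H0_pot h z)"
      by (rule continuous_on_eq[of _ "biharm_series a b"]) (use w ab(3) in \<open>auto simp: weakly_biharmonic_def\<close>)
    fix \<psi> assume "disk_test \<psi>"
    moreover have "(LINT z:ball 0 1|lborel. (F0_pot f z + H0_pot h z) * laplacian (laplacian \<psi>) z) =
       (LINT z:ball 0 1|lborel. biharm_series a b z * laplacian (laplacian \<psi>) z)"
      by (rule set_lebesgue_integral_cong) (use ab(3) in auto)
    ultimately show "(LINT z:ball 0 1|lborel. (F0_pot f z + H0_pot h z) * laplacian (laplacian \<psi>) z) = 0"
      using w by (simp add: weakly_biharmonic_def)
  qed
  then show ?thesis
    unfolding solves_biharmonic_dirichlet_def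
    using weakly_biharmonic_iff homogeneous_boundary_values[OF f h] by (auto simp: weakly_biharmonic_def)
qed

section \<open>Lebesgue measure on the complex plane\<close>

text \<open>A disk of squared radius a has area pi a, which is linear in a: with |z|^2 instead of
  |z| as radial variable the density is constant. Half-lines determine both measures.\<close>

lemma distr_cmod_sq_lborel:
  "distr lborel borel (\<lambda>z::complex. (cmod z)\<^sup>2) = density lborel (\<lambda>\<rho>. ennreal (pi * indicator {0..} \<rho>))"
  (is "?M = ?N")
proof (rule measure_eqI_generator_eq[where E = "range atMost" and A = "\<lambda>i::nat. {..real i}" and \<Omega> = UNIV])
  have [measurable]: "(\<lambda>z::complex. (cmod z)\<^sup>2) \<in> borel_measurable borel" by measurable
  have M: "emeasure ?M {..a} = (if a \<ge> 0 then ennreal (pi * a) else 0)" for a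
  proof -
    have "emeasure ?M {..a} = emeasure lborel {z::complex. (cmod z)\<^sup>2 \<le> a}"
      by (subst emeasure_distr) (auto simp: vimage_def)
    also have "\<dots> = (if a \<ge> 0 then ennreal (pi * a) else 0)"
    proof (cases "a \<ge> 0")
      case True
      have "{z::complex. (cmod z)\<^sup>2 \<le> a} = cball 0 (sqrt a)" using True real_le_rsqrt by (auto simp: real_le_rsqrt sqrt_ge_absD)
      then show ?thesis using True by (simp add: emeasure_cball unit_ball_vol_2)
    next
      case False
      then have "(cmod z)\<^sup>2 \<le> a \<longleftrightarrow> False" for z by (meson order_trans zero_le_power2)
      then show ?thesis using False by simp
    qed
    finally show ?thesis .
  qed
  have N: "emeasure ?N {..a} = (if a \<ge> 0 then ennreal (pi * a) else 0)" for a
  proof -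
    have "emeasure ?N {..a} = (\<integral>\<^sup>+\<rho>. ennreal (pi * indicator {0..} \<rho>) * indicator {..a} \<rho> \<partial>lborel)"
      by (subst emeasure_density) auto
    also have "\<dots> = (\<integral>\<^sup>+\<rho>. ennreal pi * indicator {0..a} \<rho> \<partial>lborel)"
      by (intro nn_integral_cong) (auto simp: indicator_def)
    also have "\<dots> = ennreal pi * emeasure lborel {0..a}" by (simp add: nn_integral_cmult)
    finally show ?thesis by (auto simp: ennreal_mult)
  qed
  show "emeasure ?M X = emeasure ?N X" if "X \<in> range atMost" for X using that M N by auto
  show "emeasure ?M {..real i} \<noteq> \<infinity>" for i by (simp add: M)
  show "(\<Union>i. {..real i}) = UNIV" by (auto intro: real_arch_simple)
  show "sets ?M = sigma_sets UNIV (range atMost)" "sets ?N = sigma_sets UNIV (range atMost)"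
    by (simp_all add: borel_eq_atMost)
qed (auto simp: Int_stable_def)

text \<open>Gives iterated integrals over the two coordinates, for use with the shears below; boxes
  determine the measure.\<close>

lemma lborel_complex_eq: "(lborel :: complex measure) = distr (lborel \<Otimes>\<^sub>M lborel) borel (\<lambda>(x, y). Complex x y)"
proof (rule lborel_eqI)
  have m[measurable]: "(\<lambda>(x, y). Complex x y) \<in> borel_measurable (lborel \<Otimes>\<^sub>M lborel)"
    unfolding borel_measurable_complex_iff by (simp add: case_prod_beta')
  fix l u :: complex assume le: "\<And>b. b \<in> Basis \<Longrightarrow> l \<bullet> b \<le> u \<bullet> b"
  have le': "Re l \<le> Re u" "Im l \<le> Im u" using le[of 1] le[of \<i>] by (auto simp: Basis_complex_def)
  have v: "(\<lambda>(x, y). Complex x y) -` box l u = {Re l<..<Re u} \<times> {Im l<..<Im u}"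
    by (auto simp: in_box_complex_iff)
  have "emeasure (distr (lborel \<Otimes>\<^sub>M lborel) borel (\<lambda>(x, y). Complex x y)) (box l u) =
      emeasure (lborel \<Otimes>\<^sub>M lborel) ({Re l<..<Re u} \<times> {Im l<..<Im u})"
    by (subst emeasure_distr) (auto simp: v space_pair_measure)
  also have "\<dots> = ennreal (Re u - Re l) * ennreal (Im u - Im l)"
    using le' by (simp add: lborel.emeasure_pair_measure_Times)
  also have "\<dots> = ennreal (\<Prod>b\<in>Basis. (u - l) \<bullet> b)"
    using le' by (simp add: Basis_complex_def ennreal_mult)
  finally show "emeasure (distr (lborel \<Otimes>\<^sub>M lborel) borel (\<lambda>(x, y). Complex x y)) (box l u) = ennreal (\<Prod>b\<in>Basis. (u - l) \<bullet> b)" .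
qed simp

lemma nn_integral_complex:
  assumes [measurable]: "f \<in> borel_measurable borel"
  shows "(\<integral>\<^sup>+z. f z \<partial>lborel) = (\<integral>\<^sup>+x. (\<integral>\<^sup>+y. f (Complex x y) \<partial>lborel) \<partial>lborel)"
    and "(\<integral>\<^sup>+z. f z \<partial>lborel) = (\<integral>\<^sup>+y. (\<integral>\<^sup>+x. f (Complex x y) \<partial>lborel) \<partial>lborel)"
proof -
  have m[measurable]: "(\<lambda>p. Complex (fst p) (snd p)) \<in> borel_measurable (lborel \<Otimes>\<^sub>M lborel)"
    unfolding borel_measurable_complex_iff by simp
  have "(\<integral>\<^sup>+z. f z \<partial>lborel) = (\<integral>\<^sup>+p. f (Complex (fst p) (snd p)) \<partial>(lborel \<Otimes>\<^sub>M lborel))"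
    by (subst lborel_complex_eq) (simp add: nn_integral_distr case_prod_beta')
  then show "(\<integral>\<^sup>+z. f z \<partial>lborel) = (\<integral>\<^sup>+x. (\<integral>\<^sup>+y. f (Complex x y) \<partial>lborel) \<partial>lborel)"
    "(\<integral>\<^sup>+z. f z \<partial>lborel) = (\<integral>\<^sup>+y. (\<integral>\<^sup>+x. f (Complex x y) \<partial>lborel) \<partial>lborel)"
    using lborel.nn_integral_fst[of "\<lambda>p. f (Complex (fst p) (snd p))" lborel]
      lborel_pair.nn_integral_snd[of "\<lambda>p. f (Complex (fst p) (snd p))"] by simp_all
qed

text \<open>On each line parallel to the sheared direction T is a translation, which leaves the
  inner integral unchanged.\<close>

lemma lborel_shear:
  fixes T :: "complex \<Rightarrow> complex"
  assumes "T = (\<lambda>z. z + of_real (a * Im z)) \<or> T = (\<lambda>z. z + \<i> * of_real (a * Re z))"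
  shows "distr lborel borel T = lborel"
proof (rule measure_eqI)
  have T[measurable]: "T \<in> borel_measurable borel"
    using assms by (elim disjE) (auto intro!: borel_measurable_continuous_onI continuous_intros)
  fix A assume "A \<in> sets (distr lborel borel T)"
  then have [measurable]: "A \<in> sets borel" by simp
  have c[measurable]: "(\<lambda>x. Complex x y) \<in> borel_measurable borel" "(\<lambda>x. Complex y x) \<in> borel_measurable borel" for y
    unfolding borel_measurable_complex_iff by simp_all
  have mA: "(\<lambda>z. indicator A z :: ennreal) \<in> borel_measurable borel"
    and mAT: "(\<lambda>z. indicator A (T z) :: ennreal) \<in> borel_measurable borel" by measurable
  have "(\<integral>\<^sup>+z. indicator A (T z) \<partial>lborel) = (\<integral>\<^sup>+z. indicator A z \<partial>lborel)"
    using assms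
  proof
    assume T: "T = (\<lambda>z. z + of_real (a * Im z))"
    have "(\<integral>\<^sup>+x. indicator A (T (Complex x y)) \<partial>lborel) = (\<integral>\<^sup>+x. indicator A (Complex x y) \<partial>lborel :: ennreal)" for y
    proof -
      have "T (Complex x y) = Complex (a * y + 1 * x) y" for x by (simp add: T complex_eq_iff)
      then show ?thesis
        using nn_integral_real_affine[of "\<lambda>x. indicator A (Complex x y)" 1 "a * y"] by simp
    qed
    then show ?thesis by (simp only: nn_integral_complex(2)[OF mA] nn_integral_complex(2)[OF mAT])
  next
    assume T: "T = (\<lambda>z. z + \<i> * of_real (a * Re z))"
    have "(\<integral>\<^sup>+y. indicator A (T (Complex x y)) \<partial>lborel) = (\<integral>\<^sup>+y. indicator A (Complex x y) \<partial>lborel :: ennreal)" for x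
    proof -
      have "T (Complex x y) = Complex x (a * x + 1 * y)" for y by (simp add: T complex_eq_iff)
      then show ?thesis
        using nn_integral_real_affine[of "\<lambda>y. indicator A (Complex x y)" 1 "a * x"] by simp
    qed
    then show ?thesis by (simp only: nn_integral_complex(1)[OF mA] nn_integral_complex(1)[OF mAT])
  qed
  moreover have "emeasure (distr lborel borel T) A = (\<integral>\<^sup>+z. indicator A (T z) \<partial>lborel)"
    by (simp add: nn_integral_distr[of T lborel borel "indicator A", symmetric] flip: nn_integral_indicator)
  ultimately show "emeasure (distr lborel borel T) A = emeasure lborel A" by simp
qed simp

text \<open>A rotation that is not a multiple of the identity is a product of three shears.\<close>

lemma lborel_rotation:
  assumes "cmod c = 1"
  shows "distr lborel borel (\<lambda>z. c * z) = lborel"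
proof -
  have comp: "distr lborel borel (\<lambda>z. S (T z)) = lborel"
    if "distr lborel borel S = lborel" "distr lborel borel T = lborel" "S \<in> borel_measurable borel" "T \<in> borel_measurable borel"
    for S T :: "complex \<Rightarrow> complex"
  proof -
    have "distr (distr lborel borel T) borel S = distr lborel borel (S \<circ> T)"
      using that by (intro distr_distr) auto
    then show ?thesis using that by (simp add: o_def)
  qed
  have *: "distr lborel borel (\<lambda>z. c * z) = lborel" if c: "cmod c = 1" "Im c \<noteq> 0" for c
  proof -
    define p q where "p = Re c" and "q = Im c"
    have pq: "p\<^sup>2 + q\<^sup>2 = 1" "q \<noteq> 0" using c by (auto simp: p_def q_def cmod_def)
    \<comment> \<open>Chosen so that \<open>1 + a * q = p\<close>; because
      \<open>p\<^sup>2 + q\<^sup>2 = 1\<close>, the remaining matrix entry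
      \<open>2 * a + a * a * q\<close> becomes - q.\<close>
    define a where "a = (p - 1) / q"
    define S where "S = (\<lambda>z. z + of_real (a * Im z))"
    define T where "T = (\<lambda>z. z + \<i> * of_real (q * Re z))"
    have m: "S \<in> borel_measurable borel" "T \<in> borel_measurable borel"
      unfolding S_def T_def by (auto intro!: borel_measurable_continuous_onI continuous_intros)
    have ST: "distr lborel borel S = lborel" "distr lborel borel T = lborel"
      by (rule lborel_shear[of S a], simp add: S_def) (rule lborel_shear[of T q], simp add: T_def)
    have "distr lborel borel (\<lambda>z. S (T z)) = lborel" by (rule comp[OF ST m])
    moreover have "(\<lambda>z. S (T z)) \<in> borel_measurable borel" using m by measurable
    ultimately have "distr lborel borel (\<lambda>z. S (T (S z))) = lborel" using comp[of "\<lambda>z. S (T z)" S] ST m by simp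
    moreover have "S (T (S z)) = c * z" for z
    proof (rule complex_eqI)
      have aq: "a * q = p - 1" using pq by (simp add: a_def)
      have "q * (2 * a + a * a * q) = q * (- q)"
      proof -
        have "q * (2 * a + a * a * q) = 2 * (a * q) + (a * q) * (a * q)" by (simp add: algebra_simps)
        also have "\<dots> = p\<^sup>2 - 1" unfolding aq by (simp add: power2_eq_square algebra_simps)
        also have "\<dots> = q * (- q)" using pq by (simp add: power2_eq_square)
        finally show ?thesis .
      qed
      then have a2: "2 * a + a * a * q = - q" by (rule mult_left_cancel[THEN iffD1, OF pq(2)])
      have "Re (S (T (S z))) = (1 + a * q) * Re z + (2 * a + a * a * q) * Im z"
        by (simp add: S_def T_def algebra_simps)
      then show "Re (S (T (S z))) = Re (c * z)" unfolding a2 aq by (simp add: p_def q_def)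
      have "Im (S (T (S z))) = (1 + a * q) * Im z + q * Re z"
        by (simp add: S_def T_def algebra_simps)
      then show "Im (S (T (S z))) = Im (c * z)" unfolding aq by (simp add: p_def q_def)
    qed
    ultimately show ?thesis by simp
  qed
  have mult: "(\<lambda>z. d * z) \<in> borel_measurable borel" for d :: complex by measurable
  show ?thesis
  proof (cases "Im c = 0")
    case False
    then show ?thesis using * assms by blast
  next
    \<comment> \<open>Here c is 1 or -1; it is written as the product of \<open>\<i>\<close> and
      \<open>- \<i> * c\<close>, two rotations with nonzero imaginary part.\<close>
    case True
    have i: "distr lborel borel (\<lambda>z. \<i> * z) = lborel" by (rule *) auto
    have ci: "Im (- \<i> * c) \<noteq> 0"
      using True assms by (auto simp: cmod_def)
    have "distr lborel borel (\<lambda>z. (- \<i> * c) * z) = lborel"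
      by (rule *) (use assms ci in \<open>auto simp: norm_mult\<close>)
    from comp[OF i this mult mult] show ?thesis by (simp flip: mult.assoc)
  qed
qed

section \<open>Polar coordinates\<close>

lemma lborel_integral_rotation:
  fixes F :: "complex \<Rightarrow> complex"
  assumes "cmod c = 1" "F \<in> borel_measurable borel"
  shows "(\<integral>z. F (c * z) \<partial>lborel) = (\<integral>z. F z \<partial>lborel)"
proof -
  have "(\<integral>z. F z \<partial>lborel) = (\<integral>z. F z \<partial>distr lborel borel (\<lambda>z. c * z))" using lborel_rotation[OF assms(1)] by simp
  also have "\<dots> = (\<integral>z. F (c * z) \<partial>lborel)" using assms(2) by (subst integral_distr) auto
  finally show ?thesis ..
qed

lemma lborel_integral_radial:
  fixes R :: "real \<Rightarrow> complex"
  assumes [measurable]: "R \<in> borel_measurable borel"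
  shows "(\<integral>z. R ((cmod z)\<^sup>2) \<partial>lborel) = of_real pi * (\<integral>\<rho>. indicator {0..} \<rho> *\<^sub>R R \<rho> \<partial>lborel)"
proof -
  have "(\<integral>z. R ((cmod z)\<^sup>2) \<partial>lborel) = (\<integral>\<rho>. R \<rho> \<partial>distr lborel borel (\<lambda>z::complex. (cmod z)\<^sup>2))"
    by (subst integral_distr) auto
  also have "\<dots> = (\<integral>\<rho>. (pi * indicator {0..} \<rho>) *\<^sub>R R \<rho> \<partial>lborel)"
    unfolding distr_cmod_sq_lborel by (subst integral_density) (auto simp: indicator_def)
  also have "\<dots> = (\<integral>\<rho>. of_real pi * (indicator {0..} \<rho> *\<^sub>R R \<rho>) \<partial>lborel)"
    by (intro Bochner_Integration.integral_cong) (auto simp: scaleR_conv_of_real indicator_def)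
  finally show ?thesis by (simp only: integral_mult_right_zero)
qed

lemma integral_periodic_shift:
  fixes p :: "real \<Rightarrow> complex"
  assumes c: "continuous_on UNIV p" and per: "\<And>t. p (t + 2 * pi) = p t" and a: "0 \<le> a" "a \<le> 2 * pi"
  shows "integral {0..2*pi} (\<lambda>t. p (t + a)) = integral {0..2*pi} p"
proof -
  have i: "p integrable_on {u..v}" for u v
    by (intro integrable_continuous_real continuous_on_subset[OF c]) auto
  have sh: "integral {u..v} (\<lambda>t. p (t + b)) = integral {u+b..v+b} p" for u v b
    using integral_shift_real_ivl[of "u + b" b "v + b" p] by simp
  have "integral {0..2*pi} (\<lambda>t. p (t + a)) = integral {a..2*pi + a} p" using sh[of 0 "2*pi" a] by simp
  also have "\<dots> = integral {a..2*pi} p + integral {2*pi..2*pi+a} p"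
    using a i by (intro Henstock_Kurzweil_Integration.integral_combine[symmetric]) auto
  also have "integral {2*pi..2*pi+a} p = integral {0..a} p"
    using sh[of 0 a "2 * pi"] per by (simp add: add.commute)
  also have "integral {a..2*pi} p + integral {0..a} p = integral {0..2*pi} p"
    using a i Henstock_Kurzweil_Integration.integral_combine[of 0 a "2*pi" p] by (simp add: add.commute)
  finally show ?thesis .
qed

text \<open>Averaging over all rotations does not change the integral. After Fubini the integrand is
  a circular mean, hence a function of |z|^2, and the image measure of |z|^2 finishes the
  reduction.\<close>

lemma polar_integral:
  fixes F :: "complex \<Rightarrow> complex"
  assumes F: "continuous_on UNIV F" and K: "compact K" "\<And>z. z \<notin> K \<Longrightarrow> F z = 0"
  shows "(\<integral>z. F z \<partial>lborel) =
    of_real pi * (\<integral>\<rho>. indicator {0..} \<rho> *\<^sub>R (1 / (2 * of_real pi) * integral {0..2*pi} (\<lambda>t. F (of_real (sqrt \<rho>) * cis t))) \<partial>lborel)"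
proof -
  have Fm[measurable]: "F \<in> borel_measurable borel" by (rule borel_measurable_continuous_onI[OF F])
  have cF: "continuous_on S (\<lambda>t. F (w * cis t))" for w S
    by (rule continuous_on_compose2[OF F]) (auto intro!: continuous_intros)
  obtain M where M: "M > 0" "\<And>z. norm (F z) \<le> M" using compact_support_bounded[OF F K] by blast
  obtain B where B: "\<And>z. z \<in> K \<Longrightarrow> norm z \<le> B" using compact_imp_bounded[OF K(1)] unfolding bounded_iff by blast
  let ?I = "{0..2*pi}"
  define h where "h t z = indicator ?I t *\<^sub>R F (cis t * z)" for t z
  have jc: "continuous_on UNIV (\<lambda>p::real \<times> complex. F (cis (fst p) * snd p))"
    by (rule continuous_on_compose2[OF F]) (auto intro!: continuous_intros)
  have jm[measurable]: "(\<lambda>p::real \<times> complex. F (cis (fst p) * snd p)) \<in> borel_measurable (lborel \<Otimes>\<^sub>M lborel)"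
    unfolding lborel_prod using borel_measurable_continuous_onI[OF jc] by simp
  have int: "integrable (lborel \<Otimes>\<^sub>M lborel) (case_prod h)"
  proof (rule integrableI_bounded_set[where A = "?I \<times> cball 0 B" and B = M])
    show "emeasure (lborel \<Otimes>\<^sub>M lborel) (?I \<times> cball (0::complex) B) < \<infinity>"
    proof -
      have "emeasure lborel (cball (0::complex) B) < \<infinity>" by (rule emeasure_bounded_finite) simp
      moreover have "emeasure lborel ?I < \<infinity>" by (rule emeasure_bounded_finite) simp
      ultimately show ?thesis
        by (subst lborel.emeasure_pair_measure_Times) (simp_all only: sets_lborel borel_closed closed_cball closed_atLeastAtMost ennreal_mult_less_top infinity_ennreal_def, simp)
    qed
    show "case_prod h \<in> borel_measurable (lborel \<Otimes>\<^sub>M lborel)"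
      unfolding h_def case_prod_beta' by measurable
    show "AE x in lborel \<Otimes>\<^sub>M lborel. x \<in> ?I \<times> cball 0 B \<longrightarrow> norm (case_prod h x) \<le> M"
      using M by (intro AE_I2) (auto simp: h_def indicator_def)
    show "AE x in lborel \<Otimes>\<^sub>M lborel. x \<notin> ?I \<times> cball 0 B \<longrightarrow> case_prod h x = 0"
    proof (intro AE_I2 impI)
      fix x :: "real \<times> complex" assume "x \<notin> ?I \<times> cball 0 B"
      then have "fst x \<notin> ?I \<or> cis (fst x) * snd x \<notin> K" using B[of "cis (fst x) * snd x"] by (auto simp: norm_mult mem_Times_iff)
      then show "case_prod h x = 0" using K(2) by (auto simp: h_def indicator_def case_prod_beta')
    qed
  qed auto
  have "(\<integral>t. (\<integral>z. h t z \<partial>lborel) \<partial>lborel) = (\<integral>z. (\<integral>t. h t z \<partial>lborel) \<partial>lborel)"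
    using lborel_pair.Fubini_integral[OF int] by simp
  moreover have "(\<integral>z. h t z \<partial>lborel) = indicator ?I t *\<^sub>R (\<integral>z. F z \<partial>lborel)" for t
    unfolding h_def using lborel_integral_rotation[of "cis t" F] by simp
  moreover have "(\<integral>t. indicator ?I t *\<^sub>R (\<integral>z. F z \<partial>lborel) \<partial>lborel) = of_real (2 * pi) * (\<integral>z. F z \<partial>lborel)"
    by (subst Bochner_Integration.integral_scaleR_left) (auto simp: scaleR_conv_of_real)
  \<comment> \<open>The argument of z only shifts the angle, and an integral over a full period does
    not see the shift; so the angular integral depends on the modulus alone.\<close>
  moreover have inner: "(\<integral>t. h t z \<partial>lborel) = integral ?I (\<lambda>t. F (of_real (cmod z) * cis t))" for z
  proof -
    have "set_integrable lborel ?I (\<lambda>t. F (z * cis t))"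
      unfolding set_integrable_def by (intro borel_integrable_compact cF) auto
    then have "(\<integral>t. h t z \<partial>lborel) = integral ?I (\<lambda>t. F (z * cis t))"
      using set_borel_integral_eq_integral(2)[of ?I "\<lambda>t. F (z * cis t)"]
      by (simp add: h_def set_lebesgue_integral_def mult.commute)
    also have "\<dots> = integral ?I (\<lambda>t. F (of_real (cmod z) * cis t))"
    proof -
      have z: "z = of_real (cmod z) * cis (Arg2pi z)" using Arg2pi_eq[of z] by (simp add: cis_conv_exp)
      have "F (z * cis t) = F (of_real (cmod z) * cis (t + Arg2pi z))" for t
        by (subst z) (simp add: mult.assoc cis_mult add.commute)
      then have "integral ?I (\<lambda>t. F (z * cis t)) = integral ?I (\<lambda>t. (\<lambda>s. F (of_real (cmod z) * cis s)) (t + Arg2pi z))" by simp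
      also have "\<dots> = integral ?I (\<lambda>s. F (of_real (cmod z) * cis s))"
      proof (rule integral_periodic_shift[OF cF])
        show "F (of_real (cmod z) * cis (t + 2 * pi)) = F (of_real (cmod z) * cis t)" for t by (simp flip: cis_mult)
      qed (use Arg2pi_ge_0[of z] Arg2pi_lt_2pi[of z] in auto)
      finally show ?thesis .
    qed
    finally show ?thesis .
  qed
  ultimately have E: "of_real (2 * pi) * (\<integral>z. F z \<partial>lborel) = (\<integral>z. integral ?I (\<lambda>t. F (of_real (cmod z) * cis t)) \<partial>lborel)"
    by simp
  define R where "R \<rho> = integral ?I (\<lambda>t. F (of_real (sqrt \<rho>) * cis t))" for \<rho>
  have Rm: "R \<in> borel_measurable borel"
  proof (rule borel_measurable_continuous_onI)
    have "continuous_on UNIV (\<lambda>\<rho>. integral (cbox 0 (2*pi)) (\<lambda>t. F (of_real (sqrt \<rho>) * cis t)))"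
    proof (rule integral_continuous_on_param)
      show "continuous_on (UNIV \<times> cbox 0 (2*pi)) (\<lambda>(\<rho>, t). F (of_real (sqrt \<rho>) * cis t))"
        unfolding case_prod_beta' by (rule continuous_on_compose2[OF F]) (auto intro!: continuous_intros)
    qed
    then show "continuous_on UNIV R" by (simp add: R_def[abs_def])
  qed
  have "(\<integral>z. integral ?I (\<lambda>t. F (of_real (cmod z) * cis t)) \<partial>lborel) = (\<integral>z. R ((cmod z)\<^sup>2) \<partial>lborel)"
    by (simp add: R_def)
  also have "\<dots> = of_real pi * (\<integral>\<rho>. indicator {0..} \<rho> *\<^sub>R R \<rho> \<partial>lborel)" by (rule lborel_integral_radial[OF Rm])
  finally have "(\<integral>z. F z \<partial>lborel) = 1 / (2 * of_real pi) * (of_real pi * (\<integral>\<rho>. indicator {0..} \<rho> *\<^sub>R R \<rho> \<partial>lborel))"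
    using E by (simp add: field_simps)
  also have "\<dots> = of_real pi * (\<integral>\<rho>. 1 / (2 * of_real pi) * (indicator {0..} \<rho> *\<^sub>R R \<rho>) \<partial>lborel)"
    unfolding integral_mult_right_zero by (rule mult.left_commute)
  finally show ?thesis by (simp add: R_def scaleR_conv_of_real mult_ac)
qed

text \<open>The mass of the approximate identity after rescaling: in \<rho> = |w|^2 it is pi times
  the integral of 2 (\<rho> + 1)^(-3) over the half-line, with antiderivative - (\<rho> +
  1)^(-2).\<close>

lemma has_bochner_integral_cauchy_kernel:
  "has_bochner_integral lborel (\<lambda>w::complex. 2 / ((cmod w)\<^sup>2 + 1) ^ 3) pi"
proof (rule has_bochner_integral_nn_integral)
  have "(\<integral>\<^sup>+w. ennreal (2 / ((cmod w)\<^sup>2 + 1) ^ 3) \<partial>lborel) =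
      (\<integral>\<^sup>+\<rho>. ennreal (2 / (\<rho> + 1) ^ 3) \<partial>distr lborel borel (\<lambda>z::complex. (cmod z)\<^sup>2))"
    by (subst nn_integral_distr) auto
  also have "\<dots> = (\<integral>\<^sup>+\<rho>. ennreal (pi * indicator {0..} \<rho>) * ennreal (2 / (\<rho> + 1) ^ 3) \<partial>lborel)"
    unfolding distr_cmod_sq_lborel by (subst nn_integral_density) auto
  also have "\<dots> = (\<integral>\<^sup>+\<rho>. ennreal pi * (ennreal (2 / (\<rho> + 1) ^ 3) * indicator {0..} \<rho>) \<partial>lborel)"
    by (intro nn_integral_cong) (auto simp: indicator_def)
  also have "\<dots> = ennreal pi * (\<integral>\<^sup>+\<rho>. ennreal (2 / (\<rho> + 1) ^ 3) * indicator {0..} \<rho> \<partial>lborel)"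
    by (rule nn_integral_cmult) auto
  also have "(\<integral>\<^sup>+\<rho>. ennreal (2 / (\<rho> + 1) ^ 3) * indicator {0..} \<rho> \<partial>lborel) = ennreal (0 - (- (1 / (0 + 1)\<^sup>2)))"
  proof (rule nn_integral_FTC_atLeast)
    show "((\<lambda>\<rho>. - (1 / (\<rho> + 1)\<^sup>2)) has_real_derivative 2 / (x + 1) ^ 3) (at x)" if "0 \<le> x" for x :: real
    proof (rule DERIV_cong)
      have y: "x + 1 \<noteq> 0" using that by simp
      show "((\<lambda>\<rho>. - (1 / (\<rho> + 1)\<^sup>2)) has_real_derivative - ((0 * (x + 1)\<^sup>2 - 1 * (2 * (x + 1))) / ((x + 1)\<^sup>2 * (x + 1)\<^sup>2))) (at x)"
        by (rule derivative_eq_intros refl | simp add: y)+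
      show "- ((0 * (x + 1)\<^sup>2 - 1 * (2 * (x + 1))) / ((x + 1)\<^sup>2 * (x + 1)\<^sup>2)) = 2 / (x + 1) ^ 3"
      proof -
        have "- ((0 * y\<^sup>2 - 1 * (2 * y)) / (y\<^sup>2 * y\<^sup>2)) = 2 / y ^ 3" if "y \<noteq> 0" for y :: real
          using that by (simp add: power2_eq_square power3_eq_cube)
        from this[OF y] show ?thesis .
      qed
    qed
    have "filterlim (\<lambda>\<rho>::real. 1 + \<rho>) at_top at_top"
      by (rule filterlim_tendsto_add_at_top[OF tendsto_const filterlim_ident])
    then have "filterlim (\<lambda>\<rho>::real. (\<rho> + 1)\<^sup>2) at_top at_top"
      by (intro filterlim_pow_at_top) (simp_all add: add.commute)
    from tendsto_minus[OF tendsto_inverse_0_at_top[OF this]]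
    have "((\<lambda>\<rho>::real. - inverse ((\<rho> + 1)\<^sup>2)) \<longlongrightarrow> - 0) at_top" .
    then show "((\<lambda>\<rho>::real. - (1 / (\<rho> + 1)\<^sup>2)) \<longlongrightarrow> 0) at_top" by (simp add: inverse_eq_divide)
  qed auto
  finally show "(\<integral>\<^sup>+w. ennreal (2 / ((cmod w)\<^sup>2 + 1) ^ 3) \<partial>lborel) = ennreal pi" by simp
qed auto

lemma lborel_integral_affine:
  fixes f :: "complex \<Rightarrow> complex"
  assumes [measurable]: "f \<in> borel_measurable borel" and c: "c > 0"
  shows "(\<integral>z. f z \<partial>lborel) = (\<integral>w. (c\<^sup>2) *\<^sub>R f (a + c *\<^sub>R w) \<partial>lborel)"
proof -
  have "(\<integral>z. f z \<partial>lborel) = (\<integral>z. f z \<partial>density (distr lborel borel (\<lambda>x. a + c *\<^sub>R x)) (\<lambda>_. \<bar>c\<bar> ^ DIM(complex)))"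
    using lborel_affine[of c a] c by simp
  also have "\<dots> = (\<integral>z. (c\<^sup>2) *\<^sub>R f z \<partial>distr lborel borel (\<lambda>x. a + c *\<^sub>R x))"
    using c by (subst integral_density) auto
  also have "\<dots> = (\<integral>w. (c\<^sup>2) *\<^sub>R f (a + c *\<^sub>R w) \<partial>lborel)" by (subst integral_distr) auto
  finally show ?thesis .
qed

section \<open>The biharmonic Green potential\<close>

lemma abs_x_ln_x_le: "0 \<le> x \<Longrightarrow> \<bar>x * ln x\<bar> \<le> 1 + x\<^sup>2" for x :: real
proof (cases "x \<ge> 1")
  case True
  have "0 < x" using True by simp
  from ln_le_minus_one[OF this] have "ln x \<le> x" by simp
  then have "x * ln x \<le> x * x" using True by (intro mult_left_mono) auto
  moreover have "0 \<le> x * ln x" using True by simp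
  ultimately show ?thesis by (simp add: power2_eq_square)
next
  case False
  assume "0 \<le> x"
  show ?thesis
  proof (cases "x = 0")
    case False
    with \<open>0 \<le> x\<close> have x: "0 < x" by simp
    have "ln (1 / x) \<le> 1 / x - 1" using x by (intro ln_le_minus_one) auto
    then have "x * - ln x \<le> x * (1 / x - 1)" using x by (intro mult_left_mono) (auto simp: ln_div)
    also have "\<dots> \<le> 1" using x by (simp add: right_diff_distrib)
    finally have "- (x * ln x) \<le> 1" by simp
    moreover have "x * ln x \<le> 0" using x \<open>\<not> x \<ge> 1\<close> by (simp add: mult_le_0_iff)
    ultimately show ?thesis using zero_le_power2[of x] by linarith
  qed simp
qed

lemma continuous_on_x_ln_x: "continuous_on {0..} (\<lambda>x::real. x * ln x)"
  unfolding continuous_on_eq_continuous_within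
proof
  fix x :: real assume "x \<in> {0..}"
  show "continuous (at x within {0..}) (\<lambda>x. x * ln x)"
  proof (cases "x = 0")
    case False
    with \<open>x \<in> {0..}\<close> show ?thesis by (intro continuous_intros) auto
  next
    case True
    \<comment> \<open>Applying ln x \<le> x - 1 to \<open>1 / sqrt y\<close> keeps half a power of
      y, which tends to 0.\<close>
    have b: "\<bar>y * ln y\<bar> \<le> 2 * sqrt y" if y: "0 < y" "y < 1" for y :: real
    proof -
      have "ln (1 / sqrt y) \<le> 1 / sqrt y - 1" using y by (intro ln_le_minus_one) auto
      then have "- ln y \<le> 2 * (1 / sqrt y)" using y by (simp add: ln_div ln_sqrt)
      then have "y * - ln y \<le> y * (2 * (1 / sqrt y))" using y by (intro mult_left_mono) auto
      also have "\<dots> = 2 * (y / sqrt y)" by simp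
      also have "\<dots> = 2 * sqrt y" using y by (simp only: real_div_sqrt less_imp_le)
      finally have "- (y * ln y) \<le> 2 * sqrt y" by simp
      moreover have "y * ln y \<le> 0" using y by (simp add: mult_le_0_iff)
      ultimately show ?thesis by linarith
    qed
    have "((\<lambda>y::real. y * ln y) \<longlongrightarrow> 0) (at 0 within {0..})"
    proof (rule Lim_null_comparison)
      have "\<forall>\<^sub>F y in at 0 within {0..}. y \<in> {..<1} \<and> y \<in> {0..} \<and> y \<noteq> (0::real)"
        unfolding eventually_at_topological by (intro exI[of _ "{..<1}"]) auto
      then show "\<forall>\<^sub>F y in at 0 within {0..}. norm (y * ln y) \<le> 2 * sqrt (y::real)"
        by (rule eventually_mono) (use b in auto)
      have "((\<lambda>y. 2 * sqrt y) \<longlongrightarrow> 2 * sqrt 0) (at 0 within {0..})" by (intro tendsto_intros)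
      then show "((\<lambda>y. 2 * sqrt y) \<longlongrightarrow> 0) (at 0 within {0..})" by simp
    qed
    then show ?thesis using True by (simp add: continuous_within)
  qed
qed

lemma continuous_on_cmod_sq_ln: "continuous_on S (\<lambda>z. (cmod (z - a))\<^sup>2 * ln ((cmod (z - a))\<^sup>2))"
  by (rule continuous_on_compose2[OF continuous_on_x_ln_x]) (auto intro!: continuous_intros)

text \<open>Adding e moves the singularity of the logarithm out of the range of
  \<open>(cmod (z - a))\<^sup>2\<close>, so \<open>laplacian_radial_monomial\<close> with k = 0
  applies twice and Green's identity transfers the bilaplacian.\<close>

lemma regularized_fundamental_solution:
  assumes \<psi>: "smooth_on UNIV \<psi>" "compact K" "\<And>z. z \<notin> K \<Longrightarrow> \<psi> z = 0" and e: "e > 0"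
  shows "(\<integral>z. of_real (((cmod (z - a))\<^sup>2 + e) * ln ((cmod (z - a))\<^sup>2 + e)) * laplacian (laplacian \<psi>) z \<partial>lborel) =
    (\<integral>z. of_real (2 * e\<^sup>2 / ((cmod (z - a))\<^sup>2 + e) ^ 3) * \<psi> z \<partial>lborel)"
proof -
  let ?q = "\<lambda>z. (cmod (z - a))\<^sup>2"
  define f where "f z = complex_of_real ((?q z + e) * ln (?q z + e))" for z
  define m where "m \<rho> = ln (\<rho> + e) + 1 + \<rho> / (\<rho> + e)" for \<rho>
  define m1 where "m1 \<rho> = 1 / (\<rho> + e) + e / (\<rho> + e)\<^sup>2" for \<rho>
  define m2 where "m2 \<rho> = - 1 / (\<rho> + e)\<^sup>2 - 2 * e / (\<rho> + e) ^ 3" for \<rho>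
  have ne: "\<rho> + e \<noteq> 0" "\<rho> + e > 0" if "\<rho> \<ge> 0" for \<rho> using that e by auto
  have d0: "((\<lambda>\<rho>. complex_of_real ((\<rho> + e) * ln (\<rho> + e))) has_vector_derivative of_real (ln (\<rho> + e) + 1)) (at \<rho>)" if "\<rho> \<ge> 0" for \<rho>
    by (rule has_vector_derivative_of_real) (use ne[OF that] in \<open>auto intro!: derivative_eq_intros\<close>)
  have d1: "((\<lambda>\<rho>. complex_of_real (ln (\<rho> + e) + 1)) has_vector_derivative of_real (1 / (\<rho> + e))) (at \<rho>)" if "\<rho> \<ge> 0" for \<rho>
    by (rule has_vector_derivative_of_real) (use ne[OF that] in \<open>auto intro!: derivative_eq_intros\<close>)
  have c1: "continuous_on {0..} (\<lambda>\<rho>. complex_of_real (1 / (\<rho> + e)))"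
    using e by (intro continuous_intros) (auto simp: add_nonneg_eq_0_iff)
  note L1 = laplacian_radial_monomial[OF disjI1[OF refl] d0 d1 c1, of a 0]
  have C1: "C2_on UNIV f" using L1(1) by (simp add: f_def[abs_def])
  \<comment> \<open>The factor \<open>(z - a) ^ 0\<close> keeps the shape to which the radial
    formula can be applied again.\<close>
  have Lf: "laplacian f = (\<lambda>z. (z - a) ^ 0 * complex_of_real (m (?q z)))"
    using L1(2) by (simp add: f_def[abs_def] m_def fun_eq_iff)
  have dm: "(m has_real_derivative m1 \<rho>) (at \<rho>)" if "\<rho> \<ge> 0" for \<rho>
  proof (rule DERIV_cong)
    show "(m has_real_derivative (1 / (\<rho> + e) + (1 * (\<rho> + e) - \<rho> * 1) / ((\<rho> + e) * (\<rho> + e)))) (at \<rho>)"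
      unfolding m_def[abs_def] by (rule derivative_eq_intros refl | simp add: ne[OF that])+
    show "1 / (\<rho> + e) + (1 * (\<rho> + e) - \<rho> * 1) / ((\<rho> + e) * (\<rho> + e)) = m1 \<rho>" by (simp add: m1_def power2_eq_square)
  qed
  have dm1: "(m1 has_real_derivative m2 \<rho>) (at \<rho>)" if "\<rho> \<ge> 0" for \<rho>
  proof (rule DERIV_cong)
    show "(m1 has_real_derivative ((0 * (\<rho> + e) - 1 * 1) / ((\<rho> + e) * (\<rho> + e)) + (0 * (\<rho> + e)\<^sup>2 - e * (2 * (\<rho> + e))) / ((\<rho> + e)\<^sup>2 * (\<rho> + e)\<^sup>2))) (at \<rho>)"
      unfolding m1_def[abs_def] by (rule derivative_eq_intros refl | simp add: ne[OF that])+
    have "(0 * y - 1 * 1) / (y * y) + (0 * y\<^sup>2 - e * (2 * y)) / (y\<^sup>2 * y\<^sup>2) = - 1 / y\<^sup>2 - 2 * e / y ^ 3" if "y \<noteq> 0" for y :: real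
      using that by (simp add: power2_eq_square power3_eq_cube field_simps)
    from this[OF ne(1)[OF that]]
    show "(0 * (\<rho> + e) - 1 * 1) / ((\<rho> + e) * (\<rho> + e)) + (0 * (\<rho> + e)\<^sup>2 - e * (2 * (\<rho> + e))) / ((\<rho> + e)\<^sup>2 * (\<rho> + e)\<^sup>2) = m2 \<rho>"
      by (simp only: m2_def)
  qed
  have c2: "continuous_on {0..} (\<lambda>\<rho>. complex_of_real (m2 \<rho>))" 
    unfolding m2_def using e by (intro continuous_intros) (auto simp: add_nonneg_eq_0_iff)
  note L2 = laplacian_radial_monomial[OF disjI1[OF refl] has_vector_derivative_of_real[OF dm] has_vector_derivative_of_real[OF dm1] c2, of a 0]
  have C2: "C2_on UNIV (laplacian f)" unfolding Lf by (rule L2(1))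
  have LLf: "laplacian (laplacian f) z = of_real (2 * e\<^sup>2 / (?q z + e) ^ 3)" for z
  proof -
    have "laplacian (laplacian f) z = of_real (m1 (?q z) + ?q z * m2 (?q z))"
      unfolding Lf using L2(2)[of z] by simp
    moreover have "m1 \<rho> + \<rho> * m2 \<rho> = 2 * e\<^sup>2 / (\<rho> + e) ^ 3" if "\<rho> \<ge> 0" for \<rho>
    proof -
      define y where "y = \<rho> + e"
      have y: "y \<noteq> 0" "\<rho> = y - e" using ne[OF that] by (auto simp: y_def)
      have "m1 \<rho> + \<rho> * m2 \<rho> = 1 / y + e / y\<^sup>2 + (y - e) * (- 1 / y\<^sup>2 - 2 * e / y ^ 3)"
        unfolding m1_def m2_def y_def[symmetric] by (simp add: y(2))
      also have "\<dots> = 2 * e\<^sup>2 / y ^ 3" using y(1) by (simp add: power2_eq_square power3_eq_cube divide_simps) (simp add: algebra_simps)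
      finally show ?thesis by (simp add: y_def)
    qed
    ultimately show ?thesis by simp
  qed
  have "(LINT z:UNIV|lborel. f z * laplacian (laplacian \<psi>) z) = (LINT z:UNIV|lborel. laplacian (laplacian f) z * \<psi> z)"
    by (rule bilaplacian_green_identity[OF open_UNIV \<psi>(2) subset_UNIV C1 C2 \<psi>(1,3)])
  then show ?thesis by (simp add: set_lebesgue_integral_def f_def LLf)
qed

text \<open>On the right the kernels have mass pi and concentrate at a; on the left x ln x is
  continuous down to 0 and the differentiated test function has compact support.\<close>

lemma fundamental_solution:
  assumes \<psi>: "smooth_on UNIV \<psi>" "compact K" "\<And>z. z \<notin> K \<Longrightarrow> \<psi> z = 0"
  shows "(\<integral>z. of_real ((cmod (z - a))\<^sup>2 * ln ((cmod (z - a))\<^sup>2)) * laplacian (laplacian \<psi>) z \<partial>lborel) = of_real pi * \<psi> a"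
proof -
  let ?q = "\<lambda>z. (cmod (z - a))\<^sup>2"
  let ?L = "laplacian (laplacian \<psi>)"
  let ?x = "\<lambda>x::real. x * ln x"
  \<comment> \<open>The regularisation parameter will be \<open>(d n)\<^sup>2\<close>, because the
    substitution z = a + d n w then turns the kernel into one that is independent of n.\<close>
  define d where "d n = 1 / real (Suc n)" for n
  have d: "d n > 0" "d n \<le> 1" for n by (auto simp: d_def)
  have dlim: "d \<longlonglongrightarrow> 0" unfolding d_def[abs_def] by (rule LIMSEQ_Suc[OF lim_1_over_n])
  have L0: "laplacian \<psi> z = 0" if "z \<notin> K" for z by (rule laplacian_zero_outside[OF \<psi>(2) _ that]) (use \<psi>(3) in auto)
  have LL0: "?L z = 0" if "z \<notin> K" for z by (rule laplacian_zero_outside[OF \<psi>(2) _ that]) (use L0 in auto)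
  have cL: "continuous_on UNIV ?L" and c\<psi>: "continuous_on UNIV \<psi>"
    using smooth_on_continuous smooth_on_laplacian[OF open_UNIV] \<psi>(1) by blast+
  have [measurable]: "?L \<in> borel_measurable borel" "\<psi> \<in> borel_measurable borel"
    using cL c\<psi> by (auto intro: borel_measurable_continuous_onI)
  obtain M where M: "M > 0" "\<And>z. norm (?L z) \<le> M" using compact_support_bounded[OF cL \<psi>(2) LL0] by blast
  obtain M' where M': "M' > 0" "\<And>z. norm (\<psi> z) \<le> M'" using compact_support_bounded[OF c\<psi> \<psi>(2,3)] by blast
  have "bounded (?q ` K)" by (intro compact_imp_bounded compact_continuous_image \<psi>(2) continuous_intros)
  then obtain B where B: "\<And>z. z \<in> K \<Longrightarrow> ?q z \<le> B" unfolding bounded_iff by (metis abs_le_D1 imageI real_norm_def)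
  have lhs: "(\<lambda>n. \<integral>z. of_real (?x (?q z + (d n)\<^sup>2)) * ?L z \<partial>lborel) \<longlonglongrightarrow> (\<integral>z. of_real (?x (?q z)) * ?L z \<partial>lborel)"
  proof (rule integral_dominated_convergence[where w = "\<lambda>z. indicator K z *\<^sub>R ((1 + (B + 1)\<^sup>2) * M)"])
    show "integrable lborel (\<lambda>z. indicator K z *\<^sub>R ((1 + (B + 1)\<^sup>2) * M))"
      using \<psi>(2) by (intro borel_integrable_compact) auto
    show "AE z in lborel. (\<lambda>n. of_real (?x (?q z + (d n)\<^sup>2)) * ?L z) \<longlonglongrightarrow> of_real (?x (?q z)) * ?L z"
    proof (intro AE_I2 tendsto_mult_right tendsto_of_real)
      fix z
      have "(\<lambda>n. ?q z + (d n)\<^sup>2) \<longlonglongrightarrow> ?q z + 0\<^sup>2" by (intro tendsto_intros dlim)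
      then have "(\<lambda>n. ?q z + (d n)\<^sup>2) \<longlonglongrightarrow> ?q z" by simp
      then show "(\<lambda>n. ?x (?q z + (d n)\<^sup>2)) \<longlonglongrightarrow> ?x (?q z)"
        by (rule continuous_on_tendsto_compose[OF continuous_on_x_ln_x]) auto
    qed
    show "AE z in lborel. norm (of_real (?x (?q z + (d n)\<^sup>2)) * ?L z) \<le> indicator K z *\<^sub>R ((1 + (B + 1)\<^sup>2) * M)" for n
    proof (intro AE_I2)
      fix z
      show "norm (of_real (?x (?q z + (d n)\<^sup>2)) * ?L z) \<le> indicator K z *\<^sub>R ((1 + (B + 1)\<^sup>2) * M)"
      proof (cases "z \<in> K")
        case True
        have "(d n)\<^sup>2 \<le> 1" using d[of n] by (intro power_le_one) auto
        then have y: "0 \<le> ?q z + (d n)\<^sup>2" "?q z + (d n)\<^sup>2 \<le> B + 1" using B[OF True] by auto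
        have "\<bar>?x (?q z + (d n)\<^sup>2)\<bar> \<le> 1 + (?q z + (d n)\<^sup>2)\<^sup>2" by (rule abs_x_ln_x_le[OF y(1)])
        also have "\<dots> \<le> 1 + (B + 1)\<^sup>2" using y by (intro add_left_mono power_mono)
        finally have "\<bar>?x (?q z + (d n)\<^sup>2)\<bar> * norm (?L z) \<le> (1 + (B + 1)\<^sup>2) * M" using M by (intro mult_mono) auto
        then show ?thesis by (simp only: True indicator_simps scaleR_one norm_mult norm_of_real)
      qed (simp add: LL0)
    qed
  qed measurable
  have rhs: "(\<lambda>n. \<integral>w. of_real (2 / ((cmod w)\<^sup>2 + 1) ^ 3) * \<psi> (a + d n *\<^sub>R w) \<partial>lborel) \<longlonglongrightarrow> (\<integral>w. of_real (2 / ((cmod w)\<^sup>2 + 1) ^ 3) * \<psi> a \<partial>lborel)"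
  proof (rule integral_dominated_convergence[where w = "\<lambda>w. M' * (2 / ((cmod w)\<^sup>2 + 1) ^ 3)"])
    show "integrable lborel (\<lambda>w. M' * (2 / ((cmod w)\<^sup>2 + 1) ^ 3))"
      using has_bochner_integral_cauchy_kernel by (intro integrable_mult_right) (auto simp: has_bochner_integral_iff)
    show "AE w in lborel. (\<lambda>n. of_real (2 / ((cmod w)\<^sup>2 + 1) ^ 3) * \<psi> (a + d n *\<^sub>R w)) \<longlonglongrightarrow> of_real (2 / ((cmod w)\<^sup>2 + 1) ^ 3) * \<psi> a"
    proof (intro AE_I2 tendsto_mult_left)
      fix w
      have "(\<lambda>n. a + d n *\<^sub>R w) \<longlonglongrightarrow> a + 0 *\<^sub>R w" by (intro tendsto_intros dlim)
      then have "(\<lambda>n. a + d n *\<^sub>R w) \<longlonglongrightarrow> a" by simp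
      then show "(\<lambda>n. \<psi> (a + d n *\<^sub>R w)) \<longlonglongrightarrow> \<psi> a"
        by (rule continuous_on_tendsto_compose[OF c\<psi>]) auto
    qed
    show "AE w in lborel. norm (of_real (2 / ((cmod w)\<^sup>2 + 1) ^ 3) * \<psi> (a + d n *\<^sub>R w)) \<le> M' * (2 / ((cmod w)\<^sup>2 + 1) ^ 3)" for n
    proof (intro AE_I2)
      fix w
      have p: "0 \<le> 2 / ((cmod w)\<^sup>2 + 1) ^ 3" by simp
      show "norm (of_real (2 / ((cmod w)\<^sup>2 + 1) ^ 3) * \<psi> (a + d n *\<^sub>R w)) \<le> M' * (2 / ((cmod w)\<^sup>2 + 1) ^ 3)"
        unfolding norm_mult norm_of_real abs_of_nonneg[OF p] mult.commute[of _ "norm _"] by (rule mult_right_mono[OF M'(2) p])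
    qed
  qed measurable
  have eq: "(\<integral>z. of_real (?x (?q z + (d n)\<^sup>2)) * ?L z \<partial>lborel) = (\<integral>w. of_real (2 / ((cmod w)\<^sup>2 + 1) ^ 3) * \<psi> (a + d n *\<^sub>R w) \<partial>lborel)" for n
  proof -
    have "(d n)\<^sup>2 > 0" using d(1)[of n] by simp
    from regularized_fundamental_solution[OF \<psi> this, of a]
    have "(\<integral>z. of_real (?x (?q z + (d n)\<^sup>2)) * ?L z \<partial>lborel) = (\<integral>z. of_real (2 * ((d n)\<^sup>2)\<^sup>2 / (?q z + (d n)\<^sup>2) ^ 3) * \<psi> z \<partial>lborel)" .
    also have "\<dots> = (\<integral>w. (d n)\<^sup>2 *\<^sub>R (of_real (2 * ((d n)\<^sup>2)\<^sup>2 / (?q (a + d n *\<^sub>R w) + (d n)\<^sup>2) ^ 3) * \<psi> (a + d n *\<^sub>R w)) \<partial>lborel)"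
      by (rule lborel_integral_affine) (auto simp: d)
    also have "\<dots> = (\<integral>w. of_real (2 / ((cmod w)\<^sup>2 + 1) ^ 3) * \<psi> (a + d n *\<^sub>R w) \<partial>lborel)"
    proof (intro Bochner_Integration.integral_cong refl)
      fix w
      have "?q (a + d n *\<^sub>R w) + (d n)\<^sup>2 = (d n)\<^sup>2 * ((cmod w)\<^sup>2 + 1)" by (simp add: power_mult_distrib algebra_simps)
      then have "(d n)\<^sup>2 * (2 * ((d n)\<^sup>2)\<^sup>2 / (?q (a + d n *\<^sub>R w) + (d n)\<^sup>2) ^ 3) = (d n)\<^sup>2 * (2 * ((d n)\<^sup>2)\<^sup>2 / ((d n)\<^sup>2 * ((cmod w)\<^sup>2 + 1)) ^ 3)" by (simp only:)
      also have "\<dots> = 2 / ((cmod w)\<^sup>2 + 1) ^ 3"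
      proof -
        have "D * (2 * D\<^sup>2 / (D * y) ^ 3) = 2 / y ^ 3" if "D \<noteq> 0" for D y :: real
          using that by (simp add: power_mult_distrib power2_eq_square power3_eq_cube)
        then show ?thesis using d(1)[of n] by (metis less_numeral_extra(3) zero_less_power2)
      qed
      finally have "complex_of_real ((d n)\<^sup>2 * (2 * ((d n)\<^sup>2)\<^sup>2 / (?q (a + d n *\<^sub>R w) + (d n)\<^sup>2) ^ 3)) = of_real (2 / ((cmod w)\<^sup>2 + 1) ^ 3)" by (simp only:)
      then show "(d n)\<^sup>2 *\<^sub>R (of_real (2 * ((d n)\<^sup>2)\<^sup>2 / (?q (a + d n *\<^sub>R w) + (d n)\<^sup>2) ^ 3) * \<psi> (a + d n *\<^sub>R w)) = of_real (2 / ((cmod w)\<^sup>2 + 1) ^ 3) * \<psi> (a + d n *\<^sub>R w)"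
        unfolding scaleR_conv_of_real mult.assoc[symmetric] of_real_mult[symmetric] by (simp only:)
    qed
    finally show ?thesis .
  qed
  have "(\<integral>w. of_real (2 / ((cmod w)\<^sup>2 + 1) ^ 3) * \<psi> a \<partial>lborel) = of_real pi * \<psi> a"
  proof -
    have "(\<integral>w. complex_of_real (2 / ((cmod w)\<^sup>2 + 1) ^ 3) \<partial>lborel) = of_real pi"
      using has_bochner_integral_integral_eq[OF has_bochner_integral_cauchy_kernel] integral_complex_of_real by metis
    then show ?thesis by (simp only: integral_mult_left_zero)
  qed
  then show ?thesis using LIMSEQ_unique[OF lhs rhs[folded eq]] by simp
qed

section \<open>The regular part of the Green function\<close>

lemma weakly_biharmonic_cong:
  assumes "\<And>z. cmod z < 1 \<Longrightarrow> u z = v z" "weakly_biharmonic u"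
  shows "weakly_biharmonic v"
  unfolding weakly_biharmonic_def
proof (intro conjI allI impI)
  show "continuous_on (ball 0 1) v"
    by (rule continuous_on_eq[of _ u]) (use assms in \<open>auto simp: weakly_biharmonic_def\<close>)
  fix \<psi> assume "disk_test \<psi>"
  moreover have "(LINT z:ball 0 1|lborel. v z * laplacian (laplacian \<psi>) z) =
     (LINT z:ball 0 1|lborel. u z * laplacian (laplacian \<psi>) z)"
    by (rule set_lebesgue_integral_cong) (use assms(1) in auto)
  ultimately show "(LINT z:ball 0 1|lborel. v z * laplacian (laplacian \<psi>) z) = 0"
    using assms(2) by (simp add: weakly_biharmonic_def)
qed

text \<open>Expand \<open>(z - a) * cnj (z - a)\<close>. Multiplying \<open>harm n\<close> by z or
  by its conjugate either shifts the index by one or yields |z|^2 times a shifted monomial,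
  according to the sign of n.\<close>

lemma weakly_biharmonic_cmod_sq_diff_harm:
  "weakly_biharmonic (\<lambda>z. of_real ((cmod (z - a))\<^sup>2) * harm n z)"
proof -
  have z: "weakly_biharmonic (\<lambda>z. z * harm n z)"
  proof (cases "n \<ge> 0")
    case True
    then have "z * harm n z = harm (n + 1) z" for z by (simp add: harm_def nat_add_distrib)
    then show ?thesis using weakly_biharmonic_harm[of "n + 1"] by simp
  next
    case False
    define m where "m = nat (- n - 1)"
    have n: "n = - int (Suc m)" using False by (simp add: m_def)
    have "z * harm n z = of_real ((cmod z)\<^sup>2) * harm (n + 1) z" for z
      unfolding complex_norm_square by (simp add: n harm_def mult_ac nat_add_distrib)
    then show ?thesis using weakly_biharmonic_cmod_sq_harm[of "n + 1"] by simp
  qed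
  have zb: "weakly_biharmonic (\<lambda>z. cnj z * harm n z)"
  proof (cases "n \<le> 0")
    case True
    define m where "m = nat (- n)"
    have n: "n = - int m" using True by (simp add: m_def)
    have "cnj z * harm n z = harm (n - 1) z" for z
      by (cases m) (simp_all add: n harm_def nat_add_distrib)
    then show ?thesis using weakly_biharmonic_harm[of "n - 1"] by simp
  next
    case False
    define m where "m = nat (n - 1)"
    have n: "n = int (Suc m)" using False by (simp add: m_def)
    have "cnj z * harm n z = of_real ((cmod z)\<^sup>2) * harm (n - 1) z" for z
      unfolding complex_norm_square by (simp add: n harm_def mult_ac nat_add_distrib)
    then show ?thesis using weakly_biharmonic_cmod_sq_harm[of "n - 1"] by simp
  qed
  have "weakly_biharmonic (\<lambda>z. of_real ((cmod z)\<^sup>2) * harm n z + ((- cnj a) * (z * harm n z) + ((- a) * (cnj z * harm n z) + (a * cnj a) * harm n z)))"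
    by (intro weakly_biharmonic_add weakly_biharmonic_cmult z zb weakly_biharmonic_harm weakly_biharmonic_cmod_sq_harm)
  moreover have "of_real ((cmod z)\<^sup>2) * harm n z + ((- cnj a) * (z * harm n z) + ((- a) * (cnj z * harm n z) + (a * cnj a) * harm n z)) = of_real ((cmod (z - a))\<^sup>2) * harm n z" for z
    unfolding complex_norm_square by (simp add: algebra_simps)
  ultimately show ?thesis by simp
qed

text \<open>The series of \<open>Ln (1 - w)\<close> added to its conjugate. The summand k = 0 is 0,
  since dividing by \<open>of_nat 0\<close> gives 0.\<close>

lemma ln_cmod_one_minus_sums:
  assumes "cmod w < 1"
  shows "(\<lambda>k. - (harm (int k) w + harm (- int k) w) / of_nat k) sums of_real (ln ((cmod (1 - w))\<^sup>2))"
proof -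
  have nz: "1 - w \<noteq> 0" "cmod (1 - w) > 0" using assms by auto
  have 1: "(\<lambda>k. - (w ^ k) / of_nat k) sums Ln (1 - w)" using Ln_series'[of "- w"] assms by simp
  have 2: "(\<lambda>k. - (cnj w ^ k) / of_nat k) sums cnj (Ln (1 - w))"
    using bounded_linear.sums[OF bounded_linear_cnj 1] by simp
  have "Ln (1 - w) + cnj (Ln (1 - w)) = of_real (ln ((cmod (1 - w))\<^sup>2))"
    using nz by (simp add: complex_add_cnj ln_realpow Re_Ln)
  moreover have "harm (int k) w + harm (- int k) w = w ^ k + cnj w ^ k" for k by (cases "k = 0") (simp_all add: harm_def)
  ultimately show ?thesis using sums_add[OF 1 2] by (simp add: add_divide_distrib diff_divide_distrib)
qed

text \<open>\<open>ln ((cmod (1 - cnj a * z))\<^sup>2)\<close> is a series of harmonic monomials in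
  z, and each of its terms is biharmonic after multiplication by |z - a|^2. Since |a| < 1 the
  convergence is uniform on the disk.\<close>

lemma weakly_biharmonic_green_regular_part:
  assumes a: "cmod a < 1"
  shows "weakly_biharmonic (\<lambda>z. of_real ((cmod (z - a))\<^sup>2 * ln ((cmod (1 - cnj a * z))\<^sup>2) - (1 - (cmod z)\<^sup>2) * (1 - (cmod a)\<^sup>2)))"
proof -
  let ?c = "\<lambda>k z. of_real ((cmod (z - a))\<^sup>2) * (- (harm (int k) (cnj a * z) + harm (- int k) (cnj a * z)) / of_nat k)"
  have wk: "weakly_biharmonic (?c k)" for k
  proof -
    have "weakly_biharmonic (\<lambda>z. (- harm (int k) (cnj a) / of_nat k) * (of_real ((cmod (z - a))\<^sup>2) * harm (int k) z) +
       (- harm (- int k) (cnj a) / of_nat k) * (of_real ((cmod (z - a))\<^sup>2) * harm (- int k) z))"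
      by (intro weakly_biharmonic_add weakly_biharmonic_cmult weakly_biharmonic_cmod_sq_diff_harm)
    then show ?thesis
      by (rule weakly_biharmonic_cong[rotated]) (simp add: harm_mult add_divide_distrib diff_divide_distrib algebra_simps)
  qed
  have series: "weakly_biharmonic (\<lambda>z. \<Sum>k. ?c k z)"
  proof (rule weakly_biharmonic_uniform_limit)
    show "weakly_biharmonic (\<lambda>z. \<Sum>k<n. ?c k z)" for n by (rule weakly_biharmonic_sum) (rule wk)
    fix K assume K: "compact K" "K \<subseteq> ball (0::complex) 1"
    show "uniform_limit K (\<lambda>n z. \<Sum>k<n. ?c k z) (\<lambda>z. \<Sum>k. ?c k z) sequentially"
    \<comment> \<open>The constant 8 is 4 times 2: |z - a|^2 \<le> 4, and there are two conjugate
      terms of modulus at most |a|^k.\<close>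
    proof (rule Weierstrass_m_test[where M = "\<lambda>k. 8 * cmod a ^ k"])
      show "summable (\<lambda>k. 8 * cmod a ^ k)" using a by (intro summable_mult summable_geometric) simp
      fix k z assume "z \<in> K"
      then have z: "cmod z \<le> 1" using K(2) by (auto intro: less_imp_le)
      have "cmod (z - a) \<le> 2" using norm_triangle_ineq4[of z a] z a by simp
      then have 1: "(cmod (z - a))\<^sup>2 \<le> 2\<^sup>2" by (intro power_mono) auto
      have h: "norm (harm j (cnj a * z)) \<le> cmod a ^ nat \<bar>j\<bar>" for j
        unfolding norm_harm norm_mult using z by (intro power_mono) (auto intro: mult_left_le)
      have 2: "norm (- (harm (int k) (cnj a * z) + harm (- int k) (cnj a * z)) / of_nat k) \<le> cmod a ^ k + cmod a ^ k"
      proof (cases "k = 0")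
        case False
        have "norm (harm (int k) (cnj a * z) + harm (- int k) (cnj a * z)) \<le> cmod a ^ k + cmod a ^ k"
          using h[of "int k"] h[of "- int k"] by (intro order_trans[OF norm_triangle_ineq] add_mono) auto
        moreover have "x / real k \<le> x" if "x \<ge> 0" for x :: real using False that by (simp add: divide_le_eq mult_left_mono[of 1 "real k" x, simplified])
        ultimately show ?thesis unfolding norm_divide norm_minus_cancel norm_of_nat by (meson norm_ge_zero order_trans)
      qed simp
      have "norm (?c k z) = (cmod (z - a))\<^sup>2 * norm (- (harm (int k) (cnj a * z) + harm (- int k) (cnj a * z)) / of_nat k)"
        by (simp only: norm_mult norm_of_real abs_of_nonneg[OF zero_le_power2])
      also have "\<dots> \<le> 2\<^sup>2 * (cmod a ^ k + cmod a ^ k)" by (intro mult_mono 1 2) auto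
      finally show "norm (?c k z) \<le> 8 * cmod a ^ k" by simp
    qed
  qed
  have t: "weakly_biharmonic (\<lambda>z. (- of_real (1 - (cmod a)\<^sup>2)) * harm 0 z + of_real (1 - (cmod a)\<^sup>2) * (of_real ((cmod z)\<^sup>2) * harm 0 z))"
    by (intro weakly_biharmonic_add weakly_biharmonic_cmult weakly_biharmonic_harm weakly_biharmonic_cmod_sq_harm)
  show ?thesis
  proof (rule weakly_biharmonic_cong[OF _ weakly_biharmonic_add[OF series t]])
    fix z :: complex assume z: "cmod z < 1"
    have "cmod (cnj a * z) < 1" using a z by (simp add: norm_mult) (metis mult_less_cancel_left2 norm_ge_zero less_le_not_le mult_le_one order_le_less mult.commute norm_not_less_zero mult_strict_mono mult.right_neutral zero_less_one)
    from sums_mult[OF ln_cmod_one_minus_sums[OF this], of "of_real ((cmod (z - a))\<^sup>2)"]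
    have "(\<Sum>k. ?c k z) = of_real ((cmod (z - a))\<^sup>2) * of_real (ln ((cmod (1 - cnj a * z))\<^sup>2))" by (simp only: sums_iff)
    then show "(\<Sum>k. ?c k z) + ((- of_real (1 - (cmod a)\<^sup>2)) * harm 0 z + of_real (1 - (cmod a)\<^sup>2) * (of_real ((cmod z)\<^sup>2) * harm 0 z)) =
        of_real ((cmod (z - a))\<^sup>2 * ln ((cmod (1 - cnj a * z))\<^sup>2) - (1 - (cmod z)\<^sup>2) * (1 - (cmod a)\<^sup>2))"
      by (simp add: harm_def algebra_simps)
  qed
qed

lemma biharmonic_G_split:
  assumes "cmod z < 1" "cmod a < 1"
  shows "biharmonic_G z a = - ((cmod (z - a))\<^sup>2 * ln ((cmod (z - a))\<^sup>2)) +
    ((cmod (z - a))\<^sup>2 * ln ((cmod (1 - cnj a * z))\<^sup>2) - (1 - (cmod z)\<^sup>2) * (1 - (cmod a)\<^sup>2))"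
proof (cases "z = a")
  case False
  have "cmod (cnj a * z) < 1" using assms by (simp add: norm_mult) (metis assms mult.commute mult_less_cancel_left2 mult_strict_mono norm_ge_zero mult_1 zero_less_one)
  then have "1 - cnj a * z \<noteq> 0" by auto
  then show ?thesis using False
    by (simp add: biharmonic_G_def norm_divide power_divide ln_div algebra_simps)
qed (simp add: biharmonic_G_def)

text \<open>G is minus the fundamental solution plus a biharmonic function, whence the sign. The
  factor pi cancels later against the normalisation of the area measure.\<close>

lemma green_representation:
  assumes \<psi>: "disk_test \<psi>" and a: "cmod a < 1"
  shows "(LINT z:ball 0 1|lborel. of_real (biharmonic_G z a) * laplacian (laplacian \<psi>) z) = - (of_real pi * \<psi> a)"
proof -
  obtain K where K: "compact K" "K \<subseteq> ball 0 1" "\<And>z. z \<notin> K \<Longrightarrow> \<psi> z = 0"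
    "\<And>z. z \<notin> K \<Longrightarrow> laplacian (laplacian \<psi>) z = 0" "smooth_on UNIV \<psi>"
    using disk_testD[OF \<psi>] by metis
  let ?S = "\<lambda>z. complex_of_real ((cmod (z - a))\<^sup>2 * ln ((cmod (z - a))\<^sup>2))"
  let ?R = "\<lambda>z. complex_of_real ((cmod (z - a))\<^sup>2 * ln ((cmod (1 - cnj a * z))\<^sup>2) - (1 - (cmod z)\<^sup>2) * (1 - (cmod a)\<^sup>2))"
  have cS: "continuous_on (ball 0 1) ?S" by (intro continuous_on_of_real continuous_on_cmod_sq_ln)
  have R: "weakly_biharmonic ?R" by (rule weakly_biharmonic_green_regular_part[OF a])
  have G: "of_real (biharmonic_G z a) * L = ?R z * L - ?S z * L" if "z \<in> ball 0 1" for z and L :: complex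
  proof -
    have "complex_of_real (biharmonic_G z a) = ?R z - ?S z"
      using that a by (subst biharmonic_G_split) auto
    then show ?thesis by (simp only: left_diff_distrib)
  qed
  have "(LINT z:ball 0 1|lborel. of_real (biharmonic_G z a) * laplacian (laplacian \<psi>) z) =
     (LINT z:ball 0 1|lborel. ?R z * laplacian (laplacian \<psi>) z - ?S z * laplacian (laplacian \<psi>) z)"
    by (rule set_lebesgue_integral_cong) (use G in auto)
  also have "\<dots> = (LINT z:ball 0 1|lborel. ?R z * laplacian (laplacian \<psi>) z) - (LINT z:ball 0 1|lborel. ?S z * laplacian (laplacian \<psi>) z)"
    by (intro set_integral_diff(2) weakly_biharmonic_set_integrable(1)[OF \<psi>] cS) (use R in \<open>simp add: weakly_biharmonic_def\<close>)
  also have "(LINT z:ball 0 1|lborel. ?R z * laplacian (laplacian \<psi>) z) = 0" using R \<psi> by (simp add: weakly_biharmonic_def)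
  also have "(LINT z:ball 0 1|lborel. ?S z * laplacian (laplacian \<psi>) z) = (\<integral>z. ?S z * laplacian (laplacian \<psi>) z \<partial>lborel)"
    unfolding set_lebesgue_integral_def
  proof (intro Bochner_Integration.integral_cong refl)
    fix z
    show "indicat_real (ball 0 1) z *\<^sub>R (?S z * laplacian (laplacian \<psi>) z) = ?S z * laplacian (laplacian \<psi>) z"
    proof (cases "z \<in> ball 0 1")
      case False
      then have "laplacian (laplacian \<psi>) z = 0" using K(2,4) by blast
      then show ?thesis by simp
    qed simp
  qed
  also have "\<dots> = of_real pi * \<psi> a" by (rule fundamental_solution[OF K(5,1,3)])
  finally show ?thesis by simp
qed

section \<open>Size and continuity of the Green function\<close>

lemma cmod_sq_one_minus_cnj_mult:
  "(cmod (1 - cnj a * z))\<^sup>2 = (cmod (z - a))\<^sup>2 + (1 - (cmod z)\<^sup>2) * (1 - (cmod a)\<^sup>2)"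
proof -
  have "complex_of_real ((cmod (1 - cnj a * z))\<^sup>2) = of_real ((cmod (z - a))\<^sup>2 + (1 - (cmod z)\<^sup>2) * (1 - (cmod a)\<^sup>2))"
    unfolding of_real_add of_real_mult of_real_diff of_real_1 complex_norm_square by (simp add: algebra_simps)
  then show ?thesis by (simp only: of_real_eq_iff)
qed

text \<open>Off the diagonal, with d, q, \<sigma> as below and x = d q / \<sigma>^2, the preceding
  identity gives G = \<sigma>^2 (ln (1 + x) - x). For \<sigma> \<le> d, q is at most 4 d and -G
  \<le> d q suffices; for \<sigma> > d the second-order bound ln (1 + x) \<ge> x - x^2 produces both
  factors d.\<close>

lemma biharmonic_G_bound:
  assumes z: "cmod z < 1" and a: "cmod a < 1"
  shows "\<bar>biharmonic_G z a\<bar> \<le> 16 * (1 - (cmod z)\<^sup>2)\<^sup>2"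
proof -
  define d where "d = 1 - (cmod z)\<^sup>2"
  define q where "q = 1 - (cmod a)\<^sup>2"
  define \<sigma> where "\<sigma> = cmod (z - a)"
  have d: "0 < d" "0 < q" unfolding d_def q_def using z a by (simp_all add: abs_square_less_1)
  have "1 - cmod z \<le> d"
  proof -
    have "cmod z * cmod z \<le> cmod z * 1" using z by (intro mult_left_mono) auto
    then show ?thesis by (simp add: d_def power2_eq_square)
  qed
  moreover have "q \<le> 2 * (1 - cmod a)"
  proof -
    have "q = (1 - cmod a) * (1 + cmod a)" by (simp add: q_def power2_eq_square algebra_simps)
    also have "\<dots> \<le> (1 - cmod a) * 2" using a by (intro mult_left_mono) auto
    finally show ?thesis by simp
  qed
  moreover have "cmod z \<le> \<sigma> + cmod a" unfolding \<sigma>_def by (metis diff_add_cancel norm_triangle_ineq)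
  \<comment> \<open>Moving from z to a changes the distance to the circle by at most
    \<sigma>.\<close>
  ultimately have q: "q \<le> 2 * d + 2 * \<sigma>" by simp
  have \<sigma>0: "\<sigma> \<ge> 0" by (simp add: \<sigma>_def)
  show ?thesis
  proof (cases "z = a")
    case True
    then have "biharmonic_G z a = - (d * d)" by (simp add: biharmonic_G_def d_def)
    then show ?thesis unfolding d_def[symmetric] by (simp add: power2_eq_square abs_mult)
  next
    case False
    then have \<sigma>: "\<sigma> > 0" by (simp add: \<sigma>_def)
    define x where "x = d * q / \<sigma>\<^sup>2"
    have x: "x > 0" using d \<sigma> by (simp add: x_def)
    have "(cmod ((1 - cnj a * z) / (z - a)))\<^sup>2 = 1 + x"
      using \<sigma> by (simp add: norm_divide power_divide cmod_sq_one_minus_cnj_mult x_def d_def q_def \<sigma>_def[symmetric] add_divide_distrib)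
    then have G: "biharmonic_G z a = \<sigma>\<^sup>2 * ln (1 + x) - d * q"
      by (simp add: biharmonic_G_def \<sigma>_def d_def q_def)
    have sx: "\<sigma>\<^sup>2 * x = d * q" using \<sigma> by (simp add: x_def)
    have "ln (1 + x) \<le> x" using x by (intro ln_add_one_self_le_self) auto
    then have "\<sigma>\<^sup>2 * ln (1 + x) \<le> \<sigma>\<^sup>2 * x" by (intro mult_left_mono) auto
    then have up: "biharmonic_G z a \<le> 0" using G sx by simp
    have low: "- biharmonic_G z a \<le> 16 * d\<^sup>2"
    proof (cases "\<sigma> \<le> d")
      case True
      have "0 \<le> \<sigma>\<^sup>2 * ln (1 + x)" using x by (intro mult_nonneg_nonneg) auto
      then have "- biharmonic_G z a \<le> d * q" using G by simp
      also have "\<dots> \<le> d * (4 * d)" using q True d by (intro mult_left_mono) auto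
      also have "\<dots> \<le> 16 * d\<^sup>2" by (simp add: power2_eq_square)
      finally show ?thesis .
    next
      case False
      have "x - x\<^sup>2 \<le> ln (1 + x)"
      proof (cases "x \<le> 1")
        case True
        then show ?thesis using x by (intro ln_one_plus_pos_lower_bound) auto
      next
        case False
        then have "x * 1 \<le> x * x" using x by (intro mult_left_mono) auto
        moreover have "0 \<le> ln (1 + x)" using x by simp
        ultimately show ?thesis by (simp add: power2_eq_square)
      qed
      then have "\<sigma>\<^sup>2 * (x - x\<^sup>2) \<le> \<sigma>\<^sup>2 * ln (1 + x)" by (intro mult_left_mono) auto
      moreover have "\<sigma>\<^sup>2 * (x - x\<^sup>2) = \<sigma>\<^sup>2 * x - \<sigma>\<^sup>2 * x * x"
        by (simp add: right_diff_distrib power2_eq_square mult.assoc)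
      ultimately have "- biharmonic_G z a \<le> \<sigma>\<^sup>2 * x * x" using G sx by linarith
      also have "\<dots> = d\<^sup>2 * (q / \<sigma>)\<^sup>2" unfolding sx by (simp add: x_def power2_eq_square)
      \<comment> \<open>Here d < \<sigma>, so q \<le> 4 \<sigma>; the square of this 4 is the
        constant 16 of the statement.\<close>
      also have "\<dots> \<le> d\<^sup>2 * 4\<^sup>2"
      proof (intro mult_left_mono power_mono)
        show "q / \<sigma> \<le> 4" using q False \<sigma> by (simp add: divide_le_eq)
      qed (use d \<sigma> in auto)
      finally show ?thesis by simp
    qed
    show ?thesis using up low unfolding d_def by linarith
  qed
qed

lemma continuous_on_biharmonic_G:
  assumes a: "cmod a < 1"
  shows "continuous_on (ball 0 1) (\<lambda>z. biharmonic_G z a)"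
proof (rule continuous_on_eq)
  have nz: "cmod (1 - cnj a * z) \<noteq> 0" if "z \<in> ball 0 1" for z
  proof -
    have "0 < (1 - (cmod z)\<^sup>2) * (1 - (cmod a)\<^sup>2)" using that a by (intro mult_pos_pos) (simp_all add: abs_square_less_1)
    then have "0 < (cmod (1 - cnj a * z))\<^sup>2" unfolding cmod_sq_one_minus_cnj_mult using zero_le_power2[of "cmod (z - a)"] by linarith
    then show ?thesis by auto
  qed
  show "continuous_on (ball 0 1) (\<lambda>z. - ((cmod (z - a))\<^sup>2 * ln ((cmod (z - a))\<^sup>2)) +
    ((cmod (z - a))\<^sup>2 * ln ((cmod (1 - cnj a * z))\<^sup>2) - (1 - (cmod z)\<^sup>2) * (1 - (cmod a)\<^sup>2)))"
    by (intro continuous_on_add continuous_on_minus continuous_on_cmod_sq_ln continuous_intros) (use nz in auto)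
qed (use a in \<open>simp add: biharmonic_G_split\<close>)

lemma borel_measurable_biharmonic_G:
  "(\<lambda>p. biharmonic_G (fst p) (snd p)) \<in> borel_measurable (borel \<Otimes>\<^sub>M borel)"
  "(\<lambda>a. biharmonic_G z a) \<in> borel_measurable borel"
proof -
  have [measurable]: "cnj \<in> borel_measurable borel" by (intro borel_measurable_continuous_onI continuous_intros)
  show "(\<lambda>p. biharmonic_G (fst p) (snd p)) \<in> borel_measurable (borel \<Otimes>\<^sub>M borel)"
    "(\<lambda>a. biharmonic_G z a) \<in> borel_measurable borel"
    unfolding biharmonic_G_def by measurable
qed

lemma emeasure_lborel_unit_disk: "emeasure lborel (ball (0::complex) 1) = ennreal pi"
  by (simp add: emeasure_ball unit_ball_vol_2)

section \<open>Potentials of continuous densities\<close>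

context
  fixes g :: "complex \<Rightarrow> complex" and \<gamma> :: "complex \<Rightarrow> complex"
  assumes g: "continuous_on (cball 0 1) g"
  defines "\<gamma> \<equiv> \<lambda>\<zeta>. indicator (ball 0 1) \<zeta> *\<^sub>R g \<zeta>"
begin

text \<open>g is controlled on the closed disk only; \<gamma> cuts it off to a Borel function on the
  plane, to which Fubini and the convergence theorems apply.\<close>

lemma density_measurable: "\<gamma> \<in> borel_measurable borel"
  unfolding \<gamma>_def using continuous_on_subset[OF g ball_subset_cball]
  by (intro borel_measurable_continuous_on_indicator) auto

lemma density_bounded: obtains M where "M > 0" "\<And>\<zeta>. norm (\<gamma> \<zeta>) \<le> M"
proof -
  have "bounded (g ` cball 0 1)" using g by (intro compact_imp_bounded compact_continuous_image) auto
  then obtain M where M: "\<And>z. z \<in> cball 0 1 \<Longrightarrow> norm (g z) \<le> M" unfolding bounded_iff by blast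
  have "norm (\<gamma> \<zeta>) \<le> max M 1" for \<zeta>
    using M[of \<zeta>] by (cases "\<zeta> \<in> ball 0 1") (auto simp: \<gamma>_def)
  then show ?thesis using that[of "max M 1"] by simp
qed

lemma G_pot_eq_lborel: "G_pot g z = 1 / of_real pi * (\<integral>\<zeta>. of_real (biharmonic_G z \<zeta>) * \<gamma> \<zeta> \<partial>lborel)"
proof -
  have m: "(\<lambda>\<zeta>. of_real (biharmonic_G z \<zeta>) * \<gamma> \<zeta>) \<in> borel_measurable borel"
    using borel_measurable_biharmonic_G(2) density_measurable by measurable
  have "(LINT \<zeta>:ball 0 1|lebesgue. of_real (biharmonic_G z \<zeta>) * g \<zeta>) = (\<integral>\<zeta>. of_real (biharmonic_G z \<zeta>) * \<gamma> \<zeta> \<partial>lebesgue)"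
    by (simp add: set_lebesgue_integral_def \<gamma>_def)
  also have "\<dots> = (\<integral>\<zeta>. of_real (biharmonic_G z \<zeta>) * \<gamma> \<zeta> \<partial>lborel)"
    by (rule integral_completion) (use m in simp)
  finally show ?thesis by (simp add: G_pot_def disk_integral_def)
qed

lemma G_pot_integrable:
  assumes z: "cmod z < 1"
  shows "integrable lborel (\<lambda>\<zeta>. of_real (biharmonic_G z \<zeta>) * \<gamma> \<zeta>)"
proof -
  obtain M where M: "M > 0" "\<And>\<zeta>. norm (\<gamma> \<zeta>) \<le> M" using density_bounded by blast
  show ?thesis
  proof (rule integrableI_bounded_set[where A = "ball 0 1" and B = "16 * (1 - (cmod z)\<^sup>2)\<^sup>2 * M"])
    show "(\<lambda>\<zeta>. of_real (biharmonic_G z \<zeta>) * \<gamma> \<zeta>) \<in> borel_measurable lborel"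
      using borel_measurable_biharmonic_G(2) density_measurable by measurable
    show "AE x in lborel. x \<in> ball 0 1 \<longrightarrow> norm (of_real (biharmonic_G z x) * \<gamma> x) \<le> 16 * (1 - (cmod z)\<^sup>2)\<^sup>2 * M"
    proof (intro AE_I2 impI)
      fix x :: complex assume "x \<in> ball 0 1"
      then show "norm (of_real (biharmonic_G z x) * \<gamma> x) \<le> 16 * (1 - (cmod z)\<^sup>2)\<^sup>2 * M"
        unfolding norm_mult norm_of_real using z M biharmonic_G_bound[OF z] by (intro mult_mono) auto
    qed
  qed (auto simp: \<gamma>_def emeasure_lborel_unit_disk)
qed

lemma norm_G_pot_le:
  obtains C where "C > 0" "\<And>z. cmod z < 1 \<Longrightarrow> norm (G_pot g z) \<le> C * (1 - (cmod z)\<^sup>2)\<^sup>2"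
proof -
  obtain M where M: "M > 0" "\<And>\<zeta>. norm (\<gamma> \<zeta>) \<le> M" using density_bounded by blast
  have "norm (G_pot g z) \<le> (16 * M) * (1 - (cmod z)\<^sup>2)\<^sup>2" if z: "cmod z < 1" for z
  proof -
    let ?B = "16 * (1 - (cmod z)\<^sup>2)\<^sup>2 * M"
    have "norm (\<integral>\<zeta>. of_real (biharmonic_G z \<zeta>) * \<gamma> \<zeta> \<partial>lborel) \<le> (\<integral>\<zeta>. indicator (ball (0::complex) 1) \<zeta> *\<^sub>R ?B \<partial>lborel)"
    proof (rule Bochner_Integration.integral_norm_bound_integral[OF G_pot_integrable[OF z]])
      show "integrable lborel (\<lambda>\<zeta>::complex. indicator (ball 0 1) \<zeta> *\<^sub>R ?B)"
        by (intro integrable_scaleR_left integrable_real_indicator) (auto simp: emeasure_lborel_unit_disk)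
      fix \<zeta> :: complex
      show "norm (of_real (biharmonic_G z \<zeta>) * \<gamma> \<zeta>) \<le> indicator (ball 0 1) \<zeta> *\<^sub>R ?B"
      proof (cases "\<zeta> \<in> ball 0 1")
        case True
        then have "norm (of_real (biharmonic_G z \<zeta>) * \<gamma> \<zeta>) \<le> ?B"
          unfolding norm_mult norm_of_real using z M biharmonic_G_bound[OF z, of \<zeta>] by (intro mult_mono) auto
        then show ?thesis using True by simp
      qed (simp add: \<gamma>_def)
    qed
    also have "\<dots> = pi * ?B" by (simp add: emeasure_lborel_unit_disk measure_def)
    finally show ?thesis unfolding G_pot_eq_lborel norm_mult norm_divide by (simp add: field_simps)
  qed
  then show ?thesis using that[of "16 * M"] M by simp
qed

lemma continuous_on_G_pot: "continuous_on (ball 0 1) (G_pot g)"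
proof (subst continuous_on_sequentially, intro ballI allI impI, elim conjE)
  fix z :: complex and x :: "nat \<Rightarrow> complex"
  assume z: "z \<in> ball 0 1" and x: "\<forall>n. x n \<in> ball 0 1" "x \<longlonglongrightarrow> z"
  obtain M where M: "M > 0" "\<And>\<zeta>. norm (\<gamma> \<zeta>) \<le> M" using density_bounded by blast
  have "(\<lambda>n. \<integral>\<zeta>. of_real (biharmonic_G (x n) \<zeta>) * \<gamma> \<zeta> \<partial>lborel) \<longlonglongrightarrow> (\<integral>\<zeta>. of_real (biharmonic_G z \<zeta>) * \<gamma> \<zeta> \<partial>lborel)"
  proof (rule integral_dominated_convergence[where w = "\<lambda>\<zeta>. indicator (ball 0 1) \<zeta> *\<^sub>R (16 * M)"])
    show "(\<lambda>\<zeta>. of_real (biharmonic_G z \<zeta>) * \<gamma> \<zeta>) \<in> borel_measurable lborel" for z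
      using borel_measurable_biharmonic_G(2) density_measurable by measurable
    then show "(\<lambda>\<zeta>. of_real (biharmonic_G (x n) \<zeta>) * \<gamma> \<zeta>) \<in> borel_measurable lborel" for n .
    show "integrable lborel (\<lambda>\<zeta>::complex. indicator (ball 0 1) \<zeta> *\<^sub>R (16 * M))"
      by (intro integrable_scaleR_left integrable_real_indicator) (auto simp: emeasure_lborel_unit_disk)
    show "AE \<zeta> in lborel. (\<lambda>n. of_real (biharmonic_G (x n) \<zeta>) * \<gamma> \<zeta>) \<longlonglongrightarrow> of_real (biharmonic_G z \<zeta>) * \<gamma> \<zeta>"
    proof (intro AE_I2)
      fix \<zeta>
      show "(\<lambda>n. of_real (biharmonic_G (x n) \<zeta>) * \<gamma> \<zeta>) \<longlonglongrightarrow> of_real (biharmonic_G z \<zeta>) * \<gamma> \<zeta>"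
      proof (cases "\<zeta> \<in> ball 0 1")
        case True
        then have "(\<lambda>n. biharmonic_G (x n) \<zeta>) \<longlonglongrightarrow> biharmonic_G z \<zeta>"
          by (intro continuous_on_tendsto_compose[OF continuous_on_biharmonic_G x(2) z]) (use x in auto)
        then show ?thesis by (intro tendsto_intros)
      qed (simp add: \<gamma>_def)
    qed
    show "AE \<zeta> in lborel. norm (of_real (biharmonic_G (x n) \<zeta>) * \<gamma> \<zeta>) \<le> indicator (ball 0 1) \<zeta> *\<^sub>R (16 * M)" for n
    proof (intro AE_I2)
      fix \<zeta>
      show "norm (of_real (biharmonic_G (x n) \<zeta>) * \<gamma> \<zeta>) \<le> indicator (ball 0 1) \<zeta> *\<^sub>R (16 * M)"
      proof (cases "\<zeta> \<in> ball 0 1")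
        case True
        have xn: "cmod (x n) < 1" using x(1) by simp
        have "(1 - (cmod (x n))\<^sup>2)\<^sup>2 \<le> 1"
          using xn by (intro power_le_one) (auto simp: abs_square_le_1)
        then have "\<bar>biharmonic_G (x n) \<zeta>\<bar> \<le> 16" using biharmonic_G_bound[OF xn, of \<zeta>] True by simp
        then have "norm (of_real (biharmonic_G (x n) \<zeta>) * \<gamma> \<zeta>) \<le> 16 * M"
          unfolding norm_mult norm_of_real using M by (intro mult_mono) auto
        then show ?thesis using True by simp
      qed (simp add: \<gamma>_def)
    qed
  qed
  then show "(G_pot g \<circ> x) \<longlonglongrightarrow> G_pot g z"
    unfolding o_def G_pot_eq_lborel by (intro tendsto_mult_left)
qed

text \<open>G is bounded by 16 on the disk, so the double integral converges absolutely. Fubini lets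
  the inner integral run over the first variable of G, where \<open>green_representation\<close>
  evaluates it.\<close>

lemma bilaplacian_G_pot:
  assumes \<psi>: "disk_test \<psi>"
  shows "(LINT z:ball 0 1|lborel. G_pot g z * laplacian (laplacian \<psi>) z) = - (LINT z:ball 0 1|lborel. g z * \<psi> z)"
proof -
  let ?L = "laplacian (laplacian \<psi>)"
  obtain M where M: "M > 0" "\<And>\<zeta>. norm (\<gamma> \<zeta>) \<le> M" using density_bounded by blast
  obtain K where K: "compact K" "\<And>z. z \<notin> K \<Longrightarrow> ?L z = 0" using disk_testD[OF \<psi>] by metis
  obtain M' where M': "M' > 0" "\<And>z. norm (?L z) \<le> M'"
    using compact_support_bounded[OF disk_test_continuous(2)[OF \<psi>] K] by blast
  define \<Phi> where "\<Phi> z \<zeta> = indicator (ball 0 1) z *\<^sub>R (of_real (biharmonic_G z \<zeta>) * \<gamma> \<zeta> * ?L z)" for z \<zeta>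
  have Lm: "?L \<in> borel_measurable borel" by (intro borel_measurable_continuous_onI disk_test_continuous(2)[OF \<psi>])
  have int: "integrable (lborel \<Otimes>\<^sub>M lborel) (case_prod \<Phi>)"
  proof (rule integrableI_bounded_set[where A = "ball 0 1 \<times> ball 0 1" and B = "16 * M * M'"])
    show "emeasure (lborel \<Otimes>\<^sub>M lborel) (ball (0::complex) 1 \<times> ball (0::complex) 1) < \<infinity>"
      by (subst lborel.emeasure_pair_measure_Times) (auto simp: emeasure_lborel_unit_disk ennreal_mult[symmetric])
    have [measurable]: "(\<lambda>p. biharmonic_G (fst p) (snd p)) \<in> borel_measurable (lborel \<Otimes>\<^sub>M lborel)"
      using borel_measurable_biharmonic_G(1) by (simp cong: measurable_cong_sets sets_pair_measure_cong)
    have [measurable]: "(\<lambda>x. \<gamma> (snd x)) \<in> borel_measurable (lborel \<Otimes>\<^sub>M lborel)" "(\<lambda>x. ?L (fst x)) \<in> borel_measurable (lborel \<Otimes>\<^sub>M lborel)"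
      by (rule measurable_compose[OF measurable_snd], use density_measurable in simp)
        (rule measurable_compose[OF measurable_fst], use Lm in simp)
    have [measurable]: "(\<lambda>x. indicat_real (ball (0::complex) 1) (fst x)) \<in> borel_measurable (lborel \<Otimes>\<^sub>M lborel)"
    proof -
      have "indicat_real (ball (0::complex) 1) \<in> borel_measurable lborel"
        by (rule borel_measurable_indicator) simp
      from measurable_compose[OF measurable_fst this] show ?thesis .
    qed
    show "case_prod \<Phi> \<in> borel_measurable (lborel \<Otimes>\<^sub>M lborel)"
      unfolding \<Phi>_def case_prod_beta' by measurable
    show "AE x in lborel \<Otimes>\<^sub>M lborel. x \<in> ball 0 1 \<times> ball 0 1 \<longrightarrow> norm (case_prod \<Phi> x) \<le> 16 * M * M'"
    proof (intro AE_I2 impI)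
      fix x :: "complex \<times> complex" assume "x \<in> ball 0 1 \<times> ball 0 1"
      then obtain z \<zeta> where x: "x = (z, \<zeta>)" "cmod z < 1" "cmod \<zeta> < 1" by auto
      have "(1 - (cmod z)\<^sup>2)\<^sup>2 \<le> 1" using x by (intro power_le_one) (auto simp: abs_square_le_1)
      then have "\<bar>biharmonic_G z \<zeta>\<bar> \<le> 16" using biharmonic_G_bound[OF x(2,3)] by simp
      then have "\<bar>biharmonic_G z \<zeta>\<bar> * norm (\<gamma> \<zeta>) * norm (?L z) \<le> 16 * M * M'"
        using M M' by (intro mult_mono) auto
      then show "norm (case_prod \<Phi> x) \<le> 16 * M * M'" using x by (simp add: \<Phi>_def norm_mult)
    qed
    show "AE x in lborel \<Otimes>\<^sub>M lborel. x \<notin> ball 0 1 \<times> ball 0 1 \<longrightarrow> case_prod \<Phi> x = 0"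
      by (intro AE_I2) (auto simp: \<Phi>_def \<gamma>_def indicator_def)
  qed auto
  have G: "(\<integral>\<zeta>. \<Phi> z \<zeta> \<partial>lborel) = of_real pi * (indicator (ball 0 1) z *\<^sub>R (G_pot g z * ?L z))" for z
  proof -
    have "(\<integral>\<zeta>. \<Phi> z \<zeta> \<partial>lborel) = indicator (ball 0 1) z *\<^sub>R ((\<integral>\<zeta>. of_real (biharmonic_G z \<zeta>) * \<gamma> \<zeta> \<partial>lborel) * ?L z)"
      unfolding \<Phi>_def by simp
    then show ?thesis unfolding G_pot_eq_lborel by simp
  qed
  have H: "(\<integral>z. \<Phi> z \<zeta> \<partial>lborel) = - (of_real pi * (indicator (ball 0 1) \<zeta> *\<^sub>R (g \<zeta> * \<psi> \<zeta>)))" for \<zeta>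
  proof (cases "\<zeta> \<in> ball 0 1")
    case True
    have "\<Phi> z \<zeta> = \<gamma> \<zeta> * (indicator (ball 0 1) z *\<^sub>R (of_real (biharmonic_G z \<zeta>) * ?L z))" for z
      by (simp add: \<Phi>_def mult_ac)
    then have "(\<integral>z. \<Phi> z \<zeta> \<partial>lborel) = \<gamma> \<zeta> * (LINT z:ball 0 1|lborel. of_real (biharmonic_G z \<zeta>) * ?L z)"
      by (simp only: set_lebesgue_integral_def integral_mult_right_zero)
    also have "\<dots> = \<gamma> \<zeta> * - (of_real pi * \<psi> \<zeta>)" using green_representation[OF \<psi>, of \<zeta>] True by simp
    finally show ?thesis using True by (simp add: \<gamma>_def)
  qed (simp add: \<Phi>_def \<gamma>_def)
  have "(\<integral>z. (\<integral>\<zeta>. \<Phi> z \<zeta> \<partial>lborel) \<partial>lborel) = (\<integral>\<zeta>. (\<integral>z. \<Phi> z \<zeta> \<partial>lborel) \<partial>lborel)"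
    using lborel_pair.Fubini_integral[OF int] by simp
  then have "of_real pi * (LINT z:ball 0 1|lborel. G_pot g z * ?L z) = - (of_real pi * (LINT z:ball 0 1|lborel. g z * \<psi> z))"
    unfolding G H set_lebesgue_integral_def Bochner_Integration.integral_minus integral_mult_right_zero .
  then have "of_real pi * (LINT z:ball 0 1|lborel. G_pot g z * ?L z) = of_real pi * (- (LINT z:ball 0 1|lborel. g z * \<psi> z))"
    by (simp only: mult_minus_right)
  then show ?thesis by (rule mult_left_cancel[THEN iffD1, rotated]) simp
qed

lemma solves_green: "solves_biharmonic_dirichlet g (\<lambda>_. 0) (\<lambda>_. 0) (\<lambda>z. - G_pot g z)"
proof -
  have cG: "continuous_on (ball 0 1) (\<lambda>z. - G_pot g z)" by (intro continuous_intros continuous_on_G_pot)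
  have cg: "continuous_on (ball 0 1) g" by (rule continuous_on_subset[OF g ball_subset_cball])
  have "bilaplacian_eq (\<lambda>z. - G_pot g z) g"
    unfolding bilaplacian_eq_def
  proof (intro conjI allI impI)
    show "locally_integrable_disk (\<lambda>z. - G_pot g z)" "locally_integrable_disk g"
      by (intro continuous_imp_locally_integrable_disk cG cg)+
    fix \<psi> assume \<psi>: "disk_test \<psi>"
    have "(LINT z:ball 0 1|lborel. - G_pot g z * laplacian (laplacian \<psi>) z) = - (LINT z:ball 0 1|lborel. G_pot g z * laplacian (laplacian \<psi>) z)"
      by (simp add: set_lebesgue_integral_def)
    then show "disk_integral (\<lambda>z. - G_pot g z * laplacian (laplacian \<psi>) z) = disk_integral (\<lambda>z. g z * \<psi> z)"
      using bilaplacian_G_pot[OF \<psi>] disk_integral_eq_lborel[OF continuous_on_mult[OF cG disk_test_continuous(2)[OF \<psi>]]]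
        disk_integral_eq_lborel[OF continuous_on_mult[OF cg disk_test_continuous(1)[OF \<psi>]]] by simp
  qed
  moreover have "boundary_value (\<lambda>z. - G_pot g z) (\<lambda>_. 0) \<and> boundary_normal_deriv (\<lambda>z. - G_pot g z) (\<lambda>_. 0) (\<lambda>_. 0)"
  proof -
    obtain C where C: "C > 0" "\<And>z. cmod z < 1 \<Longrightarrow> norm (G_pot g z) \<le> C * (1 - (cmod z)\<^sup>2)\<^sup>2" using norm_G_pot_le by blast
    have *: "((\<lambda>r. circle_dist_of_fun (dilate (\<lambda>z. - G_pot g z) r) \<phi>) \<longlongrightarrow> 0) (at_left 1) \<and>
      ((\<lambda>r. (circle_dist_of_fun (dilate (\<lambda>z. - G_pot g z) r) \<phi> - 0) / of_real (1 - r)) \<longlongrightarrow> 0) (at_left 1)"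
      if \<phi>: "circle_test \<phi>" for \<phi>
    proof -
      have c\<phi>: "continuous_on S (\<lambda>t. \<phi> (cis t))" for S
        using \<phi> smooth_on_continuous continuous_on_subset unfolding circle_test_def by blast
      have "bounded ((\<lambda>t. \<phi> (cis t)) ` {0..2*pi})" by (intro compact_imp_bounded compact_continuous_image c\<phi>) auto
      then obtain B where B: "\<And>t. t \<in> {0..2*pi} \<Longrightarrow> norm (\<phi> (cis t)) \<le> B" unfolding bounded_iff by blast
      have B0: "B \<ge> 0" by (rule order_trans[OF norm_ge_zero B[of 0]]) simp
      let ?I = "\<lambda>r. circle_dist_of_fun (dilate (\<lambda>z. - G_pot g z) r) \<phi>"
      \<comment> \<open>The 4 comes from (1 - r^2)^2 \<le> 4 (1 - r)^2. The decay is quadratic, so a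
        factor 1 - r survives in the difference quotient.\<close>
      have bd: "norm (?I r) \<le> C * B * (4 * (1 - r)\<^sup>2)" if r: "0 < r" "r < 1" for r
      proof -
        have "norm (integral {0..2*pi} (\<lambda>t. - G_pot g (of_real r * cis t) * \<phi> (cis t))) \<le> (C * (1 - r\<^sup>2)\<^sup>2 * B) * (2 * pi - 0)"
        proof (rule integral_bound)
          show "continuous_on {0..2*pi} (\<lambda>t. - G_pot g (of_real r * cis t) * \<phi> (cis t))"
            using r by (intro continuous_on_mult continuous_on_minus continuous_on_compose2[OF continuous_on_G_pot] c\<phi> continuous_intros) (auto simp: norm_mult)
          fix t assume t: "t \<in> {0..2*pi}"
          have "norm (G_pot g (of_real r * cis t)) \<le> C * (1 - r\<^sup>2)\<^sup>2" using C(2)[of "of_real r * cis t"] r by (simp add: norm_mult)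
          then show "norm (- G_pot g (of_real r * cis t) * \<phi> (cis t)) \<le> C * (1 - r\<^sup>2)\<^sup>2 * B"
            unfolding norm_mult norm_minus_cancel using B[OF t] B0 C(1) by (intro mult_mono) auto
        qed auto
        then have "norm (?I r) \<le> C * (1 - r\<^sup>2)\<^sup>2 * B"
          by (simp add: circle_dist_of_fun_def dilate_def norm_mult norm_divide field_simps)
        also have "(1 - r\<^sup>2)\<^sup>2 = (1 - r)\<^sup>2 * (1 + r)\<^sup>2" by (simp add: power2_eq_square algebra_simps)
        also have "\<dots> \<le> (1 - r)\<^sup>2 * 2\<^sup>2" using r by (intro mult_left_mono power_mono) auto
        finally show ?thesis using C(1) B0 by (simp add: mult_ac mult_right_mono)
      qed
      have l1: "((\<lambda>r::real. C * B * (4 * (1 - r)\<^sup>2)) \<longlongrightarrow> 0) (at_left 1)" and l2: "((\<lambda>r::real. C * B * (4 * (1 - r))) \<longlongrightarrow> 0) (at_left 1)"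
        by (rule tendsto_eq_intros refl | simp)+
      have "(?I \<longlongrightarrow> 0) (at_left 1)"
        by (rule Lim_null_comparison[OF _ l1]) (use eventually_at_left_1 bd in \<open>auto elim: eventually_mono\<close>)
      moreover have "((\<lambda>r. (?I r - 0) / of_real (1 - r)) \<longlongrightarrow> 0) (at_left 1)"
      proof (rule Lim_null_comparison[OF _ l2], rule eventually_mono[OF eventually_at_left_1])
        fix r :: real assume r: "0 < r \<and> r < 1"
        have "norm ((?I r - 0) / of_real (1 - r)) = norm (?I r) / (1 - r)"
          using r by (simp add: norm_divide del: of_real_diff)
        also have "\<dots> \<le> (C * B * (4 * (1 - r)\<^sup>2)) / (1 - r)" using bd r by (intro divide_right_mono) auto
        also have "\<dots> = C * B * (4 * (1 - r))" using r by (simp add: power2_eq_square)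
        finally show "norm ((?I r - 0) / of_real (1 - r)) \<le> C * B * (4 * (1 - r))" .
      qed
      ultimately show ?thesis by blast
    qed
    then show ?thesis unfolding boundary_value_def boundary_normal_deriv_def circle_dist_tendsto_def by blast
  qed
  ultimately show ?thesis using cG by (simp add: solves_biharmonic_dirichlet_def)
qed

end

section \<open>Smooth bump functions and antiderivatives\<close>

lemma smooth_on_Un: "smooth_on S f \<Longrightarrow> smooth_on T f \<Longrightarrow> smooth_on (S \<union> T) f"
  unfolding smooth_on_def by blast

text \<open>If differentiating a member leads to a combination of later members, all members are
  smooth: induct on the order for all indices at once. Used for \<open>flat_fun\<close> and for the
  powers of 1 / x.\<close>

lemma smooth_on_recursive_family:
  fixes F :: "nat \<Rightarrow> real \<Rightarrow> complex"
  assumes S: "open S" and D: "\<And>n x. x \<in> S \<Longrightarrow> (F n has_vector_derivative a n * F (n + 1) x + b n * F (n + 2) x) (at x)"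
  shows "smooth_on S (F n)"
proof -
  have "diff_order m S (F n)" for m
  proof (induction m arbitrary: n)
    case 0
    then show ?case using D by (auto simp: has_vector_derivative_def differentiable_def)
  next
    case (Suc m)
    have "diff_order m S (\<lambda>x. a n * F (n + 1) x + b n * F (n + 2) x)"
      by (intro diff_order_add diff_order_mult diff_order_const Suc S)
    then have "diff_order m S (\<lambda>x. frechet_derivative (F n) (at x) 1)"
      by (rule diff_order_cong[OF S, rotated]) (use frechet_derivative_real[OF D] in simp)
    moreover have "F n differentiable (at x)" if "x \<in> S" for x
      using D[OF that] by (auto simp: has_vector_derivative_def differentiable_def)
    ultimately show ?case by simp
  qed
  then show ?thesis by (simp add: smooth_on_iff_diff_order)
qed

text \<open>The classical flat function exp (- 1 / x) with powers of 1 / x attached: the derivative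
  of member n combines the members n + 1 and n + 2, which is the shape that
  \<open>smooth_on_recursive_family\<close> asks for.\<close>

definition flat_fun :: "nat \<Rightarrow> real \<Rightarrow> real" where
  "flat_fun n x = (if x > 0 then (1 / x) ^ n * exp (- (1 / x)) else 0)"

text \<open>With y = 1 / x, exp y exceeds its single Taylor term of degree n + 2. The two extra
  powers become the factor x^2, which makes the derivative at 0 vanish.\<close>

lemma abs_flat_fun_le: "\<bar>flat_fun n x\<bar> \<le> fact (n + 2) * x\<^sup>2"
proof (cases "x > 0")
  case True
  define y where "y = 1 / x"
  have y: "y > 0" "x = 1 / y" using True by (auto simp: y_def)
  have "y ^ (n + 2) / fact (n + 2) \<le> exp y"
  proof -
    have "(\<lambda>k. y ^ k /\<^sub>R fact k) sums exp y" by (rule exp_converges)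
    then have s: "(\<lambda>k. y ^ k / fact k) sums exp y" by (simp add: field_simps)
    have "(\<Sum>k\<in>{n + 2}. y ^ k / fact k) \<le> exp y"
      by (rule sum_le_suminf[OF sums_summable[OF s], unfolded sums_unique[OF s, symmetric]]) (use y in auto)
    then show ?thesis by simp
  qed
  then have "y ^ (n + 2) \<le> fact (n + 2) * exp y" by (simp add: divide_le_eq mult.commute)
  then have "y ^ (n + 2) * exp (- y) \<le> fact (n + 2) * exp y * exp (- y)"
    by (rule mult_right_mono) simp
  also have "\<dots> = fact (n + 2)" by (simp add: mult.assoc flip: exp_add)
  finally have "y ^ n * y\<^sup>2 * exp (- y) \<le> fact (n + 2)" by (simp only: power_add)
  then have "y ^ n * exp (- y) \<le> fact (n + 2) / y\<^sup>2" using y by (simp add: le_divide_eq mult_ac)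
  then show ?thesis using True y by (simp add: flat_fun_def y_def[symmetric] power_divide)
qed (simp add: flat_fun_def)

lemma inverse_power_has_derivative:
  fixes x :: real
  assumes x: "x > 0"
  shows "((\<lambda>x. (1 / x) ^ n) has_real_derivative - real n * (1 / x) ^ (n + 1)) (at x)"
proof -
  have "((\<lambda>x. 1 / x) has_real_derivative - ((1 / x) * (1 / x))) (at x)"
    using x by (auto intro!: derivative_eq_intros)
  from DERIV_power[OF this, of n]
  have "((\<lambda>x. (1 / x) ^ n) has_real_derivative real n * (- ((1 / x) * (1 / x)) * (1 / x) ^ (n - Suc 0))) (at x)" by simp
  moreover have "real n * (- (y * y) * y ^ (n - Suc 0)) = - real n * y ^ (n + 1)" for y :: real
    by (cases n) (simp_all add: algebra_simps)
  ultimately show ?thesis by (simp only:)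
qed

lemma flat_fun_has_derivative:
  "((\<lambda>x. complex_of_real (flat_fun n x)) has_vector_derivative
     (- of_nat n) * of_real (flat_fun (n + 1) x) + 1 * of_real (flat_fun (n + 2) x)) (at x)"
proof -
  have "(flat_fun n has_real_derivative - real n * flat_fun (n + 1) x + flat_fun (n + 2) x) (at x)"
  proof (cases "x = 0")
    case True
    have "((\<lambda>h. (flat_fun n (0 + h) - flat_fun n 0) / h) \<longlongrightarrow> 0) (at 0)"
    proof (rule Lim_null_comparison)
      show "\<forall>\<^sub>F h in at 0. norm ((flat_fun n (0 + h) - flat_fun n 0) / h) \<le> fact (n + 2) * \<bar>h\<bar>"
      proof (rule eventually_mono[OF eventually_at_filter[THEN iffD2, OF always_eventually]])
        show "\<forall>h. h \<noteq> 0 \<longrightarrow> h \<in> UNIV \<longrightarrow> h \<noteq> (0::real)" by simp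
        fix h :: real assume "h \<noteq> 0"
        have "\<bar>flat_fun n h\<bar> / \<bar>h\<bar> \<le> (fact (n + 2) * h\<^sup>2) / \<bar>h\<bar>"
          by (intro divide_right_mono abs_flat_fun_le) simp
        also have "\<dots> = fact (n + 2) * \<bar>h\<bar>" using \<open>h \<noteq> 0\<close> by (simp add: power2_eq_square abs_if)
        finally show "norm ((flat_fun n (0 + h) - flat_fun n 0) / h) \<le> fact (n + 2) * \<bar>h\<bar>"
          by (simp add: flat_fun_def)
      qed
      show "((\<lambda>h::real. fact (n + 2) * \<bar>h\<bar>) \<longlongrightarrow> 0) (at 0)" by (rule tendsto_eq_intros refl | simp)+
    qed
    then have "(flat_fun n has_real_derivative 0) (at 0)" by (simp add: DERIV_def)
    then show ?thesis using True by (simp add: flat_fun_def)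
  next
    case False
    show ?thesis
    proof (cases "x > 0")
      case True
      note D = inverse_power_has_derivative[OF True, of n]
      have "((\<lambda>x. 1 / x) has_real_derivative - (1 / x\<^sup>2)) (at x)"
        using True by (auto intro!: derivative_eq_intros simp: power2_eq_square)
      then have "((\<lambda>x. (1 / x) ^ n * exp (- (1 / x))) has_real_derivative
          (- real n * (1 / x) ^ (n + 1)) * exp (- (1 / x)) + (exp (- (1 / x)) * (- (- (1 / x\<^sup>2)))) * (1 / x) ^ n) (at x)"
        by (intro DERIV_mult D DERIV_fun_exp DERIV_minus)
      moreover have "(- real n * (1 / x) ^ (n + 1)) * exp (- (1 / x)) + (exp (- (1 / x)) * (- (- (1 / x\<^sup>2)))) * (1 / x) ^ n =
         - real n * flat_fun (n + 1) x + flat_fun (n + 2) x"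
      proof -
        have "flat_fun (n + 1) x = (1 / x) ^ (n + 1) * exp (- (1 / x))" using True by (simp add: flat_fun_def)
        moreover have "flat_fun (n + 2) x = (1 / x) ^ n * (1 / x\<^sup>2) * exp (- (1 / x))"
          using True by (simp add: flat_fun_def power2_eq_square)
        ultimately show ?thesis by (simp only: minus_minus mult.assoc mult.commute mult.left_commute)
      qed
      ultimately have "((\<lambda>x. (1 / x) ^ n * exp (- (1 / x))) has_real_derivative - real n * flat_fun (n + 1) x + flat_fun (n + 2) x) (at x)"
        by simp
      then show ?thesis
        by (rule has_field_derivative_transform_within_open[where S = "{0<..}"]) (use True in \<open>auto simp: flat_fun_def\<close>)
    next
      case neg: False
      have "((\<lambda>_. 0) has_real_derivative 0) (at x)" by simp
      then have "(flat_fun n has_real_derivative 0) (at x)"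
        by (rule has_field_derivative_transform_within_open[where S = "{..<0}"]) (use False neg in \<open>auto simp: flat_fun_def\<close>)
      then show ?thesis using neg by (simp add: flat_fun_def)
    qed
  qed
  from has_vector_derivative_of_real[OF this] show ?thesis by simp
qed

lemma smooth_on_flat_fun: "smooth_on UNIV (\<lambda>x. complex_of_real (flat_fun n x))"
  by (rule smooth_on_recursive_family[where F = "\<lambda>n x. complex_of_real (flat_fun n x)" and a = "\<lambda>n. - of_nat n" and b = "\<lambda>_. 1", OF open_UNIV flat_fun_has_derivative])

lemma smooth_on_real_affine: "smooth_on S (\<lambda>x::real. complex_of_real (a + b * x))"
proof -
  have "bounded_linear (\<lambda>x::real. complex_of_real (b * x))"
    by (intro bounded_linear_compose[OF bounded_linear_of_real] bounded_linear_mult_right)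
  from smooth_on_add[OF open_UNIV smooth_on_const[of UNIV "of_real a"] smooth_on_linear[OF this, of UNIV]]
  have "smooth_on UNIV (\<lambda>x::real. complex_of_real (a + b * x))" by simp
  then show ?thesis by (rule smooth_on_subset) simp
qed

text \<open>The arguments have the literal form \<open>a + b * x\<close> of
  \<open>smooth_on_real_affine\<close>. The bump is not normalised; its mass enters later as
  \<open>m0\<close>.\<close>

definition bump :: "real \<Rightarrow> real" where
  "bump x = flat_fun 0 (1 + 1 * x) * flat_fun 0 (1 + (- 1) * x)"

lemma bump_nonneg: "bump x \<ge> 0"
  by (simp add: bump_def flat_fun_def)

lemma bump_zero: "\<bar>x\<bar> \<ge> 1 \<Longrightarrow> bump x = 0"
  by (auto simp: bump_def flat_fun_def abs_if split: if_splits)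

lemma bump_pos: "\<bar>x\<bar> < 1 \<Longrightarrow> bump x > 0"
  by (auto simp: bump_def flat_fun_def abs_if split: if_splits)

lemma smooth_on_bump: "smooth_on UNIV (\<lambda>x. complex_of_real (bump x))"
  unfolding bump_def of_real_mult
  by (intro smooth_on_mult open_UNIV smooth_on_comp[OF open_UNIV _ smooth_on_flat_fun smooth_on_real_affine]) auto

lemma continuous_on_bump: "continuous_on S bump"
proof -
  have "continuous_on UNIV (\<lambda>x. Re (complex_of_real (bump x)))"
    by (intro continuous_on_Re smooth_on_continuous[OF smooth_on_bump])
  then have "continuous_on UNIV bump" by simp
  then show ?thesis by (rule continuous_on_subset) simp
qed

lemma integrable_bump: "integrable lborel bump"
proof -
  have "integrable lborel (\<lambda>x. indicator {-1..1} x *\<^sub>R bump x)"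
    by (intro borel_integrable_compact continuous_on_bump) auto
  moreover have "(\<lambda>x. indicator {-1..1} x *\<^sub>R bump x) = bump"
  proof
    show "indicator {-1..1} x *\<^sub>R bump x = bump x" for x
      using bump_zero[of x] by (cases "x \<in> {-1..1}") (auto simp: abs_if)
  qed
  ultimately show ?thesis by simp
qed

lemma integral_bump_pos: "(\<integral>x. bump x \<partial>lborel) > 0"
proof -
  have "(\<integral>x. bump x \<partial>lborel) \<noteq> 0"
  proof
    assume "(\<integral>x. bump x \<partial>lborel) = 0"
    then have "AE x in lborel. bump x = 0"
      using integral_nonneg_eq_0_iff_AE[OF integrable_bump] bump_nonneg by auto
    moreover have "AE x in lborel. bump x \<noteq> 0 \<longrightarrow> False" if "AE x in lborel. bump x = 0"
      using that by eventually_elim simp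
    ultimately have "AE x in lborel. x \<notin> {-1<..<1::real}"
      by (elim eventually_mono) (use bump_pos in \<open>force simp: abs_if split: if_splits\<close>)
    then have "{-1<..<1::real} \<in> null_sets lborel" by (subst (asm) AE_iff_null_sets[symmetric]) auto
    then show False by (auto simp: null_sets_def)
  qed
  moreover have "(\<integral>x. bump x \<partial>lborel) \<ge> 0" by (intro integral_nonneg_AE) (simp add: bump_nonneg)
  ultimately show ?thesis by linarith
qed

lemma smooth_on_inverse_power: "smooth_on {0<..} (\<lambda>x. complex_of_real ((1 / x) ^ n))"
proof (rule smooth_on_recursive_family[where F = "\<lambda>n x. complex_of_real ((1 / x) ^ n)" and a = "\<lambda>n. - of_nat n" and b = "\<lambda>_. 0"])
  fix n and x :: real assume "x \<in> {0<..}"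
  then have x: "x > 0" by simp
  have eq: "complex_of_real (- real n * (1 / x) ^ (n + 1)) = - of_nat n * complex_of_real ((1 / x) ^ (n + 1)) + 0 * complex_of_real ((1 / x) ^ (n + 2))"
    by simp
  have "((\<lambda>x. complex_of_real ((1 / x) ^ n)) has_vector_derivative complex_of_real (- real n * (1 / x) ^ (n + 1))) (at x)"
    by (rule has_vector_derivative_of_real[OF inverse_power_has_derivative[OF x]])
  then show "((\<lambda>x. complex_of_real ((1 / x) ^ n)) has_vector_derivative - of_nat n * complex_of_real ((1 / x) ^ (n + 1)) + 0 * complex_of_real ((1 / x) ^ (n + 2))) (at x)"
    by (simp only: eq)
qed simp

text \<open>Integrating from the right endpoint makes A vanish from b on, so that a profile of |z|^2
  built from it has compact support in the plane; to the left of b it may be nonzero.\<close>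

lemma smooth_antiderivative_exists:
  fixes G :: "real \<Rightarrow> complex"
  assumes G: "smooth_on UNIV G" "\<forall>x\<ge>b. G x = 0"
  obtains A where "smooth_on UNIV A" "\<And>x. (A has_vector_derivative G x) (at x)" "\<forall>x\<ge>b. A x = 0"
    "\<And>x. A x = - integral {x..b} G"
proof -
  define A where "A x = - integral {x..b} G" for x
  have cG: "continuous_on S G" for S using smooth_on_continuous[OF G(1)] continuous_on_subset by blast
  have i: "G integrable_on {u..v}" for u v by (rule integrable_continuous_real[OF cG])
  have D: "(A has_vector_derivative G x) (at x)" for x
  proof -
    \<comment> \<open>An interval with both x and b in its interior; on it A is an indefinite
      integral up to a constant.\<close>
    define u v where "u = min (x - 1) (b - 1)" and "v = max (x + 1) (b + 1)"
    have uv: "u < x" "x < v" "u < b" "b < v" by (auto simp: u_def v_def)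
    have "((\<lambda>y. integral {u..y} G) has_vector_derivative G x) (at x within {u..v})"
      by (rule integral_has_vector_derivative[OF cG]) (use uv in auto)
    then have "((\<lambda>y. integral {u..y} G) has_vector_derivative G x) (at x)"
      using uv at_within_interior[of x "{u..v}"] by simp
    then have "((\<lambda>y. integral {u..y} G - integral {u..b} G) has_vector_derivative G x - 0) (at x)"
      by (intro has_vector_derivative_diff has_vector_derivative_const)
    then have "((\<lambda>y. integral {u..y} G - integral {u..b} G) has_vector_derivative G x) (at x)" by simp
    then show ?thesis
    proof (rule has_vector_derivative_transform_within_open)
      fix y assume y: "y \<in> {u<..<v}"
      show "integral {u..y} G - integral {u..b} G = A y"
      proof (cases "y \<le> b")
        case True
        then have "integral {u..y} G + integral {y..b} G = integral {u..b} G"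
          using y i by (intro Henstock_Kurzweil_Integration.integral_combine) auto
        then show ?thesis by (simp add: A_def algebra_simps)
      next
        case False
        then have "integral {u..b} G + integral {b..y} G = integral {u..y} G"
          using uv i by (intro Henstock_Kurzweil_Integration.integral_combine) auto
        moreover have "integral {b..y} G = 0"
          using G(2) by (subst Henstock_Kurzweil_Integration.integral_cong[of _ _ "\<lambda>_. 0"]) auto
        ultimately show ?thesis using False by (simp add: A_def)
      qed
    qed (use uv in auto)
  qed
  have "A x = 0" if "x \<ge> b" for x using that by (cases "x = b") (auto simp: A_def)
  then show ?thesis
    using that[of A] D smooth_on_antiderivative[OF open_UNIV D G(1)] A_def by blast
qed

section \<open>Uniqueness\<close>

text \<open>A weakly affine function satisfies the interpolation identity: test against a combination
  of three bumps whose first two moments vanish and shrink the bumps.\<close>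

lemma weakly_affine_interpolation:
  fixes c :: "real \<Rightarrow> complex"
  assumes c: "continuous_on {0<..<1} c"
    and weak: "\<And>\<omega> a b. 0 < a \<Longrightarrow> a < b \<Longrightarrow> b < 1 \<Longrightarrow> smooth_on UNIV \<omega> \<Longrightarrow> (\<And>x. x \<notin> {a..b} \<Longrightarrow> \<omega> x = 0) \<Longrightarrow>
      (\<integral>x. \<omega> x \<partial>lborel) = 0 \<Longrightarrow> (\<integral>x. of_real x * \<omega> x \<partial>lborel) = 0 \<Longrightarrow>
      (\<integral>x. indicator {0<..<1} x *\<^sub>R (c x * \<omega> x) \<partial>lborel) = 0"
    and x: "0 < x" "x < y" "y < z" "z < 1"
  shows "of_real (z - x) * c y = of_real (z - y) * c x + of_real (y - x) * c z"
proof -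
  \<comment> \<open>Half the distance of the outer nodes to the ends of (0, 1): every bump of
    half-width at most \<delta> stays inside.\<close>
  define \<delta> where "\<delta> = min x (1 - z) / 2"
  have \<delta>: "0 < \<delta>" "0 < x - \<delta>" "z + \<delta> < 1" using x by (auto simp: \<delta>_def min_def field_simps)
  define e where "e n = \<delta> / real (Suc n)" for n
  have e: "0 < e n" "e n \<le> \<delta>" for n using \<delta> by (auto simp: e_def divide_le_eq)
  have elim: "e \<longlonglongrightarrow> 0"
    using tendsto_mult_left[OF LIMSEQ_Suc[OF lim_1_over_n], of \<delta>] by (simp add: e_def[abs_def])
  define C where "C s = indicator {0<..<1} s *\<^sub>R c s" for s
  have Cm[measurable]: "C \<in> borel_measurable borel"
    unfolding C_def using c by (intro borel_measurable_continuous_on_indicator) auto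
  have [measurable]: "bump \<in> borel_measurable borel" by (intro borel_measurable_continuous_onI continuous_on_bump)
  define B where "B p n s = complex_of_real (bump ((s - p) / e n))" for p n s
  have Bsupp: "B p n s = 0" if "\<bar>s - p\<bar> \<ge> e n" for p n s
  proof -
    have "\<bar>(s - p) / e n\<bar> \<ge> 1" using that e(1)[of n] by (simp add: le_divide_eq)
    then show ?thesis by (simp add: B_def bump_zero)
  qed
  have Bsupp': "B p n s = 0" if "s \<notin> {p - e n..p + e n}" for p n s
    by (rule Bsupp) (use that in \<open>unfold atLeastAtMost_iff, arith\<close>)
  have Bsmooth: "smooth_on UNIV (B p n)" for p n
  proof -
    have "smooth_on UNIV (\<lambda>s. complex_of_real (bump (- (p / e n) + (1 / e n) * s)))"
      by (rule smooth_on_comp[OF open_UNIV UNIV_I smooth_on_bump smooth_on_real_affine])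
    moreover have "- (p / e n) + (1 / e n) * s = (s - p) / e n" for s by (simp add: diff_divide_distrib)
    ultimately show ?thesis by (simp add: B_def[abs_def])
  qed
  define m0 where "m0 = complex_of_real (\<integral>u. bump u \<partial>lborel)"
  have m0: "m0 \<noteq> 0" using integral_bump_pos by (simp add: m0_def)
  define m1 where "m1 = (\<integral>u. of_real u * complex_of_real (bump u) \<partial>lborel)"
  have cB: "continuous_on UNIV (B p n)" for p n by (rule smooth_on_continuous[OF Bsmooth])
  have iB: "integrable lborel (\<lambda>s. F s * B p n s)" if "continuous_on UNIV F" for F p n
  proof (rule integrable_compact_support)
    show "continuous_on UNIV (\<lambda>s. F s * B p n s)" by (intro continuous_intros that cB)
    show "F s * B p n s = 0" if "s \<notin> {p - e n..p + e n}" for s using Bsupp'[OF that] by simp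
  qed simp
  have sub: "(\<integral>s. F s * B p n s \<partial>lborel) = of_real (e n) * (\<integral>u. F (p + e n * u) * of_real (bump u) \<partial>lborel)" for F p n
    using lborel_integral_real_affine[of "e n" "\<lambda>s. F s * B p n s" p] e(1)[of n] by (simp add: B_def scaleR_conv_of_real)
  have ib: "integrable lborel (\<lambda>u. complex_of_real (bump u))" using integrable_bump by simp
  have iub: "integrable lborel (\<lambda>u. of_real u * complex_of_real (bump u))"
  proof (rule integrable_compact_support[of _ "{-1..1}"])
    show "continuous_on UNIV (\<lambda>u. complex_of_real u * complex_of_real (bump u))" by (intro continuous_intros continuous_on_bump)
    show "complex_of_real u * complex_of_real (bump u) = 0" if "u \<notin> {-1..1}" for u using bump_zero[of u] that by (auto simp: abs_if)
  qed simp
  have mom0: "(\<integral>s. B p n s \<partial>lborel) = of_real (e n) * m0" for p n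
    using sub[of "\<lambda>_. 1" p n] by (simp add: m0_def)
  have mom1: "(\<integral>s. of_real s * B p n s \<partial>lborel) = of_real (e n) * (of_real p * m0 + of_real (e n) * m1)" for p n
  proof -
    have "(\<integral>u. of_real (p + e n * u) * complex_of_real (bump u) \<partial>lborel) =
        (\<integral>u. of_real p * complex_of_real (bump u) + of_real (e n) * (of_real u * complex_of_real (bump u)) \<partial>lborel)"
      by (intro Bochner_Integration.integral_cong) (auto simp: algebra_simps)
    also have "\<dots> = of_real p * m0 + of_real (e n) * m1"
      using ib iub by (simp add: m0_def m1_def del: of_real_mult)
    finally show ?thesis using sub[of complex_of_real p n] by simp
  qed
  define J where "J p n = (\<integral>u. C (p + e n * u) * of_real (bump u) \<partial>lborel)" for p n
  have Jlim: "J p \<longlonglongrightarrow> c p * m0" if p: "x \<le> p" "p \<le> z" for p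
  proof -
    have sub1: "{p - \<delta>..p + \<delta>} \<subseteq> {0<..<1}" using p \<delta> by auto
    have "bounded (c ` {p - \<delta>..p + \<delta>})"
      by (intro compact_imp_bounded compact_continuous_image continuous_on_subset[OF c sub1]) simp
    then obtain M where M: "\<And>s. s \<in> {p - \<delta>..p + \<delta>} \<Longrightarrow> norm (c s) \<le> M" unfolding bounded_iff by blast
    have "(\<lambda>n. \<integral>u. C (p + e n * u) * of_real (bump u) \<partial>lborel) \<longlonglongrightarrow> (\<integral>u. c p * of_real (bump u) \<partial>lborel)"
    proof (rule integral_dominated_convergence[where w = "\<lambda>u. M * bump u"])
      show "integrable lborel (\<lambda>u. M * bump u)" using integrable_bump by simp
      show "AE u in lborel. (\<lambda>n. C (p + e n * u) * of_real (bump u)) \<longlonglongrightarrow> c p * of_real (bump u)"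
      proof (intro AE_I2 tendsto_mult_right)
        fix u
        have "(\<lambda>n. p + e n * u) \<longlonglongrightarrow> p + 0 * u" by (intro tendsto_intros elim)
        then have l: "(\<lambda>n. p + e n * u) \<longlonglongrightarrow> p" by simp
        have p01: "p \<in> {0<..<1}" using p x by auto
        have ev: "\<forall>\<^sub>F n in sequentially. p + e n * u \<in> {0<..<1}"
          by (rule topological_tendstoD[OF l _ p01]) simp
        have "(\<lambda>n. c (p + e n * u)) \<longlonglongrightarrow> c p" by (rule continuous_on_tendsto_compose[OF c l p01 ev])
        then show "(\<lambda>n. C (p + e n * u)) \<longlonglongrightarrow> c p"
          by (rule Lim_transform_eventually) (use ev in \<open>auto elim!: eventually_mono simp: C_def\<close>)
      qed
      show "AE u in lborel. norm (C (p + e n * u) * of_real (bump u)) \<le> M * bump u" for n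
      proof (intro AE_I2)
        fix u
        show "norm (C (p + e n * u) * of_real (bump u)) \<le> M * bump u"
        proof (cases "\<bar>u\<bar> < 1")
          case True
          have "\<bar>e n * u\<bar> \<le> \<delta> * 1" unfolding abs_mult using True e[of n] by (intro mult_mono) auto
          then have s: "p + e n * u \<in> {p - \<delta>..p + \<delta>}" by (auto simp: abs_le_iff)
          have "norm (C (p + e n * u)) \<le> M"
            unfolding C_def using M[OF s] subsetD[OF sub1 s] by (simp only: indicator_simps scaleR_one)
          then show ?thesis unfolding norm_mult norm_of_real abs_of_nonneg[OF bump_nonneg] by (intro mult_right_mono bump_nonneg)
        qed (simp add: bump_zero)
      qed
    qed measurable
    then show ?thesis by (simp add: J_def[abs_def] m0_def)
  qed
  have J0: "of_real (z - y) * J x n + of_real (y - x) * J z n = of_real (z - x) * J y n" for n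
  proof -
    \<comment> \<open>The three coefficients sum to 0, and so do their products with the nodes. All
      three bumps have the same shape, so the terms with \<open>m1\<close> cancel too and both
      moments of \<omega> vanish.\<close>
    define \<omega> where "\<omega> s = of_real (z - y) * B x n s + of_real (y - x) * B z n s + of_real (x - z) * B y n s" for s
    have sm: "smooth_on UNIV \<omega>"
      unfolding \<omega>_def[abs_def] by (intro smooth_on_add smooth_on_mult smooth_on_const open_UNIV Bsmooth)
    have supp: "\<omega> s = 0" if "s \<notin> {x - \<delta>..z + \<delta>}" for s
    proof -
      have "\<bar>s - x\<bar> \<ge> e n" "\<bar>s - y\<bar> \<ge> e n" "\<bar>s - z\<bar> \<ge> e n" using that e(2)[of n] x by (auto simp: abs_if)
      then show ?thesis by (simp add: \<omega>_def Bsupp)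
    qed
    have i0: "integrable lborel (B p n)" for p using iB[of "\<lambda>_. 1" p n] by simp
    have i1: "integrable lborel (\<lambda>s. of_real s * B p n s)" for p by (intro iB continuous_intros)
    have "(\<integral>s. \<omega> s \<partial>lborel) = of_real (z - y) * (of_real (e n) * m0) + of_real (y - x) * (of_real (e n) * m0) + of_real (x - z) * (of_real (e n) * m0)"
      unfolding \<omega>_def using i0 mom0 by simp
    also have "\<dots> = 0" by (simp add: algebra_simps)
    finally have 0: "(\<integral>s. \<omega> s \<partial>lborel) = 0" .
    have "(\<integral>s. of_real s * \<omega> s \<partial>lborel) = (\<integral>s. of_real (z - y) * (of_real s * B x n s) + of_real (y - x) * (of_real s * B z n s) + of_real (x - z) * (of_real s * B y n s) \<partial>lborel)"
      by (intro Bochner_Integration.integral_cong) (auto simp: \<omega>_def algebra_simps)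
    also have "\<dots> = of_real (z - y) * (\<integral>s. of_real s * B x n s \<partial>lborel) + of_real (y - x) * (\<integral>s. of_real s * B z n s \<partial>lborel) + of_real (x - z) * (\<integral>s. of_real s * B y n s \<partial>lborel)"
      using i1 by simp
    also have "\<dots> = 0" unfolding mom1 by (simp add: algebra_simps)
    finally have 1: "(\<integral>s. of_real s * \<omega> s \<partial>lborel) = 0" .
    have w: "(\<integral>s. indicator {0<..<1} s *\<^sub>R (c s * \<omega> s) \<partial>lborel) = 0"
      by (rule weak[of "x - \<delta>" "z + \<delta>"]) (use \<delta> x sm supp 0 1 in auto)
    have iC: "integrable lborel (\<lambda>s. C s * B p n s)" if p: "x \<le> p" "p \<le> z" for p
    proof -
      have "continuous_on UNIV (\<lambda>s. indicator {0<..<1} s *\<^sub>R (c s * B p n s))"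
        by (rule continuous_on_indicator_compact_support[of _ "{p - e n..p + e n}"])
          (use p \<delta> e(2)[of n] Bsupp'[of _ p n] in \<open>auto intro!: continuous_on_mult c continuous_on_subset[OF cB]\<close>)
      then have "integrable lborel (\<lambda>s. indicator {0<..<1} s *\<^sub>R (c s * B p n s))"
        by (rule integrable_compact_support[of _ "{p - e n..p + e n}"]) (use Bsupp'[of _ p n] in auto)
      then show ?thesis by (simp add: C_def)
    qed
    have "(\<integral>s. indicator {0<..<1} s *\<^sub>R (c s * \<omega> s) \<partial>lborel) =
        (\<integral>s. of_real (z - y) * (C s * B x n s) + of_real (y - x) * (C s * B z n s) + of_real (x - z) * (C s * B y n s) \<partial>lborel)"
      by (intro Bochner_Integration.integral_cong) (auto simp: \<omega>_def C_def indicator_def algebra_simps)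
    also have "\<dots> = of_real (z - y) * (\<integral>s. C s * B x n s \<partial>lborel) + of_real (y - x) * (\<integral>s. C s * B z n s \<partial>lborel) + of_real (x - z) * (\<integral>s. C s * B y n s \<partial>lborel)"
      using iC[of x] iC[of y] iC[of z] x by simp
    also have "\<dots> = of_real (e n) * (of_real (z - y) * J x n + of_real (y - x) * J z n + of_real (x - z) * J y n)"
      unfolding sub J_def[symmetric] by (simp add: algebra_simps)
    finally have "of_real (e n) * (of_real (z - y) * J x n + of_real (y - x) * J z n + of_real (x - z) * J y n) = 0" using w by simp
    then have "of_real (z - y) * J x n + of_real (y - x) * J z n + of_real (x - z) * J y n = 0" using e(1)[of n] by simp
    then show ?thesis by (simp add: algebra_simps)
  qed
  have "(\<lambda>n. of_real (z - y) * J x n + of_real (y - x) * J z n) \<longlonglongrightarrow> of_real (z - y) * (c x * m0) + of_real (y - x) * (c z * m0)"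
    using x by (intro tendsto_intros Jlim) auto
  moreover have "(\<lambda>n. of_real (z - x) * J y n) \<longlonglongrightarrow> of_real (z - x) * (c y * m0)"
    using x by (intro tendsto_intros Jlim) auto
  ultimately have "of_real (z - y) * (c x * m0) + of_real (y - x) * (c z * m0) = of_real (z - x) * (c y * m0)"
    unfolding J0 by (rule LIMSEQ_unique)
  then have "(of_real (z - x) * c y) * m0 = (of_real (z - y) * c x + of_real (y - x) * c z) * m0" by (simp only: distrib_right mult.assoc)
  then show ?thesis by (rule mult_right_cancel[THEN iffD1, OF m0])
qed

section \<open>Radial test functions and angular means\<close>

lemma smooth_on_harm: "smooth_on UNIV (harm n)"
proof -
  obtain \<kappa> where \<kappa>: "\<kappa> = (\<lambda>z. z) \<or> \<kappa> = cnj" "harm n = (\<lambda>z. \<kappa> z ^ nat \<bar>n\<bar>)" using harm_cases[of n] by blast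
  have "bounded_linear \<kappa>" using \<kappa>(1) bounded_linear_ident bounded_linear_cnj by auto
  then show ?thesis unfolding \<kappa>(2) by (intro smooth_on_power open_UNIV smooth_on_linear)
qed

lemma smooth_on_cmod_sq: "smooth_on UNIV (\<lambda>z. complex_of_real ((cmod z)\<^sup>2))"
  unfolding complex_norm_square
  by (intro smooth_on_mult open_UNIV smooth_on_linear bounded_linear_ident bounded_linear_cnj)

text \<open>A vanishing total integral makes the antiderivative taken from the right vanish on the
  left as well; a vanishing first moment does the same for the second antiderivative, by integrating
  the derivative of s A1(s).\<close>

lemma two_fold_antiderivative_compact_support:
  fixes \<omega> :: "real \<Rightarrow> complex"
  assumes \<omega>: "smooth_on UNIV \<omega>" "\<And>x. x \<notin> {l..h} \<Longrightarrow> \<omega> x = 0" and lh: "l < h"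
    and m: "(\<integral>x. \<omega> x \<partial>lborel) = 0" "(\<integral>x. of_real x * \<omega> x \<partial>lborel) = 0"
  obtains \<eta> \<eta>' where "smooth_on UNIV \<eta>" "\<And>x. (\<eta> has_vector_derivative \<eta>' x) (at x)"
    "\<And>x. (\<eta>' has_vector_derivative \<omega> x) (at x)" "\<And>x. x \<le> l \<or> h \<le> x \<Longrightarrow> \<eta> x = 0"
proof -
  have c\<omega>: "continuous_on S \<omega>" for S using smooth_on_continuous[OF \<omega>(1)] continuous_on_subset by blast
  \<comment> \<open>At h itself \<omega> vanishes by continuity, as the support hypothesis speaks of
    points outside \<open>{l..h}\<close>.\<close>
  have h0: "\<omega> x = 0" if "x \<ge> h" for x
  proof (cases "x = h")
    case True
    have "(\<lambda>n. \<omega> (h + 1 / real (Suc n))) \<longlonglongrightarrow> \<omega> h"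
    proof (rule continuous_on_tendsto_compose[OF c\<omega>[of UNIV]])
      have "(\<lambda>n. h + 1 / real (Suc n)) \<longlonglongrightarrow> h + 0" by (intro tendsto_intros LIMSEQ_Suc[OF lim_1_over_n])
      then show "(\<lambda>n. h + 1 / real (Suc n)) \<longlonglongrightarrow> h" by simp
    qed auto
    moreover have "\<omega> (h + 1 / real (Suc n)) = 0" for n by (rule \<omega>(2)) simp
    ultimately show ?thesis using True by (simp add: LIMSEQ_const_iff)
  qed (use that \<omega>(2) in auto)
  have "\<forall>x\<ge>h. \<omega> x = 0" using h0 by blast
  then obtain A1 where A1: "smooth_on UNIV A1" "\<And>x. (A1 has_vector_derivative \<omega> x) (at x)" "\<forall>x\<ge>h. A1 x = 0"
    "\<And>x. A1 x = - integral {x..h} \<omega>"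
    using smooth_antiderivative_exists[OF \<omega>(1)] by metis
  obtain A2 where A2: "smooth_on UNIV A2" "\<And>x. (A2 has_vector_derivative A1 x) (at x)" "\<forall>x\<ge>h. A2 x = 0"
    "\<And>x. A2 x = - integral {x..h} A1"
    using smooth_antiderivative_exists[OF A1(1,3)] by metis
  have int: "integral {x..h} (\<lambda>s. F s * \<omega> s) = (\<integral>s. F s * \<omega> s \<partial>lborel)" if "x \<le> l" "continuous_on UNIV F" for x F
  proof -
    have "set_integrable lborel {x..h} (\<lambda>s. F s * \<omega> s)"
      unfolding set_integrable_def by (intro borel_integrable_compact continuous_on_mult c\<omega> continuous_on_subset[OF that(2)]) auto
    then have "integral {x..h} (\<lambda>s. F s * \<omega> s) = (\<integral>s. indicator {x..h} s *\<^sub>R (F s * \<omega> s) \<partial>lborel)"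
      using set_borel_integral_eq_integral(2)[of "{x..h}" "\<lambda>s. F s * \<omega> s"] by (simp add: set_lebesgue_integral_def)
    also have "\<dots> = (\<integral>s. F s * \<omega> s \<partial>lborel)"
      by (intro Bochner_Integration.integral_cong) (use that(1) \<omega>(2) in \<open>auto simp: indicator_def\<close>)
    finally show ?thesis .
  qed
  have A1l: "A1 x = 0" if "x \<le> l" for x
    using int[OF that, of "\<lambda>_. 1"] m(1) by (simp add: A1(4))
  have A2l: "A2 x = 0" if x: "x \<le> l" for x
  proof -
    have "((\<lambda>s. of_real s * \<omega> s + 1 * A1 s) has_integral (of_real h * A1 h - of_real x * A1 x)) {x..h}"
    proof (rule fundamental_theorem_of_calculus)
      fix s
      have "(complex_of_real has_vector_derivative 1) (at s within {x..h})" by (auto intro!: derivative_eq_intros)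
      from has_vector_derivative_mult[OF this has_vector_derivative_at_within[OF A1(2)]]
      show "((\<lambda>s. of_real s * A1 s) has_vector_derivative of_real s * \<omega> s + 1 * A1 s) (at s within {x..h})" .
    qed (use x lh in simp)
    moreover have "of_real h * A1 h - of_real x * A1 x = 0" using A1(3) A1l[OF x] by simp
    moreover have "((\<lambda>s. of_real s * \<omega> s + 1 * A1 s) has_integral (integral {x..h} (\<lambda>s. of_real s * \<omega> s) + 1 * integral {x..h} A1)) {x..h}"
      by (intro has_integral_add has_integral_mult_right integrable_integral integrable_continuous_real continuous_intros c\<omega>
          continuous_on_subset[OF smooth_on_continuous[OF A1(1)]]) auto
    ultimately have "integral {x..h} (\<lambda>s. of_real s * \<omega> s) + 1 * integral {x..h} A1 = 0"
      using has_integral_unique by metis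
    then show ?thesis using int[OF x, of complex_of_real] m(2) by (simp add: A2(4))
  qed
  show ?thesis
    by (rule that[of A2 A1]) (use A2 A1 A2l in auto)
qed

text \<open>Normalised to return a + b \<rho> when v is \<open>harm (- n)\<close> times a + b |z|^2:
  both v and \<open>harm n\<close> then carry a factor \<rho>^(|n|/2).\<close>

definition radial_mean :: "(complex \<Rightarrow> complex) \<Rightarrow> int \<Rightarrow> real \<Rightarrow> complex" where
  "radial_mean v n \<rho> = of_real ((1 / \<rho>) ^ nat \<bar>n\<bar>) * (1 / (2 * of_real pi) *
     integral {0..2*pi} (\<lambda>t. v (of_real (sqrt \<rho>) * cis t) * harm n (of_real (sqrt \<rho>) * cis t)))"

text \<open>Given \<omega>, let \<eta> be its compactly supported second antiderivative, G =
  \<rho>^(-k-2) \<eta> with k = |n|, and B2 a second antiderivative of G. The test function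
  \<open>harm n z\<close> times B2(|z|^2) has bilaplacian \<open>harm n z\<close> times \<rho>^(-k)
  \<omega>, and polar coordinates turn its pairing with v into the integral of the mean against
  \<omega>.\<close>

lemma weakly_biharmonic_radial_mean:
  fixes v :: "complex \<Rightarrow> complex" and n :: int
  assumes v: "weakly_biharmonic v"
  shows "continuous_on {0<..<1} (radial_mean v n)"
    and "\<And>\<omega> l h. 0 < l \<Longrightarrow> l < h \<Longrightarrow> h < 1 \<Longrightarrow> smooth_on UNIV \<omega> \<Longrightarrow> (\<And>x. x \<notin> {l..h} \<Longrightarrow> \<omega> x = 0) \<Longrightarrow>
      (\<integral>x. \<omega> x \<partial>lborel) = 0 \<Longrightarrow> (\<integral>x. of_real x * \<omega> x \<partial>lborel) = 0 \<Longrightarrow>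
      (\<integral>x. indicator {0<..<1} x *\<^sub>R (radial_mean v n x * \<omega> x) \<partial>lborel) = 0"
proof -
  define b where "b \<rho> = 1 / (2 * of_real pi) * integral {0..2*pi} (\<lambda>t. v (of_real (sqrt \<rho>) * cis t) * harm n (of_real (sqrt \<rho>) * cis t))" for \<rho>
  define c where "c = radial_mean v n"
  have c_eq: "c \<rho> = of_real ((1 / \<rho>) ^ nat \<bar>n\<bar>) * b \<rho>" for \<rho> by (simp add: c_def radial_mean_def b_def)
  have cv: "continuous_on (ball 0 1) v" using v by (simp add: weakly_biharmonic_def)
  have ch: "continuous_on S (harm n)" for S using smooth_on_continuous[OF smooth_on_harm] continuous_on_subset by blast
  let ?k = "nat \<bar>n\<bar>"
  have "continuous_on {0<..<1} (\<lambda>\<rho>. integral (cbox 0 (2*pi)) (\<lambda>t. v (of_real (sqrt \<rho>) * cis t) * harm n (of_real (sqrt \<rho>) * cis t)))"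
  proof (rule integral_continuous_on_param)
    show "continuous_on ({0<..<1} \<times> cbox 0 (2*pi)) (\<lambda>(\<rho>, t). v (of_real (sqrt \<rho>) * cis t) * harm n (of_real (sqrt \<rho>) * cis t))"
      unfolding case_prod_beta'
      by (intro continuous_on_mult continuous_on_compose2[OF cv] continuous_on_compose2[OF ch[of UNIV]])
        (auto intro!: continuous_intros simp: norm_mult)
  qed
  then show "continuous_on {0<..<1} (radial_mean v n)"
    unfolding radial_mean_def[abs_def] by (auto intro!: continuous_intros)
  fix \<omega> :: "real \<Rightarrow> complex" and l h :: real
  assume lh: "0 < l" "l < h" "h < 1" and \<omega>: "smooth_on UNIV \<omega>" "\<And>x. x \<notin> {l..h} \<Longrightarrow> \<omega> x = 0"
    and m: "(\<integral>x. \<omega> x \<partial>lborel) = 0" "(\<integral>x. of_real x * \<omega> x \<partial>lborel) = 0"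
  obtain \<eta> \<eta>' where \<eta>: "smooth_on UNIV \<eta>" "\<And>x. (\<eta> has_vector_derivative \<eta>' x) (at x)"
    "\<And>x. (\<eta>' has_vector_derivative \<omega> x) (at x)" "\<And>x. x \<le> l \<or> h \<le> x \<Longrightarrow> \<eta> x = 0"
    by (rule two_fold_antiderivative_compact_support[OF \<omega>(1) _ lh(2) m]) (use \<omega>(2) in blast)+
  \<comment> \<open>\<eta> vanishes below l > 0, so the extension by 0 is smooth across the
    origin.\<close>
  define G where "G x = (if x > 0 then complex_of_real ((1 / x) ^ (?k + 2)) * \<eta> x else 0)" for x
  have sG: "smooth_on UNIV G"
  proof -
    have "smooth_on {0<..} (\<lambda>x. complex_of_real ((1 / x) ^ (?k + 2)) * \<eta> x)"
      by (intro smooth_on_mult smooth_on_inverse_power smooth_on_subset[OF \<eta>(1)]) auto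
    then have 1: "smooth_on {0<..} G" by (rule smooth_on_cong[rotated 2]) (auto simp: G_def)
    have 2: "smooth_on {..<l} G"
      by (rule smooth_on_cong[OF _ _ smooth_on_const[of _ 0]]) (auto simp: G_def \<eta>(4))
    have "{0<..} \<union> {..<l} = UNIV" using lh by auto
    then show ?thesis using smooth_on_Un[OF 1 2] by simp
  qed
  have Gh: "\<forall>x\<ge>h. G x = 0" using \<eta>(4) by (simp add: G_def)
  obtain B1 where B1: "smooth_on UNIV B1" "\<And>x. (B1 has_vector_derivative G x) (at x)" "\<forall>x\<ge>h. B1 x = 0"
    using smooth_antiderivative_exists[OF sG Gh] by metis
  \<comment> \<open>B2 vanishes from h on, which puts the support of \<psi> inside the disk; below
    l, where G is 0, it is an affine function.\<close>
  obtain B2 where B2: "smooth_on UNIV B2" "\<And>x. (B2 has_vector_derivative B1 x) (at x)" "\<forall>x\<ge>h. B2 x = 0"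
    using smooth_antiderivative_exists[OF B1(1,3)] by metis
  define G1 where "G1 = iter_deriv [1] G"
  have sG1: "smooth_on UNIV G1" unfolding G1_def by (rule smooth_on_iter_deriv[OF sG]) simp
  have dG: "(G has_vector_derivative G1 x) (at x)" for x
    unfolding G1_def by (rule smooth_on_real_has_vector_derivative[OF sG]) simp
  define G2 where "G2 = iter_deriv [1] G1"
  have sG2: "smooth_on UNIV G2" unfolding G2_def by (rule smooth_on_iter_deriv[OF sG1]) simp
  have dG1: "(G1 has_vector_derivative G2 x) (at x)" for x
    unfolding G2_def by (rule smooth_on_real_has_vector_derivative[OF sG1]) simp
  define \<psi> where "\<psi> z = harm n z * B2 ((cmod z)\<^sup>2)" for z
  define Q where "Q \<rho> = (of_nat ?k + 1) * (of_nat ?k + 2) * G \<rho> + 2 * (of_nat ?k + 2) * of_real \<rho> * G1 \<rho> + of_real \<rho> * of_real \<rho> * G2 \<rho>" for \<rho>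
  have cG2: "continuous_on {0..} G2" using smooth_on_continuous[OF sG2] continuous_on_subset by blast
  have L: "laplacian (laplacian \<psi>) = (\<lambda>z. harm n z * Q ((cmod z)\<^sup>2))"
    using bilaplacian_radial_harm(3)[OF B2(2) B1(2) dG dG1 cG2, of n] by (simp add: \<psi>_def[abs_def] Q_def)
  let ?K = "cball (0::complex) (sqrt h)"
  have "sqrt h < 1" using lh(3) by simp
  have K: "compact ?K" "?K \<subseteq> ball 0 1"
  proof -
    show "?K \<subseteq> ball 0 1"
    proof
      fix z assume "z \<in> ?K"
      then have "cmod z \<le> sqrt h" by simp
      with \<open>sqrt h < 1\<close> have "cmod z < 1" by linarith
      then show "z \<in> ball 0 1" by simp
    qed
  qed (rule compact_cball)
  have \<psi>0: "\<psi> z = 0" if "z \<notin> ?K" for z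
  proof -
    have "sqrt h < cmod z" using that by simp
    then have "h < (cmod z)\<^sup>2" using lh real_less_lsqrt real_sqrt_less_iff by (metis abs_norm_cancel not_less real_sqrt_abs real_sqrt_le_iff)
    then show ?thesis using B2(3) by (simp add: \<psi>_def)
  qed
  have s\<psi>: "smooth_on UNIV \<psi>"
    unfolding \<psi>_def[abs_def] by (intro smooth_on_mult open_UNIV smooth_on_harm smooth_on_comp[OF open_UNIV UNIV_I B2(1) smooth_on_cmod_sq])
  have test: "disk_test \<psi>" unfolding disk_test_def using s\<psi> K \<psi>0 by blast
  have L0: "laplacian (laplacian \<psi>) z = 0" if "z \<notin> ?K" for z
    by (rule laplacian_zero_outside[OF K(1) _ that], rule laplacian_zero_outside[OF K(1)]) (use \<psi>0 in auto)
  define F where "F z = indicator (ball 0 1) z *\<^sub>R (v z * laplacian (laplacian \<psi>) z)" for z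
  have "(\<integral>z. F z \<partial>lborel) = 0" using v test by (simp add: weakly_biharmonic_def F_def set_lebesgue_integral_def)
  moreover have "(\<integral>z. F z \<partial>lborel) =
    of_real pi * (\<integral>\<rho>. indicator {0..} \<rho> *\<^sub>R (1 / (2 * of_real pi) * integral {0..2*pi} (\<lambda>t. F (of_real (sqrt \<rho>) * cis t))) \<partial>lborel)"
  proof (rule polar_integral[OF _ K(1)])
    show "continuous_on UNIV F"
      unfolding F_def by (rule continuous_on_indicator_compact_support[OF open_ball K continuous_on_mult[OF cv disk_test_continuous(2)[OF test]]])
        (simp add: L0)
    show "F z = 0" if "z \<notin> ?K" for z using L0[OF that] by (simp add: F_def)
  qed
  moreover have "indicator {0..} \<rho> *\<^sub>R (1 / (2 * of_real pi) * integral {0..2*pi} (\<lambda>t. F (of_real (sqrt \<rho>) * cis t))) =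
      indicator {0<..<1} \<rho> *\<^sub>R (c \<rho> * \<omega> \<rho>)" for \<rho>
  proof -
    consider "\<rho> < 0" | "\<rho> = 0" | "0 < \<rho>" "\<rho> < 1" | "\<rho> \<ge> 1" by linarith
    then show ?thesis
    proof cases
      case 1
      then show ?thesis by simp
    next
      case 2
      then show ?thesis by (simp add: F_def L Q_def G_def)
    next
      case 3
      have "of_real (sqrt \<rho>) * cis t \<in> ball 0 1" for t using 3 by (simp add: norm_mult)
      then have F: "F (of_real (sqrt \<rho>) * cis t) = (v (of_real (sqrt \<rho>) * cis t) * harm n (of_real (sqrt \<rho>) * cis t)) * Q \<rho>" for t
        using 3 by (simp add: F_def L norm_mult mult.assoc)
      have pk: "((\<lambda>x. complex_of_real (x ^ j)) has_vector_derivative of_nat j * of_real (\<rho> ^ (j - 1))) (at \<rho>)" for j \<rho>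
      proof -
        have "((\<lambda>x. x ^ j) has_real_derivative real j * \<rho> ^ (j - 1)) (at \<rho>)" by (auto intro!: derivative_eq_intros)
        from has_vector_derivative_of_real[OF this, where 'a = complex] show ?thesis by simp
      qed
      have \<eta>G: "\<eta> x = of_real (x ^ (?k + 2)) * G x" if "x > 0" for x
        using that by (simp add: G_def power_divide)
      have d1: "\<eta>' x = of_real (x ^ (?k + 2)) * G1 x + (of_nat (?k + 2) * of_real (x ^ (?k + 1))) * G x" if x: "x > 0" for x
      proof -
        have "((\<lambda>x. of_real (x ^ (?k + 2)) * G x) has_vector_derivative of_real (x ^ (?k + 2)) * G1 x + (of_nat (?k + 2) * of_real (x ^ (?k + 2 - 1))) * G x) (at x)"
          by (intro has_vector_derivative_mult pk dG)
        then have "(\<eta> has_vector_derivative of_real (x ^ (?k + 2)) * G1 x + (of_nat (?k + 2) * of_real (x ^ (?k + 2 - 1))) * G x) (at x)"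
          by (rule has_vector_derivative_transform_within_open[of _ _ _ "{0<..}"]) (use x \<eta>G in auto)
        from vector_derivative_unique_at[OF \<eta>(2) this] show ?thesis by simp
      qed
      have "((\<lambda>x. of_real (x ^ (?k + 2)) * G1 x + (of_nat (?k + 2) * of_real (x ^ (?k + 1))) * G x) has_vector_derivative
         (of_real (\<rho> ^ (?k + 2)) * G2 \<rho> + (of_nat (?k + 2) * of_real (\<rho> ^ (?k + 2 - 1))) * G1 \<rho>) +
         ((of_nat (?k + 2) * of_real (\<rho> ^ (?k + 1))) * G1 \<rho> + (of_nat (?k + 2) * (of_nat (?k + 1) * of_real (\<rho> ^ (?k + 1 - 1)))) * G \<rho>)) (at \<rho>)"
        by (intro has_vector_derivative_add has_vector_derivative_mult has_vector_derivative_mult_right pk dG dG1)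
      then have "(\<eta>' has_vector_derivative
         (of_real (\<rho> ^ (?k + 2)) * G2 \<rho> + (of_nat (?k + 2) * of_real (\<rho> ^ (?k + 2 - 1))) * G1 \<rho>) +
         ((of_nat (?k + 2) * of_real (\<rho> ^ (?k + 1))) * G1 \<rho> + (of_nat (?k + 2) * (of_nat (?k + 1) * of_real (\<rho> ^ (?k + 1 - 1)))) * G \<rho>)) (at \<rho>)"
        by (rule has_vector_derivative_transform_within_open[of _ _ _ "{0<..}"]) (use 3 d1 in auto)
      \<comment> \<open>Two expressions for the second derivative of \<eta> = \<rho>^(k+2) G are
        compared.\<close>
      from vector_derivative_unique_at[OF \<eta>(3) this]
      have "\<omega> \<rho> = of_real (\<rho> ^ ?k) * Q \<rho>" by (simp add: Q_def power_add algebra_simps)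
      then have Q: "of_real ((1 / \<rho>) ^ ?k) * \<omega> \<rho> = Q \<rho>" using 3 by (simp add: power_divide)
      have "1 / (2 * of_real pi) * integral {0..2*pi} (\<lambda>t. F (of_real (sqrt \<rho>) * cis t)) = b \<rho> * Q \<rho>"
        unfolding F by (simp add: b_def)
      also have "\<dots> = c \<rho> * \<omega> \<rho>" by (simp add: c_eq Q[symmetric])
      finally show ?thesis using 3 by simp
    next
      case 4
      have "F w = 0" if "w \<notin> ball 0 1" for w using that by (simp add: F_def)
      moreover have "of_real (sqrt \<rho>) * cis t \<notin> ball 0 1" for t using 4 by (simp add: norm_mult)
      ultimately have "F (of_real (sqrt \<rho>) * cis t) = 0" for t by blast
      then show ?thesis using 4 by simp
    qed
  qed
  ultimately have "of_real pi * (\<integral>\<rho>. indicator {0<..<1} \<rho> *\<^sub>R (c \<rho> * \<omega> \<rho>) \<partial>lborel) = 0" by simp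
  then show "(\<integral>x. indicator {0<..<1} x *\<^sub>R (radial_mean v n x * \<omega> x) \<partial>lborel) = 0" by (simp add: c_def)
qed

text \<open>Each mean c is affine on (0, 1). Its value and its slope at 1 both vanish, so c = 0 and
  every angular Fourier coefficient of v is 0; completeness of the characters on each circle then
  gives v = 0.\<close>

lemma weakly_biharmonic_zero_boundary_values:
  assumes v: "weakly_biharmonic v" and bv: "boundary_value v (\<lambda>_. 0)" and bn: "boundary_normal_deriv v (\<lambda>_. 0) (\<lambda>_. 0)"
    and z: "cmod z < 1"
  shows "v z = 0"
proof -
  have cv: "continuous_on (ball 0 1) v" using v by (simp add: weakly_biharmonic_def)
  have zero: "circle_dist_of_fun (dilate v r) (harm n) = 0" if r: "0 < r" "r < 1" for r and n :: int
  proof -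
    let ?k = "nat \<bar>n\<bar>"
    define D where "D s = circle_dist_of_fun (dilate v s) (harm n)" for s
    define c where "c = radial_mean v n"
    note W = weakly_biharmonic_radial_mean[OF v, where n = n, folded c_def]
    have lin: "of_real (z - x) * c y = of_real (z - y) * c x + of_real (y - x) * c z" if xyz: "0 < x" "x < y" "y < z" "z < 1" for x y z
    proof (rule weakly_affine_interpolation[where c = c, OF W(1) _ xyz])
      show "(\<integral>x. indicator {0<..<1} x *\<^sub>R (c x * \<omega> x) \<partial>lborel) = 0"
        if "0 < l" "l < h" "h < 1" "smooth_on UNIV \<omega>" "\<And>x. x \<notin> {l..h} \<Longrightarrow> \<omega> x = 0"
          "(\<integral>x. \<omega> x \<partial>lborel) = 0" "(\<integral>x. of_real x * \<omega> x \<partial>lborel) = 0" for \<omega> l h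
        by (rule W(2)[OF that(1-4)]) (use that(5-7) in auto)
    qed
    have cD: "c (s\<^sup>2) = of_real ((1 / s) ^ ?k) * D s" if s: "0 < s" for s
    proof -
      define b where "b \<rho> = 1 / (2 * of_real pi) * integral {0..2*pi} (\<lambda>t. v (of_real (sqrt \<rho>) * cis t) * harm n (of_real (sqrt \<rho>) * cis t))" for \<rho>
      have "b (s\<^sup>2) = 1 / (2 * of_real pi) * integral {0..2*pi} (\<lambda>t. of_real (s ^ ?k) * (v (of_real s * cis t) * harm n (cis t)))"
        using s by (simp add: b_def harm_mult harm_of_real mult_ac)
      then have "b (s\<^sup>2) = of_real (s ^ ?k) * D s"
        by (simp only: D_def circle_dist_of_fun_def dilate_def Henstock_Kurzweil_Integration.integral_mult_right mult.left_commute)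
      moreover have "c (s\<^sup>2) = of_real ((1 / s\<^sup>2) ^ ?k) * b (s\<^sup>2)" by (simp only: c_def radial_mean_def b_def)
      ultimately show ?thesis using s by (simp add: power_divide power_mult_distrib power2_eq_square)
    qed
    have D0: "(D \<longlongrightarrow> 0) (at_left 1)"
      using bv circle_test_harm unfolding boundary_value_def circle_dist_tendsto_def D_def[abs_def] by blast
    have D1: "((\<lambda>s. D s / of_real (1 - s)) \<longlongrightarrow> 0) (at_left 1)"
      using bn circle_test_harm[of n] unfolding boundary_normal_deriv_def circle_dist_tendsto_def D_def[abs_def] by auto
    have pw: "((\<lambda>s. complex_of_real ((1 / s) ^ ?k)) \<longlongrightarrow> 1) (at_left 1)"
    proof -
      have "((\<lambda>s. complex_of_real ((1 / s) ^ ?k)) \<longlongrightarrow> of_real ((1 / 1) ^ ?k)) (at_left 1)" by (intro tendsto_intros) auto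
      then show ?thesis by simp
    qed
    have sq: "((\<lambda>s::real. s\<^sup>2) \<longlongrightarrow> 1) (at_left 1)" by (rule tendsto_eq_intros refl | simp)+
    have c0: "((\<lambda>s. c (s\<^sup>2)) \<longlongrightarrow> 0) (at_left 1)"
    proof (rule Lim_transform_eventually)
      show "((\<lambda>s. of_real ((1 / s) ^ ?k) * D s) \<longlongrightarrow> 0) (at_left 1)" using tendsto_mult[OF pw D0] by simp
      show "\<forall>\<^sub>F s in at_left 1. of_real ((1 / s) ^ ?k) * D s = c (s\<^sup>2)"
        by (rule eventually_mono[OF eventually_at_left_1]) (use cD in auto)
    qed
    \<comment> \<open>The radius s and the variable s^2 of c lead to comparable quotients, as 1 -
      s^2 = (1 - s) (1 + s).\<close>
    have c1: "((\<lambda>s. c (s\<^sup>2) / of_real (1 - s\<^sup>2)) \<longlongrightarrow> 0) (at_left 1)"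
    proof (rule Lim_transform_eventually)
      have "((\<lambda>s. of_real ((1 / s) ^ ?k) * (D s / of_real (1 - s)) * (1 / of_real (1 + s))) \<longlongrightarrow> 1 * 0 * (1 / of_real (1 + 1))) (at_left 1)"
        by (intro tendsto_mult tendsto_divide pw D1 tendsto_of_real tendsto_add tendsto_const tendsto_ident_at) simp
      then show "((\<lambda>s. of_real ((1 / s) ^ ?k) * (D s / of_real (1 - s)) * (1 / of_real (1 + s))) \<longlongrightarrow> 0) (at_left 1)" by simp
      show "\<forall>\<^sub>F s in at_left 1. of_real ((1 / s) ^ ?k) * (D s / of_real (1 - s)) * (1 / of_real (1 + s)) = c (s\<^sup>2) / of_real (1 - s\<^sup>2)"
      proof (rule eventually_mono[OF eventually_at_left_1])
        fix s :: real assume s: "0 < s \<and> s < 1"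
        have "complex_of_real (1 - s\<^sup>2) = of_real (1 - s) * of_real (1 + s)" by (simp add: power2_eq_square algebra_simps)
        then show "of_real ((1 / s) ^ ?k) * (D s / of_real (1 - s)) * (1 / of_real (1 + s)) = c (s\<^sup>2) / of_real (1 - s\<^sup>2)"
          using cD[of s] s by (simp only: times_divide_eq_right times_divide_eq_left mult_1_right divide_divide_eq_left)
      qed
    qed
    \<comment> \<open>The interpolation identity with its right node sent to 1, where c tends to
      0.\<close>
    have line: "of_real (1 - x) * c y = of_real (1 - y) * c x" if xy: "0 < x" "x < y" "y < 1" for x y
    proof (rule tendsto_unique[of "at_left (1::real)"])
      have "((\<lambda>s. of_real (s\<^sup>2 - x) * c y) \<longlongrightarrow> of_real (1 - x) * c y) (at_left 1)" by (intro tendsto_intros sq)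
      then show "((\<lambda>s. of_real (s\<^sup>2 - y) * c x + of_real (y - x) * c (s\<^sup>2)) \<longlongrightarrow> of_real (1 - x) * c y) (at_left 1)"
      proof (rule Lim_transform_eventually)
        have "\<forall>\<^sub>F s in at_left 1. y < s\<^sup>2" using sq xy(3) by (rule order_tendstoD(1))
        then show "\<forall>\<^sub>F s in at_left 1. of_real (s\<^sup>2 - x) * c y = of_real (s\<^sup>2 - y) * c x + of_real (y - x) * c (s\<^sup>2)"
          using eventually_at_left_1
        proof eventually_elim
          case (elim s)
          then have "s\<^sup>2 < 1" by (simp add: abs_square_less_1)
          then show ?case using elim xy by (intro lin) auto
        qed
      qed
      have "((\<lambda>s. of_real (s\<^sup>2 - y) * c x + of_real (y - x) * c (s\<^sup>2)) \<longlongrightarrow> of_real (1 - y) * c x + of_real (y - x) * 0) (at_left 1)"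
        by (intro tendsto_intros sq c0)
      then show "((\<lambda>s. of_real (s\<^sup>2 - y) * c x + of_real (y - x) * c (s\<^sup>2)) \<longlongrightarrow> of_real (1 - y) * c x) (at_left 1)" by simp
    qed (simp add: trivial_limit_at_left_real)
    have "r\<^sup>2 < 1" "0 < r\<^sup>2" using r by (auto simp: abs_square_less_1)
    \<comment> \<open>By \<open>line\<close> the quotient c(\<rho>) / (1 - \<rho>) does not depend
      on \<rho>, and its limit at 1 is 0.\<close>
    have "0 = c (r\<^sup>2)"
    proof (rule tendsto_unique[of "at_left (1::real)"])
      have "((\<lambda>s. of_real (1 - r\<^sup>2) * (c (s\<^sup>2) / of_real (1 - s\<^sup>2))) \<longlongrightarrow> of_real (1 - r\<^sup>2) * 0) (at_left 1)"
        by (intro tendsto_mult_left c1)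
      then show "((\<lambda>s. of_real (1 - r\<^sup>2) * (c (s\<^sup>2) / of_real (1 - s\<^sup>2))) \<longlongrightarrow> 0) (at_left 1)" by simp
      have "\<forall>\<^sub>F s in at_left 1. r\<^sup>2 < s\<^sup>2" using sq \<open>r\<^sup>2 < 1\<close> by (rule order_tendstoD(1))
      then have "\<forall>\<^sub>F s in at_left 1. c (r\<^sup>2) = of_real (1 - r\<^sup>2) * (c (s\<^sup>2) / of_real (1 - s\<^sup>2))"
        using eventually_at_left_1
      proof eventually_elim
        case (elim s)
        then have "s\<^sup>2 < 1" by (simp add: abs_square_less_1)
        then have "complex_of_real (1 - s\<^sup>2) \<noteq> 0" by (simp del: of_real_diff)
        then show ?case using line[of "r\<^sup>2" "s\<^sup>2"] \<open>0 < r\<^sup>2\<close> elim \<open>s\<^sup>2 < 1\<close> by (simp del: of_real_diff add: field_simps)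
      qed
      then show "((\<lambda>s. of_real (1 - r\<^sup>2) * (c (s\<^sup>2) / of_real (1 - s\<^sup>2))) \<longlongrightarrow> c (r\<^sup>2)) (at_left 1)"
        by (rule Lim_transform_eventually[OF tendsto_const])
    qed (simp add: trivial_limit_at_left_real)
    then have "of_real ((1 / r) ^ ?k) * D r = 0" using cD[OF r(1)] by simp
    then show ?thesis using r by (simp add: D_def)
  qed
  have vr: "v (of_real r * cis t) = 0" if r: "0 < r" "r < 1" for r t
  proof -
    have "dilate v r (cis t) = 0"
    proof (rule fourier_uniqueness)
      show "continuous_on (sphere 0 1) (dilate v r)"
        unfolding dilate_def using r by (intro continuous_on_compose2[OF cv] continuous_intros) (auto simp: norm_mult)
      fix n :: int
      \<comment> \<open>\<open>fourier_coeff\<close> integrates against the character of index - n,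
        hence the pairing with \<open>harm (- n)\<close>.\<close>
      have "harm (- n) (cis t) = cis (- of_int n * t)" for t using harm_cis[of "- n" t] by simp
      then show "fourier_coeff (\<lambda>t. dilate v r (cis t)) n = 0"
        using zero[OF r, of "- n"] by (simp add: fourier_coeff_def circle_dist_of_fun_def)
    qed
    then show ?thesis by (simp add: dilate_def)
  qed
  show ?thesis
  proof (cases "z = 0")
    case False
    have "z = of_real (cmod z) * cis (Arg2pi z)" using Arg2pi_eq[of z] by (simp add: cis_conv_exp)
    then show ?thesis using vr[of "cmod z" "Arg2pi z"] False z by simp
  next
    \<comment> \<open>The centre lies on no circle of positive radius; continuity reaches
      it.\<close>
    case True
    have "(\<lambda>n. v (of_real (1 / real (Suc (Suc n))))) \<longlonglongrightarrow> v 0"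
    proof (rule continuous_on_tendsto_compose[OF cv])
      have "(\<lambda>n. complex_of_real (1 / real (Suc (Suc n)))) \<longlonglongrightarrow> of_real 0"
        by (intro tendsto_of_real LIMSEQ_Suc[OF LIMSEQ_Suc[OF lim_1_over_n]])
      then show "(\<lambda>n. complex_of_real (1 / real (Suc (Suc n)))) \<longlonglongrightarrow> 0" by simp
    qed (auto simp: norm_divide simp del: of_nat_Suc)
    moreover have "v (of_real (1 / real (Suc (Suc n)))) = 0" for n
      using vr[of "1 / real (Suc (Suc n))" 0] by simp
    ultimately show ?thesis using True by (simp add: LIMSEQ_const_iff)
  qed
qed

section \<open>Locally integrable right-hand sides\<close>

lemma bump_le_1: "bump x \<le> 1"
proof -
  have f: "0 \<le> flat_fun 0 y" "flat_fun 0 y \<le> 1" for y by (auto simp: flat_fun_def)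
  have "flat_fun 0 (1 + 1 * x) * flat_fun 0 (1 + - 1 * x) \<le> 1 * 1" by (intro mult_mono f) auto
  then show ?thesis by (simp add: bump_def)
qed

lemma smooth_on_bump_affine_comp:
  assumes "bounded_linear (\<lambda>z::complex. complex_of_real (q z))"
  shows "smooth_on UNIV (\<lambda>z. complex_of_real (bump ((q z - m) / r)))"
proof -
  have "smooth_on UNIV (\<lambda>s. complex_of_real (bump (- (m / r) + (1 / r) * s)))"
    by (rule smooth_on_comp[OF open_UNIV UNIV_I smooth_on_bump smooth_on_real_affine])
  from smooth_on_comp[OF open_UNIV UNIV_I this smooth_on_linear[OF assms]]
  have "smooth_on UNIV (\<lambda>z. complex_of_real (bump (- (m / r) + (1 / r) * q z)))" .
  moreover have "- (m / r) + (1 / r) * s = (s - m) / r" for s by (simp add: diff_divide_distrib)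
  ultimately show ?thesis by simp
qed

lemma set_integrable_locally_integrable_mult:
  assumes g: "locally_integrable_disk g" and K: "compact K" "K \<subseteq> ball 0 1"
    and \<chi>': "continuous_on UNIV \<phi>" "\<And>z. z \<notin> K \<Longrightarrow> \<phi> z = 0"
  shows "set_integrable lebesgue (ball 0 1) (\<lambda>z. g z * \<phi> z)"
proof -
  have i: "integrable lebesgue (\<lambda>z. indicator K z *\<^sub>R g z)"
    using g K by (simp add: locally_integrable_disk_def set_integrable_def)
  obtain M where M: "M > 0" "\<And>z. norm (\<phi> z) \<le> M" using compact_support_bounded[OF \<chi>'(1) K(1) \<chi>'(2)] by blast
  have m: "\<phi> \<in> borel_measurable lebesgue" using borel_measurable_continuous_onI[OF \<chi>'(1)] by (simp add: measurable_completion)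
  have "integrable lebesgue (\<lambda>z. (indicator K z *\<^sub>R g z) * \<phi> z)"
  proof (rule Bochner_Integration.integrable_bound)
    show "integrable lebesgue (\<lambda>z. M * norm (indicator K z *\<^sub>R g z))" using i by (intro integrable_mult_right integrable_norm)
    show "(\<lambda>z. (indicator K z *\<^sub>R g z) * \<phi> z) \<in> borel_measurable lebesgue"
      using i m by (intro borel_measurable_times) auto
    show "AE z in lebesgue. norm ((indicator K z *\<^sub>R g z) * \<phi> z) \<le> norm (M * norm (indicator K z *\<^sub>R g z))"
    proof (intro AE_I2)
      fix z
      have "norm (indicator K z *\<^sub>R g z) * norm (\<phi> z) \<le> norm (indicator K z *\<^sub>R g z) * M" using M by (intro mult_left_mono) auto
      then show "norm ((indicator K z *\<^sub>R g z) * \<phi> z) \<le> norm (M * norm (indicator K z *\<^sub>R g z))"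
        using M(1) by (simp only: norm_mult real_norm_def abs_mult abs_norm_cancel abs_of_pos mult.commute)
    qed
  qed
  moreover have "(indicator K z *\<^sub>R g z) * \<phi> z = indicator (ball 0 1) z *\<^sub>R (g z * \<phi> z)" for z
    using K(2) \<chi>'(2)[of z] by (cases "z \<in> K") (auto simp: subset_iff)
  ultimately show ?thesis unfolding set_integrable_def by (simp only:)
qed

lemma set_integrable_disk_test:
  assumes "locally_integrable_disk g" "disk_test \<psi>"
  shows "set_integrable lebesgue (ball 0 1) (\<lambda>z. g z * \<psi> z)"
    and "set_integrable lebesgue (ball 0 1) (\<lambda>z. g z * laplacian (laplacian \<psi>) z)"
proof -
  obtain K where K: "compact K" "K \<subseteq> ball 0 1" "\<And>z. z \<notin> K \<Longrightarrow> \<psi> z = 0" "\<And>z. z \<notin> K \<Longrightarrow> laplacian (laplacian \<psi>) z = 0"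
    using disk_testD[OF assms(2)] by metis
  show "set_integrable lebesgue (ball 0 1) (\<lambda>z. g z * \<psi> z)"
    by (rule set_integrable_locally_integrable_mult[OF assms(1) K(1,2) disk_test_continuous(1)[OF assms(2)] K(3)])
  show "set_integrable lebesgue (ball 0 1) (\<lambda>z. g z * laplacian (laplacian \<psi>) z)"
    by (rule set_integrable_locally_integrable_mult[OF assms(1) K(1,2) disk_test_continuous(2)[OF assms(2)] K(4)])
qed

text \<open>The powers \<open>1 - (1 - \<tau>)^n\<close> of a bump \<open>\<tau>\<close> with values in \<open>[0, 1]\<close> are test functions that
  increase to the indicator of the open box where \<open>\<tau>\<close> is positive.\<close>

lemma weakly_zero_integral_box:
  assumes h: "locally_integrable_disk h" and 0: "\<And>\<psi>. disk_test \<psi> \<Longrightarrow> disk_integral (\<lambda>z. h z * \<psi> z) = 0"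
    and ab: "cbox a b \<subseteq> ball 0 1"
  shows "(\<integral>z. indicator (box a b) z *\<^sub>R h z \<partial>lebesgue) = 0"
proof (cases "Re a < Re b \<and> Im a < Im b")
  case False
  then have "z \<notin> box a b" for z by (auto simp: in_box_complex_iff)
  then have "box a b = {}" by blast
  then show ?thesis by simp
next
  case True
  define m1 r1 m2 r2 where "m1 = (Re a + Re b) / 2" and "r1 = (Re b - Re a) / 2" and "m2 = (Im a + Im b) / 2" and "r2 = (Im b - Im a) / 2"
  define \<tau> where "\<tau> z = bump ((Re z - m1) / r1) * bump ((Im z - m2) / r2)" for z
  have r: "r1 > 0" "r2 > 0" using True by (auto simp: r1_def r2_def)
  have \<tau>01: "0 \<le> \<tau> z" "\<tau> z \<le> 1" for z
  proof -
    show "0 \<le> \<tau> z" unfolding \<tau>_def by (intro mult_nonneg_nonneg bump_nonneg)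
    have "\<tau> z \<le> 1 * 1" unfolding \<tau>_def by (intro mult_mono bump_le_1 bump_nonneg) auto
    then show "\<tau> z \<le> 1" by simp
  qed
  have box: "z \<in> box a b \<longleftrightarrow> \<bar>(Re z - m1) / r1\<bar> < 1 \<and> \<bar>(Im z - m2) / r2\<bar> < 1" for z
    using r by (auto simp: in_box_complex_iff m1_def m2_def r1_def r2_def abs_less_iff field_simps)
  have \<tau>pos: "\<tau> z > 0" if "z \<in> box a b" for z
    using that unfolding box \<tau>_def by (intro mult_pos_pos bump_pos) auto
  have \<tau>0: "\<tau> z = 0" if "z \<notin> box a b" for z
    using that unfolding box \<tau>_def by (auto simp: bump_zero not_less)
  define \<psi> where "\<psi> n z = complex_of_real (1 - (1 - \<tau> z) ^ n)" for n z
  have s\<tau>: "smooth_on UNIV (\<lambda>z. complex_of_real (\<tau> z))"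
    unfolding \<tau>_def of_real_mult
    by (intro smooth_on_mult open_UNIV smooth_on_bump_affine_comp bounded_linear_compose[OF bounded_linear_of_real] bounded_linear_Re bounded_linear_Im)
  have s\<psi>: "smooth_on UNIV (\<psi> n)" for n
    unfolding \<psi>_def[abs_def] of_real_diff of_real_power of_real_1
    by (intro smooth_on_diff smooth_on_power smooth_on_const open_UNIV s\<tau>)
  have sub: "box a b \<subseteq> cbox a b" by (rule box_subset_cbox)
  have \<psi>0: "\<psi> n z = 0" if "z \<notin> cbox a b" for n z
  proof -
    have "z \<notin> box a b" using that sub by blast
    then show ?thesis by (simp add: \<psi>_def \<tau>0)
  qed
  have test: "disk_test (\<psi> n)" for n
    unfolding disk_test_def using s\<psi> compact_cbox[of a b] ab \<psi>0 by blast
  have i: "integrable lebesgue (\<lambda>z. indicator (cbox a b) z *\<^sub>R h z)"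
    using h ab compact_cbox[of a b] by (simp add: locally_integrable_disk_def set_integrable_def)
  have \<psi>m: "\<psi> n \<in> borel_measurable lebesgue" for n
    using borel_measurable_continuous_onI[OF smooth_on_continuous[OF s\<psi>]] by (simp add: measurable_completion)
  have "(\<lambda>n. \<integral>z. (indicator (cbox a b) z *\<^sub>R h z) * \<psi> n z \<partial>lebesgue) \<longlonglongrightarrow> (\<integral>z. indicator (box a b) z *\<^sub>R h z \<partial>lebesgue)"
  proof (rule integral_dominated_convergence[where w = "\<lambda>z. norm (indicator (cbox a b) z *\<^sub>R h z)"])
    show "integrable lebesgue (\<lambda>z. norm (indicator (cbox a b) z *\<^sub>R h z))" using i by (rule integrable_norm)
    show "(\<lambda>z. (indicator (cbox a b) z *\<^sub>R h z) * \<psi> n z) \<in> borel_measurable lebesgue" for n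
      using i \<psi>m by (intro borel_measurable_times) auto
    have "integrable lebesgue (\<lambda>z. indicator (box a b) z *\<^sub>R (indicator (cbox a b) z *\<^sub>R h z))"
      by (rule integrable_mult_indicator[OF _ i]) simp
    moreover have "indicator (box a b) z *\<^sub>R (indicator (cbox a b) z *\<^sub>R h z) = indicator (box a b) z *\<^sub>R h z" for z
      using sub by (auto simp: indicator_def)
    ultimately have "integrable lebesgue (\<lambda>z. indicator (box a b) z *\<^sub>R h z)" by (simp only:)
    then show "(\<lambda>z. indicator (box a b) z *\<^sub>R h z) \<in> borel_measurable lebesgue" by (rule borel_measurable_integrable)
    show "AE z in lebesgue. (\<lambda>n. (indicator (cbox a b) z *\<^sub>R h z) * \<psi> n z) \<longlonglongrightarrow> indicator (box a b) z *\<^sub>R h z"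
    proof (intro AE_I2)
      fix z
      show "(\<lambda>n. (indicator (cbox a b) z *\<^sub>R h z) * \<psi> n z) \<longlonglongrightarrow> indicator (box a b) z *\<^sub>R h z"
      proof (cases "z \<in> box a b")
        case True
        have "(\<lambda>n. (1 - \<tau> z) ^ n) \<longlonglongrightarrow> 0" using \<tau>pos[OF True] \<tau>01[of z] by (intro LIMSEQ_power_zero) auto
        then have "(\<lambda>n. h z * of_real (1 - (1 - \<tau> z) ^ n)) \<longlonglongrightarrow> h z * of_real (1 - 0)"
          by (intro tendsto_mult tendsto_of_real tendsto_diff tendsto_const)
        moreover have "z \<in> cbox a b" using sub True by blast
        ultimately show ?thesis using True by (simp add: \<psi>_def)
      next
        case False
        then show ?thesis using \<tau>0[OF False] by (simp add: \<psi>_def)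
      qed
    qed
    show "AE z in lebesgue. norm ((indicator (cbox a b) z *\<^sub>R h z) * \<psi> n z) \<le> norm (indicator (cbox a b) z *\<^sub>R h z)" for n
    proof (intro AE_I2)
      fix z
      have p: "0 \<le> (1 - \<tau> z) ^ n" "(1 - \<tau> z) ^ n \<le> 1" using \<tau>01[of z] by (auto intro!: power_le_one)
      have "norm (\<psi> n z) \<le> 1" unfolding \<psi>_def norm_of_real using p by (simp add: abs_le_iff)
      then show "norm ((indicator (cbox a b) z *\<^sub>R h z) * \<psi> n z) \<le> norm (indicator (cbox a b) z *\<^sub>R h z)"
        unfolding norm_mult by (intro mult_left_le) auto
    qed
  qed
  moreover have "(\<integral>z. (indicator (cbox a b) z *\<^sub>R h z) * \<psi> n z \<partial>lebesgue) = 0" for n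
  proof -
    have "(indicator (cbox a b) z *\<^sub>R h z) * \<psi> n z = indicator (ball 0 1) z *\<^sub>R (h z * \<psi> n z)" for z
      using ab \<psi>0[of z n] by (cases "z \<in> cbox a b") (auto simp: subset_iff)
    then have "(\<integral>z. (indicator (cbox a b) z *\<^sub>R h z) * \<psi> n z \<partial>lebesgue) = (\<integral>z. indicator (ball 0 1) z *\<^sub>R (h z * \<psi> n z) \<partial>lebesgue)"
      by (simp only:)
    also have "\<dots> = 0" using 0[OF test, of n] by (auto simp: disk_integral_def set_lebesgue_integral_def)
    finally show ?thesis .
  qed
  ultimately show ?thesis by (simp add: LIMSEQ_const_iff)
qed

lemma sigma_finite_lebesgue: "sigma_finite_measure (lebesgue :: 'a::euclidean_space measure)"
proof
  let ?A = "range (\<lambda>n. cball (0::'a) (real n))"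
  have "z \<in> \<Union>?A" for z :: 'a using real_arch_simple[of "norm z"] by auto
  then have "\<Union>?A = space lebesgue" by auto
  moreover have "emeasure lebesgue a \<noteq> \<infinity>" if a: "a \<in> ?A" for a
  proof -
    obtain n where "a = cball 0 (real n)" using a by blast
    then show ?thesis using fmeasurableD2[OF lmeasurable_cball[of "0::'a" "real n"]] by simp
  qed
  ultimately show "\<exists>A. countable A \<and> A \<subseteq> sets (lebesgue :: 'a measure) \<and> \<Union>A = space lebesgue \<and> (\<forall>a\<in>A. emeasure lebesgue a \<noteq> \<infinity>)"
    by (intro exI[of _ ?A]) auto
qed

text \<open>Cut to a box whose closure lies in the disk, h is integrable and its integrals over open
  boxes vanish. Boxes are stable under intersection, so Dynkin's argument reaches all Borel sets and
  completion all Lebesgue sets, which forces h to vanish almost everywhere there. Countably many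
  closed boxes fill the disk.\<close>

lemma weakly_zero_imp_AE_zero:
  assumes h: "locally_integrable_disk h" and 0: "\<And>\<psi>. disk_test \<psi> \<Longrightarrow> disk_integral (\<lambda>z. h z * \<psi> z) = 0"
  shows "AE z in lebesgue. z \<in> ball 0 1 \<longrightarrow> h z = 0"
proof -
  have box: "AE z in lebesgue. z \<in> cbox a b \<longrightarrow> h z = 0" if ab: "cbox a b \<subseteq> ball 0 1" for a b :: complex
  proof -
    \<comment> \<open>h may fail to be integrable up to the circle, hence the cut to one
      box.\<close>
    define H where "H z = indicator (box a b) z *\<^sub>R h z" for z
    have i: "integrable lebesgue (\<lambda>z. indicator (cbox a b) z *\<^sub>R h z)"
      using h ab compact_cbox[of a b] by (simp add: locally_integrable_disk_def set_integrable_def)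
    have "integrable lebesgue (\<lambda>z. indicator (box a b) z *\<^sub>R (indicator (cbox a b) z *\<^sub>R h z))"
      by (rule integrable_mult_indicator[OF _ i]) simp
    moreover have "indicator (box a b) z *\<^sub>R (indicator (cbox a b) z *\<^sub>R h z) = H z" for z
      using box_subset_cbox[of a b] by (auto simp: indicator_def H_def)
    ultimately have H: "integrable lebesgue H" by simp
    have HA: "set_integrable lebesgue A H" if "A \<in> sets lebesgue" for A
      unfolding set_integrable_def by (rule integrable_mult_indicator[OF that H])
    have borel: "set_lebesgue_integral lebesgue A H = 0" if "A \<in> sets borel" for A
    proof -
      let ?G = "range (\<lambda>(a, b). box a b :: complex set)"
      have G: "Int_stable ?G" "?G \<subseteq> Pow UNIV" by (auto simp: Int_stable_def box_Int_box)
      have s: "sigma_sets UNIV ?G = sets borel" by (simp add: borel_eq_box)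
      have A: "A \<in> sigma_sets UNIV ?G" using that s by simp
      show ?thesis using G A
      proof (induction rule: sigma_sets_induct_disjoint)
        case (basic A)
        then obtain c d where A: "A = box c d" by auto
        obtain p q where pq: "box c d \<inter> box a b = box p q" by (simp add: box_Int_box)
        have "(\<integral>z. indicator (box p q) z *\<^sub>R h z \<partial>lebesgue) = 0"
        proof (cases "box p q = {}")
          case False
          have "box p q \<subseteq> cbox a b" using pq box_subset_cbox[of a b] by blast
          then have "cbox p q \<subseteq> cbox a b" using closure_minimal[OF _ closed_cbox] unfolding closure_box[OF False, symmetric] by blast
          then show ?thesis using weakly_zero_integral_box[OF h 0] ab by (meson order_trans)
        qed simp
        moreover have "indicator A z *\<^sub>R H z = indicator (box p q) z *\<^sub>R h z" for z
          unfolding pq[symmetric] by (auto simp: A H_def indicator_def)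
        ultimately show ?case by (simp add: set_lebesgue_integral_def)
      next
        case empty
        then show ?case by (simp add: set_lebesgue_integral_def)
      next
        case (compl A)
        then have A: "A \<in> sets lebesgue" using s by auto
        then have A': "UNIV - A \<in> sets lebesgue" using sets.compl_sets[OF A] by simp
        have "(\<integral>z. indicator A z *\<^sub>R H z + indicator (UNIV - A) z *\<^sub>R H z \<partial>lebesgue) =
            set_lebesgue_integral lebesgue A H + set_lebesgue_integral lebesgue (UNIV - A) H"
          unfolding set_lebesgue_integral_def
          using HA[OF A] HA[OF A'] unfolding set_integrable_def by (rule Bochner_Integration.integral_add)
        moreover have "indicator A z *\<^sub>R H z + indicator (UNIV - A) z *\<^sub>R H z = H z" for z by (auto simp: indicator_def)
        \<comment> \<open>Complements bring in the total integral, which is itself the integral of h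
          over a box.\<close>
        moreover have "(\<integral>z. H z \<partial>lebesgue) = 0" unfolding H_def by (rule weakly_zero_integral_box[OF h 0 ab])
        ultimately have "0 = set_lebesgue_integral lebesgue A H + set_lebesgue_integral lebesgue (UNIV - A) H"
          by (simp only:)
        then show ?case using compl by simp
      next
        case (union A)
        have A: "A i \<in> sets lebesgue" for i using union(2) s by auto
        have "set_lebesgue_integral lebesgue (\<Union>i. A i) H = (\<Sum>i. set_lebesgue_integral lebesgue (A i) H)"
          by (rule lebesgue_integral_countable_add) (use A HA union(1) in \<open>auto simp: disjoint_family_on_def\<close>)
        then show ?case using union by simp
      qed
    qed
    have leb: "set_lebesgue_integral lebesgue A H = 0" if A: "A \<in> sets lebesgue" for A
    proof -
      obtain S N N' where SN: "A = S \<union> N" "N \<subseteq> N'" "N' \<in> null_sets lborel" "S \<in> sets lborel"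
        using sets_completionE[OF A] by metis
      have S: "S \<in> sets lebesgue" using SN(4) by auto
      have "AE z in lebesgue. z \<notin> N'" using SN(3) by (intro AE_not_in null_sets_completionI)
      then have "AE z in lebesgue. indicator A z *\<^sub>R H z = indicator S z *\<^sub>R H z"
        by eventually_elim (use SN in \<open>auto simp: indicator_def\<close>)
      then have "set_lebesgue_integral lebesgue A H = set_lebesgue_integral lebesgue S H"
        unfolding set_lebesgue_integral_def using HA[OF A] HA[OF S]
        by (intro integral_cong_AE) (auto simp: set_integrable_def)
      then show ?thesis using borel[of S] SN(4) by simp
    qed
    have "AE z in lebesgue. H z = 0" by (rule sigma_finite_measure.density_zero[OF sigma_finite_lebesgue H leb])
    \<comment> \<open>\<open>H\<close> is cut off at the open box; the boundary of the box is a null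
      set.\<close>
    moreover have "AE z in lebesgue. z \<notin> cbox a b - box a b"
      using negligible_frontier_interval[of a b] by (intro AE_not_in) (simp add: negligible_iff_null_sets)
    ultimately show ?thesis by eventually_elim (auto simp: H_def)
  qed
  obtain \<D> where D: "countable \<D>" "\<D> \<subseteq> Pow (ball (0::complex) 1)" "\<And>X. X \<in> \<D> \<Longrightarrow> \<exists>a b. X = cbox a b" "\<Union>\<D> = ball (0::complex) 1"
    using open_countable_Union_open_cbox[of "ball (0::complex) 1"] by auto
  have "AE z in lebesgue. \<forall>X\<in>\<D>. z \<in> X \<longrightarrow> h z = 0"
    unfolding AE_ball_countable[OF D(1)]
  proof
    fix X assume X: "X \<in> \<D>"
    then obtain a b where ab: "X = cbox a b" using D(3) by blast
    show "AE z in lebesgue. z \<in> X \<longrightarrow> h z = 0" unfolding ab by (rule box) (use X D(2) ab in auto)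
  qed
  then show ?thesis by eventually_elim (use D(4) in blast)
qed

section \<open>The Dirichlet problem\<close>

lemma locally_integrable_disk_add_scale:
  assumes "locally_integrable_disk g1" "locally_integrable_disk g2"
  shows "locally_integrable_disk (\<lambda>z. g1 z + k * g2 z)"
  using assms unfolding locally_integrable_disk_def by (intro allI impI set_integral_add(1) set_integrable_mult_right) auto

lemma disk_integral_add_scale:
  assumes "set_integrable lebesgue (ball 0 1) F1" "set_integrable lebesgue (ball 0 1) F2"
  shows "disk_integral (\<lambda>z. F1 z + k * F2 z) = disk_integral F1 + k * disk_integral F2"
  using assms by (simp add: disk_integral_def set_integral_add(2) set_integrable_mult_right algebra_simps)

lemma circle_dist_of_fun_dilate_add_scale:
  assumes v: "continuous_on (ball 0 1) v1" "continuous_on (ball 0 1) v2" and r: "0 < r" "r < 1" and \<phi>: "circle_test \<phi>"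
  shows "circle_dist_of_fun (dilate (\<lambda>z. v1 z + k * v2 z) r) \<phi> = circle_dist_of_fun (dilate v1 r) \<phi> + k * circle_dist_of_fun (dilate v2 r) \<phi>"
proof -
  have c\<phi>: "continuous_on S (\<lambda>t. \<phi> (cis t))" for S
    using \<phi> smooth_on_continuous continuous_on_subset unfolding circle_test_def by blast
  have c: "continuous_on {0..2*pi} (\<lambda>t. v (of_real r * cis t) * \<phi> (cis t))" if "continuous_on (ball 0 1) v" for v
    using r by (intro continuous_on_mult c\<phi> continuous_on_compose2[OF that] continuous_intros) (auto simp: norm_mult)
  have "((\<lambda>t. v1 (of_real r * cis t) * \<phi> (cis t) + k * (v2 (of_real r * cis t) * \<phi> (cis t))) has_integral
     integral {0..2*pi} (\<lambda>t. v1 (of_real r * cis t) * \<phi> (cis t)) + k * integral {0..2*pi} (\<lambda>t. v2 (of_real r * cis t) * \<phi> (cis t))) {0..2*pi}"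
    by (intro has_integral_add has_integral_mult_right integrable_integral integrable_continuous_real c v)
  then show ?thesis
    unfolding circle_dist_of_fun_def dilate_def by (simp add: integral_unique algebra_simps)
qed

text \<open>One combination serves two purposes: k = 1 superposes the solution with boundary data
  and the one with right-hand side g, and k = -1 reduces uniqueness to zero data.\<close>

lemma solves_add_scale:
  assumes 1: "solves_biharmonic_dirichlet g1 f1 h1 v1" and 2: "solves_biharmonic_dirichlet g2 f2 h2 v2"
  shows "solves_biharmonic_dirichlet (\<lambda>z. g1 z + k * g2 z) (\<lambda>\<phi>. f1 \<phi> + k * f2 \<phi>) (\<lambda>\<phi>. h1 \<phi> + k * h2 \<phi>) (\<lambda>z. v1 z + k * v2 z)"
proof -
  note D = 1[unfolded solves_biharmonic_dirichlet_def] 2[unfolded solves_biharmonic_dirichlet_def]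
  have c: "continuous_on (ball 0 1) v1" "continuous_on (ball 0 1) v2" using D by auto
  have b: "bilaplacian_eq v1 g1" "bilaplacian_eq v2 g2" using D by auto
  note L = b[unfolded bilaplacian_eq_def]
  have B: "bilaplacian_eq (\<lambda>z. v1 z + k * v2 z) (\<lambda>z. g1 z + k * g2 z)"
    unfolding bilaplacian_eq_def
  proof (intro conjI allI impI)
    show "locally_integrable_disk (\<lambda>z. v1 z + k * v2 z)" "locally_integrable_disk (\<lambda>z. g1 z + k * g2 z)"
      using L by (auto intro: locally_integrable_disk_add_scale)
    fix \<psi> assume \<psi>: "disk_test \<psi>"
    have "disk_integral (\<lambda>z. (v1 z + k * v2 z) * laplacian (laplacian \<psi>) z) =
        disk_integral (\<lambda>z. v1 z * laplacian (laplacian \<psi>) z + k * (v2 z * laplacian (laplacian \<psi>) z))"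
      by (simp only: distrib_right mult.assoc)
    also have "\<dots> = disk_integral (\<lambda>z. v1 z * laplacian (laplacian \<psi>) z) + k * disk_integral (\<lambda>z. v2 z * laplacian (laplacian \<psi>) z)"
      using L \<psi> by (intro disk_integral_add_scale set_integrable_disk_test) auto
    also have "\<dots> = disk_integral (\<lambda>z. g1 z * \<psi> z) + k * disk_integral (\<lambda>z. g2 z * \<psi> z)" using L \<psi> by auto
    also have "\<dots> = disk_integral (\<lambda>z. g1 z * \<psi> z + k * (g2 z * \<psi> z))"
      using L \<psi> by (intro disk_integral_add_scale[symmetric] set_integrable_disk_test) auto
    also have "\<dots> = disk_integral (\<lambda>z. (g1 z + k * g2 z) * \<psi> z)" by (simp only: distrib_right mult.assoc)
    finally show "disk_integral (\<lambda>z. (v1 z + k * v2 z) * laplacian (laplacian \<psi>) z) = disk_integral (\<lambda>z. (g1 z + k * g2 z) * \<psi> z)" .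
  qed
  have ev: "\<forall>\<^sub>F r in at_left 1. circle_dist_of_fun (dilate v1 r) \<phi> + k * circle_dist_of_fun (dilate v2 r) \<phi> =
      circle_dist_of_fun (dilate (\<lambda>z. v1 z + k * v2 z) r) \<phi>" if "circle_test \<phi>" for \<phi>
    by (rule eventually_mono[OF eventually_at_left_1]) (use circle_dist_of_fun_dilate_add_scale[OF c _ _ that] in auto)
  have "boundary_value (\<lambda>z. v1 z + k * v2 z) (\<lambda>\<phi>. f1 \<phi> + k * f2 \<phi>)"
    unfolding boundary_value_def circle_dist_tendsto_def
  proof (intro allI impI)
    fix \<phi> assume \<phi>: "circle_test \<phi>"
    have "((\<lambda>r. circle_dist_of_fun (dilate v1 r) \<phi> + k * circle_dist_of_fun (dilate v2 r) \<phi>) \<longlongrightarrow> f1 \<phi> + k * f2 \<phi>) (at_left 1)"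
      using D \<phi> by (intro tendsto_intros) (auto simp: boundary_value_def circle_dist_tendsto_def)
    then show "((\<lambda>r. circle_dist_of_fun (dilate (\<lambda>z. v1 z + k * v2 z) r) \<phi>) \<longlongrightarrow> f1 \<phi> + k * f2 \<phi>) (at_left 1)"
      by (rule Lim_transform_eventually[OF _ ev[OF \<phi>]])
  qed
  moreover have "boundary_normal_deriv (\<lambda>z. v1 z + k * v2 z) (\<lambda>\<phi>. f1 \<phi> + k * f2 \<phi>) (\<lambda>\<phi>. h1 \<phi> + k * h2 \<phi>)"
    unfolding boundary_normal_deriv_def circle_dist_tendsto_def
  proof (intro allI impI)
    fix \<phi> assume \<phi>: "circle_test \<phi>"
    have "((\<lambda>r. (circle_dist_of_fun (dilate v1 r) \<phi> - f1 \<phi>) / of_real (1 - r) + k * ((circle_dist_of_fun (dilate v2 r) \<phi> - f2 \<phi>) / of_real (1 - r))) \<longlongrightarrow> h1 \<phi> + k * h2 \<phi>) (at_left 1)"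
      using D \<phi> by (intro tendsto_add tendsto_mult_left) (auto simp: boundary_normal_deriv_def circle_dist_tendsto_def)
    then show "((\<lambda>r. (circle_dist_of_fun (dilate (\<lambda>z. v1 z + k * v2 z) r) \<phi> - (f1 \<phi> + k * f2 \<phi>)) / of_real (1 - r)) \<longlongrightarrow> h1 \<phi> + k * h2 \<phi>) (at_left 1)"
    proof (rule Lim_transform_eventually)
      show "\<forall>\<^sub>F r in at_left 1. (circle_dist_of_fun (dilate v1 r) \<phi> - f1 \<phi>) / of_real (1 - r) + k * ((circle_dist_of_fun (dilate v2 r) \<phi> - f2 \<phi>) / of_real (1 - r)) =
          (circle_dist_of_fun (dilate (\<lambda>z. v1 z + k * v2 z) r) \<phi> - (f1 \<phi> + k * f2 \<phi>)) / of_real (1 - r)"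
        using ev[OF \<phi>]
      proof eventually_elim
        case (elim r)
        have "(A - B) / x + k * ((C - E) / x) = (A + k * C - (B + k * E)) / x" for A B C E x :: complex
          by (simp add: diff_divide_distrib add_divide_distrib right_diff_distrib)
        then show ?case using elim by metis
      qed
    qed
  qed
  ultimately show ?thesis unfolding solves_biharmonic_dirichlet_def using B c by (auto intro!: continuous_intros)
qed

lemma dirichlet_unique:
  assumes "solves_biharmonic_dirichlet g f h v1" "solves_biharmonic_dirichlet g f h v2" "z \<in> ball 0 1"
  shows "v1 z = v2 z"
proof -
  have "solves_biharmonic_dirichlet (\<lambda>_. 0) (\<lambda>_. 0) (\<lambda>_. 0) (\<lambda>z. v1 z + (-1) * v2 z)"
    using solves_add_scale[OF assms(1,2), of "-1"] by simp
  then have "v1 z + (-1) * v2 z = 0"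
    using assms(3) weakly_biharmonic_iff weakly_biharmonic_zero_boundary_values[of "\<lambda>z. v1 z + (-1) * v2 z" z]
    unfolding solves_biharmonic_dirichlet_def by auto
  then show ?thesis by simp
qed

text \<open>Linearity of \<open>frechet_derivative\<close> presupposes differentiability. The head
  direction is applied last, so the induction hypothesis holds throughout the open set S and may be
  differentiated.\<close>

lemma iter_deriv_add_scale:
  assumes "open S" "smooth_on S f" "smooth_on S g" "set vs \<subseteq> Basis" "x \<in> S"
  shows "iter_deriv vs (\<lambda>x. a * f x + b * g x) x = a * iter_deriv vs f x + b * iter_deriv vs g x"
  using assms(4,5)
proof (induction vs arbitrary: x)
  case (Cons v vs)
  let ?f = "iter_deriv vs f" and ?g = "iter_deriv vs g"
  have d: "(?f has_derivative frechet_derivative ?f (at x)) (at x)" "(?g has_derivative frechet_derivative ?g (at x)) (at x)"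
    using smooth_on_differentiable[OF smooth_on_iter_deriv[OF assms(2)]] smooth_on_differentiable[OF smooth_on_iter_deriv[OF assms(3)]] Cons.prems
    by (auto simp: frechet_derivative_works[symmetric])
  have "frechet_derivative (iter_deriv vs (\<lambda>x. a * f x + b * g x)) (at x) v = frechet_derivative (\<lambda>x. a * ?f x + b * ?g x) (at x) v"
    using frechet_derivative_cong_open[OF assms(1) Cons.prems(2), of "iter_deriv vs (\<lambda>x. a * f x + b * g x)" "\<lambda>x. a * ?f x + b * ?g x"] Cons by simp
  also have "\<dots> = a * frechet_derivative ?f (at x) v + b * frechet_derivative ?g (at x) v"
    by (rule frechet_derivative_eqI) (intro has_derivative_add has_derivative_mult_right d)
  finally show ?case by simp
qed simp

text \<open>The bilaplacian is a sixteenth of a sum of four derivatives of order four, each of which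
  extends continuously to the closed disk by assumption.\<close>

lemma smooth_on_closed_disk_bilaplacian:
  assumes w: "smooth_on_closed_disk w"
  obtains g0 where "continuous_on (cball 0 1) g0" "\<And>z. z \<in> ball 0 1 \<Longrightarrow> g0 z = laplacian (laplacian w) z"
proof -
  have s: "smooth_on (ball 0 1) w" using w by (simp add: smooth_on_closed_disk_def)
  have b: "set [1, 1::complex] \<subseteq> Basis" "set [\<i>, \<i>] \<subseteq> Basis" by (auto simp: Basis_complex_def)
  obtain W where W: "\<And>vs. set vs \<subseteq> Basis \<Longrightarrow> continuous_on (cball 0 1) (W vs) \<and> (\<forall>z\<in>ball 0 1. W vs z = iter_deriv vs w z)"
    using w unfolding smooth_on_closed_disk_def by metis
  have L: "iter_deriv vs (laplacian w) z = (1/4) * iter_deriv (vs @ [1, 1]) w z + (1/4) * iter_deriv (vs @ [\<i>, \<i>]) w z"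
    if "z \<in> ball 0 1" "set vs \<subseteq> Basis" for vs z
  proof -
    have "laplacian w = (\<lambda>z. (1/4) * iter_deriv [1, 1] w z + (1/4) * iter_deriv [\<i>, \<i>] w z)"
      by (simp add: laplacian_def fun_eq_iff add_divide_distrib del: iter_deriv_Cons)
    then show ?thesis
      using iter_deriv_add_scale[OF open_ball smooth_on_iter_deriv[OF s b(1)] smooth_on_iter_deriv[OF s b(2)] that(2,1), of "1/4" "1/4"]
      by (simp only: iter_deriv_append)
  qed
  define g0 where "g0 z = (W [1, 1, 1, 1] z + W [1, 1, \<i>, \<i>] z + W [\<i>, \<i>, 1, 1] z + W [\<i>, \<i>, \<i>, \<i>] z) / 16" for z
  have B: "set [1, 1, 1, 1::complex] \<subseteq> Basis" "set [1, 1, \<i>, \<i>] \<subseteq> Basis" "set [\<i>, \<i>, 1, 1] \<subseteq> Basis" "set [\<i>, \<i>, \<i>, \<i>] \<subseteq> Basis"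
    by (auto simp: Basis_complex_def)
  have "continuous_on (cball 0 1) g0"
    unfolding g0_def using W[OF B(1)] W[OF B(2)] W[OF B(3)] W[OF B(4)] by (intro continuous_intros) auto
  moreover have "g0 z = laplacian (laplacian w) z" if z: "z \<in> ball 0 1" for z
    unfolding laplacian_def[of "laplacian w"] L[OF z b(1)] L[OF z b(2)]
    using W[OF B(1)] W[OF B(2)] W[OF B(3)] W[OF B(4)] z by (simp add: g0_def field_simps del: iter_deriv_Cons)
  ultimately show ?thesis by (rule that)
qed

text \<open>Local integrability gives measurability on compact subsets, and the closed discs of
  radius 1 - 1 / (n + 1) exhaust the open disk.\<close>

lemma locally_integrable_measurable:
  assumes "locally_integrable_disk g"
  shows "(\<lambda>z. indicator (ball 0 1) z *\<^sub>R g z) \<in> borel_measurable lebesgue"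
proof (rule borel_measurable_LIMSEQ_metric)
  let ?K = "\<lambda>n. cball (0::complex) (1 - 1 / real (Suc n))"
  show "(\<lambda>z. indicator (?K n) z *\<^sub>R g z) \<in> borel_measurable lebesgue" for n
  proof -
    have "z \<in> ball 0 1" if "z \<in> ?K n" for z
    proof -
      have "cmod z \<le> 1 - 1 / real (Suc n)" using that by simp
      moreover have "1 / real (Suc n) > 0" by simp
      ultimately have "cmod z < 1" by linarith
      then show ?thesis by simp
    qed
    then have "?K n \<subseteq> ball 0 1" by blast
    then have "set_integrable lebesgue (?K n) g"
      using assms compact_cball[of 0 "1 - 1 / real (Suc n)"] unfolding locally_integrable_disk_def by blast
    then show ?thesis by (simp add: set_integrable_def)
  qed
  fix z :: complex
  show "(\<lambda>n. indicator (?K n) z *\<^sub>R g z) \<longlonglongrightarrow> indicator (ball 0 1) z *\<^sub>R g z"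
  proof (cases "z \<in> ball 0 1")
    case True
    have "(\<lambda>n. 1 - 1 / real (Suc n)) \<longlonglongrightarrow> 1 - 0" by (intro tendsto_intros LIMSEQ_Suc[OF lim_1_over_n])
    then have "\<forall>\<^sub>F n in sequentially. cmod z < 1 - 1 / real (Suc n)"
      by (rule order_tendstoD(1)) (use True in simp)
    then have "\<forall>\<^sub>F n in sequentially. indicator (?K n) z *\<^sub>R g z = indicator (ball 0 1) z *\<^sub>R g z"
      by eventually_elim (use True in simp)
    then show ?thesis by (rule tendsto_eventually)
  next
    case False
    have "z \<notin> ?K n" for n
    proof
      assume "z \<in> ?K n"
      then have "cmod z \<le> 1 - 1 / real (Suc n)" by simp
      moreover have "1 / real (Suc n) > 0" by simp
      ultimately have "cmod z < 1" by linarith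
      then show False using False by simp
    qed
    then show ?thesis using False by simp
  qed
qed

lemma G_pot_cong_AE:
  assumes g: "locally_integrable_disk g" "locally_integrable_disk g0" and AE: "AE z in lebesgue. z \<in> ball 0 1 \<longrightarrow> g z = g0 z"
  shows "G_pot g z = G_pot g0 z"
proof -
  have m: "(\<lambda>\<zeta>. indicator (ball 0 1) \<zeta> *\<^sub>R (of_real (biharmonic_G z \<zeta>) * g \<zeta>)) \<in> borel_measurable lebesgue"
    if "locally_integrable_disk g" for g
  proof -
    have "(\<lambda>\<zeta>. complex_of_real (biharmonic_G z \<zeta>)) \<in> borel_measurable lborel"
      using borel_measurable_biharmonic_G(2) by simp
    then have "(\<lambda>\<zeta>. complex_of_real (biharmonic_G z \<zeta>)) \<in> borel_measurable lebesgue" by (rule measurable_completion)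
    then have "(\<lambda>\<zeta>. complex_of_real (biharmonic_G z \<zeta>) * (indicator (ball 0 1) \<zeta> *\<^sub>R g \<zeta>)) \<in> borel_measurable lebesgue"
      by (intro borel_measurable_times locally_integrable_measurable that)
    then show ?thesis by simp
  qed
  have "(LINT \<zeta>:ball 0 1|lebesgue. of_real (biharmonic_G z \<zeta>) * g \<zeta>) = (LINT \<zeta>:ball 0 1|lebesgue. of_real (biharmonic_G z \<zeta>) * g0 \<zeta>)"
    unfolding set_lebesgue_integral_def
    by (rule integral_cong_AE[OF m[OF g(1)] m[OF g(2)]]) (use AE in eventually_elim, auto simp: indicator_def)
  then show ?thesis by (simp add: G_pot_def disk_integral_def)
qed

text \<open>The weak equation determines g only almost everywhere. The classical bilaplacian g0 of w
  extends continuously to the closed disk, so minus its potential solves the problem that w solves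
  with g0; the potential does not see the null set on which g and g0 differ.\<close>

lemma smooth_solution_eq_G_pot:
  assumes w: "smooth_on_closed_disk w" and s: "solves_biharmonic_dirichlet g (\<lambda>_. 0) (\<lambda>_. 0) w" and z: "z \<in> ball 0 1"
  shows "w z = - G_pot g z"
proof -
  obtain g0 where g0: "continuous_on (cball 0 1) g0" "\<And>z. z \<in> ball 0 1 \<Longrightarrow> g0 z = laplacian (laplacian w) z"
    using smooth_on_closed_disk_bilaplacian[OF w] by metis
  have sw: "smooth_on (ball 0 1) w" using w by (simp add: smooth_on_closed_disk_def)
  have cg0: "continuous_on (ball 0 1) g0" by (rule continuous_on_subset[OF g0(1) ball_subset_cball])
  have cw: "continuous_on (ball 0 1) w" by (rule smooth_on_continuous[OF sw])
  have lg0: "locally_integrable_disk g0" by (rule continuous_imp_locally_integrable_disk[OF cg0])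
  have bw: "bilaplacian_eq w g" using s by (simp add: solves_biharmonic_dirichlet_def)
  have lg: "locally_integrable_disk g" using bw by (simp add: bilaplacian_eq_def)
  have w0: "disk_integral (\<lambda>z. w z * laplacian (laplacian \<psi>) z) = disk_integral (\<lambda>z. g0 z * \<psi> z)" if \<psi>: "disk_test \<psi>" for \<psi>
  proof -
    obtain K where K: "compact K" "K \<subseteq> ball 0 1" "\<And>z. z \<notin> K \<Longrightarrow> \<psi> z = 0" "smooth_on UNIV \<psi>"
      using disk_testD[OF \<psi>] by metis
    have "(LINT z:ball 0 1|lborel. w z * laplacian (laplacian \<psi>) z) = (LINT z:ball 0 1|lborel. laplacian (laplacian w) z * \<psi> z)"
      by (rule bilaplacian_green_identity[OF open_ball K(1,2) smooth_on_C2[OF sw] smooth_on_C2[OF smooth_on_laplacian[OF open_ball sw]] K(4,3)])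
    also have "\<dots> = (LINT z:ball 0 1|lborel. g0 z * \<psi> z)"
      by (rule set_lebesgue_integral_cong) (use g0(2) in auto)
    finally show ?thesis
      using disk_integral_eq_lborel[OF continuous_on_mult[OF cw disk_test_continuous(2)[OF \<psi>]]]
        disk_integral_eq_lborel[OF continuous_on_mult[OF cg0 disk_test_continuous(1)[OF \<psi>]]] by simp
  qed
  have "AE z in lebesgue. z \<in> ball 0 1 \<longrightarrow> g z + (-1) * g0 z = 0"
  proof (rule weakly_zero_imp_AE_zero)
    show "locally_integrable_disk (\<lambda>z. g z + (-1) * g0 z)" by (rule locally_integrable_disk_add_scale[OF lg lg0])
    fix \<psi> assume \<psi>: "disk_test \<psi>"
    have "disk_integral (\<lambda>z. (g z + (-1) * g0 z) * \<psi> z) = disk_integral (\<lambda>z. g z * \<psi> z + (-1) * (g0 z * \<psi> z))"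
      by (simp only: distrib_right mult.assoc)
    also have "\<dots> = disk_integral (\<lambda>z. g z * \<psi> z) + (-1) * disk_integral (\<lambda>z. g0 z * \<psi> z)"
      by (intro disk_integral_add_scale set_integrable_disk_test lg lg0 \<psi>)
    also have "\<dots> = 0" using bw w0[OF \<psi>] \<psi> by (simp add: bilaplacian_eq_def)
    finally show "disk_integral (\<lambda>z. (g z + (-1) * g0 z) * \<psi> z) = 0" .
  qed
  then have AE: "AE z in lebesgue. z \<in> ball 0 1 \<longrightarrow> g z = g0 z" by eventually_elim auto
  have "solves_biharmonic_dirichlet g0 (\<lambda>_. 0) (\<lambda>_. 0) w"
    using s w0 lg0 continuous_imp_locally_integrable_disk[OF cw]
    unfolding solves_biharmonic_dirichlet_def bilaplacian_eq_def by auto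
  from dirichlet_unique[OF this solves_green[OF g0(1)] z] show ?thesis
    using G_pot_cong_AE[OF lg lg0 AE] by simp
qed

theorem theorem1p1:
  fixes f h :: "(complex \<Rightarrow> complex) \<Rightarrow> complex"
  assumes "circle_distribution f" and "circle_distribution h"
  shows
    "(\<forall>u w g.
        solves_biharmonic_dirichlet (\<lambda>_. 0) f h u \<longrightarrow>
        smooth_on_closed_disk w \<longrightarrow>
        solves_biharmonic_dirichlet g (\<lambda>_. 0) (\<lambda>_. 0) w \<longrightarrow>
          solves_biharmonic_dirichlet g f h (\<lambda>z. u z + w z) \<and>
          (\<forall>\<Phi>. solves_biharmonic_dirichlet g f h \<Phi> \<longrightarrow> (\<forall>z\<in>ball 0 1. \<Phi> z = u z + w z)) \<and>
          (\<forall>z\<in>ball 0 1. u z = F0_pot f z + H0_pot h z \<and> w z = - G_pot g z))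
     \<and> (\<forall>g. continuous_on (cball 0 1) g \<longrightarrow>
          solves_biharmonic_dirichlet g f h (\<lambda>z. F0_pot f z + H0_pot h z - G_pot g z))"
proof (intro conjI allI impI)
  fix u w g
  assume u: "solves_biharmonic_dirichlet (\<lambda>_. 0) f h u" and sw: "smooth_on_closed_disk w"
    and w: "solves_biharmonic_dirichlet g (\<lambda>_. 0) (\<lambda>_. 0) w"
  show s: "solves_biharmonic_dirichlet g f h (\<lambda>z. u z + w z)"
    using solves_add_scale[OF u w, of 1] by simp
  show "\<forall>z\<in>ball 0 1. \<Phi> z = u z + w z" if "solves_biharmonic_dirichlet g f h \<Phi>" for \<Phi>
    using dirichlet_unique[OF that s] by blast
  show "\<forall>z\<in>ball 0 1. u z = F0_pot f z + H0_pot h z \<and> w z = - G_pot g z"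
    using dirichlet_unique[OF u solves_homogeneous[OF assms]] smooth_solution_eq_G_pot[OF sw w] by blast
next
  fix g :: "complex \<Rightarrow> complex" assume "continuous_on (cball 0 1) g"
  from solves_add_scale[OF solves_homogeneous[OF assms] solves_green[OF this], of 1]
  show "solves_biharmonic_dirichlet g f h (\<lambda>z. F0_pot f z + H0_pot h z - G_pot g z)" by simp
qed

end
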